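(* Let $\delta\in\mathbb Z^S$ be not a square in $\mathbb Q$, $s\in\mathbb C$ and $A>0$. Then \[ L^S(s,\delta)=\sum_f\sum_{k\in\mathbb Z_{(S)}^{>0}}\frac{1}{k^sf^{2s-1}}\Big(\frac{\delta/f^2}{k}\Big)F\Big(\frac{kf^2}{A}\Big)+|\delta|'^{\frac12-s}_{\infty,q}\sum_f\sum_{k\in\mathbb Z_{(S)}^{>0}}\frac{1}{k^{1-s}f^{1-2s}}\Big(\frac{\delta/f^2}{k}\Big)V_{\iota,\epsilon,s}\Big(\frac{kf^2A}{|\delta|'_{\infty,q}}\Big), \] with $f$ ranging over $f\in\mathbb Z^{>0}_{(S)}$ with $\delta/f^2\in\mathbb Z^S$, where \[ V_{\iota,\epsilon,s}(x)=\frac{\pi^{s-1/2}}{2\pi i}\int_{(\sigma)}\widetilde F(u)\prod_{i=1}^r\frac{1-\epsilon_iq_i^{-s+u}}{1-\epsilon_iq_i^{s-u-1}}\frac{\Gamma(\frac{\iota+1-s+u}{2})}{\Gamma(\frac{\iota+s-u}{2})}(\pi x)^{-u}du \] for any real $\sigma$ with $\sigma+\mathrm{Re}\,s>1$ and $\sigma+\mathrm{Re}(1-s)>1$, $\iota=0$ if $\delta>0$, $\iota=1$ if $\delta<0$, and $\epsilon_i=(\tau_\delta/q_i)$.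
   Context: $q_1,\dots,q_r$ distinct primes with $2$ among them, $S=\{\infty,q_1,\dots,q_r\}$, $\mathbb Z^S=\{\alpha\in\mathbb Q:v_\ell(\alpha)\ge0$ for all primes $\ell\notin S\}$, $\mathbb Z_{(S)}^{>0}$ the positive integers prime to all $q_i$; $(d/k)=\prod_{p\mid k}(d/p)^{v_p(k)}$ (Legendre symbols of $d\bmod p$). $L^S(s,\delta)=\sum_ff^{1-2s}\sum_k(\frac{\delta/f^2}{k})k^{-s}$ (analytically continued; entire for nonsquare $\delta$). $\delta=\sigma^2D$ with $D$ the fundamental discriminant of $\mathbb Q(\sqrt\delta)$, $\sigma_{(q)}=\prod_iq_i^{v_{q_i}(\sigma)}$, $\tau_\delta=\delta/\sigma_{(q)}^2$, $|\delta|'_{\infty,q}=|\tau_\delta|$; $(\tau_\delta/q_i)$ Kronecker symbol. $F(x)=\frac{1}{2K_0(2)}\int_x^\infty e^{-t-1/t}dt/t$ with $K_s(y)=\frac12\int_0^\infty e^{-y(t+1/t)/2}t^{s-1}dt$; $\widetilde F(u)=\int_0^\infty F(t)t^{u-1}dt$ (meromorphically continued). $(\sigma)$ is the vertical line $\mathrm{Re}\,u=\sigma$ traversed upward. *)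

theory Defs
  imports "HOL-Complex_Analysis.Complex_Analysis" "HOL-Number_Theory.Number_Theory" "HOL-Computational_Algebra.Squarefree"
begin

text \<open>The finite set of primes q_1,...,q_r is represented by a set Q :: nat set
  (finite, consisting of primes, containing 2).\<close>

definition qval :: "nat \<Rightarrow> rat \<Rightarrow> int" where
  "qval p x = (let (a, b) = quotient_of x in
     int (multiplicity (int p) a) - int (multiplicity (int p) b))"

definition ZS :: "nat set \<Rightarrow> rat set" where
  "ZS Q = {x. \<forall>l. prime l \<and> l \<notin> Q \<longrightarrow> qval l x \<ge> 0}"

definition ZSpos :: "nat set \<Rightarrow> nat set" where
  "ZSpos Q = {k. k > 0 \<and> (\<forall>q\<in>Q. coprime k q)}"

text \<open>Residue of a rational number (with denominator prime to p) modulo p.\<close>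
definition rat_mod :: "rat \<Rightarrow> nat \<Rightarrow> int" where
  "rat_mod d p = (let (a, b) = quotient_of d in
     THE r. 0 \<le> r \<and> r < int p \<and> [b * r = a] (mod int p))"

definition jac :: "rat \<Rightarrow> nat \<Rightarrow> int" where
  "jac d k = (\<Prod>p\<in>prime_factors k. Legendre (rat_mod d p) (int p) ^ multiplicity p k)"

definition fset :: "nat set \<Rightarrow> rat \<Rightarrow> nat set" where
  "fset Q \<delta> = {f \<in> ZSpos Q. \<delta> / of_nat f ^ 2 \<in> ZS Q}"

text \<open>The Dirichlet series defining L^S(s,delta) (absolutely convergent for Re s > 1).\<close>
definition LSseries :: "nat set \<Rightarrow> rat \<Rightarrow> complex \<Rightarrow> complex" where
  "LSseries Q \<delta> s = (\<Sum>\<^sub>\<infinity> f \<in> fset Q \<delta>. (of_nat f :: complex) powr (1 - 2 * s) *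
      (\<Sum>\<^sub>\<infinity> k \<in> ZSpos Q. of_int (jac (\<delta> / of_nat f ^ 2) k) * of_nat k powr (-s)))"

text \<open>L^S(s,delta): the analytic continuation (entire for nonsquare delta).\<close>
definition LS :: "nat set \<Rightarrow> rat \<Rightarrow> complex \<Rightarrow> complex" where
  "LS Q \<delta> = (THE g. g holomorphic_on UNIV \<and> (\<forall>s. Re s > 1 \<longrightarrow> g s = LSseries Q \<delta> s))"

definition sqfree_part :: "rat \<Rightarrow> int" where
  "sqfree_part \<delta> = (THE d. squarefree d \<and> (\<exists>r::rat. r \<noteq> 0 \<and> \<delta> = of_int d * r ^ 2))"

definition fund_disc :: "rat \<Rightarrow> int" where
  "fund_disc \<delta> = (let d = sqfree_part \<delta> in if d mod 4 = 1 then d else 4 * d)"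

definition sigma_of :: "rat \<Rightarrow> rat" where
  "sigma_of \<delta> = (THE \<sigma>. \<sigma> > 0 \<and> \<delta> = \<sigma> ^ 2 * of_int (fund_disc \<delta>))"

definition sigma_q :: "nat set \<Rightarrow> rat \<Rightarrow> rat" where
  "sigma_q Q \<delta> = (\<Prod>q\<in>Q. of_nat q powi qval q (sigma_of \<delta>))"

definition tau :: "nat set \<Rightarrow> rat \<Rightarrow> rat" where
  "tau Q \<delta> = \<delta> / (sigma_q Q \<delta>) ^ 2"

definition kronecker :: "int \<Rightarrow> nat \<Rightarrow> int" where
  "kronecker t q = (if q = 2 then
       (if even t then 0 else if t mod 8 \<in> {1, 7} then 1 else -1)
     else Legendre t (int q))"

text \<open>epsilon_i = (tau_delta / q_i); tau_delta is an integer, we take its numerator.\<close>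
definition eps :: "nat set \<Rightarrow> rat \<Rightarrow> nat \<Rightarrow> int" where
  "eps Q \<delta> q = kronecker (fst (quotient_of (tau Q \<delta>))) q"

definition BesselK :: "real \<Rightarrow> real \<Rightarrow> real" where
  "BesselK s y = 1/2 * (\<integral>t\<in>{0<..}. exp (- y * (t + 1/t) / 2) * t powr (s - 1) \<partial>lborel)"

definition Fcut :: "real \<Rightarrow> real" where
  "Fcut x = 1 / (2 * BesselK 0 2) * (\<integral>t\<in>{x<..}. exp (- t - 1/t) / t \<partial>lborel)"

text \<open>Mellin transform of F (convergent for Re u > 0, which is all that is used).\<close>
definition Fmellin :: "complex \<Rightarrow> complex" where
  "Fmellin u = (\<integral>t\<in>{0<..}. complex_of_real (Fcut t) * complex_of_real t powr (u - 1) \<partial>lborel)"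

text \<open>V_{iota,eps,s}(x), the line integral over (sigma) written as
  (1/(2 pi i)) int g(u) du = (1/(2 pi)) int_R g(sigma + i t) dt.\<close>
definition Vfun :: "nat set \<Rightarrow> nat \<Rightarrow> (nat \<Rightarrow> int) \<Rightarrow> complex \<Rightarrow> real \<Rightarrow> real \<Rightarrow> complex" where
  "Vfun Q \<iota> \<epsilon> s \<sigma> x =
     complex_of_real pi powr (s - 1/2) / (2 * pi) *
     (\<integral>t. (let u = Complex \<sigma> t in
        Fmellin u *
        (\<Prod>q\<in>Q. (1 - of_int (\<epsilon> q) * of_nat q powr (- s + u)) /
                 (1 - of_int (\<epsilon> q) * of_nat q powr (s - u - 1))) *
        Gamma ((of_nat \<iota> + 1 - s + u) / 2) / Gamma ((of_nat \<iota> + s - u) / 2) *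
        complex_of_real (pi * x) powr (- u)) \<partial>lborel)"

end

theory Submission
  imports Defs "HOL-Probability.Characteristic_Functions" "HOL-Probability.Sinc_Integral" "HOL-Real_Asymp.Real_Asymp"
begin

text \<open>
Write \<open>\<delta> = \<sigma>\<^sup>2 D\<close> with \<open>D\<close> a fundamental discriminant and let \<open>n\<close> be the part of \<open>\<sigma>\<close> prime to all \<open>q\<^sub>i\<close>. Then
\<open>\<tau>\<^sub>\<delta> = n\<^sup>2 D\<close>, and the admissible \<open>f\<close> are the divisors of \<open>n\<close>. With \<open>chi\<close> the Kronecker character of \<open>D\<close>, the symbol
of \<open>\<delta> / f\<^sup>2\<close> at \<open>k\<close> is \<open>chi k\<close> if \<open>k\<close> is prime to \<open>n / f\<close> and \<open>0\<close> otherwise, so \<open>L\<^sup>S(s, \<delta>)\<close> is \<open>L(s, chi)\<close> times the Euler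
factors \<open>1 - chi(q\<^sub>i) q\<^sub>i\<^sup>-\<^sup>s\<close> times the finite sum \<open>T(s)\<close> of the terms \<open>f\<^sup>1\<^sup>-\<^sup>2\<^sup>s \<Prod> (1 - chi(p) p\<^sup>-\<^sup>s)\<close> over \<open>f\<close> dividing \<open>n\<close>, the
product being over the primes \<open>p\<close> dividing \<open>n / f\<close>. Expanding this product over sets of primes shows that
\<open>T(s) = n\<^sup>1\<^sup>-\<^sup>2\<^sup>s T(1 - s)\<close>. Together with the functional equation of \<open>L(s, chi)\<close>, which follows from the theta
series and the value of the Gauss sum, this gives \<open>L\<^sup>S(s, \<delta>) = W(s) L\<^sup>S(1 - s, \<delta>)\<close> with explicit \<open>W\<close>.

The Mellin transform of \<open>F\<close> is \<open>K\<^sub>u(2) / (u K\<^sub>0(2))\<close>: it is odd, has residue \<open>1\<close> at its only pole \<open>0\<close>, and decays like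
\<open>exp (- \<bar>Im u\<bar>)\<close>, faster than \<open>L\<^sup>S\<close> and \<open>W\<close> can grow. Hence the integral of \<open>L\<^sup>S(s + u, \<delta>) A\<^sup>u\<close> against it can be moved from
\<open>Re u = \<sigma>\<close> to \<open>Re u = - \<sigma>\<close>; the residue is the left-hand side, the first integral gives the sum with \<open>F\<close>, and the
functional equation turns the second one into the sum with \<open>V\<close>.

The character of \<open>D\<close> is built, with its Gauss sum, as a product of characters of prime discriminants.
\<close>

subsection \<open>Laplace integrals, contour shifts and the gamma function\<close>

text \<open>No Stirling estimate and no convexity bound enters. \<open>Lam\<close> is bounded in
  vertical strips because its kernel is, so \<open>L\<close> grows at most like the reciprocal gamma
  factor, whose true rate at \<open>s / 2\<close> is \<pi> / 4; the gamma factor in the numerator of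
  \<open>W\<close> is merely bounded. Everything thus rests on a kernel that decays at a rate beyond
  \<pi> / 4: rotating the Bessel integral by an angle below \<pi> / 2 gives that angle as the rate,
  and the angle 1 is a convenient choice. That \<delta> is not a square enters as
  \<open>chi 0 = 0\<close>: the theta series has no constant term, the completed L-function is an
  entire Laplace transform, and the only residue is that of the kernel. The Gauss sum is needed with
  its exact sign, since the formula leaves no room for an unknown root number. As 2 lies in
  \<open>Q\<close>, all \<open>k\<close> and \<open>f\<close> are odd, so only Legendre symbols at
  odd primes occur in the series, and the factor 4 in the discriminant is invisible to valuations
  outside \<open>Q\<close>. The numbers \<open>f\<close> are the divisors of one integer, so only
  the sum over \<open>k\<close> has to be exchanged with an integral.\<close>

lemma laplace_entire:
  fixes \<phi> :: "real \<Rightarrow> complex"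
  assumes meas [measurable]: "\<phi> \<in> borel_measurable lborel"
    and int: "\<And>c. integrable lborel (\<lambda>v. exp (c * \<bar>v\<bar>) * norm (\<phi> v))"
  shows "(\<lambda>w. \<integral>v. \<phi> v * exp (w * of_real v) \<partial>lborel) holomorphic_on UNIV"
proof -
  \<comment> \<open>The moments of \<open>\<phi>\<close> over factorials: the integral becomes an
    everywhere convergent power series, and no differentiation under the integral is needed.\<close>
  define a where "a k = (\<integral>v. \<phi> v * of_real v ^ k \<partial>lborel) / fact k" for k
  have sums: "(\<lambda>k. a k * w ^ k) sums (\<integral>v. \<phi> v * exp (w * of_real v) \<partial>lborel)" for w
  proof -
    define f where "f k v = \<phi> v * ((w * of_real v) ^ k / fact k)" for k and v :: real
    have nf: "norm (f k v) = norm (\<phi> v) * ((norm w * \<bar>v\<bar>) ^ k / fact k)" for k v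
      by (simp add: f_def norm_mult norm_divide norm_power power_mult_distrib)
    \<comment> \<open>One integrable function bounds all partial sums of norms; it gives both the
      integrability of each term and the convergence of the series of integrals.\<close>
    have part: "(\<Sum>k<K. norm (f k v)) \<le> exp (norm w * \<bar>v\<bar>) * norm (\<phi> v)" for K v
    proof -
      have "(\<Sum>k<K. (norm w * \<bar>v\<bar>) ^ k / fact k) \<le> exp (norm w * \<bar>v\<bar>)"
        using summable_exp_generic[of "norm w * \<bar>v\<bar>"] unfolding exp_def
        by (intro order_trans[OF _ sum_le_suminf[where I = "{..<K}"]])
           (auto simp: divide_inverse mult_ac summable_exp scaleR_conv_of_real)
      then show ?thesis
        unfolding nf sum_distrib_left[symmetric] by (simp add: mult.commute mult_left_mono)
    qed
    have le1: "norm (f k v) \<le> exp (norm w * \<bar>v\<bar>) * norm (\<phi> v)" for k v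
      using part[where K = "Suc k" and v = v] sum_nonneg[of "{..<k}" "\<lambda>k. norm (f k v)"] by simp
    have fm [measurable]: "f k \<in> borel_measurable lborel" for k
      unfolding f_def by measurable
    have fi: "integrable lborel (f k)" for k
      by (rule Bochner_Integration.integrable_bound[OF int[of "norm w"]]) (use le1 in auto)
    have sm: "summable (\<lambda>k. norm (f k v))" for v
      unfolding nf using summable_exp[of "norm w * \<bar>v\<bar>"] 
      by (intro summable_mult) (simp add: divide_inverse mult_ac)
    have "summable (\<lambda>k. \<integral>v. norm (f k v) \<partial>lborel)"
    proof (rule summableI_nonneg_bounded)
      fix K show "(\<Sum>k<K. \<integral>v. norm (f k v) \<partial>lborel) \<le> (\<integral>v. exp (norm w * \<bar>v\<bar>) * norm (\<phi> v) \<partial>lborel)"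
      proof -
        have "(\<Sum>k<K. \<integral>v. norm (f k v) \<partial>lborel) = (\<integral>v. (\<Sum>k<K. norm (f k v)) \<partial>lborel)"
          using fi by (intro Bochner_Integration.integral_sum[symmetric] integrable_norm)
        also have "\<dots> \<le> (\<integral>v. exp (norm w * \<bar>v\<bar>) * norm (\<phi> v) \<partial>lborel)"
          using fi int part by (intro integral_mono Bochner_Integration.integrable_sum integrable_norm)
        finally show ?thesis .
      qed
    qed simp
    from sums_integral[OF fi _ this] sm
    have "(\<lambda>k. integral\<^sup>L lborel (f k)) sums (\<integral>v. (\<Sum>k. f k v) \<partial>lborel)" by auto
    moreover have "(\<Sum>k. f k v) = \<phi> v * exp (w * of_real v)" for v
    proof -
      have "(\<lambda>k. f k v) sums (\<phi> v * exp (w * of_real v))"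
        unfolding f_def using exp_converges[of "w * of_real v"]
        by (intro sums_mult) (simp add: scaleR_conv_of_real divide_inverse mult.commute)
      then show ?thesis by (rule sums_unique[symmetric])
    qed
    moreover have "integral\<^sup>L lborel (f k) = a k * w ^ k" for k
    proof -
      have "f k = (\<lambda>v. (w ^ k / fact k) * (\<phi> v * of_real v ^ k))"
        by (auto simp: f_def power_mult_distrib)
      then show ?thesis by (simp add: a_def)
    qed
    ultimately show ?thesis by simp
  qed
  have "(\<lambda>w. \<integral>v. \<phi> v * exp (w * of_real v) \<partial>lborel) holomorphic_on ball 0 r" for r
    by (rule power_series_holomorphic[where a = a]) (use sums in simp)
  then have "(\<lambda>w. \<integral>v. \<phi> v * exp (w * of_real v) \<partial>lborel) field_differentiable at z" for z
    by (rule holomorphic_on_imp_differentiable_at[of _ "ball 0 (norm z + 1)"]) auto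
  then show ?thesis by (simp add: holomorphic_on_def field_differentiable_at_within)
qed

text \<open>Cauchy's formula on the rectangle with vertical sides at \<open>a\<close> and
  \<open>b\<close> and horizontal sides at height \<open>- T\<close> and \<open>T\<close>; each
  horizontal side contributes at most \<open>(b - a) * e\<close>. Parametrising the vertical sides
  by real \<open>t\<close> divides by \<i>, so \<open>2 * pi * h 0\<close> appears without
  it.\<close>

lemma vertical_line_shift_pole:
  fixes h :: "complex \<Rightarrow> complex"
  assumes h: "h holomorphic_on UNIV" and ab: "a < 0" "0 < b"
    and small: "\<And>e. e > 0 \<Longrightarrow> \<forall>\<^sub>F T in at_top. \<forall>x\<in>{a..b}.
        norm (h (Complex x T) / Complex x T) \<le> e \<and> norm (h (Complex x (-T)) / Complex x (-T)) \<le> e"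
    and ia: "integrable lborel (\<lambda>t. h (Complex a t) / Complex a t)"
    and ib: "integrable lborel (\<lambda>t. h (Complex b t) / Complex b t)"
  shows "(\<integral>t. h (Complex b t) / Complex b t \<partial>lborel)
       - (\<integral>t. h (Complex a t) / Complex a t \<partial>lborel) = 2 * pi * h 0"
proof -
  define g where "g w = h w / w" for w
  define J where "J c T = (LINT t:{-T..T}|lborel. g (Complex c t))" for c T
  have lim: "((\<lambda>T. J c T) \<longlongrightarrow> (\<integral>t. g (Complex c t) \<partial>lborel)) at_top"
    if "integrable lborel (\<lambda>t. g (Complex c t))" for c
    unfolding J_def set_lebesgue_integral_def
  proof (rule integral_dominated_convergence_at_top[where w = "\<lambda>t. norm (g (Complex c t))"])
    show "AE t in lborel. ((\<lambda>T. indicat_real {-T..T} t *\<^sub>R g (Complex c t)) \<longlongrightarrow> g (Complex c t)) at_top"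
    proof (rule AE_I2)
      fix t :: real
      have "\<forall>\<^sub>F T in at_top. indicat_real {-T..T} t *\<^sub>R g (Complex c t) = g (Complex c t)"
        using eventually_ge_at_top[of "\<bar>t\<bar>"] by eventually_elim (auto simp: indicator_def)
      then show "((\<lambda>T. indicat_real {-T..T} t *\<^sub>R g (Complex c t)) \<longlongrightarrow> g (Complex c t)) at_top"
        by (rule tendsto_eventually)
    qed
    show "\<forall>\<^sub>F T in at_top. AE t in lborel. norm (indicat_real {-T..T} t *\<^sub>R g (Complex c t)) \<le> norm (g (Complex c t))"
      by (intro always_eventually allI AE_I2) (auto simp: indicator_def)
  qed (use that in auto)
  have key: "norm (\<i> * J b T - \<i> * J a T - 2 * pi * \<i> * h 0) \<le> 2 * (b - a) * e"
    if T: "T > 0" and e: "e > 0"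
      and s: "\<forall>x\<in>{a..b}. norm (g (Complex x T)) \<le> e \<and> norm (g (Complex x (-T))) \<le> e" for T e
  proof -
    define A1 A2 A3 A4 where "A1 = Complex a (-T)" and "A2 = Complex b (-T)"
      and "A3 = Complex b T" and "A4 = Complex a T"
    have rp: "rectpath A1 A3 = linepath A1 A2 +++ linepath A2 A3 +++ linepath A3 A4 +++ linepath A4 A1"
      by (simp add: rectpath_def A1_def A2_def A3_def A4_def Let_def)
    have box: "0 \<in> box A1 A3" using ab T by (simp add: in_box_complex_iff A1_def A3_def)
    have pim: "path_image (rectpath A1 A3) \<subseteq> UNIV - {0}"
      using box path_image_rectpath_cbox_minus_box[of A1 A3] ab T by (auto simp: A1_def A3_def)
    have "((\<lambda>w. h w / (w - 0)) has_contour_integral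
        (2*pi * \<i> * winding_number (rectpath A1 A3) 0 * h 0)) (rectpath A1 A3)"
      using h pim by (intro Cauchy_integral_formula_convex_simple[where S = UNIV]) auto
    then have tot: "(g has_contour_integral (2*pi * \<i> * h 0)) (rectpath A1 A3)"
      using winding_number_rectpath[OF box] by (simp add: g_def[abs_def])
    have gh: "g holomorphic_on UNIV - {0}"
      unfolding g_def using h by (intro holomorphic_intros holomorphic_on_subset[OF h]) auto
    then have gc: "continuous_on (UNIV - {0}) g" by (rule holomorphic_on_imp_continuous_on)
    have seg: "closed_segment A1 A2 \<union> closed_segment A2 A3 \<union> closed_segment A3 A4 \<union> closed_segment A4 A1
        \<subseteq> UNIV - {0}"
      using pim unfolding rp by (simp add: path_image_join)
    have ci: "g contour_integrable_on linepath A1 A2" "g contour_integrable_on linepath A2 A3"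
      "g contour_integrable_on linepath A3 A4" "g contour_integrable_on linepath A4 A1"
      using seg by (auto intro!: contour_integrable_continuous_linepath continuous_on_subset[OF gc])
    have sum: "contour_integral (linepath A1 A2) g + (contour_integral (linepath A2 A3) g +
        (contour_integral (linepath A3 A4) g + contour_integral (linepath A4 A1) g)) = 2*pi * \<i> * h 0"
      using contour_integral_unique[OF tot] ci unfolding rp by simp
    have hseg1: "x \<in> closed_segment A1 A2 \<Longrightarrow> \<exists>y\<in>{a..b}. x = Complex y (-T)" for x
      using ab by (intro bexI[of _ "Re x"])
        (auto simp: A1_def A2_def closed_segment_same_Im closed_segment_eq_real_ivl complex_eq_iff)
    have hseg3: "x \<in> closed_segment A3 A4 \<Longrightarrow> \<exists>y\<in>{a..b}. x = Complex y T" for x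
      using ab by (intro bexI[of _ "Re x"])
        (auto simp: A3_def A4_def closed_segment_same_Im closed_segment_eq_real_ivl complex_eq_iff)
    have n1: "norm (contour_integral (linepath A1 A2) g) \<le> e * norm (A2 - A1)"
      using ci(1) e s by (intro contour_integral_bound_linepath) (auto dest!: hseg1)
    have n3: "norm (contour_integral (linepath A3 A4) g) \<le> e * norm (A4 - A3)"
      using ci(3) e s by (intro contour_integral_bound_linepath) (auto dest!: hseg3)
    have nd: "norm (A2 - A1) = b - a" "norm (A4 - A3) = b - a"
      using ab by (simp_all add: A1_def A2_def A3_def A4_def norm_complex_def)
    have vert: "contour_integral (linepath (Complex c (-T)) (Complex c T)) g = \<i> * J c T"
      if c: "c \<noteq> 0" for c
    proof -
      have "continuous_on {-T..T} (\<lambda>t. g (Complex c t))"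
        unfolding Complex_eq using c
        by (intro continuous_on_compose2[OF gc] continuous_intros) (auto simp: complex_eq_iff)
      then have "set_integrable lborel {-T..T} (\<lambda>t. g (Complex c t))"
        by (rule borel_integrable_atLeastAtMost')
      then have "((\<lambda>t. g (Complex c t)) has_integral J c T) {-T..T}"
        using has_integral_set_lebesgue[of "{-T..T}" "\<lambda>t. g (Complex c t)"] 
        by (simp add: J_def set_borel_integral_eq_integral integrable_integral)
      then have "(g has_contour_integral (\<i> * J c T)) (linepath (Complex c (-T)) (Complex c T))"
        using T by (subst has_contour_integral_linepath_same_Re_iff[of _ c _ "-T" T]) auto
      then show ?thesis by (rule contour_integral_unique)
    qed
    have "contour_integral (linepath A4 A1) g = - (\<i> * J a T)"
      using vert[of a] ab ci(4) contour_integral_reverse_linepath[of A4 A1 g]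
        continuous_on_subset[OF gc, of "closed_segment A4 A1"] seg
      by (simp add: A1_def A4_def)
    moreover have "contour_integral (linepath A2 A3) g = \<i> * J b T"
      using vert[of b] ab by (simp add: A2_def A3_def)
    ultimately have "\<i> * J b T - \<i> * J a T - 2 * pi * \<i> * h 0 =
       - contour_integral (linepath A1 A2) g - contour_integral (linepath A3 A4) g"
      using sum by (simp add: algebra_simps)
    then have "norm (\<i> * J b T - \<i> * J a T - 2 * pi * \<i> * h 0) \<le>
       norm (contour_integral (linepath A1 A2) g) + norm (contour_integral (linepath A3 A4) g)"
      by (metis norm_minus_cancel norm_triangle_ineq4)
    then show ?thesis using n1 n3 unfolding nd by (simp add: algebra_simps)
  qed
  have "((\<lambda>T. \<i> * J b T - \<i> * J a T - 2 * pi * \<i> * h 0) \<longlongrightarrow>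
     \<i> * (\<integral>t. g (Complex b t) \<partial>lborel) - \<i> * (\<integral>t. g (Complex a t) \<partial>lborel) - 2 * pi * \<i> * h 0) at_top"
    by (intro tendsto_intros lim) (use ia ib in \<open>simp_all add: g_def\<close>)
  moreover have "((\<lambda>T. \<i> * J b T - \<i> * J a T - 2 * pi * \<i> * h 0) \<longlongrightarrow> 0) at_top"
  proof (rule tendstoI)
    fix e :: real assume e: "e > 0"
    \<comment> \<open>The two horizontal sides together are then at most
      \<open>2 * (b - a) * e' = e / 2\<close>.\<close>
    define e' where "e' = e / (4 * (b - a))"
    have e': "e' > 0" "2 * (b - a) * e' < e" using e ab by (auto simp: e'_def field_simps)
    from small[OF e'(1)] eventually_gt_at_top[of 0]
    show "\<forall>\<^sub>F T in at_top. dist (\<i> * J b T - \<i> * J a T - 2 * pi * \<i> * h 0) 0 < e"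
    proof eventually_elim
      case (elim T)
      then show ?case using key[of T e'] e' by (simp add: g_def)
    qed
  qed
  ultimately have "\<i> * (\<integral>t. g (Complex b t) \<partial>lborel) - \<i> * (\<integral>t. g (Complex a t) \<partial>lborel)
      - 2 * pi * \<i> * h 0 = 0"
    by (rule tendsto_unique[OF trivial_limit_at_top_linorder])
  then have "\<i> * ((\<integral>t. g (Complex b t) \<partial>lborel) - (\<integral>t. g (Complex a t) \<partial>lborel) - 2 * pi * h 0) = 0"
    by (simp add: algebra_simps)
  then have "(\<integral>t. g (Complex b t) \<partial>lborel) - (\<integral>t. g (Complex a t) \<partial>lborel) - 2 * pi * h 0 = 0"
    using mult_eq_0_iff[of \<i>] by simp
  then show ?thesis by (simp add: g_def)
qed

text \<open>In Euler's product the quotient has the factors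
  \<open>sqrt (1 + (y / (x + k))\<^sup>2)\<close>, which decrease in \<open>x\<close>. So
  \<open>x = 1/2\<close> is the worst case, and there the reflection formula gives the modulus
  exactly.\<close>

lemma norm_rGamma_le_aux:
  assumes "x \<ge> 1/2"
  shows "norm (Gamma (of_real x :: complex) * rGamma (Complex x y)) \<le> sqrt (cosh (pi * y))"
proof -
  have half: "norm (Gamma (1/2 :: complex) * rGamma (Complex (1/2) y)) = sqrt (cosh (pi * y))"
  proof -
    have cj: "1 - Complex (1/2) y = cnj (Complex (1/2) y)" by (simp add: complex_eq_iff)
    have s: "sin (of_real pi * Complex (1/2) y) = of_real (cosh (pi * y))"
    proof -
      have "of_real pi * Complex (1/2) y = of_real pi / 2 - (- \<i> * of_real (pi * y))"
        by (simp add: complex_eq_iff)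
      also have "sin \<dots> = cos (- \<i> * of_real (pi * y))" 
        by (simp add: sin_add del: of_real_mult)
      also have "\<dots> = of_real (cosh (pi * y))"
        by (simp add: cos_exp_eq cosh_def exp_of_real[symmetric] mult.assoc[symmetric] scaleR_conv_of_real)
      finally show ?thesis .
    qed
    have "rGamma (Complex (1/2) y) * rGamma (1 - Complex (1/2) y) = of_real (cosh (pi*y)) / of_real pi"
      using rGamma_reflection_complex[of "Complex (1/2) y"] s by simp
    then have "rGamma (Complex (1/2) y) * cnj (rGamma (Complex (1/2) y)) = of_real (cosh (pi*y)) / of_real pi"
      unfolding cj by (simp add: cnj_rGamma)
    then have "complex_of_real ((norm (rGamma (Complex (1/2) y)))\<^sup>2) = of_real (cosh (pi*y) / pi)"
      by (simp only: complex_norm_square of_real_divide)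
    then have n: "(norm (rGamma (Complex (1/2) y)))\<^sup>2 = cosh (pi*y) / pi"
      by (simp only: of_real_eq_iff)
    have "norm (Gamma (1/2::complex)) = sqrt pi" by (simp add: Gamma_one_half_complex)
    then have "(norm (Gamma (1/2 :: complex) * rGamma (Complex (1/2) y)))\<^sup>2 = cosh (pi*y)"
      using n by (simp add: norm_mult power_mult_distrib)
    then show ?thesis by (metis norm_ge_zero real_sqrt_unique)
  qed
  \<comment> \<open>The finite Euler approximants. The powers of \<open>n\<close> in numerator and
    denominator have equal modulus, so only a quotient of Pochhammer symbols remains.\<close>
  define R where "R x n = norm (Gamma_series (of_real x :: complex) n * rGamma_series (Complex x y) n)" for x n
  have R: "R x n = (\<Prod>k\<le>n. norm (Complex (x + real k) y) / (x + real k))" if "x > 0" for x n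
  proof -
    have ne: "norm (exp (complex_of_real x * complex_of_real (ln (real n)))) = 
       norm (exp (Complex x y * complex_of_real (ln (real n))))"
      by (simp add: norm_exp_eq_Re)
    have "R x n = norm (pochhammer (Complex x y) (Suc n)) / norm (pochhammer (complex_of_real x) (Suc n))"
      unfolding R_def Gamma_series_def rGamma_series_def norm_mult norm_divide
      using ne by (simp add: field_simps)
    also have "\<dots> = (\<Prod>k\<le>n. norm (Complex x y + of_nat k) / norm (complex_of_real x + of_nat k))"
      by (simp add: pochhammer_prod prod_norm prod_dividef atLeast0AtMost atLeast0LessThan lessThan_Suc_atMost)
    also have "\<dots> = (\<Prod>k\<le>n. norm (Complex (x + real k) y) / (x + real k))"
    proof (rule prod.cong, simp)
      fix k
      have "Complex x y + of_nat k = Complex (x + real k) y" by (simp add: complex_eq_iff)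
      moreover have "norm (complex_of_real x + of_nat k) = x + real k"
        using that by (metis abs_of_pos add_pos_nonneg norm_of_real of_nat_0_le_iff of_real_add of_real_of_nat_eq)
      ultimately show "norm (Complex x y + of_nat k) / norm (complex_of_real x + of_nat k) =
         norm (Complex (x + real k) y) / (x + real k)" by simp
    qed
    finally show ?thesis .
  qed
  have mono: "R x n \<le> R (1/2) n" for n
  proof -
    have "norm (Complex p y) / p \<le> norm (Complex q y) / q" if "0 < q" "q \<le> p" for p q
    proof -
      have e: "norm (Complex p y) / p = sqrt (1 + (y/p)\<^sup>2)" if "p > 0" for p
      proof -
        have "norm (Complex p y) / p = sqrt ((p\<^sup>2 + y\<^sup>2) / p\<^sup>2)"
          using that by (simp add: norm_complex_def real_sqrt_divide)
        also have "(p\<^sup>2 + y\<^sup>2) / p\<^sup>2 = 1 + (y/p)\<^sup>2" using that by (simp add: field_simps power2_eq_square)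
        finally show ?thesis .
      qed
      have "\<bar>y / p\<bar> \<le> \<bar>y / q\<bar>" using that by (simp add: frac_le)
      then have "(y/p)\<^sup>2 \<le> (y/q)\<^sup>2" by (simp only: abs_le_square_iff)
      then show ?thesis using e[of p] e[of q] that by simp
    qed
    then show ?thesis unfolding R[OF order.strict_trans2[OF half_gt_zero[OF zero_less_one] assms]]
      using R[of "1/2" n] assms by (auto intro!: prod_mono)
  qed
  have l1: "(\<lambda>n. R x n) \<longlonglongrightarrow> norm (Gamma (of_real x :: complex) * rGamma (Complex x y))" for x
    unfolding R_def by (intro tendsto_intros)
  have "norm (Gamma (of_real x :: complex) * rGamma (Complex x y)) \<le>
      norm (Gamma (of_real (1/2) :: complex) * rGamma (Complex (1/2) y))"
    using mono by (intro LIMSEQ_le[OF l1 l1]) auto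
  with half show ?thesis by simp
qed

text \<open>Any rate between \<open>\<pi> / 2\<close> and \<open>2\<close> would do instead of \<open>17 / 10\<close>: the gamma factor is taken at \<open>s / 2\<close>, and
  half the rate has to stay below the rate \<open>1\<close> at which \<open>bessel2\<close> decays.\<close>
lemma norm_rGamma_strip_le:
  fixes a b :: real
  shows "\<exists>C\<ge>0. \<forall>x\<in>{a..b}. \<forall>y. norm (rGamma (Complex x y)) \<le> C * exp (17/10 * \<bar>y\<bar>)"
proof -
  \<comment> \<open>Adding \<open>N\<close> moves the strip to real part at least 1, where
    \<open>norm_rGamma_le_aux\<close> applies; the price is a Pochhammer factor, a polynomial of
    degree \<open>N\<close> in the variable.\<close>
  obtain N :: nat where N: "a + real N \<ge> 1"
    using real_arch_simple[of "1 - a"] by (auto simp: algebra_simps)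
  define B where "B = \<bar>a\<bar> + \<bar>b\<bar> + real N"
  have "continuous_on {a + N..b + N} (\<lambda>x. rGamma (complex_of_real x))"
    by (intro continuous_on_compose2[OF holomorphic_on_imp_continuous_on[OF holomorphic_rGamma[of UNIV]]] continuous_intros) auto
  then have "compact ((\<lambda>x. rGamma (complex_of_real x)) ` {a + N..b + N})"
    by (rule compact_continuous_image) simp
  then obtain M where M: "\<And>x. x \<in> {a + N..b + N} \<Longrightarrow> norm (rGamma (complex_of_real x)) \<le> M"
    using compact_imp_bounded bounded_iff by (metis (no_types, lifting) image_eqI)
  define C where "C = 10 ^ N * fact N * exp (B / 10) * \<bar>M\<bar>"
  have "norm (rGamma (Complex x y)) \<le> C * exp (17/10 * \<bar>y\<bar>)" if x: "x \<in> {a..b}" for x y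
  proof -
    define X where "X = x + real N"
    have X: "X \<ge> 1/2" "X \<in> {a + N..b + N}" using x N by (auto simp: X_def)
    have "Complex x y + of_nat N = Complex X y" by (simp add: X_def complex_eq_iff)
    then have e: "norm (rGamma (Complex x y)) = norm (pochhammer (Complex x y) N) * norm (rGamma (Complex X y))"
      using pochhammer_rGamma[of "Complex x y" N] by (simp add: norm_mult)
    have "norm (pochhammer (Complex x y) N) = (\<Prod>k<N. norm (Complex x y + of_nat k))"
      by (simp add: pochhammer_prod prod_norm atLeast0LessThan)
    also have "\<dots> \<le> (\<Prod>k<N. B + \<bar>y\<bar>)"
    proof (intro prod_mono conjI)
      fix k assume "k \<in> {..<N}"
      have "norm (Complex x y + of_nat k) \<le> \<bar>Re (Complex x y + of_nat k)\<bar> + \<bar>Im (Complex x y + of_nat k)\<bar>"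
        by (rule cmod_le)
      also have "\<dots> \<le> B + \<bar>y\<bar>" using x \<open>k \<in> {..<N}\<close> by (auto simp: B_def)
      finally show "norm (Complex x y + of_nat k) \<le> B + \<bar>y\<bar>" .
    qed simp
    also have "\<dots> = 10 ^ N * ((B + \<bar>y\<bar>) / 10) ^ N" by (simp add: power_divide)
    \<comment> \<open>A single term of the exponential series absorbs the polynomial into
      \<open>exp (\<bar>y\<bar> / 10)\<close>; together with the rate \<open>16/10\<close> from the
      cosh below this makes \<open>17/10\<close>.\<close>
    also have "((B + \<bar>y\<bar>) / 10) ^ N \<le> fact N * exp ((B + \<bar>y\<bar>) / 10)"
    proof -
      have B0: "B + \<bar>y\<bar> \<ge> 0" by (simp add: B_def)
      have "((B + \<bar>y\<bar>) / 10) ^ N /\<^sub>R fact N \<le> exp ((B + \<bar>y\<bar>) / 10)"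
        unfolding exp_def using B0
        by (intro order_trans[OF _ sum_le_suminf[where I = "{N}"]]) (auto simp: summable_exp)
      then show ?thesis by (simp add: field_simps)
    qed
    finally have p: "norm (pochhammer (Complex x y) N) \<le> 10 ^ N * (fact N * exp ((B + \<bar>y\<bar>) / 10))"
      by simp
    have ch: "sqrt (cosh (pi * y)) \<le> exp (16/10 * \<bar>y\<bar>)"
    proof -
      have "cosh (pi * y) = cosh (pi * \<bar>y\<bar>)" by (cases "y \<ge> 0") auto
      also have "\<dots> \<le> exp (pi * \<bar>y\<bar>)" by (simp add: cosh_def)
      also have "\<dots> \<le> exp (32/10 * \<bar>y\<bar>)" using mult_right_mono[of pi "32/10" "\<bar>y\<bar>"] pi_approx by simp
      also have "\<dots> = (exp (16/10 * \<bar>y\<bar>))\<^sup>2" by (simp add: power2_eq_square exp_add[symmetric])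
      finally show ?thesis by (rule real_le_lsqrt[rotated -1]) auto
    qed
    have gx: "Gamma (complex_of_real X) * rGamma (of_real X) = 1"
    proof -
      have "Gamma X > 0" using X(1) by (intro Gamma_real_pos) simp
      then have "Gamma (complex_of_real X) \<noteq> 0" by (simp add: Gamma_complex_of_real)
      then show ?thesis by (simp add: rGamma_inverse_Gamma)
    qed
    have "Gamma (of_real X :: complex) * rGamma (Complex X y) * rGamma (complex_of_real X) = rGamma (Complex X y)"
      using gx by (metis mult.assoc mult.commute mult.right_neutral)
    then have "norm (rGamma (Complex X y)) = norm (Gamma (of_real X :: complex) * rGamma (Complex X y)) * norm (rGamma (complex_of_real X))"
      by (metis norm_mult)
    also have "\<dots> \<le> exp (16/10 * \<bar>y\<bar>) * \<bar>M\<bar>"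
      using M[OF X(2)] norm_rGamma_le_aux[OF X(1), of y] ch by (intro mult_mono) auto
    finally have "norm (rGamma (Complex x y)) \<le> (10 ^ N * (fact N * exp ((B + \<bar>y\<bar>) / 10))) * (exp (16/10 * \<bar>y\<bar>) * \<bar>M\<bar>)"
      unfolding e using p by (intro mult_mono) auto
    also have "\<dots> = C * (exp (\<bar>y\<bar> / 10) * exp (16/10 * \<bar>y\<bar>))"
      by (simp add: C_def add_divide_distrib exp_add)
    also have "exp (\<bar>y\<bar> / 10) * exp (16/10 * \<bar>y\<bar>) = exp (17/10 * \<bar>y\<bar>)"
      by (simp add: exp_add[symmetric] algebra_simps)
    finally show ?thesis .
  qed
  moreover have "C \<ge> 0" by (auto simp: C_def)
  ultimately show ?thesis by blast
qed

subsection \<open>Fourier inversion\<close>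

text \<open>Endpoints are extended reals so that one statement covers the whole line with image (0,
  \<infinity>) as well as half-lines. Integrability reaches the \<open>t\<close> side through the
  nonnegative substitution applied to the norm of \<open>f\<close>; equality then follows from the
  substitution for integrable functions.\<close>

lemma exp_substitution_einterval:
  fixes f :: "real \<Rightarrow> 'a::euclidean_space" and a A :: ereal
  assumes cont: "\<And>x. x > 0 \<Longrightarrow> isCont f x" and a: "a < \<infinity>" and A: "0 \<le> A"
    and lim: "((ereal \<circ> exp \<circ> real_of_ereal) \<longlongrightarrow> A) (at_right a)"
    and int: "set_integrable lborel (einterval a \<infinity>) (\<lambda>v. exp v *\<^sub>R f (exp v))"
  shows "set_integrable lborel (einterval A \<infinity>) f"
    and "(LBINT t:einterval A \<infinity>. f t) = (LBINT v:einterval a \<infinity>. exp v *\<^sub>R f (exp v))"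
proof -
  have lim2: "((ereal \<circ> exp \<circ> real_of_ereal) \<longlongrightarrow> \<infinity>) (at_left \<infinity>)"
    by (simp add: ereal_tendsto_simps exp_at_top)
  have "set_integrable lborel (einterval a \<infinity>) (\<lambda>v. norm (exp v *\<^sub>R f (exp v)))"
    using set_integrable_norm[OF int] by simp
  then have "set_integrable lborel (einterval A \<infinity>) (\<lambda>x. norm (f x))"
    by (intro interval_integral_substitution_nonneg(1)[OF a, where g = exp and g' = exp and f = "\<lambda>x. norm (f x)"])
       (use lim lim2 in \<open>simp_all add: mult.commute continuous_norm cont\<close>)
  moreover have "(\<lambda>x. indicat_real (einterval A \<infinity>) x *\<^sub>R f x) \<in> borel_measurable lborel"
  proof -
    have "continuous_on (einterval A \<infinity>) f"
      using A cont by (intro continuous_at_imp_continuous_on ballI)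
        (auto simp: einterval_def dest: order.strict_trans1)
    from borel_measurable_continuous_on_indicator[OF _ this] show ?thesis by simp
  qed
  ultimately show 1: "set_integrable lborel (einterval A \<infinity>) f"
    unfolding set_integrable_def by (subst integrable_norm_iff[symmetric]) simp_all
  have "(LBINT x=A..\<infinity>. f x) = (LBINT x=a..\<infinity>. exp x *\<^sub>R f (exp x))"
    by (rule interval_integral_substitution_integrable[OF a])
       (use lim lim2 1 int in \<open>simp_all add: cont\<close>)
  then show "(LBINT t:einterval A \<infinity>. f t) = (LBINT v:einterval a \<infinity>. exp v *\<^sub>R f (exp v))"
    using a by (simp add: interval_lebesgue_integral_def less_imp_le)
qed

lemma lborel_integral_scale:
  fixes f :: "real \<Rightarrow> complex"
  assumes "c > 0"
  shows "(\<integral>x. f x \<partial>lborel) = of_real c * (\<integral>x. f (c * x + t) \<partial>lborel)"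
  using lborel_integral_real_affine[of c f t] assms by (simp add: scaleR_conv_of_real add.commute)

lemma gaussian_integrable: "integrable lborel (\<lambda>x. exp (- (x\<^sup>2) / 2) :: real)"
proof -
  have "integrable lborel (\<lambda>x. sqrt (2 * pi) * std_normal_density x)"
    using integrable_std_normal_moment[of 0] by simp
  also have "(\<lambda>x. sqrt (2 * pi) * std_normal_density x) = (\<lambda>x. exp (- (x\<^sup>2) / 2))"
    by (simp add: std_normal_density_def fun_eq_iff)
  finally show ?thesis .
qed

text \<open>Up to the normalisation of the density this is the characteristic function of the
  standard normal distribution.\<close>

lemma gaussian_fourier:
  "(\<integral>x. of_real (exp (- (x\<^sup>2) / 2)) * cis (t * x) \<partial>lborel) = of_real (sqrt (2 * pi) * exp (- (t\<^sup>2) / 2))"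
proof -
  have "of_real (exp (- (t\<^sup>2) / 2)) = (\<integral>x. iexp (t * x) \<partial>std_normal_distribution)"
    using char_std_normal_distribution unfolding char_def by metis
  also have "\<dots> = (\<integral>x. std_normal_density x *\<^sub>R iexp (t * x) \<partial>lborel)"
    by (subst integral_density) (auto simp: normal_density_nonneg)
  also have "\<dots> = (\<integral>x. of_real (1 / sqrt (2 * pi)) * (of_real (exp (- (x\<^sup>2) / 2)) * cis (t * x)) \<partial>lborel)"
    by (intro Bochner_Integration.integral_cong)
      (simp_all add: std_normal_density_def scaleR_conv_of_real cis_conv_exp)
  also have "\<dots> = of_real (1 / sqrt (2 * pi)) * (\<integral>x. of_real (exp (- (x\<^sup>2) / 2)) * cis (t * x) \<partial>lborel)"
    by simp
  finally have "of_real (exp (- (t\<^sup>2) / 2)) = of_real (1 / sqrt (2 * pi)) * (\<integral>x. of_real (exp (- (x\<^sup>2) / 2)) * cis (t * x) \<partial>lborel)" .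
  then show ?thesis by (simp add: field_simps)
qed

text \<open>Gaussian summability: with the factor \<open>G n\<close> inserted, Fubini turns the
  inversion integral into an average of \<open>f\<close> against a Gaussian of width
  \<open>1 / (n + 1)\<close> centred at \<open>x\<close>. Dominated convergence applies on both
  sides, by the integrable transform on one and by the bound \<open>B\<close> on the other.\<close>

lemma fourier_inversion:
  fixes f :: "real \<Rightarrow> complex"
  assumes cont: "continuous_on UNIV f" and bd: "\<And>x. norm (f x) \<le> B"
    and int: "integrable lborel f"
    and inth: "integrable lborel (\<lambda>\<xi>. \<integral>y. f y * cis (\<xi> * y) \<partial>lborel)"
  shows "(\<integral>\<xi>. (\<integral>y. f y * cis (\<xi> * y) \<partial>lborel) * cis (- \<xi> * x) \<partial>lborel) = 2 * pi * f x"
proof -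
  define fh where "fh \<xi> = (\<integral>y. f y * cis (\<xi> * y) \<partial>lborel)" for \<xi>
  have fm [measurable]: "f \<in> borel_measurable borel"
    using cont by (rule borel_measurable_continuous_onI)
  have cism [measurable]: "cis \<in> borel_measurable borel"
    by (intro borel_measurable_continuous_onI continuous_intros)
  have fhm [measurable]: "fh \<in> borel_measurable borel"
    using inth by (auto simp: fh_def[abs_def] dest: borel_measurable_integrable)
  have fhi: "integrable lborel fh" using inth by (simp add: fh_def[abs_def])
  define G where "G n \<xi> = exp (- ((\<xi> / real (Suc n))\<^sup>2) / 2)" for n \<xi>
  have Gm [measurable]: "G n \<in> borel_measurable borel" for n unfolding G_def by measurable
  have Gi: "integrable lborel (G n)" for n
    using lborel_integrable_real_affine[OF gaussian_integrable, of "1 / real (Suc n)" 0]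
    by (simp add: G_def[abs_def])
  have step: "(\<integral>\<xi>. of_real (G n \<xi>) * (fh \<xi> * cis (- \<xi> * x)) \<partial>lborel)
     = (\<integral>z. of_real (sqrt (2 * pi)) * (of_real (exp (- (z\<^sup>2) / 2)) * f (z / real (Suc n) + x)) \<partial>lborel)" for n
  proof -
    define N where "N = real (Suc n)"
    have N: "N > 0" by (simp add: N_def)
    have "(\<integral>\<xi>. of_real (G n \<xi>) * (fh \<xi> * cis (- \<xi> * x)) \<partial>lborel)
       = (\<integral>\<xi>. \<integral>y. of_real (G n \<xi>) * f y * cis (\<xi> * (y - x)) \<partial>lborel \<partial>lborel)"
    proof (intro Bochner_Integration.integral_cong refl)
      fix \<xi>
      have "(\<integral>y. of_real (G n \<xi>) * f y * cis (\<xi> * (y - x)) \<partial>lborel)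
          = (\<integral>y. (of_real (G n \<xi>) * cis (- \<xi> * x)) * (f y * cis (\<xi> * y)) \<partial>lborel)"
        by (intro Bochner_Integration.integral_cong refl) (simp add: algebra_simps cis_mult)
      also have "\<dots> = of_real (G n \<xi>) * cis (- \<xi> * x) * fh \<xi>"
        unfolding fh_def by (rule integral_mult_right_zero)
      finally show "of_real (G n \<xi>) * (fh \<xi> * cis (- \<xi> * x)) = (\<integral>y. of_real (G n \<xi>) * f y * cis (\<xi> * (y - x)) \<partial>lborel)"
        by (simp add: mult_ac)
    qed
    also have "\<dots> = (\<integral>y. \<integral>\<xi>. of_real (G n \<xi>) * f y * cis (\<xi> * (y - x)) \<partial>lborel \<partial>lborel)"
    proof (rule lborel_pair.Fubini_integral[symmetric])
      have *: "integrable (lborel \<Otimes>\<^sub>M lborel) (\<lambda>(\<xi>, y). of_real (G n \<xi>) * f y)"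
        by (intro lborel_pair.Fubini_integrable)
           (use Gi[of n] int in \<open>auto simp: norm_mult intro!: integrable_mult_left integrable_mult_right\<close>)
      show "integrable (lborel \<Otimes>\<^sub>M lborel) (\<lambda>(\<xi>, y). of_real (G n \<xi>) * f y * cis (\<xi> * (y - x)))"
        by (rule Bochner_Integration.integrable_bound[OF *]) (auto simp: norm_mult split: prod.splits)
    qed
    also have "\<dots> = (\<integral>y. f y * of_real (N * sqrt (2 * pi) * exp (- ((N * (y - x))\<^sup>2) / 2)) \<partial>lborel)"
    proof (intro Bochner_Integration.integral_cong refl)
      fix y
      have "(\<integral>\<xi>. of_real (G n \<xi>) * f y * cis (\<xi> * (y - x)) \<partial>lborel) =
         f y * (\<integral>\<xi>. of_real (G n \<xi>) * cis (\<xi> * (y - x)) \<partial>lborel)"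
        by (subst integral_mult_right_zero[symmetric]) (simp add: mult_ac)
      also have "(\<integral>\<xi>. of_real (G n \<xi>) * cis (\<xi> * (y - x)) \<partial>lborel) =
         of_real N * (\<integral>\<xi>. of_real (exp (- (\<xi>\<^sup>2) / 2)) * cis (N * (y - x) * \<xi>) \<partial>lborel)"
        using N by (subst lborel_integral_scale[of N _ 0]) (auto simp: G_def N_def[symmetric] mult_ac simp del: of_nat_Suc)
      finally show "(\<integral>\<xi>. of_real (G n \<xi>) * f y * cis (\<xi> * (y - x)) \<partial>lborel) =
         f y * of_real (N * sqrt (2 * pi) * exp (- ((N * (y - x))\<^sup>2) / 2))"
        unfolding gaussian_fourier by simp
    qed
    \<comment> \<open>Substituting \<open>y = z / N + x\<close> makes the Gaussian independent of
      \<open>n\<close> and moves the scale into the argument of \<open>f\<close>.\<close>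
    also have "\<dots> = of_real (1 / N) * (\<integral>z. f (1/N * z + x) * of_real (N * sqrt (2 * pi) * exp (- ((N * ((1/N*z+x) - x))\<^sup>2) / 2)) \<partial>lborel)"
      using N by (intro lborel_integral_scale) auto
    also have "\<dots> = (\<integral>z. of_real (1 / N) * (f (1/N * z + x) * of_real (N * sqrt (2 * pi) * exp (- ((N * ((1/N*z+x) - x))\<^sup>2) / 2))) \<partial>lborel)"
      by (rule integral_mult_right_zero[symmetric])
    also have "\<dots> = (\<integral>z. of_real (sqrt (2 * pi)) * (of_real (exp (- (z\<^sup>2) / 2)) * f (z / real (Suc n) + x)) \<partial>lborel)"
      using N by (intro Bochner_Integration.integral_cong refl) (simp add: N_def[symmetric] del: of_nat_Suc)
    finally show ?thesis .
  qed
  have l1: "(\<lambda>n. \<integral>\<xi>. of_real (G n \<xi>) * (fh \<xi> * cis (- \<xi> * x)) \<partial>lborel) \<longlonglongrightarrow> (\<integral>\<xi>. fh \<xi> * cis (- \<xi> * x) \<partial>lborel)"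
  proof (rule integral_dominated_convergence[where w = "\<lambda>\<xi>. norm (fh \<xi>)"])
    show "AE \<xi> in lborel. (\<lambda>n. of_real (G n \<xi>) * (fh \<xi> * cis (- \<xi> * x))) \<longlonglongrightarrow> fh \<xi> * cis (- \<xi> * x)"
    proof (rule AE_I2)
      fix \<xi>
      have "(\<lambda>n. \<xi> / real (Suc n)) \<longlonglongrightarrow> 0"
        using LIMSEQ_Suc[OF lim_const_over_n[of \<xi>]] by simp
      then have "(\<lambda>n. G n \<xi>) \<longlonglongrightarrow> exp (- (0\<^sup>2) / 2)"
        unfolding G_def by (intro tendsto_intros) auto
      then have "(\<lambda>n. complex_of_real (G n \<xi>) * (fh \<xi> * cis (- \<xi> * x))) \<longlonglongrightarrow> of_real (exp (- (0\<^sup>2) / 2)) * (fh \<xi> * cis (- \<xi> * x))"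
        by (intro tendsto_intros)
      then show "(\<lambda>n. complex_of_real (G n \<xi>) * (fh \<xi> * cis (- \<xi> * x))) \<longlonglongrightarrow> fh \<xi> * cis (- \<xi> * x)"
        by simp
    qed
    show "AE \<xi> in lborel. norm (of_real (G n \<xi>) * (fh \<xi> * cis (- \<xi> * x))) \<le> norm (fh \<xi>)" for n
      by (auto simp: norm_mult G_def intro!: mult_left_le_one_le)
  qed (use fhi in auto)
  have l2: "(\<lambda>n. \<integral>z. of_real (sqrt (2 * pi)) * (of_real (exp (- (z\<^sup>2) / 2)) * f (z / real (Suc n) + x)) \<partial>lborel)
     \<longlonglongrightarrow> (\<integral>z. of_real (sqrt (2 * pi)) * (of_real (exp (- (z\<^sup>2) / 2)) * f x) \<partial>lborel)"
  proof (rule integral_dominated_convergence[where w = "\<lambda>z. sqrt (2 * pi) * exp (- (z\<^sup>2) / 2) * B"])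
    show "AE z in lborel. (\<lambda>n. of_real (sqrt (2 * pi)) * (of_real (exp (- (z\<^sup>2) / 2)) * f (z / real (Suc n) + x))) \<longlonglongrightarrow> of_real (sqrt (2 * pi)) * (of_real (exp (- (z\<^sup>2) / 2)) * f x)"
    proof (rule AE_I2)
      fix z
      have "(\<lambda>n. z / real (Suc n) + x) \<longlonglongrightarrow> 0 + x"
        using LIMSEQ_Suc[OF lim_const_over_n[of z]] by (intro tendsto_intros) simp
      then have "(\<lambda>n. f (z / real (Suc n) + x)) \<longlonglongrightarrow> f (0 + x)"
        using cont by (intro continuous_on_tendsto_compose[of UNIV f]) auto
      then show "(\<lambda>n. complex_of_real (sqrt (2 * pi)) * (of_real (exp (- (z\<^sup>2) / 2)) * f (z / real (Suc n) + x))) \<longlonglongrightarrow> of_real (sqrt (2 * pi)) * (of_real (exp (- (z\<^sup>2) / 2)) * f x)"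
        by (intro tendsto_intros) simp
    qed
    show "AE z in lborel. norm (of_real (sqrt (2 * pi)) * (of_real (exp (- (z\<^sup>2) / 2)) * f (z / real (Suc n) + x))) \<le> sqrt (2 * pi) * exp (- (z\<^sup>2) / 2) * B" for n
      using bd by (intro AE_I2) (simp add: norm_mult mult.assoc mult_left_mono)
    show "integrable lborel (\<lambda>z. sqrt (2 * pi) * exp (- (z\<^sup>2) / 2) * B)"
      using gaussian_integrable by (intro integrable_mult_left integrable_mult_right) auto
  qed auto
  have "(\<integral>z. of_real (sqrt (2 * pi)) * (of_real (exp (- (z\<^sup>2) / 2)) * f x) \<partial>lborel)
     = of_real (sqrt (2 * pi)) * f x * (\<integral>z. of_real (exp (- (z\<^sup>2) / 2)) * cis (0 * z) \<partial>lborel)"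
    by (subst integral_mult_right_zero[symmetric]) (simp add: mult_ac)
  also have "\<dots> = of_real (sqrt (2 * pi)) * f x * of_real (sqrt (2 * pi))"
    by (subst gaussian_fourier) simp
  also have "\<dots> = of_real (sqrt (2 * pi) * sqrt (2 * pi)) * f x" by (simp only: of_real_mult mult_ac)
  also have "\<dots> = 2 * pi * f x" by simp
  finally have fin: "(\<integral>z. of_real (sqrt (2 * pi)) * (of_real (exp (- (z\<^sup>2) / 2)) * f x) \<partial>lborel) = 2 * pi * f x" .
  have "(\<integral>\<xi>. fh \<xi> * cis (- \<xi> * x) \<partial>lborel) =
      (\<integral>z. of_real (sqrt (2 * pi)) * (of_real (exp (- (z\<^sup>2) / 2)) * f x) \<partial>lborel)"
    by (rule LIMSEQ_unique[OF l1]) (unfold step, rule l2)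
  then show ?thesis unfolding fin fh_def .
qed

lemma gaussian_fourier_scaled:
  assumes "t > 0"
  shows "(\<integral>y. of_real (exp (- pi * y\<^sup>2 * t)) * cis (\<xi> * y) \<partial>lborel) = of_real (exp (- (\<xi>\<^sup>2) / (4 * pi * t)) / sqrt t)"
    and "integrable lborel (\<lambda>y. exp (- pi * y\<^sup>2 * t))"
proof -
  \<comment> \<open>Chosen so that \<open>pi * (c * x)\<^sup>2 * t\<close> becomes
    \<open>x\<^sup>2 / 2\<close>.\<close>
  define c where "c = 1 / sqrt (2 * pi * t)"
  have c: "c > 0" and c2: "c\<^sup>2 = 1 / (2 * pi * t)" using assms by (simp_all add: c_def power_divide)
  have e: "- pi * (c * x)\<^sup>2 * t = - (x\<^sup>2) / 2" for x
    using assms unfolding power_mult_distrib c2 by (simp add: field_simps)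
  have "(\<integral>y. of_real (exp (- pi * y\<^sup>2 * t)) * cis (\<xi> * y) \<partial>lborel) =
     of_real c * (\<integral>x. of_real (exp (- pi * (c * x + 0)\<^sup>2 * t)) * cis (\<xi> * (c * x + 0)) \<partial>lborel)"
    using c by (rule lborel_integral_scale)
  also have "\<dots> = of_real c * of_real (sqrt (2 * pi) * exp (- ((\<xi> * c)\<^sup>2) / 2))"
    unfolding add_0_right e by (simp only: mult.assoc[symmetric] gaussian_fourier)
  also have "\<dots> = of_real (exp (- (\<xi>\<^sup>2) / (4 * pi * t)) / sqrt t)"
  proof -
    have "c * sqrt (2 * pi) = 1 / sqrt t" using assms by (simp add: c_def real_sqrt_mult)
    moreover have "- ((\<xi> * c)\<^sup>2) / 2 = - (\<xi>\<^sup>2) / (4 * pi * t)" 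
      using assms unfolding power_mult_distrib c2 by (simp add: field_simps)
    ultimately show ?thesis by (metis mult.assoc mult.commute mult.right_neutral of_real_mult times_divide_eq_left)
  qed
  finally show "(\<integral>y. of_real (exp (- pi * y\<^sup>2 * t)) * cis (\<xi> * y) \<partial>lborel) = of_real (exp (- (\<xi>\<^sup>2) / (4 * pi * t)) / sqrt t)" .
  have "integrable lborel (\<lambda>x. exp (- ((0 + (1 / c) * x)\<^sup>2) / 2))"
    using c by (intro lborel_integrable_real_affine gaussian_integrable) auto
  moreover have "- ((0 + (1 / c) * x)\<^sup>2) / 2 = - pi * x\<^sup>2 * t" for x
    using e[of "x / c"] c by simp
  ultimately show "integrable lborel (\<lambda>y. exp (- pi * y\<^sup>2 * t))" by simp
qed

text \<open>The version with a pole, centred at the midpoint \<open>m\<close> of the strip and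
  applied to \<open>w * g (w + m)\<close>: the quotient by \<open>w\<close> is \<open>g\<close>
  again and the residue is 0.\<close>

lemma vertical_line_shift:
  fixes g :: "complex \<Rightarrow> complex"
  assumes g: "g holomorphic_on UNIV" and ab: "a < b"
    and small: "\<And>e. e > 0 \<Longrightarrow> \<forall>\<^sub>F T in at_top. \<forall>x\<in>{a..b}.
        norm (g (Complex x T)) \<le> e \<and> norm (g (Complex x (-T))) \<le> e"
    and ia: "integrable lborel (\<lambda>t. g (Complex a t))"
    and ib: "integrable lborel (\<lambda>t. g (Complex b t))"
  shows "(\<integral>t. g (Complex b t) \<partial>lborel) = (\<integral>t. g (Complex a t) \<partial>lborel)"
proof -
  define m where "m = (a + b) / 2"
  define h where "h w = w * g (w + of_real m)" for w
  have sh: "Complex x t + of_real m = Complex (x + m) t" for x t by (simp add: complex_eq_iff)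
  have hq: "h (Complex x t) / Complex x t = g (Complex (x + m) t)" if "x \<noteq> 0 \<or> t \<noteq> 0" for x t
    using that by (auto simp: h_def sh complex_eq_iff)
  have "(\<integral>t. h (Complex (b - m) t) / Complex (b - m) t \<partial>lborel)
       - (\<integral>t. h (Complex (a - m) t) / Complex (a - m) t \<partial>lborel) = 2 * pi * h 0"
  proof (rule vertical_line_shift_pole)
    show "h holomorphic_on UNIV"
      unfolding h_def by (intro holomorphic_intros holomorphic_on_compose_gen[OF _ g, unfolded o_def]) auto
    show "a - m < 0" "0 < b - m" using ab by (auto simp: m_def)
    fix e :: real assume "e > 0"
    from small[OF this] eventually_gt_at_top[of 0]
    show "\<forall>\<^sub>F T in at_top. \<forall>x\<in>{a - m..b - m}.
        norm (h (Complex x T) / Complex x T) \<le> e \<and> norm (h (Complex x (-T)) / Complex x (-T)) \<le> e"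
    proof eventually_elim
      case (elim T)
      then show ?case by (auto simp: hq)
    qed
  qed (use ia ib ab in \<open>simp_all add: hq m_def\<close>)
  moreover have "h (Complex (c - m) t) / Complex (c - m) t = g (Complex c t)" if "c = a \<or> c = b" for c t
    using hq[of "c - m" t] that ab by (auto simp: m_def)
  moreover have "h 0 = 0" by (simp add: h_def)
  ultimately show ?thesis by simp
qed

subsection \<open>The Bessel kernel and the Mellin transform of the cutoff\<close>

lemma integrable_exp_abs_gaussian:
  fixes c d :: real
  assumes "d > 0"
  shows "integrable lborel (\<lambda>v. exp (c * \<bar>v\<bar>) * exp (- d * v\<^sup>2))"
proof -
  have le: "c * \<bar>v\<bar> - d * v\<^sup>2 \<le> c\<^sup>2 / (2 * d) - d / 2 * v\<^sup>2" for v
  proof -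
    \<comment> \<open>Half of the Gaussian pays for completing the square; the other half remains
      for integrability.\<close>
    have "0 \<le> (c - d * \<bar>v\<bar>)\<^sup>2 / (2 * d)" using assms by simp
    also have "\<dots> = c\<^sup>2 / (2 * d) - c * \<bar>v\<bar> + d / 2 * v\<^sup>2"
      using assms by (simp add: power2_diff power_mult_distrib field_simps power2_eq_square)
    finally show ?thesis by (simp add: field_simps)
  qed
  have "integrable lborel (\<lambda>v. exp (c\<^sup>2 / (2 * d)) * exp (- pi * v\<^sup>2 * (d / (2 * pi))))"
    using gaussian_fourier_scaled(2)[of "d / (2 * pi)"] assms by (intro integrable_mult_right) auto
  then have "integrable lborel (\<lambda>v. exp (c\<^sup>2 / (2 * d)) * exp (- d / 2 * v\<^sup>2))"
    by (simp add: mult_ac)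
  then show ?thesis
  proof (rule Bochner_Integration.integrable_bound)
    show "AE v in lborel. norm (exp (c * \<bar>v\<bar>) * exp (- d * v\<^sup>2)) \<le> norm (exp (c\<^sup>2 / (2 * d)) * exp (- d / 2 * v\<^sup>2))"
      using le by (intro AE_I2) (simp add: exp_add[symmetric])
  qed measurable
qed

lemma cosh_ge_square: "cosh (x :: real) \<ge> x\<^sup>2 / 4"
proof -
  have "\<bar>x\<bar> ^ 2 /\<^sub>R fact 2 \<le> exp \<bar>x\<bar>"
    unfolding exp_def
    by (intro order_trans[OF _ sum_le_suminf[where I = "{2}"]]) (auto simp: summable_exp)
  moreover have "cosh x = cosh \<bar>x\<bar>" by (cases "x \<ge> 0") auto
  moreover have "cosh \<bar>x\<bar> \<ge> exp \<bar>x\<bar> / 2" by (simp add: cosh_def)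
  ultimately show ?thesis by (simp add: field_simps)
qed

text \<open>After \<open>t = exp v\<close> the Bessel, theta and gamma integrals all decay doubly
  exponentially; this is their common dominating function.\<close>

lemma integrable_exp_cosh:
  fixes c d :: real
  assumes "d > 0"
  shows "integrable lborel (\<lambda>v. exp (c * \<bar>v\<bar>) * exp (- d * cosh v))"
proof (rule Bochner_Integration.integrable_bound[OF integrable_exp_abs_gaussian[of "d/4" c]])
  show "AE v in lborel. norm (exp (c * \<bar>v\<bar>) * exp (- d * cosh v)) \<le> norm (exp (c * \<bar>v\<bar>) * exp (- (d / 4) * v\<^sup>2))"
    using assms mult_left_mono[OF cosh_ge_square, of d] by (intro AE_I2) simp
  have "(\<lambda>v :: real. cosh v) \<in> borel_measurable borel" 
    by (intro borel_measurable_continuous_onI continuous_intros)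
  then show "(\<lambda>v. exp (c * \<bar>v\<bar>) * exp (- d * cosh v)) \<in> borel_measurable lborel" by measurable
qed (use assms in auto)

text \<open>\<open>bessel2 u\<close> is \<open>2 K\<^sub>u(2)\<close>, after \<open>t = exp v\<close>.\<close>
definition bessel2 :: "complex \<Rightarrow> complex" where
  "bessel2 u = (\<integral>v. of_real (exp (- 2 * cosh v)) * exp (u * of_real v) \<partial>lborel)"

lemma cosh_measurable [measurable]: "(cosh :: real \<Rightarrow> real) \<in> borel_measurable borel"
  by (intro borel_measurable_continuous_onI continuous_intros)

lemma holomorphic_bessel2: "bessel2 holomorphic_on UNIV"
  unfolding bessel2_def[abs_def]
  using integrable_exp_cosh[of 2] by (intro laplace_entire) auto

lemma bessel2_minus: "bessel2 (- u) = bessel2 u"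
  unfolding bessel2_def
  using lborel_integral_real_affine[of "-1" "\<lambda>v. of_real (exp (- 2 * cosh v)) * exp (u * of_real v)" 0] by simp

lemma bessel2_real: 
  "bessel2 0 = of_real (\<integral>v. exp (- 2 * cosh v) \<partial>lborel)" "(\<integral>v. exp (- 2 * cosh v) \<partial>lborel) > (0::real)"
proof -
  show "bessel2 0 = of_real (\<integral>v. exp (- 2 * cosh v) \<partial>lborel)"
    unfolding bessel2_def integral_complex_of_real[symmetric] by simp
  have i: "integrable lborel (\<lambda>v. exp (- 2 * cosh v) :: real)"
    using integrable_exp_cosh[of 2 0] by simp
  have "0 < exp (- 2 * cosh (1::real))" by simp
  also have "\<dots> = (\<integral>v. exp (- 2 * cosh 1) * indicator {0..1 :: real} v \<partial>lborel)" 
    using content_real[of 0 "1::real"] by (subst integral_mult_right_zero) simp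
  also have "\<dots> \<le> (\<integral>v. exp (- 2 * cosh v) \<partial>lborel)"
    using i by (intro integral_mono integrable_mult_right integrable_real_indicator)
      (auto simp: indicator_def cosh_real_nonneg_le_iff)
  finally show "(\<integral>v. exp (- 2 * cosh v) \<partial>lborel) > (0::real)" .
qed

text \<open>Moving the line of integration to \<open>Im v = 1\<close> produces the factor \<open>exp (- Im u)\<close>.\<close>
lemma bessel2_decay:
  fixes M :: real
  assumes "M \<ge> 0"
  shows "\<exists>C\<ge>0. \<forall>x y. \<bar>x\<bar> \<le> M \<longrightarrow> norm (bessel2 (Complex x y)) \<le> C * exp (- \<bar>y\<bar>)"
proof -
  \<comment> \<open>For \<bar>c\<bar> \<le> 1 the real part of \<open>2 * cos (Complex c t)\<close>
    is at least \<open>d * cosh t\<close>, and \<open>d > 0\<close> because 1 < \<pi> / 2.\<close>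
  define d where "d = 2 * cos (1::real)"
  have d: "d > 0" using cos_gt_zero_pi[of 1] pi_gt3 by (simp add: d_def)
  define C where "C = (\<integral>t. exp (M * \<bar>t\<bar>) * exp (- d * cosh t) \<partial>lborel)"
  have pos: "norm (bessel2 (Complex x y)) \<le> C * exp (- y)" if x: "\<bar>x\<bar> \<le> M" and y: "y \<ge> 0" for x y
  proof -
    \<comment> \<open>With \<open>w = \<i> * v\<close> a horizontal line in \<open>v\<close> becomes
      a vertical line in \<open>w\<close>, and \<open>cosh v\<close> becomes \<open>cos w\<close>.
      The line \<open>Re w = -1\<close> is \<open>Im v = 1\<close>.\<close>
    define g where "g w = exp (- 2 * cos w - \<i> * Complex x y * w)" for w
    have nrm: "norm (g (Complex c t)) = exp (- 2 * cos c * cosh t + x * t + y * c)" for c t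
      by (simp add: g_def norm_exp_eq_Re Re_cos cosh_def)
    have cosle: "cos c \<ge> cos 1" if "c \<in> {-1..0}" for c :: real
    proof -
      have "cos \<bar>c\<bar> \<ge> cos 1" using that pi_gt3 by (intro cos_monotone_0_pi_le) auto
      then show ?thesis by simp
    qed
    have bnd: "norm (g (Complex c t)) \<le> exp (y * c) * (exp (M * \<bar>t\<bar>) * exp (- d * cosh t))" if "c \<in> {-1..0}" for c t
    proof -
      have "x * t \<le> M * \<bar>t\<bar>" using x abs_ge_self[of "x * t"] mult_right_mono[OF x abs_ge_zero[of t]] by (simp add: abs_mult)
      moreover have "- 2 * cos c * cosh t \<le> - d * cosh t"
        using cosle[OF that] by (simp add: d_def mult_right_mono cosh_real_nonneg)
      ultimately have "- 2 * cos c * cosh t + x * t + y * c \<le> y * c + (M * \<bar>t\<bar> + - d * cosh t)" by linarith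
      then show ?thesis unfolding nrm exp_add[symmetric] by (simp only: exp_le_cancel_iff)
    qed
    have contg: "continuous_on UNIV (\<lambda>t. g (Complex c t))" for c
      unfolding g_def Complex_eq by (intro continuous_intros)
    have gi: "integrable lborel (\<lambda>t. g (Complex c t))" if "c \<in> {-1..0}" for c
    proof (rule Bochner_Integration.integrable_bound)
      show "integrable lborel (\<lambda>t. exp (y * c) * (exp (M * \<bar>t\<bar>) * exp (- d * cosh t)))"
        using integrable_exp_cosh[OF d, of M] by (intro integrable_mult_right)
      show "AE t in lborel. norm (g (Complex c t)) \<le> norm (exp (y * c) * (exp (M * \<bar>t\<bar>) * exp (- d * cosh t)))"
        using bnd[OF that] by simp
    qed (use borel_measurable_continuous_onI[OF contg] in simp)
    have "(\<integral>t. g (Complex 0 t) \<partial>lborel) = (\<integral>t. g (Complex (-1) t) \<partial>lborel)"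
    proof (rule vertical_line_shift)
      show "g holomorphic_on UNIV" unfolding g_def by (intro holomorphic_intros)
      fix e :: real assume e: "e > 0"
      have "((\<lambda>T. exp (M * T) * exp (- d * (T\<^sup>2 / 4))) \<longlongrightarrow> 0) at_top"
      proof (cases "M = 0")
        case True
        then show ?thesis using d by simp real_asymp
      next
        case False
        then have "M > 0" using assms by simp
        then show ?thesis using d by real_asymp
      qed
      then have "\<forall>\<^sub>F T in at_top. exp (M * T) * exp (- d * (T\<^sup>2 / 4)) < e"
        using e by (rule order_tendstoD)
      then show "\<forall>\<^sub>F T in at_top. \<forall>x\<in>{-1..0}. norm (g (Complex x T)) \<le> e \<and> norm (g (Complex x (-T))) \<le> e"
        using eventually_ge_at_top[of 0]
      proof eventually_elim
        case (elim T)
        have "norm (g (Complex c t)) \<le> e" if "c \<in> {-1..0}" "\<bar>t\<bar> = T" for c t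
        proof -
          have "exp (y * c) \<le> 1" using that(1) y by (simp add: mult_nonneg_nonpos)
          then have "exp (y * c) * (exp (M * \<bar>t\<bar>) * exp (- d * cosh t)) \<le> 1 * (exp (M * \<bar>t\<bar>) * exp (- d * cosh t))"
            by (intro mult_right_mono) auto
          also have "\<dots> \<le> exp (M * T) * exp (- d * (T\<^sup>2 / 4))"
using that(2) d mult_left_mono[OF cosh_ge_square[of t], of d]
            by (auto simp: power2_eq_square)
          finally show ?thesis using bnd[OF that(1), of t] elim by linarith
        qed
        note * = this
        show ?case using elim(2) by (intro ballI conjI *) simp_all
      qed
    qed (use gi in auto)
    moreover have "bessel2 (Complex x y) = (\<integral>t. g (Complex 0 t) \<partial>lborel)"
    proof -
      have "of_real (exp (- 2 * cosh t)) * exp (Complex x y * of_real t) = g (Complex 0 t)" for t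
      proof -
        have "cos (Complex 0 t) = of_real (cosh t)"
          by (simp add: complex_eq_iff Re_cos Im_cos cosh_def)
        moreover have "- \<i> * Complex x y * Complex 0 t = Complex x y * of_real t"
          by (simp add: complex_eq_iff)
        ultimately have "of_real (- 2 * cosh t) + Complex x y * of_real t = - 2 * cos (Complex 0 t) - \<i> * Complex x y * Complex 0 t"
          by (metis (no_types, opaque_lifting) add.commute add_uminus_conv_diff diff_minus_eq_add minus_mult_left of_real_minus of_real_mult of_real_numeral uminus_add_conv_diff)
        then show ?thesis
          unfolding g_def exp_of_real[symmetric] exp_add[symmetric] by (rule arg_cong)
      qed
      then show ?thesis by (simp add: bessel2_def)
    qed
    moreover have "norm (\<integral>t. g (Complex (-1) t) \<partial>lborel) \<le> (\<integral>t. exp (- y) * (exp (M * \<bar>t\<bar>) * exp (- d * cosh t)) \<partial>lborel)"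
      using gi[of "-1"] integrable_exp_cosh[OF d, of M] bnd[of "-1"]
      by (intro Bochner_Integration.integral_norm_bound_integral) auto
    ultimately show ?thesis by (simp add: C_def mult.commute)
  qed
  have C0: "C \<ge> 0" unfolding C_def by (intro Bochner_Integration.integral_nonneg) auto
  have "norm (bessel2 (Complex x y)) \<le> C * exp (- \<bar>y\<bar>)" if "\<bar>x\<bar> \<le> M" for x y
  proof (cases "y \<ge> 0")
    case True
    then show ?thesis using pos[OF that True] by simp
  next
    \<comment> \<open>Negative \<open>y\<close> reduces to positive \<open>y\<close> by the symmetry
      of \<open>bessel2\<close> under change of sign.\<close>
    case False
    have "Complex (-x) (-y) = - Complex x y" by (simp add: complex_eq_iff)
    then show ?thesis using pos[of "-x" "-y"] that False bessel2_minus[of "Complex x y"] by simp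
  qed
  with C0 show ?thesis by blast
qed

section \<open>The cutoff function in logarithmic coordinates and its Mellin transform\<close>

lemma exp_lower_halfline:
  assumes "Re u > 0"
  shows "integrable lborel (\<lambda>v. if v < w then exp (u * of_real v) else 0)"
    and "(\<integral>v. (if v < w then exp (u * of_real v) else 0) \<partial>lborel) = exp (u * of_real w) / u"
proof -
  have u: "u \<noteq> 0" using assms by auto
  have real_lim: "((\<lambda>v. exp (c * v) / n) \<longlongrightarrow> 0) at_bot" if c: "c > 0" for c n :: real
  proof -
    have "((\<lambda>v. exp (c * v)) \<longlongrightarrow> 0) at_bot" using c by real_asymp
    from tendsto_mult_left[OF this, of "1 / n"] show ?thesis by simp
  qed
  have lim: "((\<lambda>v. exp (z * complex_of_real v) / z) \<longlongrightarrow> 0) at_bot" if z: "Re z > 0" for z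
  proof (rule tendsto_norm_zero_cancel)
    show "((\<lambda>v. norm (exp (z * complex_of_real v) / z)) \<longlongrightarrow> 0) at_bot"
      using real_lim[OF z, of "norm z"] by (simp add: norm_divide norm_exp_eq_Re)
  qed
  have r: "set_integrable lborel (einterval (-\<infinity>) (ereal w)) (\<lambda>v. exp (Re u * v))"
  proof (rule interval_integral_FTC_nonneg(1)[where F = "\<lambda>v. exp (Re u * v) / Re u" and A = 0 and B = "exp (Re u * w) / Re u"])
    show "((( \<lambda>v. exp (Re u * v) / Re u) \<circ> real_of_ereal) \<longlongrightarrow> 0) (at_right (- \<infinity>))"
      unfolding ereal_tendsto_simps by (rule real_lim[OF assms])
    have "isCont (\<lambda>v. exp (Re u * v) / Re u) w" using assms by (intro continuous_intros) auto
    then show "((( \<lambda>v. exp (Re u * v) / Re u) \<circ> real_of_ereal) \<longlongrightarrow> exp (Re u * w) / Re u) (at_left (ereal w))"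
      unfolding ereal_tendsto_simps by (simp add: isCont_def filterlim_at_split)
    show "((\<lambda>v. exp (Re u * v) / Re u) has_real_derivative exp (Re u * x)) (at x)" for x
      using assms by (auto intro!: derivative_eq_intros)
    show "isCont (\<lambda>v. exp (Re u * v)) x" for x by (intro continuous_intros)
  qed simp_all
  have e: "einterval (-\<infinity>) (ereal w) = {..<w}" by (auto simp: einterval_def)
  have s: "set_integrable lborel (einterval (-\<infinity>) (ereal w)) (\<lambda>v. exp (u * of_real v))"
    unfolding set_integrable_def
    by (rule Bochner_Integration.integrable_bound[OF r[unfolded set_integrable_def]])
       (auto simp: e norm_exp_eq_Re indicator_def)
  have "(LBINT v=-\<infinity>..ereal w. exp (u * of_real v)) = exp (u * of_real w) / u - 0"
  proof (rule interval_integral_FTC_integrable[where F = "\<lambda>v. exp (u * of_real v) / u"])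
    show "((( \<lambda>v. exp (u * complex_of_real v) / u) \<circ> real_of_ereal) \<longlongrightarrow> 0) (at_right (- \<infinity>))"
      unfolding ereal_tendsto_simps by (rule lim[OF assms])
    show "((( \<lambda>v. exp (u * complex_of_real v) / u) \<circ> real_of_ereal) \<longlongrightarrow> exp (u * of_real w) / u) (at_left (ereal w))"
    proof -
      have "isCont (\<lambda>v. exp (u * complex_of_real v) / u) w" using u by (intro continuous_intros) auto
      then show ?thesis
        unfolding ereal_tendsto_simps by (simp add: isCont_def filterlim_at_split)
    qed
    show "isCont (\<lambda>v. exp (u * complex_of_real v)) x" for x by (intro continuous_intros)
    show "((\<lambda>v. exp (u * complex_of_real v) / u) has_vector_derivative exp (u * of_real x)) (at x)" for x
    proof -
      have "((\<lambda>z. exp (u * z) / u) has_field_derivative exp (u * of_real x)) (at (complex_of_real x))"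
        using u by (auto intro!: derivative_eq_intros)
      then show ?thesis by (rule has_vector_derivative_real_field)
    qed
  qed (use s in simp_all)
  then have i: "(LBINT v:{..<w}. exp (u * of_real v)) = exp (u * of_real w) / u"
    by (simp add: interval_lebesgue_integral_def e)
  have f: "indicat_real {..<w} v *\<^sub>R exp (u * of_real v) = (if v < w then exp (u * of_real v) else 0)" for v
    by (simp add: indicator_def)
  show "integrable lborel (\<lambda>v. if v < w then exp (u * of_real v) else 0)"
    using s unfolding e set_integrable_def f .
  show "(\<integral>v. (if v < w then exp (u * of_real v) else 0) \<partial>lborel) = exp (u * of_real w) / u"
    using i unfolding set_lebesgue_integral_def f .
qed

lemma integrable_exp_minus_abs:
  assumes "c > 0"
  shows "integrable lborel (\<lambda>t. exp (- c * \<bar>t\<bar>) :: real)"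
proof (rule Bochner_Integration.integrable_bound)
  \<comment> \<open>The cut at 1 instead of 0 makes \<open>g\<close> and its mirror image cover
    every \<open>t\<close>, including 0.\<close>
  define g where "g v = (if v < 1 then exp (complex_of_real c * of_real v) else 0)" for v :: real
  have g: "integrable lborel g" unfolding g_def[abs_def] using exp_lower_halfline(1)[of c 1] assms by simp
  then show "integrable lborel (\<lambda>t. norm (g t) + norm (g (0 + (-1) * t)))"
    by (intro Bochner_Integration.integrable_add integrable_norm lborel_integrable_real_affine) auto
  show "AE t in lborel. norm (exp (- c * \<bar>t\<bar>)) \<le> norm (norm (g t) + norm (g (0 + (-1) * t)))"
    
  proof (rule AE_I2)
    fix t
    have "exp (- c * \<bar>t\<bar>) \<le> norm (g t) + norm (g (0 + (-1) * t))"
      by (auto simp: g_def norm_exp_eq_Re abs_if add_increasing add_increasing2)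
    then show "norm (exp (- c * \<bar>t\<bar>)) \<le> norm (norm (g t) + norm (g (0 + (-1) * t)))" by simp
  qed
qed measurable

text \<open>This is 2 K_0(2), the normalising constant of \<open>Fcut\<close>, written in the same
  variable as \<open>bessel2\<close>.\<close>

abbreviation k0 :: real where "k0 \<equiv> (\<integral>v. exp (- 2 * cosh v) \<partial>lborel)"

lemma BesselK_0_2: "BesselK 0 2 = k0 / 2"
proof -
  have i: "integrable lborel (\<lambda>v. exp (- 2 * cosh v) :: real)" using integrable_exp_cosh[of 2 0] by simp
  define f where "f t = exp (- 2 * (t + 1/t) / 2) * t powr (0 - 1)" for t :: real
  have f: "exp v *\<^sub>R f (exp v) = exp (- 2 * cosh v)" for v
  proof -
    have "- 2 * (exp v + 1 / exp v) / 2 = - 2 * cosh v"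
      using exp_minus[of v] by (simp only: cosh_def inverse_eq_divide) simp
    moreover have "exp v powr (0 - 1) = inverse (exp v)"
      using powr_minus[of "exp v" 1] by simp
    ultimately have "f (exp v) = exp (- 2 * cosh v) * inverse (exp v)" by (simp only: f_def)
    then show ?thesis by simp
  qed
  have e: "einterval 0 \<infinity> = {0<..}" "einterval (-\<infinity>) \<infinity> = UNIV" by (auto simp: einterval_def)
  have "(LBINT t:einterval 0 \<infinity>. f t) = (LBINT v:einterval (-\<infinity>) \<infinity>. exp v *\<^sub>R f (exp v))"
  proof (rule exp_substitution_einterval)
    show "isCont f x" if "x > 0" for x unfolding f_def using that by (intro continuous_intros) auto
    show "((ereal \<circ> exp \<circ> real_of_ereal) \<longlongrightarrow> 0) (at_right (- \<infinity>))"
      unfolding zero_ereal_def ereal_tendsto_simps by (rule exp_at_bot)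
    show "set_integrable lborel (einterval (- \<infinity>) \<infinity>) (\<lambda>v. exp v *\<^sub>R f (exp v))"
      unfolding f e set_integrable_def using i by simp
  qed auto
  then show ?thesis unfolding f e BesselK_def f_def[symmetric] by (simp add: set_lebesgue_integral_def)
qed

text \<open>In the variable \<open>ln x\<close> the cutoff is the tail of a probability distribution
  with density proportional to \<open>exp (- 2 * cosh w)\<close>. Its bounds 0 and 1, its continuity
  and its Laplace transform are all read off from this form.\<close>

lemma Fcut_exp: "Fcut (exp v) = (\<integral>w. (if v < w then exp (- 2 * cosh w) else 0) \<partial>lborel) / k0"
proof -
  have i: "integrable lborel (\<lambda>v. exp (- 2 * cosh v) :: real)" using integrable_exp_cosh[of 2 0] by simp
  define f where "f t = exp (- t - 1/t) / t" for t :: real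
  have f: "exp v *\<^sub>R f (exp v) = exp (- 2 * cosh v)" for v
  proof -
    have "- exp v - 1 / exp v = - 2 * cosh v"
      using exp_minus[of v] by (simp only: cosh_def inverse_eq_divide) simp
    then show ?thesis by (simp add: f_def)
  qed
  have e: "einterval (ereal a) \<infinity> = {a<..}" for a by (auto simp: einterval_def)
  have "(LBINT t:einterval (ereal (exp v)) \<infinity>. f t) = (LBINT w:einterval (ereal v) \<infinity>. exp w *\<^sub>R f (exp w))"
  proof (rule exp_substitution_einterval)
    show "isCont f x" if "x > 0" for x unfolding f_def using that by (intro continuous_intros) auto
    show "((ereal \<circ> exp \<circ> real_of_ereal) \<longlongrightarrow> ereal (exp v)) (at_right (ereal v))"
      unfolding ereal_tendsto_simps by (intro tendsto_intros)
    show "set_integrable lborel (einterval (ereal v) \<infinity>) (\<lambda>v. exp v *\<^sub>R f (exp v))"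
      unfolding f e set_integrable_def using i by (intro integrable_mult_indicator) auto
  qed auto
  also have "\<dots> = (\<integral>w. (if v < w then exp (- 2 * cosh w) else 0) \<partial>lborel)"
    unfolding f e set_lebesgue_integral_def 
    by (intro Bochner_Integration.integral_cong refl) (simp add: indicator_def)
  finally show ?thesis unfolding e Fcut_def f_def[symmetric] BesselK_0_2 by simp
qed

lemma Fcut_exp_properties:
  shows "continuous_on UNIV (\<lambda>v. Fcut (exp v))" and "0 \<le> Fcut (exp v)" and "Fcut (exp v) \<le> 1"
proof -
  have i: "integrable lborel (\<lambda>v. exp (- 2 * cosh v) :: real)" using integrable_exp_cosh[of 2 0] by simp
  have ii: "integrable lborel (\<lambda>w. if v < w then exp (- 2 * cosh w) else (0::real))" for v
    by (rule Bochner_Integration.integrable_bound[OF i]) auto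
  show "0 \<le> Fcut (exp v)" unfolding Fcut_exp using bessel2_real(2) by (intro divide_nonneg_pos Bochner_Integration.integral_nonneg) auto
  have "(\<integral>w. (if v < w then exp (- 2 * cosh w) else 0) \<partial>lborel) \<le> k0"
    using i ii by (intro integral_mono) auto
  then show "Fcut (exp v) \<le> 1" unfolding Fcut_exp using bessel2_real(2) by simp
  have "isCont (\<lambda>v. Fcut (exp v)) v" for v
  proof (rule continuous_at_sequentiallyI)
    fix s :: "nat \<Rightarrow> real" assume s: "s \<longlonglongrightarrow> v"
    have "(\<lambda>n. \<integral>w. (if s n < w then exp (- 2 * cosh w) else 0) \<partial>lborel) \<longlonglongrightarrow> (\<integral>w. (if v < w then exp (- 2 * cosh w) else 0) \<partial>lborel)"
    proof (rule integral_dominated_convergence[OF _ _ i])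
      \<comment> \<open>Away from the null set \<open>w = v\<close> the truth value of
        \<open>s n < w\<close> is eventually constant, which gives pointwise convergence of the
        integrands.\<close>
      have "AE w in lborel. w \<noteq> v" by (rule AE_lborel_singleton)
      then show "AE w in lborel. (\<lambda>n. if s n < w then exp (- 2 * cosh w) else 0) \<longlonglongrightarrow> (if v < w then exp (- 2 * cosh w) else 0)"
      proof eventually_elim
        case (elim w)
        then consider "v < w" | "w < v" by linarith
        then have "\<forall>\<^sub>F n in sequentially. (s n < w) = (v < w)"
        proof cases
          case 1
          then show ?thesis using order_tendstoD(2)[OF s 1] by (auto elim: eventually_mono)
        next
          case 2
          then show ?thesis using order_tendstoD(1)[OF s 2] by (auto elim: eventually_mono)
        qed
        then have "\<forall>\<^sub>F n in sequentially. (if s n < w then exp (- 2 * cosh w) else 0) = (if v < w then exp (- 2 * cosh w) else 0)"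
          by eventually_elim auto
        then show ?case by (rule tendsto_eventually)
      qed
    qed auto
    then show "(\<lambda>n. Fcut (exp (s n))) \<longlonglongrightarrow> Fcut (exp v)"
      unfolding Fcut_exp using bessel2_real(2) by (intro tendsto_intros) auto
  qed
  then show "continuous_on UNIV (\<lambda>v. Fcut (exp v))" by (simp add: continuous_on_eq_continuous_within)
qed

text \<open>The tail integral is exchanged with the integral over \<open>v\<close>; the inner
  integral of \<open>exp (u v)\<close> over \<open>v < w\<close> is \<open>exp (u w) / u\<close>,
  which is where the pole at 0 comes from.\<close>

lemma Fcut_exp_laplace:
  assumes u: "Re u > 0"
  shows "integrable lborel (\<lambda>v. of_real (Fcut (exp v)) * exp (u * of_real v))"
    and "(\<integral>v. of_real (Fcut (exp v)) * exp (u * of_real v) \<partial>lborel) = bessel2 u / (u * of_real k0)"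
proof -
  define G where "G w v = of_real (exp (- 2 * cosh w)) * (if v < w then exp (u * of_real v) else 0)" for w v :: real
  \<comment> \<open>\<open>G\<close> at the real point \<open>Re u\<close>. Its values are the norms
    of \<open>G\<close>, so the same closed form that evaluates the integral also proves absolute
    convergence.\<close>
  define G' where "G' w v = of_real (exp (- 2 * cosh w)) * (if v < w then exp (of_real (Re u) * of_real v) else (0::complex))" for w v :: real
  have nG: "norm (G w v) = Re (G' w v)" for w v
  proof -
    have "exp (of_real (Re u) * of_real v) = complex_of_real (exp (Re u * v))"
      using exp_of_real[of "Re u * v", where 'a = complex] by simp
    then show ?thesis by (simp add: G_def G'_def norm_mult norm_exp_eq_Re)
  qed
  have iG: "integrable lborel (G w)" for w
    unfolding G_def[abs_def] using exp_lower_halfline(1)[OF u] by (intro integrable_mult_right)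
  have iG': "integrable lborel (G' w)" for w
    unfolding G'_def[abs_def] using exp_lower_halfline(1)[of "of_real (Re u)"] u by (intro integrable_mult_right) simp
  have nn: "(\<integral>v. norm (G w v) \<partial>lborel) = exp (- 2 * cosh w) * exp (Re u * w) / Re u" for w
  proof -
    have "(\<integral>v. norm (G w v) \<partial>lborel) = Re (\<integral>v. G' w v \<partial>lborel)"
      unfolding nG using iG' by (rule integral_Re)
    also have "(\<integral>v. G' w v \<partial>lborel) = of_real (exp (- 2 * cosh w)) * (exp (of_real (Re u) * of_real w) / of_real (Re u))"
      unfolding G'_def using exp_lower_halfline(2)[of "of_real (Re u)" w] u by simp
    also have "\<dots> = of_real (exp (- 2 * cosh w) * exp (Re u * w) / Re u)"
      using exp_of_real[of "Re u * w", where 'a = complex] by simp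
    finally show ?thesis by simp
  qed
  have intp: "integrable (lborel \<Otimes>\<^sub>M lborel) (\<lambda>(w, v). G w v)"
  proof (rule lborel_pair.Fubini_integrable)
    show "(\<lambda>(w, v). G w v) \<in> borel_measurable (lborel \<Otimes>\<^sub>M lborel)"
      unfolding G_def by measurable
    have "integrable lborel (\<lambda>w. exp (Re u * \<bar>w\<bar>) * exp (- 2 * cosh w) / Re u)"
      using integrable_exp_cosh[of 2 "Re u"] by simp
    then have "integrable lborel (\<lambda>w. exp (- 2 * cosh w) * exp (Re u * w) / Re u)"
    proof (rule Bochner_Integration.integrable_bound)
      show "AE w in lborel. norm (exp (- 2 * cosh w) * exp (Re u * w) / Re u) \<le> norm (exp (Re u * \<bar>w\<bar>) * exp (- 2 * cosh w) / Re u)"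
        using u by (intro AE_I2) (simp add: divide_right_mono exp_add[symmetric] mult_left_mono)
    qed measurable
    then show "integrable lborel (\<lambda>w. \<integral>v. norm (case (w, v) of (w, v) \<Rightarrow> G w v) \<partial>lborel)"
      by (simp add: nn)
    show "AE w in lborel. integrable lborel (\<lambda>v. case (w, v) of (w, v) \<Rightarrow> G w v)"
      using iG by simp
  qed
  have FG: "(\<integral>w. G w v \<partial>lborel) = of_real k0 * (of_real (Fcut (exp v)) * exp (u * of_real v))" for v
  proof -
    have "(\<integral>w. G w v \<partial>lborel) = (\<integral>w. exp (u * of_real v) * of_real (if v < w then exp (- 2 * cosh w) else 0) \<partial>lborel)"
      by (intro Bochner_Integration.integral_cong refl) (auto simp: G_def)
    also have "\<dots> = exp (u * of_real v) * of_real (\<integral>w. (if v < w then exp (- 2 * cosh w) else 0) \<partial>lborel)"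
      unfolding integral_mult_right_zero integral_complex_of_real ..
    also have "\<dots> = exp (u * of_real v) * of_real (k0 * Fcut (exp v))"
      unfolding Fcut_exp using bessel2_real(2) by simp
    finally show ?thesis by (simp only: of_real_mult mult_ac)
  qed
  have k: "complex_of_real k0 \<noteq> 0" using bessel2_real(2) by simp
  have sw: "integrable lborel (\<lambda>v. \<integral>w. G w v \<partial>lborel)"
    using lborel_pair.integrable_snd[OF intp] by simp
  have "integrable lborel (\<lambda>v. (1 / of_real k0) * (\<integral>w. G w v \<partial>lborel))"
    by (intro integrable_mult_right sw)
  then show "integrable lborel (\<lambda>v. of_real (Fcut (exp v)) * exp (u * of_real v))"
    unfolding FG mult.assoc[symmetric] using k by (simp del: integral_complex_of_real)
  have "of_real k0 * (\<integral>v. of_real (Fcut (exp v)) * exp (u * of_real v) \<partial>lborel) = (\<integral>v. \<integral>w. G w v \<partial>lborel \<partial>lborel)"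
    unfolding FG by (rule integral_mult_right_zero[symmetric])
  also have "\<dots> = (\<integral>w. \<integral>v. G w v \<partial>lborel \<partial>lborel)"
    by (rule lborel_pair.Fubini_integral) (rule intp)
  also have "\<dots> = (\<integral>w. (1/u) * (of_real (exp (- 2 * cosh w)) * exp (u * of_real w)) \<partial>lborel)"
  proof (intro Bochner_Integration.integral_cong refl)
    fix w show "(\<integral>v. G w v \<partial>lborel) = (1/u) * (of_real (exp (- 2 * cosh w)) * exp (u * of_real w))"
      unfolding G_def integral_mult_right_zero exp_lower_halfline(2)[OF u] by simp
  qed
  also have "\<dots> = bessel2 u / u"
    unfolding integral_mult_right_zero bessel2_def by simp
  finally have fin: "of_real k0 * (\<integral>v. of_real (Fcut (exp v)) * exp (u * of_real v) \<partial>lborel) = bessel2 u / u" .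
  have "X = b / (u * c)" if "c * X = b / u" "c \<noteq> 0" for X b c :: complex
    using that \<open>Re u > 0\<close> by (cases "u = 0") (auto simp: field_simps)
  from this[OF fin k] show "(\<integral>v. of_real (Fcut (exp v)) * exp (u * of_real v) \<partial>lborel) = bessel2 u / (u * of_real k0)" .
qed

text \<open>The integral defining \<open>Fmellin\<close> is used only for \<open>Re u > 0\<close>.
  To the left of 0 its continuation \<open>bessel2 u / (u * k0)\<close> takes over, which is
  meromorphic by inspection.\<close>

lemma Fmellin_eq:
  assumes u: "Re u > 0"
  shows "Fmellin u = (\<integral>v. of_real (Fcut (exp v)) * exp (u * of_real v) \<partial>lborel)"
    and "Fmellin u = bessel2 u / (u * of_real k0)"
proof -
  define f where "f t = complex_of_real (Fcut t) * complex_of_real t powr (u - 1)" for t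
  have f: "exp v *\<^sub>R f (exp v) = of_real (Fcut (exp v)) * exp (u * of_real v)" for v
  proof -
    have "complex_of_real (exp v) powr (u - 1) = exp ((u - 1) * of_real v)"
      by (simp add: powr_def Ln_of_real)
    moreover have "complex_of_real (exp v) = exp (of_real v)" by (simp add: exp_of_real)
    ultimately show ?thesis
      by (simp add: f_def scaleR_conv_of_real left_diff_distrib exp_diff)
  qed
  have e: "einterval 0 \<infinity> = {0<..}" "einterval (-\<infinity>) \<infinity> = UNIV" by (auto simp: einterval_def)
  have "(LBINT t:einterval 0 \<infinity>. f t) = (LBINT v:einterval (-\<infinity>) \<infinity>. exp v *\<^sub>R f (exp v))"
  proof (rule exp_substitution_einterval)
    show "isCont f x" if x: "x > 0" for x
    proof -
      have "isCont (\<lambda>v. Fcut (exp v)) (ln x)"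
        using Fcut_exp_properties(1) by (simp add: continuous_on_eq_continuous_within)
      then have "isCont (\<lambda>x. Fcut (exp (ln x))) x"
        using x by (intro isCont_o2[where f = ln and g = "\<lambda>v. Fcut (exp v)"] isCont_ln) auto
      moreover have "\<forall>\<^sub>F y in nhds x. Fcut (exp (ln y)) = Fcut y"
        using eventually_nhds_in_open[of "{0<..}" x] x by (auto elim!: eventually_mono)
      ultimately have "isCont Fcut x" by (subst (asm) isCont_cong) auto
      then show ?thesis unfolding f_def using x by (intro continuous_intros) auto
    qed
    show "((ereal \<circ> exp \<circ> real_of_ereal) \<longlongrightarrow> 0) (at_right (- \<infinity>))"
      unfolding zero_ereal_def ereal_tendsto_simps by (rule exp_at_bot)
    show "set_integrable lborel (einterval (- \<infinity>) \<infinity>) (\<lambda>v. exp v *\<^sub>R f (exp v))"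
      unfolding f e set_integrable_def using Fcut_exp_laplace(1)[OF u] by simp
  qed auto
  then show 1: "Fmellin u = (\<integral>v. of_real (Fcut (exp v)) * exp (u * of_real v) \<partial>lborel)"
    unfolding f e Fmellin_def f_def[symmetric] by (simp add: set_lebesgue_integral_def)
  show "Fmellin u = bessel2 u / (u * of_real k0)"
    unfolding 1 by (rule Fcut_exp_laplace(2)[OF u])
qed

text \<open>The kernel decays with rate 1, so any factor of exponential growth below 1 is harmless.
  This is applied to \<open>L\<close> on both vertical lines and to \<open>W\<close> on the right
  one.\<close>

lemma integrable_bessel2_line:
  assumes s: "\<sigma> \<noteq> 0" and c: "c < 1" and \<phi>: "continuous_on UNIV \<phi>"
    and bd: "\<And>t. norm (\<phi> t) \<le> B * exp (c * \<bar>t\<bar>)"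
  shows "integrable lborel (\<lambda>t. bessel2 (Complex \<sigma> t) / Complex \<sigma> t * \<phi> t)"
proof -
  obtain C where C: "C \<ge> 0" "\<And>y. norm (bessel2 (Complex \<sigma> y)) \<le> C * exp (- \<bar>y\<bar>)"
    using bessel2_decay[of "\<bar>\<sigma>\<bar>"] by auto
  have B: "B \<ge> 0" using order_trans[OF norm_ge_zero bd[of 0]] by simp
  show ?thesis
  proof (rule Bochner_Integration.integrable_bound)
    show "integrable lborel (\<lambda>t. (C * B / \<bar>\<sigma>\<bar>) * exp (- (1 - c) * \<bar>t\<bar>))"
      using c by (intro integrable_mult_right integrable_exp_minus_abs) simp
    show "AE t in lborel. norm (bessel2 (Complex \<sigma> t) / Complex \<sigma> t * \<phi> t) \<le> norm ((C * B / \<bar>\<sigma>\<bar>) * exp (- (1 - c) * \<bar>t\<bar>))"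
    proof (rule AE_I2)
      fix t
      have "norm (bessel2 (Complex \<sigma> t) / Complex \<sigma> t * \<phi> t) \<le> C * exp (- \<bar>t\<bar>) / \<bar>\<sigma>\<bar> * (B * exp (c * \<bar>t\<bar>))"
        unfolding norm_mult norm_divide using C bd[of t] s abs_Re_le_cmod[of "Complex \<sigma> t"]
        by (intro mult_mono frac_le) auto
      also have "\<dots> = (C * B / \<bar>\<sigma>\<bar>) * (exp (- \<bar>t\<bar>) * exp (c * \<bar>t\<bar>))" by simp
      also have "exp (- \<bar>t\<bar>) * exp (c * \<bar>t\<bar>) = exp (- (1 - c) * \<bar>t\<bar>)"
        by (simp add: exp_add[symmetric] algebra_simps)
      finally show "norm (bessel2 (Complex \<sigma> t) / Complex \<sigma> t * \<phi> t) \<le> norm ((C * B / \<bar>\<sigma>\<bar>) * exp (- (1 - c) * \<bar>t\<bar>))"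
        using C B by simp
    qed
    have "continuous_on UNIV bessel2" using holomorphic_bessel2 by (rule holomorphic_on_imp_continuous_on)
    then have "continuous_on UNIV (\<lambda>t. bessel2 (Complex \<sigma> t))"
      by (rule continuous_on_compose2) (auto simp: Complex_eq intro!: continuous_intros)
    moreover have "Complex \<sigma> t \<noteq> 0" for t using s by (simp add: complex_eq_iff)
    moreover have "continuous_on UNIV (\<lambda>t. Complex \<sigma> t)" by (auto simp: Complex_eq intro!: continuous_intros)
    ultimately have "continuous_on UNIV (\<lambda>t. bessel2 (Complex \<sigma> t) / Complex \<sigma> t * \<phi> t)"
      using \<phi> by (intro continuous_intros) auto
    then show "(\<lambda>t. bessel2 (Complex \<sigma> t) / Complex \<sigma> t * \<phi> t) \<in> borel_measurable lborel"
      by (simp add: borel_measurable_continuous_onI)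
  qed
qed

text \<open>Mellin inversion is Fourier inversion for
  \<open>Fcut (exp v) * exp (\<sigma> v)\<close>, whose transform at \<xi> is the Mellin transform
  at \<sigma> + \<i> \<xi>.\<close>

lemma Fcut_mellin_inversion:
  assumes \<sigma>: "\<sigma> > 0" and x: "x > 0"
  shows "of_real (Fcut x) = 1 / (2 * pi) * (\<integral>t. bessel2 (Complex \<sigma> t) / (Complex \<sigma> t * of_real k0) * of_real x powr (- Complex \<sigma> t) \<partial>lborel)"
proof -
  define f where "f v = complex_of_real (Fcut (exp v)) * exp (of_real \<sigma> * of_real v)" for v
  have fh: "(\<integral>v. f v * cis (\<xi> * v) \<partial>lborel) = bessel2 (Complex \<sigma> \<xi>) / (Complex \<sigma> \<xi> * of_real k0)" for \<xi>
  proof -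
    have "f v * cis (\<xi> * v) = of_real (Fcut (exp v)) * exp (Complex \<sigma> \<xi> * of_real v)" for v
      by (simp add: f_def cis_conv_exp exp_add[symmetric] Complex_eq algebra_simps mult.assoc)
    then show ?thesis using Fcut_exp_laplace(2)[of "Complex \<sigma> \<xi>"] \<sigma> by simp
  qed
  have fi: "integrable lborel f"
    using Fcut_exp_laplace(1)[of "of_real \<sigma>"] \<sigma> by (simp add: f_def[abs_def])
  have fc: "continuous_on UNIV f"
    unfolding f_def using Fcut_exp_properties(1) by (intro continuous_intros) auto
  \<comment> \<open>The growing factor is pulled into the tail integral, where \<open>v < w\<close>
    and \<sigma> > 0 bound it by \<open>exp (\<sigma> * \<bar>w\<bar>)\<close>.\<close>
  have fb: "\<exists>B. \<forall>v. norm (f v) \<le> B"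
  proof -
    have k: "k0 > 0" by (rule bessel2_real(2))
    have i: "integrable lborel (\<lambda>w. exp (\<sigma> * \<bar>w\<bar>) * exp (- 2 * cosh w) :: real)" by (rule integrable_exp_cosh) simp
    have "norm (f v) \<le> (\<integral>w. exp (\<sigma> * \<bar>w\<bar>) * exp (- 2 * cosh w) \<partial>lborel) / k0" for v
    proof -
      have i2: "integrable lborel (\<lambda>w. exp (- 2 * cosh w) :: real)" using integrable_exp_cosh[of 2 0] by simp
      have "norm (f v) = exp (\<sigma> * v) * Fcut (exp v)"
        using Fcut_exp_properties(2)[of v] by (simp add: f_def norm_mult norm_exp_eq_Re)
      also have "\<dots> = (\<integral>w. exp (\<sigma> * v) * (if v < w then exp (- 2 * cosh w) else 0) \<partial>lborel) / k0"
        unfolding Fcut_exp by (subst integral_mult_right_zero) simp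
      also have "\<dots> \<le> (\<integral>w. exp (\<sigma> * \<bar>w\<bar>) * exp (- 2 * cosh w) \<partial>lborel) / k0"
      proof (intro divide_right_mono integral_mono)
        show "integrable lborel (\<lambda>w. exp (\<sigma> * v) * (if v < w then exp (- 2 * cosh w) else (0::real)))"
          by (intro integrable_mult_right Bochner_Integration.integrable_bound[OF i2]) auto
        fix w show "exp (\<sigma> * v) * (if v < w then exp (- 2 * cosh w) else 0) \<le> exp (\<sigma> * \<bar>w\<bar>) * exp (- 2 * cosh w)"
          using \<sigma> by (auto intro!: mult_right_mono)
      qed (use i k in auto)
      finally show ?thesis .
    qed
    then show ?thesis by blast
  qed
  then obtain B where B: "\<And>v. norm (f v) \<le> B" by blast
  have "integrable lborel (\<lambda>t. bessel2 (Complex \<sigma> t) / Complex \<sigma> t * (1 / of_real k0))"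
    using integrable_bessel2_line[of \<sigma> 0 "\<lambda>_. 1 / of_real k0" "norm (1 / of_real k0 :: complex)"] \<sigma> by simp
  then have fhi: "integrable lborel (\<lambda>\<xi>. \<integral>v. f v * cis (\<xi> * v) \<partial>lborel)"
    unfolding fh by simp
  have "2 * pi * f (ln x) = (\<integral>\<xi>. (\<integral>y. f y * cis (\<xi> * y) \<partial>lborel) * cis (- \<xi> * ln x) \<partial>lborel)"
    using fourier_inversion[OF fc B fi fhi, of "ln x"] by simp
  also have "\<dots> = (\<integral>\<xi>. exp (of_real \<sigma> * of_real (ln x)) * (bessel2 (Complex \<sigma> \<xi>) / (Complex \<sigma> \<xi> * of_real k0) * of_real x powr (- Complex \<sigma> \<xi>)) \<partial>lborel)"
  proof (intro Bochner_Integration.integral_cong refl)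
    fix \<xi>
    have "cis (- \<xi> * ln x) = exp (of_real \<sigma> * of_real (ln x)) * of_real x powr (- Complex \<sigma> \<xi>)"
    proof -
      have "of_real x powr (- Complex \<sigma> \<xi>) = exp (- Complex \<sigma> \<xi> * of_real (ln x))"
        using x by (simp add: powr_def Ln_of_real)
      then show ?thesis 
        unfolding cis_conv_exp Complex_eq by (simp add: exp_add[symmetric] algebra_simps)
    qed
    then show "(\<integral>y. f y * cis (\<xi> * y) \<partial>lborel) * cis (- \<xi> * ln x) = exp (of_real \<sigma> * of_real (ln x)) * (bessel2 (Complex \<sigma> \<xi>) / (Complex \<sigma> \<xi> * of_real k0) * of_real x powr (- Complex \<sigma> \<xi>))"
      unfolding fh by simp
  qed
  also have "\<dots> = exp (of_real \<sigma> * of_real (ln x)) * (\<integral>\<xi>. bessel2 (Complex \<sigma> \<xi>) / (Complex \<sigma> \<xi> * of_real k0) * of_real x powr (- Complex \<sigma> \<xi>) \<partial>lborel)"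
    by (rule integral_mult_right_zero)
  finally have fin: "2 * pi * f (ln x) = exp (of_real \<sigma> * of_real (ln x)) * (\<integral>\<xi>. bessel2 (Complex \<sigma> \<xi>) / (Complex \<sigma> \<xi> * of_real k0) * of_real x powr (- Complex \<sigma> \<xi>) \<partial>lborel)" .
  have "F = 1 / (2 * complex_of_real pi) * I" if "2 * pi * (F * E) = E * I" "E \<noteq> 0" for F E I :: complex
  proof -
    from that(1) have "E * (2 * pi * F) = E * I" by (simp only: mult_ac)
    with that(2) have "2 * pi * F = I" by (simp only: mult_cancel_left) simp
    then show ?thesis by auto
  qed
  from this[OF fin[unfolded f_def]] show ?thesis using x by simp
qed

subsection \<open>Quadratic Gauss sums\<close>

lemma cis_measurable [measurable]: "cis \<in> borel_measurable borel"
  by (intro borel_measurable_continuous_onI continuous_intros)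

lemma cnj_measurable [measurable]: "cnj \<in> borel_measurable borel"
  by (intro borel_measurable_continuous_onI continuous_intros)

section \<open>Fourier coefficients on the unit interval\<close>

lemma cis_integral_period:
  "(LINT x:{0..1}|lborel. cis (2 * pi * of_int m * x)) = (if m = 0 then 1 else 0)"
proof (cases "m = 0")
  case True
  then show ?thesis by (simp add: set_lebesgue_integral_def content_real)
next
  case False
  define c where "c = 2 * pi * real_of_int m"
  have c: "c \<noteq> 0" using False by (simp add: c_def)
  have "((\<lambda>x. cis (c * x)) has_integral (cis (c * 1) / (\<i> * c) - cis (c * 0) / (\<i> * c))) {0..1}"
  proof (rule fundamental_theorem_of_calculus)
    fix x :: real
    have "((\<lambda>z. exp (\<i> * of_real c * z) / (\<i> * c)) has_field_derivative exp (\<i> * of_real c * of_real x)) (at (complex_of_real x))"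
      using c by (auto intro!: derivative_eq_intros)
    from has_vector_derivative_real_field[OF this]
    have "((\<lambda>x. cis (c * x) / (\<i> * c)) has_vector_derivative cis (c * x)) (at x)"
      by (simp add: cis_conv_exp mult.assoc)
    then show "((\<lambda>x. cis (c * x) / (\<i> * c)) has_vector_derivative cis (c * x)) (at x within {0..1})"
      by (rule has_vector_derivative_at_within)
  qed simp
  moreover have "cis (c * 1) = 1" using cis_multiple_2pi[of "of_int m"] by (simp add: c_def mult.commute)
  ultimately have "((\<lambda>x. cis (c * x)) has_integral 0) {0..1}" by simp
  moreover have "set_integrable lborel {0..1} (\<lambda>x. cis (c * x))"
    by (intro borel_integrable_atLeastAtMost' continuous_intros)
  ultimately show ?thesis
    using False by (simp add: c_def set_borel_integral_eq_integral integral_unique)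
qed

lemma set_integrable_unit_interval_bounded:
  fixes f :: "real \<Rightarrow> complex"
  assumes [measurable]: "f \<in> borel_measurable borel" and bd: "\<And>x. x \<in> {0..1} \<Longrightarrow> norm (f x) \<le> K"
  shows "set_integrable lborel {0..1} f"
  unfolding set_integrable_def
proof (rule Bochner_Integration.integrable_bound)
  show "integrable lborel (\<lambda>x::real. K * indicat_real {0..1} x)" 
    by (intro integrable_mult_right integrable_real_indicator) auto
  show "AE x in lborel. norm (indicat_real {0..1} x *\<^sub>R f x) \<le> norm (K * indicat_real {0..1} x)"
    using bd by (intro AE_I2) (auto simp: indicator_def intro: order_trans[OF _ abs_ge_self])
qed simp

lemma set_integral_sum:
  fixes f :: "'i \<Rightarrow> real \<Rightarrow> complex"
  assumes "\<And>i. i \<in> I \<Longrightarrow> set_integrable lborel A (f i)"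
  shows "(LINT x:A|lborel. \<Sum>i\<in>I. f i x) = (\<Sum>i\<in>I. LINT x:A|lborel. f i x)"
    and "set_integrable lborel A (\<lambda>x. \<Sum>i\<in>I. f i x)"
  using assms unfolding set_integrable_def set_lebesgue_integral_def scaleR_sum_right
  by (auto intro!: Bochner_Integration.integral_sum)

text \<open>The mean square distance of \<open>g\<close> from its Fourier sum \<open>S\<close> over
  \<open>A\<close> is nonnegative; by orthonormality it equals the mean square of \<open>g\<close>
  minus the sum in question. It serves as the Riemann-Lebesgue lemma for bounded functions.\<close>

lemma bessel_inequality:
  fixes g :: "real \<Rightarrow> complex"
  assumes gm [measurable]: "g \<in> borel_measurable borel" and gb: "\<And>x. x \<in> {0..1} \<Longrightarrow> norm (g x) \<le> B"
    and A: "finite A"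
  shows "(\<Sum>m\<in>A. (norm (LINT x:{0..1}|lborel. g x * cis (- (2 * pi * of_int m * x))))\<^sup>2) \<le> B\<^sup>2"
proof -
  define e where "e m x = cis (2 * pi * real_of_int m * x)" for m x
  define b where "b m = (LINT x:{0..1}|lborel. g x * cnj (e m x))" for m
  have B: "B \<ge> 0" using order_trans[OF norm_ge_zero gb[of 0]] by simp
  note si = set_integrable_unit_interval_bounded
  have em [measurable]: "e m \<in> borel_measurable borel" for m unfolding e_def by measurable
  have e1: "norm (e m x) = 1" for m x by (simp add: e_def)
  define S where "S x = (\<Sum>m\<in>A. b m * e m x)" for x
  have i1: "set_integrable lborel {0..1} (\<lambda>x. cnj (b m) * (g x * cnj (e m x)))" for m
    using gb e1 by (intro si[where K = "norm (b m) * B"]) (auto simp: norm_mult intro!: mult_left_mono)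
  have i2: "set_integrable lborel {0..1} (\<lambda>x. b m * cnj (b n) * (e m x * cnj (e n x)))" for m n
    using e1 by (intro si[where K = "norm (b m) * norm (b n)"]) (auto simp: norm_mult)
  have i3: "set_integrable lborel {0..1} (\<lambda>x. g x * cnj (g x))"
    using gb B by (intro si[where K = "B * B"]) (auto simp: norm_mult intro!: mult_mono)
  have i4: "set_integrable lborel {0..1} (\<lambda>x. b m * (cnj (g x) * e m x))" for m
    using gb e1 by (intro si[where K = "norm (b m) * B"]) (auto simp: norm_mult intro!: mult_left_mono)
  have orth: "(LINT x:{0..1}|lborel. e m x * cnj (e n x)) = (if m = n then 1 else 0)" for m n
  proof -
    have "e m x * cnj (e n x) = cis (2 * pi * of_int (m - n) * x)" for x
      by (simp add: e_def cis_cnj cis_mult algebra_simps)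
    then show ?thesis using cis_integral_period[of "m - n"] by simp
  qed
  have j1': "(LINT x:{0..1}|lborel. g x * cnj (e m x)) = b m" for m by (simp add: b_def)
  have j4': "(LINT x:{0..1}|lborel. cnj (g x) * e m x) = cnj (b m)" for m
  proof -
    have "(LINT x:{0..1}|lborel. cnj (g x) * e m x) = (\<integral>x. cnj (indicat_real {0..1} x *\<^sub>R (g x * cnj (e m x))) \<partial>lborel)"
      unfolding set_lebesgue_integral_def
      by (intro Bochner_Integration.integral_cong refl) (simp add: scaleR_conv_of_real)
    also have "\<dots> = cnj (b m)" unfolding b_def set_lebesgue_integral_def by (rule Bochner_Integration.integral_cnj)
    finally show ?thesis .
  qed
  have "(g x - S x) * cnj (g x - S x) = g x * cnj (g x) - (\<Sum>m\<in>A. cnj (b m) * (g x * cnj (e m x)))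
      - (\<Sum>m\<in>A. b m * (cnj (g x) * e m x)) + (\<Sum>m\<in>A. \<Sum>n\<in>A. b m * cnj (b n) * (e m x * cnj (e n x)))" for x
  proof -
    have "(g x - S x) * cnj (g x - S x) = g x * cnj (g x) - g x * cnj (S x) - S x * cnj (g x) + S x * cnj (S x)"
      by (simp add: algebra_simps)
    moreover have "g x * cnj (S x) = (\<Sum>m\<in>A. cnj (b m) * (g x * cnj (e m x)))"
      by (simp add: S_def sum_distrib_left mult_ac)
    moreover have "S x * cnj (g x) = (\<Sum>m\<in>A. b m * (cnj (g x) * e m x))"
      by (simp add: S_def sum_distrib_left mult_ac)
    moreover have "S x * cnj (S x) = (\<Sum>m\<in>A. \<Sum>n\<in>A. b m * cnj (b n) * (e m x * cnj (e n x)))"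
      by (simp add: S_def sum_product mult_ac)
    ultimately show ?thesis by simp
  qed
  then have "(LINT x:{0..1}|lborel. (g x - S x) * cnj (g x - S x)) =
    (LINT x:{0..1}|lborel. g x * cnj (g x) - (\<Sum>m\<in>A. cnj (b m) * (g x * cnj (e m x)))
      - (\<Sum>m\<in>A. b m * (cnj (g x) * e m x)) + (\<Sum>m\<in>A. \<Sum>n\<in>A. b m * cnj (b n) * (e m x * cnj (e n x))))"
    by simp
  also have "\<dots> = (LINT x:{0..1}|lborel. g x * cnj (g x)) - (\<Sum>m\<in>A. cnj (b m) * b m)
      - (\<Sum>m\<in>A. b m * cnj (b m)) + (\<Sum>m\<in>A. \<Sum>n\<in>A. b m * cnj (b n) * (if m = n then 1 else 0))"
    using A i1 i2 i3 i4
    by (simp add: set_integral_add set_integral_diff set_integral_sum j1' j4' orth)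
  also have "\<dots> = (LINT x:{0..1}|lborel. g x * cnj (g x)) - (\<Sum>m\<in>A. b m * cnj (b m))"
    using A by (simp add: mult.commute if_distrib cong: if_cong)
  finally have eq: "(LINT x:{0..1}|lborel. (g x - S x) * cnj (g x - S x)) = (LINT x:{0..1}|lborel. g x * cnj (g x)) - (\<Sum>m\<in>A. b m * cnj (b m))" .
  have sq: "z * cnj z = of_real ((norm z)\<^sup>2)" for z by (rule complex_norm_square[symmetric])
  have "(LINT x:{0..1}|lborel. (norm (g x - S x))\<^sup>2) = (LINT x:{0..1}|lborel. (norm (g x))\<^sup>2) - (\<Sum>m\<in>A. (norm (b m))\<^sup>2)"
    using eq unfolding sq set_integral_complex_of_real of_real_sum[symmetric] of_real_diff[symmetric] of_real_eq_iff .
  moreover have "(LINT x:{0..1}|lborel. (norm (g x - S x))\<^sup>2) \<ge> 0"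
    unfolding set_lebesgue_integral_def by (intro Bochner_Integration.integral_nonneg) auto
  moreover have "(LINT x:{0..1}|lborel. (norm (g x))\<^sup>2) \<le> B\<^sup>2"
  proof -
    have "(LINT x:{0..1}|lborel. (norm (g x))\<^sup>2) \<le> (\<integral>x. B\<^sup>2 * indicat_real {0..1::real} x \<partial>lborel)"
      unfolding set_lebesgue_integral_def
    proof (rule integral_mono')
      show "integrable lborel (\<lambda>x::real. B\<^sup>2 * indicat_real {0..1} x)"
        by (intro integrable_mult_right integrable_real_indicator) auto
    qed (use gb in \<open>auto simp: indicator_def intro!: power_mono\<close>)
    also have "\<dots> = B\<^sup>2" by (subst integral_mult_right_zero) (simp add: content_real)
    finally show ?thesis .
  qed
  ultimately show ?thesis by (simp add: b_def e_def cis_cnj)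
qed

text \<open>Dividing by \<open>cis (2 \<pi> x) - 1\<close> turns the partial sum of the Fourier series at \<open>0\<close> into a telescoping
  sum, so that the Riemann-Lebesgue lemma suffices.\<close>
lemma fourier_series_at_zero:
  fixes f :: "real \<Rightarrow> complex"
  assumes fm [measurable]: "f \<in> borel_measurable borel"
    and f0: "\<And>x. x \<in> {0..1} \<Longrightarrow> norm (f x) \<le> C * x" and f1: "\<And>x. x \<in> {0..1} \<Longrightarrow> norm (f x) \<le> C * (1 - x)"
  shows "(\<lambda>M. \<Sum>m\<in>{- int M..int M}. (LINT x:{0..1}|lborel. f x * cis (- (2 * pi * of_int m * x)))) \<longlonglongrightarrow> 0"
proof -
  define g where "g x = f x / (cis (2 * pi * x) - 1)" for x
  have C: "C \<ge> 0" using order_trans[OF norm_ge_zero f0[of 1]] by simp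
  have gm [measurable]: "g \<in> borel_measurable borel" unfolding g_def by measurable
  have nc: "norm (cis (2 * pi * x) - 1) = 2 * \<bar>sin (pi * x)\<bar>" for x
  proof -
    have "norm (cis (2 * pi * x) - 1) = norm (exp (\<i> * of_real (2 * pi * x)) - 1)"
      by (simp only: cis_conv_exp)
    also have "\<dots> = 2 * \<bar>sin (2 * pi * x / 2)\<bar>" by (rule dist_exp_i_1)
    finally show ?thesis by simp
  qed
  \<comment> \<open>Jordan's inequality, from the concavity of sine on [0, \<pi> / 2].\<close>
  have sin_ge: "sin (pi * x) \<ge> 2 * x" if x: "0 \<le> x" "x \<le> 1/2" for x :: real
  proof -
    have "convex_on {0..pi/2} (\<lambda>y. - sin y)"
      by (rule f''_ge0_imp_convex[where f' = "\<lambda>y. - cos y" and f'' = "\<lambda>y. sin y"])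
         (auto intro!: derivative_eq_intros sin_ge_zero)
    from convex_onD[OF this, of "2 * x" 0 "pi / 2"] x show ?thesis by (simp add: mult.commute)
  qed
  have sn: "\<bar>sin (pi * x)\<bar> \<ge> 2 * min x (1 - x)" if "x \<in> {0..1}" for x :: real
  proof (cases "x \<le> 1/2")
    case True
    then show ?thesis using sin_ge[of x] that by (auto simp: min_def)
  next
    case False
    have "sin (pi * x) = sin (pi * (1 - x))" by (simp add: right_diff_distrib sin_diff)
    then show ?thesis using False sin_ge[of "1 - x"] that by (auto simp: min_def)
  qed
  \<comment> \<open>The modulus of \<open>cis (2 \<pi> x) - 1\<close> is
    \<open>2 \<bar>sin (\<pi> x)\<bar>\<close>, at least 4 times the distance of \<open>x\<close> to
    the nearer endpoint. The two bounds on \<open>f\<close> cancel exactly this distance, leaving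
    \<open>C / 4\<close>.\<close>
  have gb: "norm (g x) \<le> C / 4" if x: "x \<in> {0..1}" for x
  proof (cases "min x (1 - x) = 0")
    case True
    then have "f x = 0" using f0[OF x] f1[OF x] by (auto simp: min_def split: if_splits)
    then show ?thesis using C by (simp add: g_def)
  next
    case False
    define d where "d = min x (1 - x)"
    have d: "d > 0" using False x by (auto simp: d_def min_def split: if_splits)
    have "norm (f x) \<le> C * d" using f0[OF x] f1[OF x] by (auto simp: d_def min_def)
    moreover have "norm (cis (2 * pi * x) - 1) \<ge> 4 * d" using sn[OF x] by (simp add: nc d_def)
    ultimately have "norm (g x) \<le> C * d / (4 * d)"
      unfolding g_def norm_divide using d C by (intro frac_le) auto
    then show ?thesis using d by simp
  qed
  define b where "b m = (LINT x:{0..1}|lborel. g x * cis (- (2 * pi * of_int m * x)))" for m :: int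
  have fg: "f x = g x * (cis (2 * pi * x) - 1)" if x: "x \<in> {0..1}" for x
  proof (cases "min x (1 - x) = 0")
    case True
    then have "f x = 0" using f0[OF x] f1[OF x] by (auto simp: min_def split: if_splits)
    then show ?thesis by (simp add: g_def)
  next
    case False
    then have "norm (cis (2 * pi * x) - 1) > 0"
      using sn[OF x] x unfolding nc by (auto simp: min_def split: if_splits)
    then show ?thesis by (simp add: g_def)
  qed
  have gi: "set_integrable lborel {0..1} (\<lambda>x. g x * cis (- (2 * pi * of_int m * x)))" for m :: int
    using gb by (intro set_integrable_unit_interval_bounded[where K = "C / 4"]) (auto simp: norm_mult)
  \<comment> \<open>Multiplication by \<open>cis (2 \<pi> x)\<close> lowers the index of a Fourier
    coefficient by one.\<close>
  have step: "(LINT x:{0..1}|lborel. f x * cis (- (2 * pi * of_int m * x))) = b (m - 1) - b m" for m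
  proof -
    have "(LINT x:{0..1}|lborel. f x * cis (- (2 * pi * of_int m * x))) =
       (LINT x:{0..1}|lborel. g x * cis (- (2 * pi * of_int (m - 1) * x)) - g x * cis (- (2 * pi * of_int m * x)))"
      by (rule set_lebesgue_integral_cong) (auto simp: fg left_diff_distrib right_diff_distrib cis_mult algebra_simps)
    also have "\<dots> = b (m - 1) - b m" unfolding b_def by (rule set_integral_diff(2)[OF gi gi])
    finally show ?thesis .
  qed
  have tel: "(\<Sum>m\<in>{- int M..int M}. b (m - 1) - b m) = b (- int M - 1) - b (int M)" for M
  proof (induction M)
    case (Suc M)
    have "{- int (Suc M)..int (Suc M)} = insert (- int M - 1) (insert (int M + 1) {- int M..int M})" by auto
    then show ?case using Suc by (simp add: add.commute)
  qed simp
  \<comment> \<open>Along an injective sequence of indices the squares of the coefficients are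
    summable by Bessel's inequality, hence tend to 0.\<close>
  have lim: "(\<lambda>M. b (h M)) \<longlonglongrightarrow> 0" if "inj h" for h :: "nat \<Rightarrow> int"
  proof -
    have "summable (\<lambda>M. (norm (b (h M)))\<^sup>2)"
    proof (rule summableI_nonneg_bounded)
      fix n
      have "(\<Sum>M<n. (norm (b (h M)))\<^sup>2) = (\<Sum>m\<in>h ` {..<n}. (norm (b m))\<^sup>2)"
        using that by (subst sum.reindex) (auto intro: inj_on_subset)
      also have "\<dots> \<le> (C/4)\<^sup>2" unfolding b_def by (rule bessel_inequality) (use gb in auto)
      finally show "(\<Sum>M<n. (norm (b (h M)))\<^sup>2) \<le> (C/4)\<^sup>2" .
    qed auto
    then have "(\<lambda>M. (norm (b (h M)))\<^sup>2) \<longlonglongrightarrow> 0" by (rule summable_LIMSEQ_zero)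
    then have "(\<lambda>M. sqrt ((norm (b (h M)))\<^sup>2)) \<longlonglongrightarrow> sqrt 0" by (rule tendsto_real_sqrt)
    then show ?thesis by (simp add: tendsto_norm_zero_iff)
  qed
  have "(\<lambda>M. b (- int M - 1) - b (int M)) \<longlonglongrightarrow> 0 - 0"
    by (intro tendsto_diff lim) (auto intro!: injI)
  then show ?thesis unfolding step tel by simp
qed

text \<open>Integration by parts in the form of a correction term: \<open>E\<close> has derivative
  \<open>cis (2 \<pi> x\<^sup>2)\<close> up to an error of size \<open>1 / x\<^sup>2\<close>. So
  \<open>R - E\<close> has an absolutely integrable derivative near infinity, and \<open>E\<close>
  itself tends to 0.\<close>

lemma fresnel_converges:
  fixes R :: "real \<Rightarrow> complex"
  assumes R: "\<And>x. (R has_vector_derivative cis (2 * pi * x\<^sup>2)) (at x)"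
  shows "\<exists>L. (R \<longlongrightarrow> L) at_top"
proof -
  define c where "c = 4 * complex_of_real pi * \<i>"
  have c: "c \<noteq> 0" "norm c = 4 * pi" by (simp_all add: c_def norm_mult)
  define E where "E x = cis (2 * pi * x\<^sup>2) / (c * of_real x)" for x
  define S where "S x = R x - E x" for x
  have dS: "(S has_vector_derivative (cis (2 * pi * x\<^sup>2) / (c * (of_real x)\<^sup>2))) (at x)" if x: "x > 0" for x
  proof -
    have "((\<lambda>z. exp (c / 2 * z\<^sup>2) / (c * z)) has_field_derivative
       (exp (c / 2 * (of_real x)\<^sup>2) - exp (c / 2 * (of_real x)\<^sup>2) / (c * (of_real x)\<^sup>2))) (at (complex_of_real x))"
      using x c by (auto intro!: derivative_eq_intros simp: field_simps power2_eq_square)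
    from has_vector_derivative_real_field[OF this]
    have "(E has_vector_derivative (cis (2 * pi * x\<^sup>2) - cis (2 * pi * x\<^sup>2) / (c * (of_real x)\<^sup>2))) (at x)"
      by (simp add: E_def[abs_def] c_def cis_conv_exp mult_ac)
    from has_vector_derivative_diff[OF R this] show ?thesis by (simp add: S_def[abs_def])
  qed
  have bd: "norm (S b - S a) \<le> 1 / a" if ab: "0 < a" "a < b" for a b
  proof -
    have "norm (S b - S a) \<le> - (1 / b) - (- (1 / a))"
    proof (rule differentiable_bound_general[OF ab(2), where f = S and \<phi> = "\<lambda>x. - (1 / x)" and
          f' = "\<lambda>x. cis (2 * pi * x\<^sup>2) / (c * (of_real x)\<^sup>2)" and \<phi>' = "\<lambda>x. 1 / x\<^sup>2"])
      show "continuous_on {a..b} S"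
        by (intro continuous_at_imp_continuous_on ballI) (use ab(1) has_vector_derivative_continuous[OF dS] in auto)
      show "continuous_on {a..b} (\<lambda>x. - (1 / x))" using ab by (intro continuous_intros) auto
      fix x assume x: "a < x" "x < b"
      show "(S has_vector_derivative (cis (2 * pi * x\<^sup>2) / (c * (of_real x)\<^sup>2))) (at x)" using x ab by (intro dS) auto
      show "((\<lambda>x. - (1 / x)) has_vector_derivative 1 / x\<^sup>2) (at x)"
        using x ab by (auto intro!: derivative_eq_intros simp: has_real_derivative_iff_has_vector_derivative[symmetric] power2_eq_square field_simps)
      have "1 / (4 * pi * x\<^sup>2) \<le> 1 / (1 * x\<^sup>2)" using pi_gt3 x ab by (intro divide_left_mono mult_right_mono) auto
      then show "norm (cis (2 * pi * x\<^sup>2) / (c * (of_real x)\<^sup>2)) \<le> 1 / x\<^sup>2"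
        by (simp add: norm_divide norm_mult c norm_power)
    qed
    also have "\<dots> \<le> 1 / a" using ab by simp
    finally show ?thesis .
  qed
  define X where "X n = S (real (Suc n))" for n
  have Xb: "norm (S x - X n) \<le> 1 / real (Suc n)" if "x > real (Suc n)" for x n
    unfolding X_def by (rule bd) (use that in auto)
  have "Cauchy X"
  proof (rule CauchyI')
    fix e :: real assume "e > 0"
    then obtain M where M: "1 / real (Suc M) < e" using nat_approx_posE by blast
    show "\<exists>M. \<forall>m\<ge>M. \<forall>n>m. dist (X m) (X n) < e"
    proof (intro exI[of _ M] allI impI)
      fix m n assume "M \<le> m" "m < n"
      then have "norm (X n - X m) \<le> 1 / real (Suc m)" using Xb[of m "real (Suc n)"] by (simp add: X_def)
      also have "\<dots> \<le> 1 / real (Suc M)" using \<open>M \<le> m\<close> by (simp add: frac_le)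
      finally show "dist (X m) (X n) < e" using M by (simp add: dist_norm norm_minus_commute)
    qed
  qed
  then obtain L where L: "X \<longlonglongrightarrow> L" by (auto simp: Cauchy_convergent_iff convergent_def)
  have SL: "(S \<longlongrightarrow> L) at_top"
  proof (rule tendstoI)
    fix e :: real assume e: "e > 0"
    from tendstoD[OF L, of "e/2"] e obtain N where N: "\<And>n. n \<ge> N \<Longrightarrow> dist (X n) L < e/2" by (auto simp: eventually_sequentially)
    from e obtain M where M: "1 / real (Suc M) < e/2" using nat_approx_posE[of "e/2"] by auto
    define n where "n = max M N"
    have n: "1 / real (Suc n) \<le> 1 / real (Suc M)" by (simp add: n_def frac_le)
    show "\<forall>\<^sub>F x in at_top. dist (S x) L < e"
      using eventually_gt_at_top[of "real (Suc n)"]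
    proof eventually_elim
      case (elim x)
      then show ?case using Xb[OF elim] N[of n] M n dist_triangle[of "S x" L "X n"]
        by (simp add: n_def dist_norm)
    qed
  qed
  have "(E \<longlongrightarrow> 0) at_top"
  proof (rule tendsto_norm_zero_cancel)
    have "((\<lambda>x. 1 / (4 * pi * \<bar>x\<bar>)) \<longlongrightarrow> 0) at_top" by real_asymp
    then show "((\<lambda>x. norm (E x)) \<longlongrightarrow> 0) at_top" by (simp add: E_def norm_divide norm_mult c)
  qed
  from tendsto_add[OF SL this] show ?thesis by (auto simp: S_def)
qed

lemma norm_cis_diff_le: "norm (cis a - cis b) \<le> \<bar>a - b\<bar>"
proof -
  have "cis a - cis b = cis b * (cis (a - b) - 1)" by (simp add: algebra_simps cis_mult)
  then have "norm (cis a - cis b) = norm (exp (\<i> * of_real (a - b)) - 1)" by (simp add: norm_mult cis_conv_exp)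
  also have "\<dots> = 2 * \<bar>sin ((a - b) / 2)\<bar>" by (rule dist_exp_i_1)
  also have "\<dots> \<le> \<bar>a - b\<bar>" using abs_sin_x_le_abs_x[of "(a - b) / 2"] by simp
  finally show ?thesis .
qed

text \<open>For the periodised chirp, even and odd Fourier coefficients carry different constant
  factors and telescope separately. The odd integers up to \<open>2 J\<close> in modulus are
  \<open>2 j + 1\<close> with \<open>- J \<le> j < J\<close>, hence the half-open interval.\<close>

lemma sum_symmetric_even_odd:
  fixes F :: "int \<Rightarrow> complex"
  shows "(\<Sum>m\<in>{- int (2 * J)..int (2 * J)}. F m) =
     (\<Sum>j\<in>{- int J..int J}. F (2 * j)) + (\<Sum>j\<in>{- int J..<int J}. F (2 * j + 1))"
proof (induction J)
  case (Suc J)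
  have "{- int (2 * Suc J)..int (2 * Suc J)} = insert (- 2 * int J - 2) (insert (-2 * int J - 1)
     (insert (2 * int J + 1) (insert (2 * int J + 2) {- int (2 * J)..int (2 * J)})))" by auto
  moreover have "{- int (Suc J)..int (Suc J)} = insert (- int J - 1) (insert (int J + 1) {- int J..int J})" by auto
  moreover have "{- int (Suc J)..<int (Suc J)} = insert (- int J - 1) (insert (int J) {- int J..<int J})" by auto
  moreover have "- (int J * 2) - 1 = - 1 - int J * 2" by simp
  ultimately show ?case using Suc by (simp add: algebra_simps)
qed simp

text \<open>Dirichlet's evaluation: the Fourier series of the periodised chirp at \<open>0\<close> telescopes to a Fresnel integral,
  whose value is read off from \<open>N = 1\<close>.\<close>
lemma quadratic_gauss_sum_aux:
  "\<exists>D. \<forall>N\<ge>1. (\<Sum>k<N. cis (2 * pi * real (k\<^sup>2) / real N)) = of_real (sqrt (real N)) * D * (1 + (-\<i>) ^ N)"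
proof -
  \<comment> \<open>An entire primitive \<open>P\<close> replaces Fresnel integrals throughout; only
    the existence of its limits \<open>L1\<close> and \<open>L2\<close> along the real axis matters.
    The constant \<open>D\<close> is their difference.\<close>
  have "(\<lambda>z. exp (2 * pi * \<i> * z\<^sup>2)) holomorphic_on UNIV" by (intro holomorphic_intros)
  then obtain P where P: "\<And>z. (P has_field_derivative exp (2 * pi * \<i> * z\<^sup>2)) (at z)"
    using holomorphic_convex_primitive[of UNIV "{}" "\<lambda>z. exp (2 * pi * \<i> * z\<^sup>2)"]
    by (auto simp: holomorphic_on_imp_continuous_on holomorphic_on_open field_differentiable_def)
  have dP: "((\<lambda>x. P (of_real x)) has_vector_derivative cis (2 * pi * x\<^sup>2)) (at x)" for x :: real
    using has_vector_derivative_real_field[OF P[of "of_real x"]] by (simp add: cis_conv_exp mult_ac)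
  obtain L1 where L1: "((\<lambda>x. P (of_real x)) \<longlongrightarrow> L1) at_top" using fresnel_converges[OF dP] by auto
  have "((\<lambda>x. - P (of_real (- x))) has_vector_derivative cis (2 * pi * x\<^sup>2)) (at x)" for x :: real
  proof -
    have "((\<lambda>z. - P (- z)) has_field_derivative exp (2 * pi * \<i> * (of_real x)\<^sup>2)) (at (complex_of_real x))"
    proof -
      have "((\<lambda>z. P (- z)) has_field_derivative exp (2 * pi * \<i> * (- of_real x)\<^sup>2) * (-1)) (at (complex_of_real x))"
        by (rule DERIV_chain2[where f = P, OF P]) (auto intro!: derivative_eq_intros)
      from DERIV_minus[OF this] show ?thesis by simp
    qed
    from has_vector_derivative_real_field[OF this] show ?thesis by (simp add: cis_conv_exp mult_ac)
  qed
  from fresnel_converges[OF this] obtain L2 where "((\<lambda>x. - P (of_real (- x))) \<longlongrightarrow> - L2) at_top"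
    by (metis minus_minus)
  then have L2: "((\<lambda>x. P (of_real (- x))) \<longlongrightarrow> L2) at_top"
    by (rule tendsto_minus_cancel)
  have "(\<Sum>k<N. cis (2 * pi * real (k\<^sup>2) / real N)) = of_real (sqrt (real N)) * (L1 - L2) * (1 + (-\<i>) ^ N)"
    if N: "N \<ge> 1" for N :: nat
  proof -
    define r where "r = sqrt (real N)"
    have r: "r > 0" "r\<^sup>2 = real N" using N by (simp_all add: r_def)
    \<comment> \<open>\<open>f 0\<close> is the Gauss sum. Moving from 0 to 1 replaces the term
      \<open>k = 0\<close> by \<open>k = N\<close>, and both are 1, so \<open>f 1 = f 0\<close> and
      the Fourier series can be evaluated at the endpoint.\<close>
    define f where "f x = (\<Sum>k<N. cis (2 * pi * (real k + x)\<^sup>2 / real N))" for x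
    define Q where "Q t = P (of_real (t * r))" for t :: real
    have f01: "f 1 = f 0"
    proof -
      have "f 1 = (\<Sum>k<N. cis (2 * pi * (real (Suc k))\<^sup>2 / real N))" by (simp add: f_def add.commute)
      also have "\<dots> + cis (2 * pi * (real 0)\<^sup>2 / real N) = (\<Sum>k<Suc N. cis (2 * pi * (real k)\<^sup>2 / real N))"
        by (subst sum.lessThan_Suc_shift) (simp add: add.commute)
      also have "\<dots> = f 0 + cis (2 * pi * real N)"
      proof -
        have "2 * pi * (real N)\<^sup>2 / real N = 2 * pi * real N" using N by (simp add: power2_eq_square)
        then show ?thesis by (simp only: f_def sum.lessThan_Suc add_0_right)
      qed
      also have "cis (2 * pi * real N) = 1" by (rule cis_multiple_2pi) simp
      finally show ?thesis by simp
    qed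
    define C where "C = (\<Sum>k<N. 2 * pi * (2 * real k + 2) / real N)"
    have lip: "norm (f x - f y) \<le> C * \<bar>x - y\<bar>" if "x \<in> {0..1}" "y \<in> {0..1}" for x y
    proof -
      have "norm (f x - f y) \<le> (\<Sum>k<N. norm (cis (2 * pi * (real k + x)\<^sup>2 / real N) - cis (2 * pi * (real k + y)\<^sup>2 / real N)))"
        unfolding f_def sum_subtractf[symmetric] by (rule norm_sum)
      also have "\<dots> \<le> (\<Sum>k<N. 2 * pi * (2 * real k + 2) / real N * \<bar>x - y\<bar>)"
      proof (rule sum_mono)
        fix k
        have "norm (cis (2 * pi * (real k + x)\<^sup>2 / real N) - cis (2 * pi * (real k + y)\<^sup>2 / real N))
           \<le> \<bar>2 * pi * (real k + x)\<^sup>2 / real N - 2 * pi * (real k + y)\<^sup>2 / real N\<bar>" by (rule norm_cis_diff_le)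
        also have "2 * pi * (real k + x)\<^sup>2 / real N - 2 * pi * (real k + y)\<^sup>2 / real N = 2 * pi * (2 * real k + x + y) / real N * (x - y)"
          by (simp add: diff_divide_distrib[symmetric] power2_eq_square algebra_simps)
        also have "\<bar>\<dots>\<bar> = 2 * pi * (2 * real k + x + y) / real N * \<bar>x - y\<bar>"
          using that by (simp add: abs_mult)
        also have "\<dots> \<le> 2 * pi * (2 * real k + 2) / real N * \<bar>x - y\<bar>"
          using that N by (intro mult_right_mono divide_right_mono mult_left_mono) auto
        finally show "norm (cis (2 * pi * (real k + x)\<^sup>2 / real N) - cis (2 * pi * (real k + y)\<^sup>2 / real N)) \<le> 2 * pi * (2 * real k + 2) / real N * \<bar>x - y\<bar>" .
      qed
      finally show ?thesis by (simp add: C_def sum_distrib_right)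
    qed
    have "continuous_on UNIV f" unfolding f_def by (intro continuous_intros) auto
    then have fm [measurable]: "f \<in> borel_measurable borel" by (rule borel_measurable_continuous_onI)
    have fc: "continuous_on {0..1} f" unfolding f_def by (intro continuous_intros) auto
    define a where "a m = (LINT x:{0..1}|lborel. f x * cis (- (2 * pi * of_int m * x)))" for m :: int
    have lim: "(\<lambda>M. \<Sum>m\<in>{- int M..int M}. (LINT x:{0..1}|lborel. (f x - f 0) * cis (- (2 * pi * of_int m * x)))) \<longlonglongrightarrow> 0"
    proof (rule fourier_series_at_zero[where C = C])
      show "norm (f x - f 0) \<le> C * x" if "x \<in> {0..1}" for x using lip[of x 0] that by simp
      show "norm (f x - f 0) \<le> C * (1 - x)" if "x \<in> {0..1}" for x using lip[of x 1] that by (simp add: f01)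
    qed simp
    have "(LINT x:{0..1}|lborel. (f x - f 0) * cis (- (2 * pi * of_int m * x))) = a m - (if m = 0 then f 0 else 0)" for m
    proof -
      have i1: "set_integrable lborel {0..1} (\<lambda>x. f x * cis (- (2 * pi * of_int m * x)))"
        by (intro borel_integrable_atLeastAtMost' continuous_intros fc)
      have i2: "set_integrable lborel {0..1} (\<lambda>x. f 0 * cis (- (2 * pi * of_int m * x)))"
        by (intro borel_integrable_atLeastAtMost' continuous_intros)
      show ?thesis
        unfolding left_diff_distrib set_integral_diff(2)[OF i1 i2] a_def
        using cis_integral_period[of "-m"] by simp
    qed
    then have "(\<lambda>M. (\<Sum>m\<in>{- int M..int M}. a m) - f 0) \<longlonglongrightarrow> 0"
      using lim by (simp add: sum_subtractf)
    then have "(\<lambda>M. (\<Sum>m\<in>{- int M..int M}. a m) - f 0 + f 0) \<longlonglongrightarrow> 0 + f 0" by (intro tendsto_intros)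
    then have lim1: "(\<lambda>M. \<Sum>m\<in>{- int M..int M}. a m) \<longlonglongrightarrow> f 0" by simp
    \<comment> \<open>Completing the square in the exponent produces the constant factor and a chirp
      centred at \<open>m N / 2\<close>; the factor \<open>cis (2 \<pi> m k) = 1\<close> is inserted
      to make this possible. Summing over \<open>k\<close> glues the unit intervals into
      [0, N].\<close>
    have am: "a m = cis (- (pi * (of_int m)\<^sup>2 * real N / 2)) * of_real r * (Q (1 - of_int m / 2) - Q (- of_int m / 2))" for m
    proof -
      define w where "w = cis (- (pi * (of_int m)\<^sup>2 * real N / 2))"
      define A where "A k = P (of_real ((real k - of_int m * real N / 2) / r))" for k
      have "((\<lambda>x. f x * cis (- (2 * pi * of_int m * x))) has_integral
         ((\<Sum>k<N. w * of_real r * P (of_real ((real k + 1 - of_int m * real N / 2) / r)))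
         - (\<Sum>k<N. w * of_real r * P (of_real ((real k + 0 - of_int m * real N / 2) / r))))) {0..1}"
      proof (rule fundamental_theorem_of_calculus)
        fix x :: real
        have "((\<lambda>x. \<Sum>k<N. w * of_real r * P (of_real ((real k + x - of_int m * real N / 2) / r))) has_vector_derivative
          (\<Sum>k<N. w * cis (2 * pi * ((real k + x - of_int m * real N / 2) / r)\<^sup>2))) (at x)"
        proof (rule has_vector_derivative_sum)
          fix k
          have "((\<lambda>z. w * of_real r * P ((of_nat k + z - of_int m * of_nat N / 2) / of_real r)) has_field_derivative
             w * of_real r * (exp (2 * pi * \<i> * ((of_nat k + of_real x - of_int m * of_nat N / 2) / of_real r)\<^sup>2) * (1 / of_real r))) (at (complex_of_real x))"
            by (intro DERIV_cmult DERIV_chain2[OF P]) (auto intro!: derivative_eq_intros simp: r(1)[THEN less_imp_neq, symmetric])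
          from has_vector_derivative_real_field[OF this] r
          show "((\<lambda>x. w * of_real r * P (of_real ((real k + x - of_int m * real N / 2) / r))) has_vector_derivative
             w * cis (2 * pi * ((real k + x - of_int m * real N / 2) / r)\<^sup>2)) (at x)"
            by (simp add: cis_conv_exp mult_ac)
        qed
        also have "(\<Sum>k<N. w * cis (2 * pi * ((real k + x - of_int m * real N / 2) / r)\<^sup>2)) = f x * cis (- (2 * pi * of_int m * x))"
          unfolding f_def sum_distrib_right
        proof (rule sum.cong, simp)
          fix k
          have "cis (2 * pi * (real_of_int (m * int k))) = 1" by (rule cis_multiple_2pi) simp
          then have "cis (2 * pi * (real k + x)\<^sup>2 / real N) * cis (- (2 * pi * of_int m * x)) =
             cis (2 * pi * (real k + x)\<^sup>2 / real N) * cis (- (2 * pi * of_int m * x)) * cis (- (2 * pi * (real_of_int (m * int k))))"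
            by (simp add: cis_inverse[symmetric] del: cis_inverse)
          also have "\<dots> = cis (2 * pi * (real k + x)\<^sup>2 / real N - 2 * pi * of_int m * x - 2 * pi * (real_of_int (m * int k)))"
            by (simp add: cis_mult algebra_simps)
          also have "2 * pi * (real k + x)\<^sup>2 / real N - 2 * pi * of_int m * x - 2 * pi * (real_of_int (m * int k)) =
             - (pi * (of_int m)\<^sup>2 * real N / 2) + 2 * pi * ((real k + x - of_int m * real N / 2) / r)\<^sup>2"
            using N unfolding power_divide r by (simp add: field_simps power2_eq_square)
          finally show "w * cis (2 * pi * ((real k + x - of_int m * real N / 2) / r)\<^sup>2) = cis (2 * pi * (real k + x)\<^sup>2 / real N) * cis (- (2 * pi * of_int m * x))"
            by (simp add: w_def cis_mult)
        qed
        finally show "((\<lambda>x. \<Sum>k<N. w * of_real r * P (of_real ((real k + x - of_int m * real N / 2) / r))) has_vector_derivative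
           f x * cis (- (2 * pi * of_int m * x))) (at x within {0..1})" by (rule has_vector_derivative_at_within)
      qed simp
      moreover have "set_integrable lborel {0..1} (\<lambda>x. f x * cis (- (2 * pi * of_int m * x)))"
        by (intro borel_integrable_atLeastAtMost' continuous_intros fc)
      ultimately have "a m = (\<Sum>k<N. w * of_real r * P (of_real ((real k + 1 - of_int m * real N / 2) / r)))
         - (\<Sum>k<N. w * of_real r * P (of_real ((real k + 0 - of_int m * real N / 2) / r)))"
        by (simp only: a_def set_borel_integral_eq_integral integral_unique)
      also have "\<dots> = w * of_real r * (\<Sum>k<N. A (Suc k) - A k)"
        by (simp add: A_def sum_distrib_left sum_subtractf add.commute algebra_simps)
      also have "(\<Sum>k<N. A (Suc k) - A k) = A N - A 0" by (rule sum_lessThan_telescope)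
      also have "A N = Q (1 - of_int m / 2)"
      proof -
        have "(real N - of_int m * real N / 2) / r = (1 - of_int m / 2) * r"
          using r(1) unfolding r(2)[symmetric] by (simp add: field_simps power2_eq_square)
        then show ?thesis unfolding A_def Q_def by (rule arg_cong)
      qed
      also have "A 0 = Q (- of_int m / 2)"
      proof -
        have "(real 0 - of_int m * real N / 2) / r = (- of_int m / 2) * r"
          using r(1) unfolding r(2)[symmetric] by (simp add: field_simps power2_eq_square)
        then show ?thesis unfolding A_def Q_def by (rule arg_cong)
      qed
      finally show ?thesis by (simp add: w_def)
    qed
    have ev: "a (2 * j) = of_real r * (Q (1 - of_int j) - Q (- of_int j))" for j
    proof -
      have "cis (- (pi * (of_int (2 * j))\<^sup>2 * real N / 2)) = cis (2 * pi * of_int (- (j\<^sup>2 * int N)))"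
        by (rule arg_cong[of _ _ cis]) (simp add: power_mult_distrib)
      also have "\<dots> = 1" by (rule cis_multiple_2pi) simp
      finally show ?thesis unfolding am by simp
    qed
    \<comment> \<open>An odd square is 1 plus a multiple of 4, so exactly
      \<open>cis (- \<pi> / 2) = - \<i>\<close> to the power \<open>N\<close> survives.\<close>
    have od: "a (2 * j + 1) = (-\<i>) ^ N * of_real r * (Q (1/2 - of_int j) - Q (- (1/2) - of_int j))" for j
    proof -
      have "cis (- (pi * (of_int (2 * j + 1))\<^sup>2 * real N / 2)) = cis (2 * pi * of_int (- ((j\<^sup>2 + j) * int N)) + real N * (- (pi / 2)))"
        by (rule arg_cong[of _ _ cis]) (simp add: power2_eq_square algebra_simps add_divide_distrib)
      also have "\<dots> = cis (2 * pi * of_int (- ((j\<^sup>2 + j) * int N))) * (cis (- (pi / 2))) ^ N"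
        by (subst Complex.DeMoivre, subst cis_mult, rule refl)
      also have "cis (2 * pi * of_int (- ((j\<^sup>2 + j) * int N))) = 1"
        by (rule cis_multiple_2pi) simp
      also have "cis (- (pi / 2)) = - \<i>" by (simp add: complex_eq_iff)
      finally show ?thesis unfolding am by (simp add: field_simps)
    qed
    \<comment> \<open>Consecutive intervals of length 1, scaled by \<open>r\<close>, fill a growing
      symmetric range. The odd coefficients do the same with midpoints shifted by 1/2, so both
      families tend to the full Fresnel integral.\<close>
    have tel1: "(\<Sum>j\<in>{- int J..int J}. Q (1 - of_int j) - Q (- of_int j)) = Q (real J + 1) - Q (- real J)" for J
    proof (induction J)
      case (Suc J)
      have "{- int (Suc J)..int (Suc J)} = insert (- int J - 1) (insert (int J + 1) {- int J..int J})" by auto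
      then show ?case using Suc by (simp add: algebra_simps)
    qed simp
    have tel2: "(\<Sum>j\<in>{- int J..<int J}. Q (1/2 - of_int j) - Q (- (1/2) - of_int j)) = Q (real J + 1/2) - Q (1/2 - real J)" for J
    proof (induction J)
      case (Suc J)
      have "{- int (Suc J)..<int (Suc J)} = insert (- int J - 1) (insert (int J) {- int J..<int J})" by auto
      moreover have "Q (- real J - 1 / 2) = Q (- (1 / 2) - real J)" by (rule arg_cong[of _ _ Q]) simp
      ultimately show ?case using Suc by (simp add: algebra_simps)
    qed simp
    have QL1: "(\<lambda>J. Q (real J + c)) \<longlonglongrightarrow> L1" for c
      unfolding Q_def by (rule filterlim_compose[OF L1]) (use r(1) in real_asymp)
    have QL2: "(\<lambda>J. Q (c - real J)) \<longlonglongrightarrow> L2" for c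
    proof -
      have "filterlim (\<lambda>J. - ((c - real J) * r)) at_top sequentially" using r(1) by real_asymp
      from filterlim_compose[OF L2 this] show ?thesis by (simp add: Q_def)
    qed
    have lA: "(\<lambda>J. \<Sum>m\<in>{- int (2 * J)..int (2 * J)}. a m) \<longlonglongrightarrow> f 0"
      using LIMSEQ_subseq_LIMSEQ[OF lim1, of "\<lambda>J. 2 * J"] by (simp add: strict_mono_def o_def)
    have eq: "(\<Sum>m\<in>{- int (2 * J)..int (2 * J)}. a m) =
       of_real r * (Q (real J + 1) - Q (0 - real J)) + (-\<i>) ^ N * of_real r * (Q (real J + 1/2) - Q (1/2 - real J))" for J
      unfolding sum_symmetric_even_odd ev od sum_distrib_left[symmetric] tel1 tel2 by simp
    have lB: "(\<lambda>J. of_real r * (Q (real J + 1) - Q (0 - real J)) + (-\<i>) ^ N * of_real r * (Q (real J + 1/2) - Q (1/2 - real J)))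
       \<longlonglongrightarrow> of_real r * (L1 - L2) + (-\<i>) ^ N * of_real r * (L1 - L2)"
      by (intro tendsto_intros QL1 QL2)
    have "f 0 = of_real r * (L1 - L2) + (-\<i>) ^ N * of_real r * (L1 - L2)"
      by (rule LIMSEQ_unique[OF lA]) (simp only: eq lB)
    then show ?thesis by (simp add: f_def r_def algebra_simps)
  qed
  then show ?thesis by blast
qed

lemma quadratic_gauss_sum_odd:
  assumes "odd N"
  shows "(\<Sum>k<N. cis (2 * pi * real (k\<^sup>2) / real N)) = (if N mod 4 = 1 then 1 else \<i>) * of_real (sqrt (real N))"
proof -
  obtain D where D: "\<And>N. N \<ge> 1 \<Longrightarrow> (\<Sum>k<N. cis (2 * pi * real (k\<^sup>2) / real N)) = of_real (sqrt (real N)) * D * (1 + (-\<i>) ^ N)"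
    using quadratic_gauss_sum_aux by blast
  have "D * (1 - \<i>) = 1" using D[of 1] by simp
  then have "D * ((1 - \<i>) * (1 + \<i>)) = 1 + \<i>" by (simp add: mult.assoc[symmetric])
  then have D': "D = (1 + \<i>) / 2" by (simp add: algebra_simps field_simps)
  have m4: "(- \<i>) ^ N = (- \<i>) ^ (N mod 4)"
  proof -
    have "(- \<i>) ^ N = (- \<i>) ^ (4 * (N div 4) + N mod 4)" by simp
    also have "\<dots> = ((- \<i>) ^ 4) ^ (N div 4) * (- \<i>) ^ (N mod 4)"
      by (simp only: power_add power_mult)
    also have "(- \<i>) ^ 4 = (1 :: complex)" by (simp add: eval_nat_numeral)
    finally show ?thesis by simp
  qed
  have "N mod 4 = 1 \<or> N mod 4 = 3" using assms by presburger
  have "N \<ge> 1" using assms by (cases N) auto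
  then have "(\<Sum>k<N. cis (2 * pi * real (k\<^sup>2) / real N)) = of_real (sqrt (real N)) * ((1 + \<i>) / 2 * (1 + (-\<i>) ^ (N mod 4)))"
    using D[of N] unfolding D' m4 mult.assoc by blast
  moreover have "(1 + \<i>) / 2 * (1 + (-\<i>) ^ 1) = 1" "(1 + \<i>) / 2 * (1 + (-\<i>) ^ 3) = \<i>"
    by (simp_all add: complex_eq_iff eval_nat_numeral)
  ultimately show ?thesis using \<open>N mod 4 = 1 \<or> N mod 4 = 3\<close>
    by (elim disjE) (simp_all only: mult_1_right mult_1 mult.commute refl if_True if_False, simp_all)
qed

subsection \<open>Poisson summation\<close>

lemma summable_on_int_inverse_square: "(\<lambda>n::int. K / (1 + (real_of_int n)\<^sup>2)) summable_on UNIV"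
proof -
  have s: "(\<lambda>n::nat. K / (1 + (real n)\<^sup>2)) summable_on UNIV"
  proof -
    have "summable (\<lambda>n. norm (K / (1 + (real n)\<^sup>2)))"
    proof (rule summable_comparison_test'[where N = 1])
      show "summable (\<lambda>n. \<bar>K\<bar> * (1 / (real n)\<^sup>2))"
        using inverse_power_summable[of 2, where 'a = real] by (intro summable_mult) (simp add: inverse_eq_divide)
      show "norm (norm (K / (1 + (real n)\<^sup>2))) \<le> \<bar>K\<bar> * (1 / (real n)\<^sup>2)" if "n \<ge> 1" for n
      proof -
        have "norm (norm (K / (1 + (real n)\<^sup>2))) = \<bar>K\<bar> / (1 + (real n)\<^sup>2)" by (simp add: abs_of_nonneg)
        also have "\<dots> \<le> \<bar>K\<bar> / (real n)\<^sup>2" using that by (intro divide_left_mono) (auto intro!: mult_pos_pos add_pos_nonneg)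
        finally show ?thesis by simp
      qed
    qed
    then show ?thesis by (rule norm_summable_imp_summable_on)
  qed
  have i1: "inj_on int UNIV" "inj_on (\<lambda>n. - int n - 1) UNIV" by (auto simp: inj_on_def)
  have "(\<lambda>n::int. K / (1 + (real_of_int n)\<^sup>2)) summable_on range int"
    using s summable_on_reindex[OF i1(1), of "\<lambda>n::int. K / (1 + (real_of_int n)\<^sup>2)"] by (simp add: o_def)
  moreover have "(\<lambda>n::int. K / (1 + (real_of_int n)\<^sup>2)) summable_on range (\<lambda>n. - int n - 1)"
  proof -
    have "(\<lambda>n. K / (1 + (real (Suc n))\<^sup>2)) summable_on UNIV"
      using s summable_on_reindex[of Suc UNIV "\<lambda>n. K / (1 + (real n)\<^sup>2)"] summable_on_subset_banach[OF s, of "range Suc"] by (simp add: o_def)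
    moreover have "(real_of_int (- int n - 1))\<^sup>2 = (real (Suc n))\<^sup>2" for n by (simp add: power2_eq_square algebra_simps)
    ultimately show ?thesis
      by (subst summable_on_reindex[OF i1(2)]) (simp only: o_def)
  qed
  ultimately have "(\<lambda>n::int. K / (1 + (real_of_int n)\<^sup>2)) summable_on (range int \<union> range (\<lambda>n. - int n - 1))"
    by (intro summable_on_Un_disjoint) auto
  also have "range int \<union> range (\<lambda>n. - int n - 1) = UNIV"
  proof -
    have "x \<in> range int \<union> range (\<lambda>n. - int n - 1)" for x
    proof (cases "x \<ge> 0")
      case True then show ?thesis by (auto intro!: image_eqI[of _ _ "nat x"])
    next
      case False then have "x = - int (nat (- x - 1)) - 1" by simp
      then show ?thesis by blast
    qed
    then show ?thesis by auto
  qed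
  finally show ?thesis .
qed

lemma filterlim_int_atLeastAtMost: "filterlim (\<lambda>N. {- int N..int N}) (finite_subsets_at_top UNIV) sequentially"
  unfolding filterlim_finite_subsets_at_top
proof (intro allI impI)
  fix X :: "int set" assume X: "finite X \<and> X \<subseteq> UNIV"
  then obtain B where B: "\<And>x. x \<in> X \<Longrightarrow> \<bar>x\<bar> \<le> B"
    using finite_nat_set_iff_bounded_le[of "(\<lambda>x. nat \<bar>x\<bar>) ` X"] by (metis finite_imageI image_eqI nat_le_iff)
  show "\<forall>\<^sub>F N in sequentially. finite {- int N..int N} \<and> X \<subseteq> {- int N..int N} \<and> {- int N..int N} \<subseteq> UNIV"
    using eventually_ge_at_top[of "nat B"]
  proof eventually_elim
    case (elim N)
    have "- int N \<le> x \<and> x \<le> int N" if "x \<in> X" for x using B[OF that] elim by linarith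
    then show ?case by auto
  qed
qed

text \<open>Bridges unconditional sums over the integers and the symmetric partial sums in which
  Fourier series converge here.\<close>

lemma has_sum_int_imp_tendsto:
  fixes f :: "int \<Rightarrow> 'a::real_normed_vector"
  assumes "(f has_sum S) UNIV"
  shows "(\<lambda>N. \<Sum>n\<in>{- int N..int N}. f n) \<longlonglongrightarrow> S"
  using assms unfolding has_sum_def by (rule filterlim_compose[OF _ filterlim_int_atLeastAtMost])

lemma integrable_inverse_square: "integrable lborel (\<lambda>x::real. C / (1 + x\<^sup>2))"
proof -
  have "integrable lborel (\<lambda>x::real. inverse (1 + x\<^sup>2))"
    using integrable_inverse_1_plus_square by (simp add: set_integrable_def)
  from integrable_mult_right[OF this, of C] show ?thesis by (simp add: divide_inverse)
qed

text \<open>The periodisation \<open>H\<close> is Lipschitz with equal values at 0 and 1, so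
  \<open>fourier_series_at_zero\<close> applies to \<open>H - H 0\<close>. The transform of
  \<open>h\<close> is not assumed summable, which is why the dual side is a limit of symmetric
  partial sums.\<close>

lemma poisson_summation_zero:
  fixes h h' :: "real \<Rightarrow> complex"
  assumes dh: "\<And>x. (h has_vector_derivative h' x) (at x)"
    and hb: "\<And>x. norm (h x) \<le> C / (1 + x\<^sup>2)" and hb': "\<And>x. norm (h' x) \<le> C / (1 + x\<^sup>2)"
  shows "(\<lambda>M. \<Sum>m\<in>{- int M..int M}. (\<integral>x. h x * cis (- (2 * pi * of_int m * x)) \<partial>lborel)) \<longlonglongrightarrow> (\<Sum>\<^sub>\<infinity>n\<in>UNIV. h (of_int n))"
    and "(\<lambda>n::int. norm (h (of_int n))) summable_on UNIV"
proof -
  have C: "C \<ge> 0" using order_trans[OF norm_ge_zero hb[of 0]] by simp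
  \<comment> \<open>The factor 3 comes from
    \<open>n\<^sup>2 \<le> 2 (x + n)\<^sup>2 + 2 x\<^sup>2\<close> with
    \<open>x\<^sup>2 \<le> 1\<close>. Thus \<open>K\<close> bounds all translates on [0, 1]
    simultaneously.\<close>
  define K where "K n = 3 * C / (1 + (real_of_int n)\<^sup>2)" for n :: int
  have K: "K summable_on UNIV" unfolding K_def by (rule summable_on_int_inverse_square)
  have K0: "K n \<ge> 0" for n using C by (simp add: K_def add_nonneg_nonneg)
  have shift: "C / (1 + (x + of_int n)\<^sup>2) \<le> K n" if "x \<in> {0..1}" for x n
  proof -
    have "(real_of_int n)\<^sup>2 \<le> 2 * (x + of_int n)\<^sup>2 + 2 * x\<^sup>2"
      using zero_le_power2[of "2 * x + of_int n"] by (simp add: power2_eq_square algebra_simps)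
    moreover have "x\<^sup>2 \<le> 1" using that by (simp add: power_le_one)
    ultimately have "1 + (real_of_int n)\<^sup>2 \<le> 3 * (1 + (x + of_int n)\<^sup>2)" 
    proof -
      have "1 + N \<le> 3 * (1 + X)" if "N \<le> 2 * X + 2 * Y" "Y \<le> 1" "0 \<le> X" for N X Y :: real
        using that by (simp add: algebra_simps)
      from this[OF \<open>(real_of_int n)\<^sup>2 \<le> _\<close> \<open>x\<^sup>2 \<le> 1\<close>] show ?thesis by simp
    qed
    then have "3 * C / (3 * (1 + (x + of_int n)\<^sup>2)) \<le> K n"
      unfolding K_def using C by (intro frac_le) (auto intro: add_pos_nonneg)
    moreover have "3 * C / (3 * (1 + (x + of_int n)\<^sup>2)) = C / (1 + (x + of_int n)\<^sup>2)" by (rule mult_divide_mult_cancel_left) simp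
    ultimately show ?thesis by metis
  qed
  have hK: "norm (h (x + of_int n)) \<le> K n" if "x \<in> {0..1}" for x n
    using hb[of "x + of_int n"] shift[OF that, of n] by linarith
  have lip: "norm (h (x + of_int n) - h (y + of_int n)) \<le> K n * \<bar>x - y\<bar>" if "x \<in> {0..1}" "y \<in> {0..1}" for x y n
  proof -
    have "norm (h (x + of_int n) - h (y + of_int n)) \<le> K n * norm (x - y)"
    proof (rule differentiable_bound[of "{0..1}" "\<lambda>x. h (x + of_int n)" "\<lambda>x t. t *\<^sub>R h' (x + of_int n)"])
      fix z :: real assume z: "z \<in> {0..1}"
      have "((\<lambda>x. h (x + of_int n)) has_vector_derivative h' (z + of_int n)) (at z)"
      proof -
        have "((\<lambda>x. x + real_of_int n) has_vector_derivative 1) (at z)"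
          by (auto intro!: derivative_eq_intros simp: has_real_derivative_iff_has_vector_derivative[symmetric])
        from vector_diff_chain_at[OF this, of h "h' (z + of_int n)"] dh show ?thesis by (simp add: o_def)
      qed
      then show "((\<lambda>x. h (x + of_int n)) has_derivative (\<lambda>t. t *\<^sub>R h' (z + of_int n))) (at z within {0..1})"
        unfolding has_vector_derivative_def by (rule has_derivative_at_withinI)
      have "norm (h' (z + of_int n)) \<le> K n" using hb'[of "z + of_int n"] shift[OF z, of n] by linarith
      then show "onorm (\<lambda>t. t *\<^sub>R h' (z + of_int n)) \<le> K n"
        by (intro onorm_bound) (auto simp: K0 mult.commute[of "K n"] intro: mult_left_mono)
    qed (use that in auto)
    then show ?thesis by simp
  qed
  have hc: "continuous_on A h" for A
    using has_vector_derivative_continuous[OF dh] by (intro continuous_at_imp_continuous_on) auto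
  have hm [measurable]: "h \<in> borel_measurable borel" by (rule borel_measurable_continuous_onI[OF hc])
  have hi: "integrable lborel h"
    by (rule Bochner_Integration.integrable_bound[OF integrable_inverse_square[of C]])
       (use hb C in \<open>auto intro!: AE_I2\<close>)
  have as: "(\<lambda>n::int. norm (h (x + of_int n))) summable_on UNIV" if "x \<in> {0..1}" for x
    by (rule summable_on_comparison_test[OF K]) (use hK[OF that] in auto)
  from as[of 0] show "(\<lambda>n::int. norm (h (of_int n))) summable_on UNIV" by simp
  define H where "H x = (\<Sum>\<^sub>\<infinity>n\<in>UNIV. h (x + of_int n))" for x
  have hs: "((\<lambda>n::int. h (x + of_int n)) has_sum H x) UNIV" if "x \<in> {0..1}" for x
    unfolding H_def using as[OF that] by (simp add: abs_summable_summable)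
  have H01: "H 1 = H 0"
  proof -
    have "bij_betw (\<lambda>n::int. n + 1) UNIV UNIV" by (rule bij_betwI[of _ _ _ "\<lambda>n. n - 1"]) auto
    from infsum_reindex_bij_betw[OF this, of "\<lambda>n. h (of_int n)"]
    show ?thesis by (simp add: H_def add.commute)
  qed
  define SK where "SK = infsum K UNIV"
  have Hlip: "norm (H x - H y) \<le> SK * \<bar>x - y\<bar>" if xy: "x \<in> {0..1}" "y \<in> {0..1}" for x y
  proof -
    have s1: "((\<lambda>n. h (x + of_int n) - h (y + of_int n)) has_sum (H x - H y)) UNIV"
    proof -
      have "((\<lambda>n. - h (y + of_int n)) has_sum (- H y)) UNIV"
        using hs[OF xy(2)] by (simp add: has_sum_uminus)
      from has_sum_add[OF hs[OF xy(1)] this] show ?thesis by simp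
    qed
    have s2: "((\<lambda>n. K n * \<bar>x - y\<bar>) has_sum (SK * \<bar>x - y\<bar>)) UNIV"
      unfolding SK_def by (intro has_sum_cmult_left has_sum_infsum K)
    show ?thesis
      by (rule LIMSEQ_le[OF tendsto_norm[OF has_sum_int_imp_tendsto[OF s1]] has_sum_int_imp_tendsto[OF s2]])
         (auto intro!: exI[of _ 0] order_trans[OF norm_sum] sum_mono lip xy)
  qed
  \<comment> \<open>The bounds on \<open>H\<close> hold on [0, 1]; cutting off there yields a
    function that is measurable on the whole line.\<close>
  define f where "f x = indicat_real {0..1} x *\<^sub>R (H x - H 0)" for x
  define HN where "HN N x = (\<Sum>n\<in>{- int N..int N}. h (x + of_int n))" for N x
  have HNlim: "(\<lambda>N. HN N x) \<longlonglongrightarrow> H x" if "x \<in> {0..1}" for x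
    unfolding HN_def by (rule has_sum_int_imp_tendsto[OF hs[OF that]])
  have HNm [measurable]: "HN N \<in> borel_measurable borel" for N unfolding HN_def by measurable
  have HNb: "norm (HN N x) \<le> SK" if "x \<in> {0..1}" for N x
  proof -
    have "norm (HN N x) \<le> (\<Sum>n\<in>{- int N..int N}. K n)"
      unfolding HN_def by (rule order_trans[OF norm_sum]) (intro sum_mono hK that)
    also have "\<dots> \<le> SK" unfolding SK_def by (rule finite_sum_le_infsum[OF K]) (auto simp: K0)
    finally show ?thesis .
  qed
  have Hm [measurable]: "(\<lambda>x. indicat_real {0..1} x *\<^sub>R H x) \<in> borel_measurable borel"
  proof (rule borel_measurable_LIMSEQ_metric)
    fix x show "(\<lambda>N. indicat_real {0..1} x *\<^sub>R HN N x) \<longlonglongrightarrow> indicat_real {0..1} x *\<^sub>R H x"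
      using HNlim[of x] by (cases "x \<in> {0..1}") auto
  qed measurable
  have fm [measurable]: "f \<in> borel_measurable borel"
    unfolding f_def scaleR_diff_right by measurable
  have lim: "(\<lambda>M. \<Sum>m\<in>{- int M..int M}. (LINT x:{0..1}|lborel. f x * cis (- (2 * pi * of_int m * x)))) \<longlonglongrightarrow> 0"
  proof (rule fourier_series_at_zero[where C = SK])
    show "norm (f x) \<le> SK * x" if "x \<in> {0..1}" for x using Hlip[of x 0] that by (simp add: f_def)
    show "norm (f x) \<le> SK * (1 - x)" if "x \<in> {0..1}" for x using Hlip[of x 1] that by (simp add: f_def H01)
  qed (rule fm)
  define hh where "hh m = (\<integral>x. h x * cis (- (2 * pi * of_int m * x)) \<partial>lborel)" for m :: int
  have main: "(LINT x:{0..1}|lborel. H x * cis (- (2 * pi * of_int m * x))) = hh m" for m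
  proof -
    define e where "e x = cis (- (2 * pi * real_of_int m * x))" for x
    have em [measurable]: "e \<in> borel_measurable borel" unfolding e_def by measurable
    have ep: "e (x + of_int n) = e x" for x n
    proof -
      have "e (x + of_int n) = cis (2 * pi * of_int (- m * n)) * e x"
        by (simp add: e_def cis_mult algebra_simps)
      also have "cis (2 * pi * of_int (- m * n)) = 1" by (rule cis_multiple_2pi) simp
      finally show ?thesis by simp
    qed
    have l1: "(\<lambda>N. LINT x:{0..1}|lborel. HN N x * e x) \<longlonglongrightarrow> (LINT x:{0..1}|lborel. H x * e x)"
      unfolding set_lebesgue_integral_def
    proof (rule integral_dominated_convergence[where w = "\<lambda>x::real. SK * indicat_real {0..1} x"])
      have "(\<lambda>x. (indicat_real {0..1} x *\<^sub>R H x) * e x) \<in> borel_measurable lborel" by measurable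
      then show "(\<lambda>x. indicat_real {0..1} x *\<^sub>R (H x * e x)) \<in> borel_measurable lborel"
        by (simp add: scaleR_conv_of_real mult.assoc)
      show "integrable lborel (\<lambda>x::real. SK * indicat_real {0..1} x)"
        by (intro integrable_mult_right integrable_real_indicator) auto
      show "AE x in lborel. (\<lambda>N. indicat_real {0..1} x *\<^sub>R (HN N x * e x)) \<longlonglongrightarrow> indicat_real {0..1} x *\<^sub>R (H x * e x)"
      proof (rule AE_I2)
        fix x show "(\<lambda>N. indicat_real {0..1} x *\<^sub>R (HN N x * e x)) \<longlonglongrightarrow> indicat_real {0..1} x *\<^sub>R (H x * e x)"
          using HNlim[of x] by (cases "x \<in> {0..1}") (auto intro!: tendsto_intros)
      qed
      show "AE x in lborel. norm (indicat_real {0..1} x *\<^sub>R (HN N x * e x)) \<le> SK * indicat_real {0..1} x" for N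
        using HNb by (auto simp: indicator_def norm_mult e_def)
    qed measurable
    \<comment> \<open>Unfolding: the translates of the half-open interval [0, 1) by the integers
      from \<open>- N\<close> to \<open>N\<close> tile [- N, N + 1). The closed interval is replaced
      by the half-open one off a null set.\<close>
    have HNint: "(LINT x:{0..1}|lborel. HN N x * e x) = (\<integral>y. indicat_real {- real N..<real N + 1} y *\<^sub>R (h y * e y) \<partial>lborel)" for N
    proof -
      have he: "integrable lborel (\<lambda>x. h x * e x)"
        by (rule Bochner_Integration.integrable_bound[OF hi]) (auto simp: norm_mult e_def)
      have "AE x in lborel. x \<noteq> (1::real)" by (rule AE_lborel_singleton)
      then have "(LINT x:{0..1}|lborel. HN N x * e x) = (\<integral>x. indicat_real {0..<1} x *\<^sub>R (HN N x * e x) \<partial>lborel)"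
        unfolding set_lebesgue_integral_def
        by (intro integral_cong_AE) (measurable, auto simp: indicator_def elim!: eventually_mono)
      also have "\<dots> = (\<integral>x. (\<Sum>n\<in>{- int N..int N}. indicat_real {0..<1} x *\<^sub>R (h (x + of_int n) * e (x + of_int n))) \<partial>lborel)"
        by (simp add: HN_def ep sum_distrib_right scaleR_sum_right)
      also have "\<dots> = (\<Sum>n\<in>{- int N..int N}. \<integral>x. indicat_real {0..<1} x *\<^sub>R (h (x + of_int n) * e (x + of_int n)) \<partial>lborel)"
      proof (rule Bochner_Integration.integral_sum)
        fix n :: int
        have "integrable lborel (\<lambda>x. h (x + of_int n) * e (x + of_int n))"
          using lborel_integrable_real_affine[OF he, of 1 "of_int n"] by (simp add: add.commute)
        then show "integrable lborel (\<lambda>x. indicat_real {0..<1} x *\<^sub>R (h (x + of_int n) * e (x + of_int n)))"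
          by (intro integrable_mult_indicator) auto
      qed
      also have "\<dots> = (\<Sum>n\<in>{- int N..int N}. \<integral>y. indicat_real {of_int n..<of_int n + 1} y *\<^sub>R (h y * e y) \<partial>lborel)"
      proof (rule sum.cong[OF refl])
        fix n :: int
        have "indicat_real {of_int n..<of_int n + 1} (of_int n + 1 * x) = indicat_real {0..<1} x" for x :: real
          by (auto simp: indicator_def)
        then show "(\<integral>x. indicat_real {0..<1} x *\<^sub>R (h (x + of_int n) * e (x + of_int n)) \<partial>lborel) = (\<integral>y. indicat_real {of_int n..<of_int n + 1} y *\<^sub>R (h y * e y) \<partial>lborel)"
          using lborel_integral_real_affine[of 1 "\<lambda>y. indicat_real {of_int n..<of_int n + 1} y *\<^sub>R (h y * e y)" "of_int n"]
          by (simp add: add.commute)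
      qed
      also have "\<dots> = (\<integral>y. (\<Sum>n\<in>{- int N..int N}. indicat_real {of_int n..<of_int n + 1} y *\<^sub>R (h y * e y)) \<partial>lborel)"
        by (intro Bochner_Integration.integral_sum[symmetric] integrable_mult_indicator he) auto
      also have "(\<lambda>y. \<Sum>n\<in>{- int N..int N}. indicat_real {of_int n..<of_int n + 1} y *\<^sub>R (h y * e y)) = (\<lambda>y. indicat_real {- real N..<real N + 1} y *\<^sub>R (h y * e y))"
      proof (intro ext)
        fix y :: real
        have "indicat_real {of_int n..<of_int n + 1} y = (if n = \<lfloor>y\<rfloor> then 1 else 0)" for n
          by (auto simp: indicator_def floor_eq_iff floor_unique)
        then have "(\<Sum>n\<in>{- int N..int N}. indicat_real {of_int n..<of_int n + 1} y) = (if \<lfloor>y\<rfloor> \<in> {- int N..int N} then 1 else 0)"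
          by simp
        also have "\<dots> = indicat_real {- real N..<real N + 1} y"
          by (auto simp: indicator_def le_floor_iff floor_le_iff)
        finally show "(\<Sum>n\<in>{- int N..int N}. indicat_real {of_int n..<of_int n + 1} y *\<^sub>R (h y * e y)) = indicat_real {- real N..<real N + 1} y *\<^sub>R (h y * e y)"
          by (simp add: scaleR_sum_left[symmetric])
      qed
      finally show ?thesis .
    qed
    have l2: "(\<lambda>N. \<integral>y. indicat_real {- real N..<real N + 1} y *\<^sub>R (h y * e y) \<partial>lborel) \<longlonglongrightarrow> (\<integral>y. h y * e y \<partial>lborel)"
    proof (rule integral_dominated_convergence[where w = "\<lambda>y. norm (h y)"])
      show "AE y in lborel. (\<lambda>N. indicat_real {- real N..<real N + 1} y *\<^sub>R (h y * e y)) \<longlonglongrightarrow> h y * e y"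
      proof (rule AE_I2)
        fix y :: real
        obtain N0 :: nat where N0: "\<bar>y\<bar> \<le> real N0" using real_arch_simple by blast
        have "\<forall>\<^sub>F N in sequentially. indicat_real {- real N..<real N + 1} y *\<^sub>R (h y * e y) = h y * e y"
          using eventually_ge_at_top[of N0]
        proof eventually_elim
          case (elim N)
          then have "\<bar>y\<bar> \<le> real N" using N0 by linarith
          then show ?case by (auto simp: indicator_def)
        qed
        then show "(\<lambda>N. indicat_real {- real N..<real N + 1} y *\<^sub>R (h y * e y)) \<longlonglongrightarrow> h y * e y"
          by (rule tendsto_eventually)
      qed
      show "AE y in lborel. norm (indicat_real {- real N..<real N + 1} y *\<^sub>R (h y * e y)) \<le> norm (h y)" for N
        by (auto simp: indicator_def norm_mult e_def)
    qed (use hi in auto)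
    show ?thesis using LIMSEQ_unique[OF l1[unfolded HNint] l2] by (simp add: hh_def e_def)
  qed
  have "(LINT x:{0..1}|lborel. f x * cis (- (2 * pi * of_int m * x))) = hh m - (if m = 0 then H 0 else 0)" for m
  proof -
    have b1: "norm (H x) \<le> SK" if "x \<in> {0..1}" for x
      by (rule Lim_bounded[OF tendsto_norm[OF HNlim[OF that]]]) (use HNb[OF that] in auto)
    have i1: "set_integrable lborel {0..1} (\<lambda>x. H x * cis (- (2 * pi * of_int m * x)))"
    proof -
      have "set_integrable lborel {0..1} (\<lambda>x. (indicat_real {0..1} x *\<^sub>R H x) * cis (- (2 * pi * of_int m * x)))"
        using b1 by (intro set_integrable_unit_interval_bounded[where K = SK]) (measurable, auto simp: norm_mult)
      then show ?thesis by (rule set_integrable_cong[THEN iffD1, rotated -1]) auto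
    qed
    have i2: "set_integrable lborel {0..1} (\<lambda>x. H 0 * cis (- (2 * pi * of_int m * x)))"
      by (intro borel_integrable_atLeastAtMost' continuous_intros)
    have "(LINT x:{0..1}|lborel. f x * cis (- (2 * pi * of_int m * x))) = (LINT x:{0..1}|lborel. H x * cis (- (2 * pi * of_int m * x)) - H 0 * cis (- (2 * pi * of_int m * x)))"
      by (rule set_lebesgue_integral_cong) (auto simp: f_def left_diff_distrib)
    also have "\<dots> = hh m - (LINT x:{0..1}|lborel. H 0 * cis (- (2 * pi * of_int m * x)))"
      by (simp only: set_integral_diff(2)[OF i1 i2] main)
    also have "(LINT x:{0..1}|lborel. H 0 * cis (- (2 * pi * of_int m * x))) = H 0 * (LINT x:{0..1}|lborel. cis (2 * pi * of_int (- m) * x))"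
      by (subst set_integral_mult_right) simp
    finally show ?thesis using cis_integral_period[of "-m"] by simp
  qed
  then have "(\<lambda>M. (\<Sum>m\<in>{- int M..int M}. hh m) - H 0) \<longlonglongrightarrow> 0" using lim by (simp add: sum_subtractf)
  then have "(\<lambda>M. (\<Sum>m\<in>{- int M..int M}. hh m) - H 0 + H 0) \<longlonglongrightarrow> 0 + H 0" by (intro tendsto_intros)
  then show "(\<lambda>M. \<Sum>m\<in>{- int M..int M}. (\<integral>x. h x * cis (- (2 * pi * of_int m * x)) \<partial>lborel)) \<longlonglongrightarrow> (\<Sum>\<^sub>\<infinity>n\<in>UNIV. h (of_int n))"
    by (simp add: hh_def H_def)
qed

lemma FTC_whole_line:
  fixes F f :: "real \<Rightarrow> complex"
  assumes d: "\<And>x. (F has_vector_derivative f x) (at x)" and c: "continuous_on UNIV f"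
    and i: "integrable lborel f" and l: "(F \<longlongrightarrow> 0) at_top" "(F \<longlongrightarrow> 0) at_bot"
  shows "(\<integral>x. f x \<partial>lborel) = 0"
proof -
  have "(LBINT x=-\<infinity>..\<infinity>. f x) = 0 - 0"
  proof (rule interval_integral_FTC_integrable[where F = F])
    show "((F \<circ> real_of_ereal) \<longlongrightarrow> 0) (at_right (- \<infinity>))" "((F \<circ> real_of_ereal) \<longlongrightarrow> 0) (at_left \<infinity>)"
      unfolding ereal_tendsto_simps using l by auto
    show "set_integrable lborel (einterval (- \<infinity>) \<infinity>) f" using i by (simp add: set_integrable_def)
  qed (use d c in \<open>auto simp: continuous_on_eq_continuous_within\<close>)
  then show ?thesis by (simp add: interval_lebesgue_integral_def set_lebesgue_integral_def)
qed

subsection \<open>Theta series and L-functions of quadratic characters\<close>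

lemma square_times_gaussian_bounded:
  fixes c u :: real
  assumes "c > 0" "u \<ge> 0"
  shows "(1 + u)\<^sup>2 * exp (- c * u) \<le> 2 * exp c / c\<^sup>2"
proof -
  have "(c * (1 + u)) ^ 2 /\<^sub>R fact 2 \<le> exp (c * (1 + u))"
    unfolding exp_def using assms
    by (intro order_trans[OF _ sum_le_suminf[where I = "{2}"]]) (auto simp: summable_exp)
  have "c\<^sup>2 * (1 + u)\<^sup>2 / 2 \<le> exp c * exp (c * u)"
  proof -
    have "exp (c * (1 + u)) = exp c * exp (c * u)" by (simp add: exp_add[symmetric] algebra_simps)
    moreover have "(c * (1 + u))\<^sup>2 /\<^sub>R fact 2 = c\<^sup>2 * (1 + u)\<^sup>2 / 2" by (simp add: power_mult_distrib)
    ultimately show ?thesis using \<open>(c * (1 + u)) ^ 2 /\<^sub>R fact 2 \<le> exp (c * (1 + u))\<close>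
      by metis
  qed
  then have "c\<^sup>2 * (1 + u)\<^sup>2 \<le> 2 * (exp c * exp (c * u))" by simp
  then have "c\<^sup>2 * (1 + u)\<^sup>2 * exp (- c * u) \<le> 2 * (exp c * exp (c * u)) * exp (- c * u)"
    by (intro mult_right_mono) auto
  also have "\<dots> = 2 * exp c" by (simp add: exp_minus)
  finally show ?thesis using assms by (simp add: field_simps)
qed

lemma has_sum_finite_sum:
  fixes f :: "'a \<Rightarrow> 'b \<Rightarrow> complex"
  assumes "finite A" "\<And>a. a \<in> A \<Longrightarrow> (f a has_sum S a) B"
  shows "((\<lambda>n. \<Sum>a\<in>A. f a n) has_sum (\<Sum>a\<in>A. S a)) B"
  using assms by (induction A rule: finite_induct) (auto intro: has_sum_add)

text \<open>Puts Gaussians with weights up to the second power into the form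
  \<open>C / (1 + y\<^sup>2)\<close>, which is the hypothesis of Poisson summation and a summable
  majorant.\<close>

lemma power_times_gaussian_le:
  fixes c y :: real and j :: nat
  assumes "c > 0" "j \<le> 2"
  shows "\<bar>y\<bar> ^ j * exp (- c * y\<^sup>2) \<le> 2 * exp c / c\<^sup>2 / (1 + y\<^sup>2)"
proof -
  have "\<bar>y\<bar> ^ j \<le> 1 + y\<^sup>2"
  proof -
    consider "j = 0" | "j = 1" | "j = 2" using assms(2) by linarith
    then show ?thesis
    proof cases
      case 2
      have "0 \<le> (\<bar>y\<bar> - 1)\<^sup>2 + \<bar>y\<bar>" by simp
      then show ?thesis using 2 by (simp add: power2_diff)
    qed simp_all
  qed
  moreover have p: "1 + y\<^sup>2 > 0" by (simp add: add_pos_nonneg)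
  ultimately have "\<bar>y\<bar> ^ j * exp (- c * y\<^sup>2) \<le> (1 + y\<^sup>2) * exp (- c * y\<^sup>2)" by (intro mult_right_mono) auto
  also have "\<dots> = (1 + y\<^sup>2)\<^sup>2 * exp (- c * y\<^sup>2) / (1 + y\<^sup>2)" using p by (simp add: power2_eq_square)
  also have "\<dots> \<le> 2 * exp c / c\<^sup>2 / (1 + y\<^sup>2)"
    using p by (intro divide_right_mono square_times_gaussian_bounded assms) auto
  finally show ?thesis .
qed

text \<open>For \<open>\<iota> = 1\<close> the derivative of the Gaussian times the character
  integrates to 0 over the line. This expresses the first moment by the transform of the plain
  Gaussian.\<close>

lemma gaussian_fourier_moment:
  fixes \<iota> :: nat and T \<xi> :: real
  assumes T: "T > 0" and \<iota>: "\<iota> \<le> 1"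
  shows "(\<integral>y. of_real (y ^ \<iota> * exp (- pi * y\<^sup>2 * T)) * cis (- (2 * pi * \<xi> * y)) \<partial>lborel)
     = (- \<i> * of_real \<xi> / of_real T) ^ \<iota> * of_real (exp (- pi * \<xi>\<^sup>2 / T) / sqrt T)"
proof -
  define X where "X = - 2 * pi * \<xi>"
  have X2: "- (X\<^sup>2) / (4 * pi * T) = - pi * \<xi>\<^sup>2 / T"
    by (simp add: X_def power_mult_distrib power2_eq_square)
  have G: "(\<integral>y. of_real (exp (- pi * y\<^sup>2 * T)) * cis (X * y) \<partial>lborel) = of_real (exp (- pi * \<xi>\<^sup>2 / T) / sqrt T)"
    using gaussian_fourier_scaled(1)[OF T, of X] unfolding X2 .
  consider "\<iota> = 0" | "\<iota> = 1" using \<iota> by linarith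
  then show ?thesis
  proof cases
    case 1 then show ?thesis using G by (simp add: X_def)
  next
    case 2
    define F where "F y = of_real (exp (- pi * y\<^sup>2 * T)) * cis (X * y)" for y
    define f where "f y = - (2 * pi * T) * (of_real (y * exp (- pi * y\<^sup>2 * T)) * cis (X * y)) + \<i> * X * F y" for y
    have dF: "(F has_vector_derivative f y) (at y)" for y
    proof -
      have "((\<lambda>z. exp (- of_real pi * z\<^sup>2 * of_real T) * exp (\<i> * (of_real X * z))) has_field_derivative
         (- (2 * pi * T) * (of_real y * exp (- of_real pi * (of_real y)\<^sup>2 * of_real T) * exp (\<i> * (of_real X * of_real y)))
           + \<i> * X * (exp (- of_real pi * (of_real y)\<^sup>2 * of_real T) * exp (\<i> * (of_real X * of_real y))))) (at (complex_of_real y))"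
        by (auto intro!: derivative_eq_intros simp: algebra_simps)
      moreover have "exp (- (of_real pi * (of_real y)\<^sup>2 * of_real T)) = complex_of_real (exp (- (pi * y\<^sup>2 * T)))" for y
        using exp_of_real[of "- (pi * y\<^sup>2 * T)", where 'a = complex] by simp
      ultimately show ?thesis using has_vector_derivative_real_field
        by (fastforce simp: F_def[abs_def] f_def cis_conv_exp)
    qed
    have c: "continuous_on UNIV f" unfolding f_def F_def by (intro continuous_intros)
    have i1: "integrable lborel (\<lambda>y. of_real (y * exp (- pi * y\<^sup>2 * T)) * cis (X * y))"
    proof (rule Bochner_Integration.integrable_bound[OF integrable_inverse_square[of "2 * exp (pi * T) / (pi * T)\<^sup>2"]])
      have "\<bar>y\<bar> ^ 1 * exp (- (pi * T) * y\<^sup>2) \<le> 2 * exp (pi * T) / (pi * T)\<^sup>2 / (1 + y\<^sup>2)" for y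
        using T by (intro power_times_gaussian_le) auto
      then show "AE y in lborel. norm (of_real (y * exp (- pi * y\<^sup>2 * T)) * cis (X * y)) \<le> norm (2 * exp (pi * T) / (pi * T)\<^sup>2 / (1 + y\<^sup>2))"
        by (intro AE_I2) (simp add: norm_mult mult_ac abs_mult)
    qed measurable
    have i2: "integrable lborel F"
      unfolding F_def by (rule Bochner_Integration.integrable_bound[OF gaussian_fourier_scaled(2)[OF T]]) (auto simp: norm_mult)
    have i: "integrable lborel f" unfolding f_def by (intro Bochner_Integration.integrable_add integrable_mult_right i1 i2)
    have "((\<lambda>y. exp (- pi * y\<^sup>2 * T)) \<longlongrightarrow> 0) at_top" "((\<lambda>y. exp (- pi * y\<^sup>2 * T)) \<longlongrightarrow> 0) at_bot"
      using T by real_asymp+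
    then have l: "(F \<longlongrightarrow> 0) at_top" "(F \<longlongrightarrow> 0) at_bot"
      by (auto intro!: tendsto_norm_zero_cancel[of F] simp: F_def norm_mult)
    have "0 = (\<integral>y. f y \<partial>lborel)" using FTC_whole_line[OF dF c i l] by simp
    also have "\<dots> = - (2 * pi * T) * (\<integral>y. of_real (y * exp (- pi * y\<^sup>2 * T)) * cis (X * y) \<partial>lborel) + \<i> * X * (\<integral>y. F y \<partial>lborel)"
      unfolding f_def using i1 i2 by (subst Bochner_Integration.integral_add) (auto simp del: of_real_mult)
    finally have "(2 * pi * T) * (\<integral>y. of_real (y * exp (- pi * y\<^sup>2 * T)) * cis (X * y) \<partial>lborel) = \<i> * X * (\<integral>y. F y \<partial>lborel)"
      by (simp add: algebra_simps)
    moreover have "I = - \<i> * of_real \<xi> / of_real T * G" if "complex_of_real (2 * pi * T) * I = \<i> * of_real X * G" for I G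
    proof -
      have "complex_of_real pi * (2 * of_real T * I) = of_real pi * (- 2 * \<i> * of_real \<xi> * G)"
        using that by (simp add: X_def algebra_simps)
      from this[unfolded mult_cancel_left] have "2 * of_real T * I = - 2 * \<i> * of_real \<xi> * G" by simp
      then show ?thesis using T by (simp add: field_simps)
    qed
    ultimately have "(\<integral>y. of_real (y * exp (- pi * y\<^sup>2 * T)) * cis (X * y) \<partial>lborel) = - \<i> * of_real \<xi> / of_real T * (\<integral>y. F y \<partial>lborel)"
      by (simp only: of_real_mult of_real_numeral)
    then show ?thesis using 2 G by (simp add: F_def X_def)
  qed
qed

text \<open>\<open>D = 1\<close> is allowed: it is the starting point for products of prime discriminants.\<close>
definition quadratic_character :: "int \<Rightarrow> (int \<Rightarrow> int) \<Rightarrow> bool" where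
  "quadratic_character D chi \<longleftrightarrow> D \<noteq> 0 \<and> chi 1 = 1 \<and> (\<forall>a b. chi (a * b) = chi a * chi b) \<and> (\<forall>a. chi (a + \<bar>D\<bar>) = chi a) \<and>
     chi (-1) = sgn D \<and> (\<forall>a. \<bar>chi a\<bar> \<le> 1) \<and>
     (\<forall>n. (\<Sum>a\<in>{0..<\<bar>D\<bar>}. of_int (chi a) * cis (2 * pi * of_int a * of_int n / of_int \<bar>D\<bar>)) = of_int (chi n) * csqrt (of_int D))"

text \<open>\<open>chi 0 = 0\<close> excludes \<bar>D\<bar> = 1, where periodicity would make
  \<open>chi\<close> constantly 1. It removes the constant term of the theta series.\<close>

locale quad_char =
  fixes D :: int and chi :: "int \<Rightarrow> int"
  assumes qc: "quadratic_character D chi" and chi_0: "chi 0 = 0"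
begin

definition q :: real where "q = of_int \<bar>D\<bar>"
definition \<iota> :: nat where "\<iota> = (if D > 0 then 0 else 1)"

lemma D_nz: "D \<noteq> 0" and chi_1: "chi 1 = 1" and chi_mult: "chi (a * b) = chi a * chi b"
  and chi_period: "chi (a + \<bar>D\<bar>) = chi a" and chi_m1: "chi (-1) = sgn D" and chi_le: "\<bar>chi a\<bar> \<le> 1"
  and chi_gauss: "(\<Sum>a\<in>{0..<\<bar>D\<bar>}. of_int (chi a) * cis (2 * pi * of_int a * of_int n / of_int \<bar>D\<bar>)) = of_int (chi n) * csqrt (of_int D)"
  using qc by (auto simp: quadratic_character_def)

lemma q_pos: "q > 0" using D_nz by (simp add: q_def)

lemma iota_le: "\<iota> \<le> 1" by (simp add: \<iota>_def)

lemma chi_uminus: "chi (- n) = sgn D * chi n"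
  using chi_mult[of "-1" n] chi_m1 by simp

lemma chi_period_mult: "chi (a + m * \<bar>D\<bar>) = chi a"
proof -
  have 1: "chi (a + int k * \<bar>D\<bar>) = chi a" for a k
  proof (induction k)
    case (Suc k)
    then show ?case using chi_period[of "a + int k * \<bar>D\<bar>"] by (simp add: algebra_simps)
  qed simp
  show ?thesis
  proof (cases "m \<ge> 0")
    case True then show ?thesis using 1[of a "nat m"] by simp
  next
    case False then show ?thesis using 1[of "a + m * \<bar>D\<bar>" "nat (- m)"] by (simp add: algebra_simps)
  qed
qed

lemma norm_chi_le: "norm (of_int (chi n) :: complex) \<le> 1"
  using chi_le[of n] by (simp flip: of_int_abs)

text \<open>The weight \<open>n ^ \<iota>\<close> makes the term even in \<open>n\<close>; without
  it the series of an odd character would vanish identically.\<close>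

definition theta_term :: "real \<Rightarrow> int \<Rightarrow> complex" where
  "theta_term t n = of_int (chi n) * of_int n ^ \<iota> * of_real (exp (- pi * (of_int n)\<^sup>2 * t / q))"

definition theta :: "real \<Rightarrow> complex" where "theta t = infsum (theta_term t) UNIV"

lemma theta_term_summable:
  assumes "t > 0"
  shows "(\<lambda>n. norm (theta_term t n)) summable_on UNIV"
proof (rule summable_on_comparison_test)
  define c where "c = pi * t / q"
  have c: "c > 0" using assms q_pos by (simp add: c_def)
  show "(\<lambda>n::int. 2 * exp c / c\<^sup>2 / (1 + (real_of_int n)\<^sup>2)) summable_on UNIV"
    by (rule summable_on_int_inverse_square)
  show "norm (theta_term t n) \<le> 2 * exp c / c\<^sup>2 / (1 + (real_of_int n)\<^sup>2)" for n
  proof -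
    have "norm (theta_term t n) \<le> 1 * \<bar>real_of_int n\<bar> ^ \<iota> * exp (- c * (of_int n)\<^sup>2)"
      unfolding theta_term_def norm_mult using norm_chi_le[of n]
      by (intro mult_mono) (auto simp: norm_power c_def mult_ac)
    also have "\<dots> \<le> 2 * exp c / c\<^sup>2 / (1 + (real_of_int n)\<^sup>2)"
      using power_times_gaussian_le[OF c, of \<iota> "of_int n"] iota_le by simp
    finally show ?thesis .
  qed
qed simp

text \<open>Instead of splitting the integers into residue classes, \<open>chi\<close> is expanded
  into additive characters by its Gauss sum. Poisson summation is applied to each twist, and the
  shifted Gaussians reassemble to the theta series at \<open>1 / t\<close>.\<close>

lemma theta_functional_equation:
  assumes t: "t > 0"
  shows "theta t = of_real (t powr (- 1/2 - real \<iota>)) * theta (1 / t)"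
proof -
  define T where "T = t / q"
  have T: "T > 0" using t q_pos by (simp add: T_def)
  define h :: "real \<Rightarrow> complex" where "h y = of_real (y ^ \<iota> * exp (- pi * y\<^sup>2 * T))" for y
  define G where "G \<xi> = (- \<i> * of_real \<xi> / of_real T) ^ \<iota> * of_real (exp (- pi * \<xi>\<^sup>2 / T) / sqrt T)" for \<xi>
  have hG: "(\<integral>y. h y * cis (- (2 * pi * \<xi> * y)) \<partial>lborel) = G \<xi>" for \<xi>
    unfolding h_def G_def by (rule gaussian_fourier_moment[OF T iota_le])
  \<comment> \<open>The additive character of \<open>a\<close> shifts the transform by
    \<open>a / q\<close>. Poisson summation gives only symmetric partial sums; unconditional
    summability on the dual side is supplied by \<open>F\<close> below.\<close>
  have twist: "(\<lambda>M. \<Sum>m\<in>{- int M..int M}. G (of_int m - of_int a / q)) \<longlonglongrightarrow> (\<Sum>\<^sub>\<infinity>n\<in>UNIV. h (of_int n) * cis (2 * pi * of_int a / q * of_int n))"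
    (is ?tw1) and twist_summable: "(\<lambda>n. norm (h (of_int n) * cis (2 * pi * of_int a / q * of_int n))) summable_on UNIV" (is ?tw2)
    if a: "a \<in> {0..<\<bar>D\<bar>}" for a :: int
  proof -
    define b where "b = 2 * pi * of_int a / q"
    have b: "\<bar>b\<bar> \<le> 2 * pi" using a q_pos by (auto simp: b_def q_def abs_mult field_simps intro!: mult_left_mono)
    define c where "c = pi * T"
    have c: "c > 0" using T by (simp add: c_def)
    define B where "B = 2 * exp c / c\<^sup>2"
    have pg: "\<bar>y\<bar> ^ j * exp (- c * y\<^sup>2) \<le> B / (1 + y\<^sup>2)" if "j \<le> 2" for y j
      unfolding B_def by (rule power_times_gaussian_le[OF c that])
    have B0: "B / (1 + y\<^sup>2) \<ge> 0" for y by (simp add: B_def add_nonneg_nonneg)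
    define hh where "hh y = h y * cis (b * y)" for y
    define hh' where "hh' y = (of_nat \<iota> - 2 * of_real c * of_real y ^ (\<iota> + 1) + \<i> * of_real b * of_real y ^ \<iota>) * of_real (exp (- c * y\<^sup>2)) * cis (b * y)" for y
    have d: "(hh has_vector_derivative hh' y) (at y)" for y
    proof -
      consider "\<iota> = 0" | "\<iota> = 1" using iota_le by linarith
      then have "((\<lambda>z. z ^ \<iota> * exp (- of_real c * z\<^sup>2) * exp (\<i> * (of_real b * z))) has_field_derivative
         (of_nat \<iota> - 2 * of_real c * of_real y ^ (\<iota> + 1) + \<i> * of_real b * of_real y ^ \<iota>) * exp (- of_real c * (of_real y)\<^sup>2) * exp (\<i> * (of_real b * of_real y))) (at (complex_of_real y))"
        by cases (auto intro!: derivative_eq_intros simp: algebra_simps power2_eq_square)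
      from has_vector_derivative_real_field[OF this] show ?thesis
        by (simp add: hh_def[abs_def] hh'_def h_def c_def cis_conv_exp exp_of_real[symmetric] mult_ac)
    qed
    define C where "C = (1 + 2 * c + 2 * pi) * B"
    have "norm (hh y) \<le> B / (1 + y\<^sup>2)" for y
      using pg[of \<iota> y] iota_le by (simp add: hh_def h_def norm_mult c_def norm_power mult_ac abs_mult power_abs)
    moreover have "B / (1 + y\<^sup>2) \<le> C / (1 + y\<^sup>2)" for y
    proof -
      have "1 * (B / (1 + y\<^sup>2)) \<le> (1 + 2 * c + 2 * pi) * (B / (1 + y\<^sup>2))"
        using c B0[of y] by (intro mult_right_mono) auto
      then show ?thesis by (simp add: C_def)
    qed
    ultimately have b1: "norm (hh y) \<le> C / (1 + y\<^sup>2)" for y by (meson order_trans)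
    have b2: "norm (hh' y) \<le> C / (1 + y\<^sup>2)" for y
    proof -
      define E where "E = exp (- c * y\<^sup>2)"
      have E: "E > 0" by (simp add: E_def)
      have "norm (hh' y) = norm (of_nat \<iota> - 2 * of_real c * of_real y ^ (\<iota> + 1) + \<i> * of_real b * of_real y ^ \<iota>) * E"
        by (simp add: hh'_def norm_mult E_def)
      also have "\<dots> \<le> (1 + 2 * c * \<bar>y\<bar> ^ (\<iota> + 1) + 2 * pi * \<bar>y\<bar> ^ \<iota>) * E"
      proof (intro mult_right_mono)
        have "norm (of_nat \<iota> - 2 * of_real c * of_real y ^ (\<iota> + 1) + \<i> * of_real b * of_real y ^ \<iota> :: complex) \<le>
          norm (of_nat \<iota> :: complex) + norm (2 * of_real c * of_real y ^ (\<iota> + 1) :: complex) + norm (\<i> * of_real b * of_real y ^ \<iota> :: complex)"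
          by (intro order_trans[OF norm_triangle_ineq] add_right_mono norm_triangle_ineq4)
        also have "\<dots> \<le> 1 + 2 * c * \<bar>y\<bar> ^ (\<iota> + 1) + 2 * pi * \<bar>y\<bar> ^ \<iota>"
          using c b iota_le by (intro add_mono) (auto simp: norm_mult norm_power intro!: mult_right_mono)
        finally show "norm (of_nat \<iota> - 2 * of_real c * of_real y ^ (\<iota> + 1) + \<i> * of_real b * of_real y ^ \<iota> :: complex) \<le> 1 + 2 * c * \<bar>y\<bar> ^ (\<iota> + 1) + 2 * pi * \<bar>y\<bar> ^ \<iota>" .
      qed (use E in simp)
      also have "\<dots> = \<bar>y\<bar> ^ 0 * E + 2 * c * (\<bar>y\<bar> ^ (\<iota> + 1) * E) + 2 * pi * (\<bar>y\<bar> ^ \<iota> * E)"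
        by (simp add: algebra_simps)
      also have "\<dots> \<le> B / (1 + y\<^sup>2) + 2 * c * (B / (1 + y\<^sup>2)) + 2 * pi * (B / (1 + y\<^sup>2))"
        unfolding E_def using c iota_le by (intro add_mono mult_left_mono pg) auto
      also have "\<dots> = C / (1 + y\<^sup>2)" by (simp add: C_def algebra_simps add_divide_distrib)
      finally show ?thesis .
    qed
    note ps = poisson_summation_zero[OF d b1 b2]
    show ?tw2 using ps(2) by (simp add: hh_def b_def)
    have "(\<integral>x. hh x * cis (- (2 * pi * of_int m * x)) \<partial>lborel) = G (of_int m - of_int a / q)" for m :: int
    proof -
      have "hh x * cis (- (2 * pi * of_int m * x)) = h x * cis (- (2 * pi * (of_int m - of_int a / q) * x))" for x
        by (simp add: hh_def b_def mult.assoc cis_mult algebra_simps)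
      then show ?thesis using hG by simp
    qed
    with ps(1) show ?tw1 by (simp add: hh_def b_def)
  qed
  define S where "S = (\<Sum>\<^sub>\<infinity>n\<in>UNIV. of_int (chi n) * h (of_int n))"
  have "theta_term t = (\<lambda>n. of_int (chi n) * h (of_int n))"
    by (auto simp: theta_term_def h_def T_def fun_eq_iff)
  then have St: "theta t = S" by (simp add: theta_def S_def)
  have left: "csqrt (of_int D) * S = (\<Sum>a\<in>{0..<\<bar>D\<bar>}. of_int (chi a) * (\<Sum>\<^sub>\<infinity>n\<in>UNIV. h (of_int n) * cis (2 * pi * of_int a / q * of_int n)))"
  proof -
    have "csqrt (of_int D) * S = (\<Sum>\<^sub>\<infinity>n\<in>UNIV. csqrt (of_int D) * (of_int (chi n) * h (of_int n)))"
      unfolding S_def by (rule infsum_cmult_right'[symmetric])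
    also have "\<dots> = (\<Sum>\<^sub>\<infinity>n\<in>UNIV. \<Sum>a\<in>{0..<\<bar>D\<bar>}. of_int (chi a) * (h (of_int n) * cis (2 * pi * of_int a / q * of_int n)))"
    proof (rule infsum_cong)
      fix n :: int
      have "csqrt (of_int D) * (of_int (chi n) * h (of_int n)) = h (of_int n) * (of_int (chi n) * csqrt (of_int D))" by simp
      also have "\<dots> = (\<Sum>a\<in>{0..<\<bar>D\<bar>}. of_int (chi a) * (h (of_int n) * cis (2 * pi * of_int a / q * of_int n)))"
        unfolding chi_gauss[symmetric] sum_distrib_left by (intro sum.cong) (simp_all add: q_def)
      finally show "csqrt (of_int D) * (of_int (chi n) * h (of_int n)) = (\<Sum>a\<in>{0..<\<bar>D\<bar>}. of_int (chi a) * (h (of_int n) * cis (2 * pi * of_int a / q * of_int n)))" .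
    qed
    also have "\<dots> = (\<Sum>a\<in>{0..<\<bar>D\<bar>}. \<Sum>\<^sub>\<infinity>n\<in>UNIV. of_int (chi a) * (h (of_int n) * cis (2 * pi * of_int a / q * of_int n)))"
    proof (intro infsumI has_sum_finite_sum has_sum_infsum)
      fix a assume "a \<in> {0..<\<bar>D\<bar>}"
      from abs_summable_summable[OF twist_summable[OF this]]
      show "(\<lambda>n. of_int (chi a) * (h (of_int n) * cis (2 * pi * of_int a / q * of_int n))) summable_on UNIV"
        by (rule summable_on_cmult_right)
    qed simp
    finally show ?thesis by (simp add: infsum_cmult_right')
  qed
  \<comment> \<open>All frequencies \<open>m - a / q\<close> are collected as \<open>k / q\<close>
    with \<open>k = m * \<bar>D\<bar> - a\<close>; then \<open>chi a = chi (- k)\<close>.\<close>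
  define F where "F k = of_int (chi (- k)) * G (of_int k / q)" for k :: int
  have Fth: "F k = of_int (sgn D) * (- \<i> / of_real t) ^ \<iota> * of_real (sqrt (q / t)) * theta_term (1 / t) k" for k
  proof -
    have "- \<i> * of_real (of_int k / q) / of_real T = (- \<i> / of_real t) * of_int k"
      using q_pos t by (simp add: T_def field_simps)
    moreover have "- pi * (of_int k / q)\<^sup>2 / T = - pi * (of_int k)\<^sup>2 * (1 / t) / q"
      using q_pos t by (simp add: T_def field_simps power2_eq_square)
    moreover have "1 / sqrt T = sqrt (q / t)" by (simp add: T_def real_sqrt_divide)
    ultimately have "G (of_int k / q) = (- \<i> / of_real t) ^ \<iota> * of_int k ^ \<iota> * of_real (exp (- pi * (of_int k)\<^sup>2 * (1 / t) / q) * sqrt (q / t))"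
      unfolding G_def by (metis (no_types, lifting) divide_inverse inverse_eq_divide power_mult_distrib)
    then show ?thesis by (simp add: F_def theta_term_def chi_uminus)
  qed
  have Fs: "F summable_on UNIV"
    unfolding Fth using theta_term_summable[of "1/t"] t
    by (intro summable_on_cmult_right abs_summable_summable[of "theta_term (1 / t)"]) simp
  have right: "(\<lambda>M. \<Sum>m\<in>{- int M..int M}. \<Sum>a\<in>{0..<\<bar>D\<bar>}. of_int (chi a) * G (of_int m - of_int a / q)) \<longlonglongrightarrow> infsum F UNIV"
  proof -
    have e: "of_int (chi a) * G (of_int m - of_int a / q) = F (m * \<bar>D\<bar> - a)" for a m
    proof -
      have "chi (- (m * \<bar>D\<bar> - a)) = chi a" using chi_period_mult[of a "-m"] by (simp add: algebra_simps)
      moreover have "real_of_int (m * \<bar>D\<bar> - a) / q = of_int m - of_int a / q"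
        using q_pos by (simp add: diff_divide_distrib q_def)
      ultimately show ?thesis by (simp only: F_def)
    qed
    \<comment> \<open>Division with remainder of \<open>- k\<close> by \<bar>D\<bar> has quotient
      \<open>- m\<close> and remainder \<open>a\<close>.\<close>
    have bij: "bij_betw (\<lambda>(m, a). m * \<bar>D\<bar> - a) (UNIV \<times> {0..<\<bar>D\<bar>}) UNIV"
    proof (rule bij_betwI[of _ _ _ "\<lambda>k. (- ((- k) div \<bar>D\<bar>), (- k) mod \<bar>D\<bar>)"])
      show "(\<lambda>k. (- ((- k) div \<bar>D\<bar>), (- k) mod \<bar>D\<bar>)) \<in> UNIV \<rightarrow> UNIV \<times> {0..<\<bar>D\<bar>}" using D_nz by auto
      fix x :: "int \<times> int" assume "x \<in> UNIV \<times> {0..<\<bar>D\<bar>}"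
      then obtain m a where x: "x = (m, a)" "a \<in> {0..<\<bar>D\<bar>}" by auto
      have "- (m * \<bar>D\<bar> - a) = a + (- m) * \<bar>D\<bar>" by simp
      then have "(- (m * \<bar>D\<bar> - a)) div \<bar>D\<bar> = - m \<and> (- (m * \<bar>D\<bar> - a)) mod \<bar>D\<bar> = a"
        using x(2) D_nz by (simp only: div_mult_self1 mod_mult_self1) simp
      then show "(- ((- (case x of (m, a) \<Rightarrow> m * \<bar>D\<bar> - a)) div \<bar>D\<bar>), (- (case x of (m, a) \<Rightarrow> m * \<bar>D\<bar> - a)) mod \<bar>D\<bar>) = x"
        unfolding x by simp
    next
      fix k :: int
      show "(case (- ((- k) div \<bar>D\<bar>), (- k) mod \<bar>D\<bar>) of (m, a) \<Rightarrow> m * \<bar>D\<bar> - a) = k"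
        using div_mult_mod_eq[of "- k" "\<bar>D\<bar>"] unfolding prod.case mult_minus_left by linarith
    qed auto
    have "(F has_sum infsum F UNIV) UNIV" using Fs by simp
    then have "((\<lambda>x. F (case x of (m, a) \<Rightarrow> m * \<bar>D\<bar> - a)) has_sum infsum F UNIV) (UNIV \<times> {0..<\<bar>D\<bar>})"
      by (subst has_sum_reindex_bij_betw[OF bij])
    then have "((\<lambda>m. \<Sum>a\<in>{0..<\<bar>D\<bar>}. F (m * \<bar>D\<bar> - a)) has_sum infsum F UNIV) UNIV"
      by (rule has_sum_Sigma'[where b = "\<lambda>m. \<Sum>a\<in>{0..<\<bar>D\<bar>}. F (m * \<bar>D\<bar> - a)"]) (auto intro!: has_sum_finiteI)
    from has_sum_int_imp_tendsto[OF this] show ?thesis unfolding e .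
  qed
  have "(\<lambda>M. \<Sum>a\<in>{0..<\<bar>D\<bar>}. of_int (chi a) * (\<Sum>m\<in>{- int M..int M}. G (of_int m - of_int a / q))) \<longlonglongrightarrow> csqrt (of_int D) * S"
    unfolding left by (intro tendsto_sum tendsto_mult tendsto_const twist)
  also have "(\<lambda>M. \<Sum>a\<in>{0..<\<bar>D\<bar>}. of_int (chi a) * (\<Sum>m\<in>{- int M..int M}. G (of_int m - of_int a / q)))
     = (\<lambda>M. \<Sum>m\<in>{- int M..int M}. \<Sum>a\<in>{0..<\<bar>D\<bar>}. of_int (chi a) * G (of_int m - of_int a / q))"
    unfolding sum_distrib_left by (rule ext, rule sum.swap)
  finally have "csqrt (of_int D) * S = infsum F UNIV" using right LIMSEQ_unique by blast
  also have "infsum F UNIV = of_int (sgn D) * (- \<i> / of_real t) ^ \<iota> * of_real (sqrt (q / t)) * theta (1 / t)"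
    unfolding Fth theta_def by (rule infsum_cmult_right')
  finally have fe: "csqrt (of_int D) * theta t = of_int (sgn D) * (- \<i> / of_real t) ^ \<iota> * of_real (sqrt (q / t)) * theta (1 / t)"
    unfolding St .
  have "t powr (- 1 / 2) = 1 / sqrt t" using t powr_minus_divide[of t "1/2"] by (simp add: powr_half_sqrt)
  then have sq: "sqrt (q / t) = sqrt q * t powr (- 1 / 2)" by (simp add: real_sqrt_divide)
  \<comment> \<open>The root number is 1: for \<open>D > 0\<close> all signs are trivial, and for
    \<open>D < 0\<close> the product of \<open>sgn D\<close> with \<open>- \<i>\<close> is the
    factor \<i> contained in \<open>csqrt D\<close>.\<close>
  show ?thesis
  proof (cases "D > 0")
    case True
    then have "complex_of_int D = of_real q" by (simp add: q_def)
    then have "csqrt (of_int D) = of_real (sqrt q)" using of_real_sqrt[of q] q_pos by simp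
    then show ?thesis using fe True q_pos by (simp add: \<iota>_def sq)
  next
    case False
    then have D: "D < 0" using D_nz by simp
    then have "complex_of_int D = of_real (- q)" by (simp add: q_def)
    then have csq: "csqrt (of_int D) = \<i> * of_real (sqrt q)"
      using csqrt_of_real_nonpos[of "- q"] q_pos by simp
    have "(\<i> * of_real (sqrt q)) * theta t = (\<i> * of_real (sqrt q)) * (of_real (t powr (- 1/2) / t) * theta (1 / t))"
      using fe D by (simp add: \<iota>_def sq csq mult_ac)
    from this[unfolded mult_cancel_left] have th: "theta t = of_real (t powr (- 1/2) / t) * theta (1 / t)"
      using q_pos by simp
    have pw: "t powr (- 1/2) / t = t powr (- 1/2 - real \<iota>)"
      using D t powr_diff[of t "- 1/2" 1] by (simp add: \<iota>_def)
    show ?thesis unfolding pw[symmetric] by (fact th)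
  qed
qed

text \<open>The term \<open>n = 0\<close> vanishes. For the others
  \<open>n\<^sup>2 + t \<le> 2 n\<^sup>2 t\<close>, so half of the exponent secures summability over
  \<open>n\<close> and the other half yields the decay in \<open>t\<close>; hence the 2 in
  \<open>pi / (2 * q)\<close>.\<close>

lemma theta_decay: "\<exists>A\<ge>0. \<forall>t\<ge>1. norm (theta t) \<le> A * exp (- (pi / (2 * q)) * t)"
proof -
  define c where "c = pi / (2 * q)"
  have c: "c > 0" using q_pos by (simp add: c_def)
  define g where "g n = 2 * exp c / c\<^sup>2 / (1 + (real_of_int n)\<^sup>2)" for n :: int
  have g: "g summable_on UNIV" unfolding g_def by (rule summable_on_int_inverse_square)
  have g0: "g n \<ge> 0" for n by (simp add: g_def add_nonneg_nonneg)
  have "norm (theta t) \<le> infsum g UNIV * exp (- c * t)" if t: "t \<ge> 1" for t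
  proof -
    have b: "norm (theta_term t n) \<le> g n * exp (- c * t)" for n
    proof (cases "n = 0")
      case True then show ?thesis using g0 by (simp add: theta_term_def chi_0)
    next
      case False
      have n2: "(real_of_int n)\<^sup>2 \<ge> 1"
      proof -
        have "\<bar>real_of_int n\<bar> \<ge> 1" using False by linarith
        then show ?thesis by (simp add: abs_le_square_iff[of 1, simplified] power2_eq_square[symmetric])
      qed
      have "0 \<le> ((of_int n)\<^sup>2 - 1) * (t - 1)" using n2 t by simp
      then have "(of_int n)\<^sup>2 + t - 1 \<le> (of_int n)\<^sup>2 * t" by (simp add: algebra_simps)
      then have "(of_int n)\<^sup>2 + t \<le> 2 * ((of_int n)\<^sup>2 * t)" using n2 t by linarith
      then have "c * ((of_int n)\<^sup>2 + t) \<le> c * (2 * ((of_int n)\<^sup>2 * t))" using c by (intro mult_left_mono) auto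
      also have "\<dots> = pi * (of_int n)\<^sup>2 * t / q" using q_pos by (simp add: c_def field_simps)
      finally have e: "exp (- pi * (of_int n)\<^sup>2 * t / q) \<le> exp (- c * (of_int n)\<^sup>2) * exp (- c * t)"
        by (simp add: exp_add[symmetric] algebra_simps)
      have "norm (theta_term t n) \<le> 1 * \<bar>real_of_int n\<bar> ^ \<iota> * (exp (- c * (of_int n)\<^sup>2) * exp (- c * t))"
        unfolding theta_term_def norm_mult using norm_chi_le[of n] e
        by (intro mult_mono) (auto simp: norm_power)
      also have "\<dots> = (\<bar>real_of_int n\<bar> ^ \<iota> * exp (- c * (of_int n)\<^sup>2)) * exp (- c * t)" by simp
      also have "\<dots> \<le> g n * exp (- c * t)"
        unfolding g_def using power_times_gaussian_le[OF c, of \<iota> "of_int n"] iota_le by (intro mult_right_mono) auto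
      finally show ?thesis .
    qed
    have "norm (theta t) \<le> (\<Sum>\<^sub>\<infinity>n\<in>UNIV. norm (theta_term t n))"
      unfolding theta_def using t by (intro norm_infsum_bound theta_term_summable) simp
    also have "\<dots> \<le> (\<Sum>\<^sub>\<infinity>n\<in>UNIV. g n * exp (- c * t))"
      using t by (intro infsum_mono theta_term_summable summable_on_cmult_left g b) simp
    finally show ?thesis by (simp add: infsum_cmult_left')
  qed
  moreover have "infsum g UNIV \<ge> 0" by (intro infsum_nonneg g0)
  ultimately show ?thesis unfolding c_def by blast
qed

end

section \<open>Gamma integrals, the completed L-function and its Dirichlet series\<close>

lemma of_real_powr:
  assumes "x > 0"
  shows "complex_of_real x powr w = exp (w * of_real (ln x))"
  using assms by (simp add: powr_def Ln_of_real)

lemma norm_of_real_powr: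
  assumes "x > 0"
  shows "norm (complex_of_real x powr w) = x powr Re w"
  using assms by (simp add: of_real_powr norm_exp_eq_Re powr_def)

lemma gamma_integral_exp:
  fixes z :: complex and a :: real
  assumes z: "Re z > 0" and a: "a > 0"
  shows "integrable lborel (\<lambda>v. exp (z * of_real v) * of_real (exp (- a * exp v)))"
    and "(\<integral>v. exp (z * of_real v) * of_real (exp (- a * exp v)) \<partial>lborel) = Gamma z * of_real a powr (- z)"
proof -
  have int: "integrable lborel (\<lambda>v. exp (z * of_real v) * of_real (exp (- a * exp v)))" if a: "a > 0" for a :: real
  proof (rule Bochner_Integration.integrable_bound)
    \<comment> \<open>On the left half-line the exponential alone is integrable; on the right
      \<open>exp v \<ge> cosh v\<close> gives doubly exponential decay.\<close>
    show "integrable lborel (\<lambda>v. norm (if v < 0 then exp (z * of_real v) else 0) + exp (Re z * \<bar>v\<bar>) * exp (- a * cosh v))"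
      by (intro Bochner_Integration.integrable_add integrable_norm exp_lower_halfline(1) z integrable_exp_cosh a)
    show "AE v in lborel. norm (exp (z * of_real v) * of_real (exp (- a * exp v))) \<le>
       norm (norm (if v < 0 then exp (z * of_real v) else 0) + exp (Re z * \<bar>v\<bar>) * exp (- a * cosh v))"
    proof (rule AE_I2)
      fix v :: real
      have "norm (exp (z * of_real v) * of_real (exp (- a * exp v))) = exp (Re z * v) * exp (- a * exp v)"
        by (simp add: norm_mult norm_exp_eq_Re)
      also have "\<dots> \<le> norm (if v < 0 then exp (z * of_real v) else 0) + exp (Re z * \<bar>v\<bar>) * exp (- a * cosh v)"
      proof (cases "v < 0")
        case True
        have "exp (- a * exp v) \<le> 1" using a by simp
        then have "exp (Re z * v) * exp (- a * exp v) \<le> exp (Re z * v) * 1" by (intro mult_left_mono) auto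
        then show ?thesis using True by (simp add: norm_exp_eq_Re add_increasing2)
      next
        case False
        have "cosh v \<le> exp v" using False by (simp add: cosh_def)
        then have "a * cosh v \<le> a * exp v" using a by (intro mult_left_mono) auto
        then show ?thesis using False by simp
      qed
      finally show "norm (exp (z * of_real v) * of_real (exp (- a * exp v))) \<le>
         norm (norm (if v < 0 then exp (z * of_real v) else 0) + exp (Re z * \<bar>v\<bar>) * exp (- a * cosh v))" by simp
    qed
  qed measurable
  show "integrable lborel (\<lambda>v. exp (z * of_real v) * of_real (exp (- a * exp v)))" by (rule int[OF a])
  define f where "f t = complex_of_real t powr (z - 1) / of_real (exp t)" for t
  have f: "exp v *\<^sub>R f (exp v) = exp (z * of_real v) * of_real (exp (- 1 * exp v))" for v
  proof -
    have "complex_of_real (exp v) powr (z - 1) = exp ((z - 1) * of_real v)"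
      by (simp add: powr_def Ln_of_real)
    moreover have "complex_of_real (exp v) = exp (of_real v)" by (simp add: exp_of_real)
    ultimately show ?thesis
      by (simp add: f_def scaleR_conv_of_real left_diff_distrib exp_diff exp_minus divide_inverse)
  qed
  have e: "einterval 0 \<infinity> = {0<..}" "einterval (-\<infinity>) \<infinity> = UNIV" by (auto simp: einterval_def)
  have si: "set_integrable lborel (einterval (- \<infinity>) \<infinity>) (\<lambda>v. exp v *\<^sub>R f (exp v))"
    unfolding f e set_integrable_def using int[of 1] by simp
  have sub: "set_integrable lborel (einterval 0 \<infinity>) f"
    "(LBINT t:einterval 0 \<infinity>. f t) = (LBINT v:einterval (-\<infinity>) \<infinity>. exp v *\<^sub>R f (exp v))"
  proof -
    have c: "isCont f x" if "x > 0" for x unfolding f_def using that by (intro continuous_intros) auto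
    have l: "((ereal \<circ> exp \<circ> real_of_ereal) \<longlongrightarrow> 0) (at_right (- \<infinity>))"
      unfolding zero_ereal_def ereal_tendsto_simps by (rule exp_at_bot)
    show "set_integrable lborel (einterval 0 \<infinity>) f"
      by (rule exp_substitution_einterval(1)[OF c _ _ l si]) auto
    show "(LBINT t:einterval 0 \<infinity>. f t) = (LBINT v:einterval (-\<infinity>) \<infinity>. exp v *\<^sub>R f (exp v))"
      by (rule exp_substitution_einterval(2)[OF c _ _ l si]) auto
  qed
  have "(LBINT t:{0<..}. f t) = Gamma z"
    using set_borel_integral_eq_integral(2)[OF sub(1)] Gamma_integral_complex'[OF z] unfolding e f_def
    by (simp add: integral_unique)
  then have G1: "(\<integral>v. exp (z * of_real v) * of_real (exp (- 1 * exp v)) \<partial>lborel) = Gamma z"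
    using sub(2) unfolding e f by (simp add: set_lebesgue_integral_def)
  have "(\<integral>v. exp (z * of_real v) * of_real (exp (- a * exp v)) \<partial>lborel) =
      (\<integral>v. exp (z * of_real (- ln a + 1 * v)) * of_real (exp (- a * exp (- ln a + 1 * v))) \<partial>lborel)"
    using lborel_integral_real_affine[of 1 "\<lambda>v. exp (z * of_real v) * of_real (exp (- a * exp v))" "- ln a"] by simp
  also have "\<dots> = (\<integral>v. of_real a powr (- z) * (exp (z * of_real v) * of_real (exp (- 1 * exp v))) \<partial>lborel)"
  proof (intro Bochner_Integration.integral_cong refl)
    fix v :: real
    have "a * exp (- ln a + 1 * v) = exp v" using a by (simp add: exp_diff)
    moreover have "exp (z * of_real (- ln a + 1 * v)) = of_real a powr (- z) * exp (z * of_real v)"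
      using a by (simp add: powr_def Ln_of_real exp_add[symmetric] algebra_simps)
    ultimately show "exp (z * of_real (- ln a + 1 * v)) * of_real (exp (- a * exp (- ln a + 1 * v))) =
       of_real a powr (- z) * (exp (z * of_real v) * of_real (exp (- 1 * exp v)))"
      by (simp only: mult_minus_left mult_1 mult.assoc)
  qed
  also have "\<dots> = of_real a powr (- z) * Gamma z" unfolding integral_mult_right_zero G1 ..
  finally show "(\<integral>v. exp (z * of_real v) * of_real (exp (- a * exp v)) \<partial>lborel) = Gamma z * of_real a powr (- z)"
    by (simp add: mult.commute)
qed

context quad_char begin

text \<open>The power of \<open>t = exp v\<close> is half the weight in the functional equation of
  theta, which thereby becomes evenness in \<open>v\<close>.\<close>

definition psi :: "real \<Rightarrow> complex" where
  "psi v = of_real (exp ((1/4 + real \<iota> / 2) * v)) * theta (exp v)"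

lemma psi_even: "psi (- v) = psi v"
proof -
  have "theta (exp (- v)) = of_real (exp ((1/2 + real \<iota>) * v)) * theta (exp v)"
  proof -
    have "exp (- v) powr (- 1/2 - real \<iota>) = exp ((1/2 + real \<iota>) * v)"
      by (simp add: powr_def algebra_simps)
    moreover have "1 / exp (- v) = exp v" using exp_minus[of "- v"] by (simp only: minus_minus inverse_eq_divide)
    ultimately show ?thesis using theta_functional_equation[of "exp (- v)"] by simp
  qed
  moreover have "exp ((1/4 + real \<iota> / 2) * (- v)) * exp ((1/2 + real \<iota>) * v) = exp ((1/4 + real \<iota> / 2) * v)"
    by (simp add: exp_add[symmetric] algebra_simps)
  ultimately show ?thesis unfolding psi_def by (metis (no_types, lifting) mult.assoc of_real_mult)
qed

lemma theta_term_uminus: "theta_term t (- n) = theta_term t n"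
  using D_nz by (auto simp: theta_term_def chi_uminus \<iota>_def)

lemma theta_sums:
  assumes "t > 0"
  shows "(\<lambda>n. 2 * theta_term t (int (Suc n))) sums theta t"
    and "summable (\<lambda>n. norm (theta_term t (int (Suc n))))"
proof -
  have hs: "(theta_term t has_sum theta t) UNIV"
    unfolding theta_def using abs_summable_summable[OF theta_term_summable[OF assms]] by simp
  have e: "(\<Sum>n\<in>{- int N..int N}. theta_term t n) = (\<Sum>n<N. 2 * theta_term t (int (Suc n)))" for N
  proof (induction N)
    case 0 then show ?case by (simp add: theta_term_def chi_0)
  next
    case (Suc N)
    have "{- int (Suc N)..int (Suc N)} = insert (- int (Suc N)) (insert (int (Suc N)) {- int N..int N})" by auto
    then show ?case using Suc by (simp add: theta_term_uminus del: of_nat_Suc)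
  qed
  show "(\<lambda>n. 2 * theta_term t (int (Suc n))) sums theta t"
    using has_sum_int_imp_tendsto[OF hs] unfolding e sums_def .
  have "(\<lambda>n. norm (theta_term t n)) summable_on range (\<lambda>n. int (Suc n))"
    using theta_term_summable[OF assms] by (rule summable_on_subset_banach) auto
  then have "(\<lambda>n. norm (theta_term t (int (Suc n)))) summable_on UNIV"
    by (subst (asm) summable_on_reindex) (auto simp: inj_on_def o_def)
  then show "summable (\<lambda>n. norm (theta_term t (int (Suc n))))"
    by (rule summable_on_imp_summable)
qed

lemma psi_measurable [measurable]: "psi \<in> borel_measurable borel"
proof (rule borel_measurable_LIMSEQ_metric)
  fix v
  show "(\<lambda>N. of_real (exp ((1/4 + real \<iota> / 2) * v)) * (\<Sum>n<N. 2 * theta_term (exp v) (int (Suc n)))) \<longlonglongrightarrow> psi v"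
    unfolding psi_def using theta_sums(1)[of "exp v"] unfolding sums_def by (intro tendsto_intros) simp
next
  fix N show "(\<lambda>v. of_real (exp ((1/4 + real \<iota> / 2) * v)) * (\<Sum>n<N. 2 * theta_term (exp v) (int (Suc n)))) \<in> borel_measurable borel"
    unfolding theta_term_def by measurable
qed

text \<open>\<open>theta_decay\<close> covers \<open>v \<ge> 0\<close> and evenness supplies the
  other half-line. Hence the Mellin integral converges for every \<open>s\<close> without being
  split at \<open>t = 1\<close>.\<close>

lemma psi_integrable: "integrable lborel (\<lambda>v. exp (c * \<bar>v\<bar>) * norm (psi v))"
proof -
  obtain A where A: "A \<ge> 0" "\<And>t. t \<ge> 1 \<Longrightarrow> norm (theta t) \<le> A * exp (- (pi / (2 * q)) * t)"
    using theta_decay by blast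
  define d where "d = pi / (2 * q)"
  have d: "d > 0" using q_pos by (simp add: d_def)
  have 1: "norm (psi v) \<le> exp \<bar>v\<bar> * (A * exp (- d * cosh v))" if "v \<ge> 0" for v
  proof -
    have "norm (psi v) = exp ((1/4 + real \<iota> / 2) * v) * norm (theta (exp v))"
      by (simp add: psi_def norm_mult)
    also have "\<dots> \<le> exp \<bar>v\<bar> * (A * exp (- d * exp v))"
    proof (intro mult_mono)
      have "(1/4 + real \<iota> / 2) * v \<le> 1 * v" using iota_le that by (intro mult_right_mono) auto
      then show "exp ((1/4 + real \<iota> / 2) * v) \<le> exp \<bar>v\<bar>" using that by simp
      show "norm (theta (exp v)) \<le> A * exp (- d * exp v)" using A(2)[of "exp v"] that by (simp add: d_def)
    qed auto
    also have "\<dots> \<le> exp \<bar>v\<bar> * (A * exp (- d * cosh v))"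
    proof -
      have "cosh v \<le> exp v" using that by (simp add: cosh_def)
      then have "exp (- d * exp v) \<le> exp (- d * cosh v)" using d by simp
      then show ?thesis using A(1) by (intro mult_left_mono) auto
    qed
    finally show ?thesis .
  qed
  have 2: "norm (psi v) \<le> exp \<bar>v\<bar> * (A * exp (- d * cosh v))" for v
    using 1[of v] 1[of "- v"] psi_even[of v] by (cases "v \<ge> 0") auto
  show ?thesis
  proof (rule Bochner_Integration.integrable_bound)
    show "integrable lborel (\<lambda>v. A * (exp ((c + 1) * \<bar>v\<bar>) * exp (- d * cosh v)))"
      by (intro integrable_mult_right integrable_exp_cosh d)
    show "AE v in lborel. norm (exp (c * \<bar>v\<bar>) * norm (psi v)) \<le> norm (A * (exp ((c + 1) * \<bar>v\<bar>) * exp (- d * cosh v)))"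
    proof (rule AE_I2)
      fix v
      have "exp (c * \<bar>v\<bar>) * norm (psi v) \<le> exp (c * \<bar>v\<bar>) * (exp \<bar>v\<bar> * (A * exp (- d * cosh v)))"
        using 2[of v] by (intro mult_left_mono) auto
      also have "\<dots> = A * (exp ((c + 1) * \<bar>v\<bar>) * exp (- d * cosh v))"
        by (simp add: distrib_right exp_add)
      finally show "norm (exp (c * \<bar>v\<bar>) * norm (psi v)) \<le> norm (A * (exp ((c + 1) * \<bar>v\<bar>) * exp (- d * cosh v)))"
        using A(1) by simp
    qed
  qed measurable
qed

text \<open>The completed L-function \<open>(q / \<pi>)\<^sup>z \<Gamma>(z) L(s, chi)\<close> with
  \<open>z = (s + \<iota>) / 2\<close>, as a two-sided Laplace transform. The factor 1/2 accounts
  for \<open>n\<close> and \<open>- n\<close> both occurring in theta.\<close>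

definition Lam :: "complex \<Rightarrow> complex" where
  "Lam s = 1/2 * (\<integral>v. psi v * exp ((s - 1/2) / 2 * of_real v) \<partial>lborel)"

lemma holomorphic_Lam: "Lam holomorphic_on UNIV"
proof -
  have h1: "(\<lambda>w. \<integral>v. psi v * exp (w * of_real v) \<partial>lborel) holomorphic_on UNIV"
    by (rule laplace_entire) (use psi_integrable in auto)
  have h2: "(\<lambda>s::complex. (s - 1/2) / 2) holomorphic_on UNIV" by (intro holomorphic_intros) auto
  have "(\<lambda>s. \<integral>v. psi v * exp ((s - 1/2) / 2 * of_real v) \<partial>lborel) holomorphic_on UNIV"
    by (rule holomorphic_on_compose_gen[OF h2 h1, unfolded o_def]) simp
  then show ?thesis unfolding Lam_def[abs_def] by (rule holomorphic_on_mult[OF holomorphic_on_const])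
qed

lemma Lam_reflect: "Lam (1 - s) = Lam s"
proof -
  have "(\<integral>v. psi v * exp ((s - 1/2) / 2 * of_real v) \<partial>lborel) =
    (\<integral>v. psi (- v) * exp ((s - 1/2) / 2 * of_real (- v)) \<partial>lborel)"
    using lborel_integral_real_affine[of "-1" "\<lambda>v. psi v * exp ((s - 1/2) / 2 * of_real v)" 0] by simp
  also have "\<dots> = (\<integral>v. psi v * exp ((1 - s - 1/2) / 2 * of_real v) \<partial>lborel)"
    by (intro Bochner_Integration.integral_cong refl) (simp add: psi_even field_simps)
  finally show ?thesis by (simp add: Lam_def)
qed

text \<open>The modulus of the kernel depends on \<open>Re s\<close> only. All vertical growth of
  \<open>Lfun\<close> therefore stems from the reciprocal gamma factor.\<close>

lemma Lam_bounded: "\<exists>C. \<forall>s. Re s \<in> {a..b} \<longrightarrow> norm (Lam s) \<le> C"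
proof -
  define M where "M = \<bar>a\<bar> + \<bar>b\<bar> + 1"
  have "norm (Lam s) \<le> 1/2 * (\<integral>v. exp (M * \<bar>v\<bar>) * norm (psi v) \<partial>lborel)" if s: "Re s \<in> {a..b}" for s
  proof -
    have b: "norm (psi v * exp ((s - 1/2) / 2 * of_real v)) \<le> exp (M * \<bar>v\<bar>) * norm (psi v)" for v
    proof -
      have "\<bar>(Re s - 1/2) / 2 * v\<bar> \<le> M * \<bar>v\<bar>"
        unfolding abs_mult using s by (intro mult_right_mono) (auto simp: M_def)
      then have "(Re s - 1/2) / 2 * v \<le> M * \<bar>v\<bar>" by linarith
      then have "exp ((Re s - 1/2) / 2 * v) * norm (psi v) \<le> exp (M * \<bar>v\<bar>) * norm (psi v)"
        by (intro mult_right_mono) auto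
      then show ?thesis by (simp add: norm_mult norm_exp_eq_Re mult.commute)
    qed
    have "norm (\<integral>v. psi v * exp ((s - 1/2) / 2 * of_real v) \<partial>lborel) \<le> (\<integral>v. exp (M * \<bar>v\<bar>) * norm (psi v) \<partial>lborel)"
    proof (rule Bochner_Integration.integral_norm_bound_integral)
      show "integrable lborel (\<lambda>v. psi v * exp ((s - 1/2) / 2 * of_real v))"
        by (rule Bochner_Integration.integrable_bound[OF psi_integrable[of M]])
           (use b in \<open>auto intro!: AE_I2 order_trans[OF _ abs_ge_self]\<close>)
    qed (use b psi_integrable in auto)
    then show ?thesis by (simp add: Lam_def norm_mult)
  qed
  then show ?thesis by blast
qed

text \<open>Entire continuation of the Dirichlet series \<open>\<Sum> chi n n\<^sup>-\<^sup>s\<close>.\<close>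
definition Lfun :: "complex \<Rightarrow> complex" where
  "Lfun s = Lam s * of_real (pi / q) powr ((s + of_nat \<iota>) / 2) * rGamma ((s + of_nat \<iota>) / 2)"

lemma holomorphic_Lfun: "Lfun holomorphic_on UNIV"
proof -
  have "(\<lambda>s. rGamma ((s + of_nat \<iota>) / 2)) holomorphic_on UNIV"
    by (intro holomorphic_on_compose_gen[OF _ holomorphic_rGamma, of _ UNIV UNIV, unfolded o_def] holomorphic_intros) auto
  moreover have "(\<lambda>s. of_real (pi / q) powr ((s + of_nat \<iota>) / 2)) holomorphic_on UNIV"
    using q_pos by (intro holomorphic_on_powr_right holomorphic_intros) auto
  ultimately show ?thesis
    unfolding Lfun_def[abs_def] by (intro holomorphic_on_mult[OF holomorphic_on_mult[OF holomorphic_Lam]])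
qed

lemma Lfun_growth: "\<exists>C\<ge>0. \<forall>x\<in>{a..b}. \<forall>y. norm (Lfun (Complex x y)) \<le> C * exp (17/20 * \<bar>y\<bar>)"
proof -
  obtain C1 where C1: "\<And>s. Re s \<in> {a..b} \<Longrightarrow> norm (Lam s) \<le> C1" using Lam_bounded[of a b] by auto
  obtain C2 where C2: "C2 \<ge> 0" "\<And>x y. x \<in> {(a + \<iota>)/2..(b + \<iota>)/2} \<Longrightarrow> norm (rGamma (Complex x y)) \<le> C2 * exp (17/10 * \<bar>y\<bar>)"
    using norm_rGamma_strip_le[of "(a + \<iota>)/2" "(b + \<iota>)/2"] by blast
  define M where "M = exp (\<bar>ln (pi / q)\<bar> * ((\<bar>a\<bar> + \<bar>b\<bar> + 1) / 2))"
  have "norm (Lfun (Complex x y)) \<le> (\<bar>C1\<bar> * M * C2) * exp (17/20 * \<bar>y\<bar>)" if x: "x \<in> {a..b}" for x y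
  proof -
    have e: "(Complex x y + of_nat \<iota>) / 2 = Complex ((x + \<iota>) / 2) (y / 2)" by (simp add: complex_eq_iff)
    have p: "norm (of_real (pi / q) powr Complex ((x + \<iota>) / 2) (y / 2)) \<le> M"
    proof -
      have pq: "pi / q > 0" using q_pos by simp
      have "norm (of_real (pi / q) powr Complex ((x + \<iota>) / 2) (y / 2)) = exp ((x + \<iota>) / 2 * ln (pi / q))"
        unfolding of_real_powr[OF pq] norm_exp_eq_Re by simp
      also have "\<dots> \<le> M"
      proof -
        have "(x + \<iota>) / 2 * ln (pi / q) \<le> \<bar>(x + \<iota>) / 2\<bar> * \<bar>ln (pi / q)\<bar>" by (metis abs_ge_self abs_mult)
        also have "\<dots> \<le> ((\<bar>a\<bar> + \<bar>b\<bar> + 1) / 2) * \<bar>ln (pi / q)\<bar>"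
          using x iota_le by (intro mult_right_mono) auto
        finally show ?thesis by (simp add: M_def mult.commute)
      qed
      finally show ?thesis .
    qed
    have "norm (rGamma (Complex ((x + \<iota>) / 2) (y / 2))) \<le> C2 * exp (17/10 * \<bar>y / 2\<bar>)"
      using x by (intro C2(2)) auto
    also have "17/10 * \<bar>y / 2\<bar> = 17/20 * \<bar>y\<bar>" by simp
    finally have r: "norm (rGamma (Complex ((x + \<iota>) / 2) (y / 2))) \<le> C2 * exp (17/20 * \<bar>y\<bar>)" .
    have "norm (Lam (Complex x y)) \<le> \<bar>C1\<bar>" using C1[of "Complex x y"] x by force
    then have "norm (Lfun (Complex x y)) \<le> \<bar>C1\<bar> * M * (C2 * exp (17/20 * \<bar>y\<bar>))"
      unfolding Lfun_def e norm_mult using p r by (intro mult_mono) (auto simp: M_def)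
    then show ?thesis by (simp add: mult_ac)
  qed
  moreover have "\<bar>C1\<bar> * M * C2 \<ge> 0" using C2 by (simp add: M_def)
  ultimately show ?thesis by blast
qed

text \<open>Term by term the integral over \<open>v\<close> is a gamma integral. The integrals of
  the norms are the same gamma integrals at the real part of \<open>z\<close>, so the exchange is
  justified by convergence of the series of \<open>n\<close> to the power
  \<open>- Re s\<close>.\<close>

lemma Lfun_dirichlet_series:
  assumes s: "Re s > 1"
  shows "(\<lambda>n. of_int (chi (int (Suc n))) * of_nat (Suc n) powr (- s)) sums Lfun s"
proof -
  define z where "z = (s + of_nat \<iota>) / 2"
  have z: "Re z > 0" using s by (simp add: z_def)
  define a where "a n = pi * (real (Suc n))\<^sup>2 / q" for n
  have a: "a n > 0" for n using q_pos by (simp add: a_def)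
  define g where "g n v = theta_term (exp v) (int (Suc n)) * exp (z * of_real v)" for n v
  have g: "g n = (\<lambda>v. (of_int (chi (int (Suc n))) * of_nat (Suc n) ^ \<iota>) * (exp (z * of_real v) * of_real (exp (- a n * exp v))))" for n
    by (rule ext) (simp add: g_def theta_term_def a_def mult_ac)
  have gi: "integrable lborel (g n)" for n
    unfolding g by (intro integrable_mult_right gamma_integral_exp z a)
  \<comment> \<open>Since \<open>a n\<close> is a constant times a square, its power
    \<open>- z\<close> contains \<open>n\<close> to the power \<open>- s - \<iota>\<close>; the
    extra \<open>n\<close> to the power \<open>- \<iota>\<close> cancels the weight of the theta
    series.\<close>
  have ap: "of_real (a n) powr (- z) = of_real (pi / q) powr (- z) * of_nat (Suc n) powr (- s) * inverse (of_nat (Suc n) ^ \<iota>)" for n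
  proof -
    define N where "N = real (Suc n)"
    have N: "N > 0" by (simp add: N_def)
    have an: "a n = pi / q * N\<^sup>2" by (simp add: a_def N_def)
    have "of_real (a n) powr (- z) = exp (- z * of_real (ln (pi / q * N\<^sup>2)))"
      unfolding of_real_powr[OF a] by (simp only: an)
    also have "ln (pi / q * N\<^sup>2) = ln (pi / q) + 2 * ln N"
      by (subst ln_mult) (use q_pos N in \<open>simp_all add: ln_realpow\<close>)
    also have "exp (- z * of_real (ln (pi / q) + 2 * ln N)) = exp (- z * of_real (ln (pi / q))) * exp (- s * of_real (ln N)) * exp (- of_nat \<iota> * of_real (ln N))"
      unfolding exp_add[symmetric]
      by (rule arg_cong[of _ _ exp]) (simp add: z_def algebra_simps add_divide_distrib)
    also have "exp (- z * of_real (ln (pi / q))) = of_real (pi / q) powr (- z)"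
      using of_real_powr[of "pi / q" "- z"] q_pos by simp
    also have "exp (- s * of_real (ln N)) = of_nat (Suc n) powr (- s)"
      using of_real_powr[OF N, of "- s"] by (simp add: N_def del: of_nat_Suc)
    also have "exp (- of_nat \<iota> * of_real (ln N)) = inverse (of_nat (Suc n) ^ \<iota> :: complex)"
    proof -
      have "exp (of_nat \<iota> * complex_of_real (ln N)) = of_real (N ^ \<iota>)"
        using N by (simp add: exp_of_nat_mult exp_of_real)
      then show ?thesis by (simp add: exp_minus N_def)
    qed
    finally show ?thesis .
  qed
  have gint: "integral\<^sup>L lborel (g n) = of_int (chi (int (Suc n))) * of_nat (Suc n) powr (- s) * (of_real (pi / q) powr (- z) * Gamma z)" for n
    unfolding g integral_mult_right_zero gamma_integral_exp(2)[OF z a] ap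
    by (simp del: of_nat_Suc add: field_simps)
  have sn: "summable (\<lambda>n. \<integral>v. norm (g n v) \<partial>lborel)"
  proof -
    define x where "x = Re z"
    have x: "Re (complex_of_real x) > 0" using z by (simp add: x_def)
    have "(\<integral>v. norm (g n v) \<partial>lborel) \<le> norm (of_real (pi / q) powr (- complex_of_real x) * Gamma (complex_of_real x)) * (real (Suc n) powr (- Re s))" for n
    proof -
      have "(\<integral>v. norm (g n v) \<partial>lborel) = (\<integral>v. norm (of_int (chi (int (Suc n))) * of_nat (Suc n) ^ \<iota> :: complex) * Re (exp (of_real x * of_real v) * of_real (exp (- a n * exp v))) \<partial>lborel)"
      proof (intro Bochner_Integration.integral_cong refl)
        fix v
        have "exp (of_real x * of_real v) = complex_of_real (exp (x * v))" using exp_of_real[of "x * v", where 'a = complex] by simp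
        then show "norm (g n v) = norm (of_int (chi (int (Suc n))) * of_nat (Suc n) ^ \<iota> :: complex) * Re (exp (of_real x * of_real v) * of_real (exp (- a n * exp v)))"
          by (simp add: g norm_mult norm_exp_eq_Re x_def)
      qed
      also have "\<dots> = norm (of_int (chi (int (Suc n))) * of_nat (Suc n) ^ \<iota> :: complex) * Re (Gamma (of_real x) * of_real (a n) powr (- of_real x))"
        unfolding integral_mult_right_zero gamma_integral_exp(2)[OF x a, symmetric]
        by (subst integral_Re[OF gamma_integral_exp(1)[OF x a]]) simp
      also have "\<dots> \<le> real (Suc n) ^ \<iota> * norm (Gamma (of_real x) * of_real (a n) powr (- complex_of_real x))"
      proof (intro mult_mono complex_Re_le_cmod)
        have "norm (of_int (chi (int (Suc n))) * of_nat (Suc n) ^ \<iota> :: complex) \<le> 1 * real (Suc n) ^ \<iota>"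
          unfolding norm_mult norm_power norm_of_nat using norm_chi_le by (intro mult_right_mono) auto
        then show "norm (of_int (chi (int (Suc n))) * of_nat (Suc n) ^ \<iota> :: complex) \<le> real (Suc n) ^ \<iota>" by simp
        have "0 < Gamma x" using x by (intro Gamma_real_pos) simp
        moreover have "of_real (a n) powr (- complex_of_real x) = of_real (a n powr (- x))"
          using a[of n] powr_of_real[of "a n" "- x"] by simp
        ultimately show "0 \<le> Re (Gamma (of_real x) * of_real (a n) powr (- complex_of_real x))"
          by (simp add: Gamma_complex_of_real)
      qed auto
      also have "norm (Gamma (of_real x) * of_real (a n) powr (- complex_of_real x)) = norm (Gamma (complex_of_real x)) * a n powr (- x)"
        by (simp add: norm_mult norm_of_real_powr[OF a])
      also have "a n powr (- x) = (pi / q) powr (- x) * (real (Suc n) powr (- Re s) / real (Suc n) ^ \<iota>)"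
      proof -
        have "a n powr (- x) = norm (of_real (a n) powr (- z))"
          by (simp add: x_def norm_of_real_powr[OF a])
        also have "\<dots> = (pi / q) powr (- x) * (real (Suc n) powr (- Re s)) * inverse (real (Suc n) ^ \<iota>)"
          unfolding ap norm_mult norm_inverse norm_power
          using q_pos norm_of_real_powr[of "pi / q" "- z"] norm_of_real_powr[of "real (Suc n)" "- s"]
          by (simp add: x_def del: of_nat_Suc)
        finally show ?thesis by (simp add: divide_inverse mult.assoc)
      qed
      also have "real (Suc n) ^ \<iota> * (norm (Gamma (complex_of_real x)) * ((pi / q) powr (- x) * (real (Suc n) powr (- Re s) / real (Suc n) ^ \<iota>))) = norm (Gamma (complex_of_real x)) * (pi / q) powr (- x) * (real (Suc n) powr (- Re s))"
        by (simp del: of_nat_Suc)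
      also have "\<dots> = norm (of_real (pi / q) powr (- complex_of_real x) * Gamma (complex_of_real x)) * (real (Suc n) powr (- Re s))"
        using q_pos norm_of_real_powr[of "pi / q" "- complex_of_real x"] by (simp add: norm_mult)
      finally show ?thesis .
    qed
    then have bd: "norm (\<integral>v. norm (g n v) \<partial>lborel) \<le> norm (of_real (pi / q) powr (- complex_of_real x) * Gamma (complex_of_real x)) * (real (Suc n) powr (- Re s))" for n
      using Bochner_Integration.integral_nonneg[of lborel "\<lambda>v. norm (g n v)"] by simp
    have "summable (\<lambda>n. real (Suc n) powr (- Re s))"
      using s summable_real_powr_iff[of "- Re s"] summable_Suc_iff[of "\<lambda>n. real n powr (- Re s)"] by simp
    then have "summable (\<lambda>n. norm (of_real (pi / q) powr (- complex_of_real x) * Gamma (complex_of_real x)) * (real (Suc n) powr (- Re s)))"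
      by (rule summable_mult)
    then show ?thesis by (rule summable_comparison_test[rotated]) (use bd in blast)
  qed
  \<comment> \<open>\<open>g\<close> runs over positive integers only; the factor 2 restores the
    negative ones.\<close>
  have th: "2 * (\<Sum>n. g n v) = theta (exp v) * exp (z * of_real v)" for v
  proof -
    have "(\<lambda>n. 2 * theta_term (exp v) (int (Suc n)) * exp (z * of_real v)) sums (theta (exp v) * exp (z * of_real v))"
      by (intro sums_mult2 theta_sums) simp
    then have "(\<lambda>n. 2 * g n v) sums (theta (exp v) * exp (z * of_real v))" by (simp only: g_def mult.assoc)
    moreover have "summable (\<lambda>n. g n v)"
    proof (rule summable_norm_cancel)
      show "summable (\<lambda>n. norm (g n v))"
        unfolding g_def norm_mult using theta_sums(2)[of "exp v"] by (intro summable_mult2) simp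
    qed
    ultimately show ?thesis by (metis sums_unique suminf_mult)
  qed
  have "(\<lambda>n. integral\<^sup>L lborel (g n)) sums (\<integral>v. (\<Sum>n. g n v) \<partial>lborel)"
  proof (rule sums_integral[OF gi _ sn])
    show "AE v in lborel. summable (\<lambda>n. norm (g n v))"
      unfolding g_def norm_mult using theta_sums(2) by (intro AE_I2 summable_mult2) simp
  qed
  also have "(\<integral>v. (\<Sum>n. g n v) \<partial>lborel) = (\<integral>v. 1/2 * (psi v * exp ((s - 1/2) / 2 * of_real v)) \<partial>lborel)"
  proof (intro Bochner_Integration.integral_cong refl)
    fix v :: real
    have "complex_of_real (exp ((1/4 + real \<iota> / 2) * v)) * exp ((s - 1/2) / 2 * of_real v) = exp (z * of_real v)"
      unfolding exp_of_real[symmetric] exp_add[symmetric]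
      by (rule arg_cong[of _ _ exp]) (simp add: z_def field_simps)
    then have "psi v * exp ((s - 1/2) / 2 * of_real v) = theta (exp v) * exp (z * of_real v)"
      by (simp add: psi_def mult.assoc mult.left_commute)
    then show "(\<Sum>n. g n v) = 1/2 * (psi v * exp ((s - 1/2) / 2 * of_real v))"
      unfolding th[of v, symmetric] by simp
  qed
  also have "\<dots> = Lam s" unfolding integral_mult_right_zero Lam_def ..
  finally have "(\<lambda>n. of_int (chi (int (Suc n))) * of_nat (Suc n) powr (- s) * (of_real (pi / q) powr (- z) * Gamma z)) sums Lam s"
    unfolding gint .
  then have "(\<lambda>n. of_int (chi (int (Suc n))) * of_nat (Suc n) powr (- s) * (of_real (pi / q) powr (- z) * Gamma z) * (of_real (pi / q) powr z * rGamma z)) sums (Lam s * (of_real (pi / q) powr z * rGamma z))"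
    by (rule sums_mult2)
  moreover have "(of_real (pi / q) powr (- z) * Gamma z) * (of_real (pi / q) powr z * rGamma z) = 1"
  proof -
    have "of_real (pi / q) powr (- z) * of_real (pi / q) powr z = (1::complex)"
      using q_pos by (subst powr_add[symmetric]) auto
    moreover have "Gamma z * rGamma z = 1"
    proof -
      have "z \<notin> \<int>\<^sub>\<le>\<^sub>0" using z by (auto elim!: nonpos_Ints_cases)
      then show ?thesis by (simp add: rGamma_inverse_Gamma Gamma_eq_zero_iff)
    qed
    ultimately show ?thesis by (metis mult.assoc mult.left_commute mult_1_right)
  qed
  ultimately show ?thesis unfolding Lfun_def z_def[symmetric] by (simp add: mult.assoc)
qed

end

subsection \<open>Characters of fundamental discriminants\<close>

locale odd_prime =
  fixes p :: nat
  assumes p: "prime p" and p2: "p > 2"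
begin

lemma p_odd: "odd p" using p p2 prime_odd_nat by auto

text \<open>Two numbers among -1, 0, 1 differ by at most 2 < \<open>p\<close>. This turns Euler's
  criterion, a congruence, into equalities.\<close>

lemma legendre_cong_imp_eq:
  assumes "[x = y] (mod int p)" "x \<in> {-1, 0, 1}" "y \<in> {-1, 0, 1}"
  shows "x = y"
proof -
  have d: "int p dvd x - y" using assms(1) by (simp add: cong_iff_dvd_diff)
  have "x - y = 0"
  proof (rule ccontr)
    assume "x - y \<noteq> 0"
    from dvd_imp_le_int[OF this d] have "int p \<le> \<bar>x - y\<bar>" by simp
    then show False using assms p2 by auto
  qed
  then show ?thesis by simp
qed

lemma Legendre_range: "Legendre a (int p) \<in> {-1, 0, 1}"
  by (auto simp: Legendre_def)

lemma Legendre_mult: "Legendre (a * b) (int p) = Legendre a (int p) * Legendre b (int p)"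
proof (rule legendre_cong_imp_eq)
  have "[Legendre a (int p) * Legendre b (int p) = a ^ ((p - 1) div 2) * b ^ ((p - 1) div 2)] (mod int p)"
    by (intro cong_mult euler_criterion p p2)
  then show "[Legendre (a * b) (int p) = Legendre a (int p) * Legendre b (int p)] (mod int p)"
    using euler_criterion[OF p p2, of "a * b"] by (metis cong_sym cong_trans power_mult_distrib)
  show "Legendre a (int p) * Legendre b (int p) \<in> {-1, 0, 1}" 
    using Legendre_range[of a] Legendre_range[of b] by auto
qed (rule Legendre_range)

lemma Legendre_cong:
  assumes "[a = b] (mod int p)"
  shows "Legendre a (int p) = Legendre b (int p)"
proof (rule legendre_cong_imp_eq[OF _ Legendre_range Legendre_range])
  show "[Legendre a (int p) = Legendre b (int p)] (mod int p)"
    using euler_criterion[OF p p2, of a] euler_criterion[OF p p2, of b] cong_pow[OF assms] cong_sym cong_trans by blast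
qed

lemma Legendre_m1: "Legendre (-1) (int p) = (if p mod 4 = 1 then 1 else -1)"
proof (rule legendre_cong_imp_eq)
  have "(-1::int) ^ ((p - 1) div 2) = (if p mod 4 = 1 then 1 else -1)"
  proof -
    have "even ((p - 1) div 2) \<longleftrightarrow> p mod 4 = 1" using p_odd by presburger
    then show ?thesis by auto
  qed
  then show "[Legendre (-1) (int p) = (if p mod 4 = 1 then 1 else -1)] (mod int p)"
    using euler_criterion[OF p p2, of "-1"] by simp
qed (auto simp: Legendre_range[simplified])

lemma Legendre_1: "Legendre 1 (int p) = 1"
proof (rule legendre_cong_imp_eq)
  show "[Legendre 1 (int p) = 1] (mod int p)" using euler_criterion[OF p p2, of 1] by simp
qed (auto simp: Legendre_range[simplified])

lemma Legendre_eq_0_iff: "Legendre a (int p) = 0 \<longleftrightarrow> int p dvd a"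
  by (auto simp: Legendre_def cong_0_iff)

text \<open>Gauss's lemma: the doubled residues exceeding half of \<open>p\<close> are
  \<open>2 x\<close> with \<open>h div 2 < x \<le> h\<close>, and the parity of their number depends
  on \<open>p mod 8\<close>.\<close>

lemma Legendre_2: "Legendre 2 (int p) = (if p mod 8 \<in> {1, 7} then 1 else -1)"
proof -
  define h where "h = (int p - 1) div 2"
  have h: "int p = 2 * h + 1" using p_odd by (auto simp: h_def elim!: oddE)
  have "\<not> int p dvd 2"
  proof
    assume "int p dvd 2" then have "int p \<le> 2" by (rule zdvd_imp_le) simp
    then show False using p2 by simp
  qed
  then interpret GAUSS p 2
    by unfold_locales (use p p2 in \<open>auto simp: cong_0_iff\<close>)
  have C: "C = (\<lambda>x. 2 * x) ` {0<..h}"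
  proof -
    have "x * 2 mod int p = 2 * x" if "x \<in> {0<..h}" for x using that h by (subst mod_pos_pos_trivial) auto
    then show ?thesis by (auto simp: C_def B_def A_def h_def[symmetric] image_image)
  qed
  have E: "E = (\<lambda>x. 2 * x) ` {h div 2<..h}"
    unfolding E_def C h_def[symmetric] by auto
  have "card E = card {h div 2<..h}" unfolding E by (intro card_image) (auto simp: inj_on_def)
  also have "\<dots> = nat (h - h div 2)" by simp
  finally have cE: "card E = nat (h - h div 2)" .
  have "even (card E) \<longleftrightarrow> p mod 8 \<in> {1, 7}"
  proof -
    have "h \<ge> 0" using h p2 by linarith
    then have "even (card E) \<longleftrightarrow> even (h - h div 2)" unfolding cE by (subst even_nat_iff) auto
    also have "\<dots> \<longleftrightarrow> int p mod 8 = 1 \<or> int p mod 8 = 7" unfolding h by presburger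
    also have "int p mod 8 = int (p mod 8)" by (simp add: zmod_int)
    also have "int (p mod 8) = 1 \<or> int (p mod 8) = 7 \<longleftrightarrow> p mod 8 \<in> {1, 7}" by auto
    finally show ?thesis .
  qed
  then show ?thesis using gauss_lemma by auto
qed

text \<open>The prime discriminant attached to \<open>p\<close>: the sign is the one that makes it
  congruent to 1 modulo 4.\<close>

definition pstar :: int where "pstar = (if p mod 4 = 1 then int p else - int p)"

lemma abs_pstar: "\<bar>pstar\<bar> = int p" by (simp add: pstar_def)

lemma pstar_mod4: "pstar mod 4 = 1"
proof -
  have "p mod 4 = 1 \<or> p mod 4 = 3" using p_odd by presburger
  then show ?thesis unfolding pstar_def by presburger
qed

text \<open>Reciprocity with its sign absorbed into \<open>pstar\<close>. For \<open>l = 2\<close>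
  both sides are decided by residues modulo 8, where a change of sign has no effect; for
  \<open>l = p\<close> both vanish.\<close>

lemma Legendre_pstar:
  assumes "prime l"
  shows "Legendre (int l) (int p) = kronecker pstar l"
proof (cases "l = 2")
  case True
  have "odd pstar" using pstar_mod4 by presburger
  moreover have "pstar mod 8 \<in> {1, 7} \<longleftrightarrow> p mod 8 \<in> {1, 7}"
  proof -
    have "(- x) mod 8 = 1 \<or> (- x) mod 8 = 7 \<longleftrightarrow> x mod 8 = 1 \<or> x mod 8 = 7" for x :: int by presburger
    moreover have "int p mod 8 = int (p mod 8)" by (simp add: zmod_int)
    ultimately show ?thesis unfolding pstar_def by auto
  qed
  ultimately show ?thesis using True Legendre_2 by (simp add: kronecker_def)
next
  case False
  then have l2: "l > 2" using assms prime_gt_1_nat[of l] by simp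
  show ?thesis
  proof (cases "l = p")
    case True
    have "Legendre pstar (int p) = 0" "Legendre (int p) (int p) = 0"
      by (simp_all add: Legendre_def cong_0_iff pstar_def)
    then show ?thesis using False True by (simp add: kronecker_def)
  next
    case lp: False
    have qr: "Legendre (int p) (int l) * Legendre (int l) (int p) = (-1) ^ ((p - 1) div 2 * ((l - 1) div 2))"
      using lp by (intro Quadratic_Reciprocity p p2 assms l2) simp
    interpret L: odd_prime l by unfold_locales (use assms l2 in auto)
    have ep: "even ((p - 1) div 2) \<longleftrightarrow> p mod 4 = 1" using p_odd by presburger
    have el: "even ((l - 1) div 2) \<longleftrightarrow> l mod 4 = 1" using L.p_odd by presburger
    have "\<not> l dvd p" using primes_dvd_imp_eq[OF assms p] lp by auto
    then have nz: "Legendre (int p) (int l) = 1 \<or> Legendre (int p) (int l) = -1"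
      by (auto simp: Legendre_def cong_0_iff)
    have "Legendre (int l) (int p) = Legendre pstar (int l)"
    proof (cases "p mod 4 = 1")
      case True
      then have "Legendre (int p) (int l) * Legendre (int l) (int p) = 1" using qr ep by simp
      then show ?thesis using nz True by (auto simp: pstar_def)
    next
      case False
      then have "Legendre (int p) (int l) * Legendre (int l) (int p) = Legendre (-1) (int l)"
      proof -
        have "odd ((p - 1) div 2)" using ep False by simp
        then have "(-1::int) ^ ((p - 1) div 2 * ((l - 1) div 2)) = (-1) ^ ((l - 1) div 2)" by (simp add: power_mult)
        moreover have "(-1::int) ^ ((l - 1) div 2) = Legendre (-1) (int l)"
          unfolding L.Legendre_m1 using el by (cases "even ((l - 1) div 2)") simp_all
        ultimately show ?thesis using qr by simp
      qed
      moreover have "Legendre pstar (int l) = Legendre (-1) (int l) * Legendre (int p) (int l)"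
        using L.Legendre_mult[of "-1" "int p"] False by (simp add: pstar_def)
      ultimately show ?thesis using nz by auto
    qed
    then show ?thesis using False by (simp add: kronecker_def)
  qed
qed

lemma csum_cis_period:
  assumes "\<not> int p dvd n"
  shows "(\<Sum>a\<in>{0..<int p}. cis (2 * pi * of_int a * of_int n / of_int (int p))) = 0"
proof -
  define w where "w = cis (2 * pi * of_int n / real p)"
  have "(\<Sum>a\<in>{0..<int p}. cis (2 * pi * of_int a * of_int n / of_int (int p))) = (\<Sum>k<p. w ^ k)"
    by (rule sum.reindex_bij_witness[of _ int nat])
       (auto simp: w_def Complex.DeMoivre mult_ac)
  also have "w \<noteq> 1"
  proof
    assume "w = 1"
    then have "exp (\<i> * of_real (2 * pi * of_int n / real p)) = 1" by (simp only: w_def cis_conv_exp)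
    then obtain k :: int where "2 * pi * of_int n / real p = of_int (2 * k) * pi"
      unfolding exp_eq_1 by auto
    then have "of_int n = of_int k * real p" using p2 by (simp add: field_simps)
    then have "real_of_int n = real_of_int (k * int p)" by simp
    then have "n = k * int p" by (simp only: of_int_eq_iff)
    then show False using assms by simp
  qed
  then have "(\<Sum>k<p. w ^ k) = (w ^ p - 1) / (w - 1)" by (rule geometric_sum)
  also have "w ^ p = 1"
  proof -
    have "w ^ p = cis (2 * pi * of_int n)" using p2 by (simp add: w_def Complex.DeMoivre)
    also have "\<dots> = 1" by (rule cis_multiple_2pi) simp
    finally show ?thesis .
  qed
  finally show ?thesis by simp
qed

text \<open>Counts the fibres of squaring modulo \<open>p\<close>, in order to pass between sums
  over squares and sums weighted by the Legendre symbol. A nonzero square has the roots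
  \<open>r\<close> and \<open>p - r\<close>, distinct because \<open>p\<close> is odd.\<close>

lemma card_square_roots:
  assumes "a \<in> {0..<int p}"
  shows "int (card {k \<in> {..<p}. int (k\<^sup>2) mod int p = a}) = 1 + Legendre a (int p)"
proof (cases "a = 0")
  case True
  have "{k \<in> {..<p}. int (k\<^sup>2) mod int p = a} = {0}"
  proof -
    have "k = 0" if "k < p" "int (k\<^sup>2) mod int p = 0" for k
    proof -
      have "p dvd k\<^sup>2" using that(2) by (metis dvd_eq_mod_eq_0 int_dvd_int_iff)
      then have "p dvd k" using p prime_dvd_power by blast
      then show ?thesis using that(1) nat_dvd_not_less[of k p] by (cases "k = 0") auto
    qed
    then show ?thesis using True p2 by auto
  qed
  then show ?thesis using True Legendre_eq_0_iff[of 0] by simp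
next
  case a0: False
  have na: "\<not> int p dvd a" using assms a0 zdvd_not_zless by auto
  show ?thesis
  proof (cases "QuadRes (int p) a")
    case False
    have "{k \<in> {..<p}. int (k\<^sup>2) mod int p = a} = {}"
    proof -
      have "QuadRes (int p) a" if "int (k\<^sup>2) mod int p = a" for k
        unfolding QuadRes_def using that by (intro exI[of _ "int k"]) (auto simp: cong_def)
      then show ?thesis using False by auto
    qed
    then show ?thesis using False na by (simp add: Legendre_def cong_0_iff)
  next
    case True
    then obtain y where y: "[y\<^sup>2 = a] (mod int p)" by (auto simp: QuadRes_def)
    define r where "r = nat (y mod int p)"
    have r: "r < p" "int r = y mod int p" using p2 by (auto simp: r_def nat_less_iff)
    have r2: "int (r\<^sup>2) mod int p = a"
    proof -
      have "int (r\<^sup>2) mod int p = (y mod int p)\<^sup>2 mod int p" using r by simp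
      also have "\<dots> = a mod int p" using y by (simp add: power_mod cong_def)
      finally show ?thesis using assms by simp
    qed
    have r0: "r > 0" using r2 a0 by (cases r) auto
    have "{k \<in> {..<p}. int (k\<^sup>2) mod int p = a} = {r, p - r}"
    proof -
      have "k = r \<or> k = p - r" if "k < p" "int (k\<^sup>2) mod int p = a" for k
      proof -
        have "int (k\<^sup>2) mod int p = int (r\<^sup>2) mod int p" using that(2) r2 by simp
        then have "int p dvd int (k\<^sup>2) - int (r\<^sup>2)" by (rule mod_eq_dvd_iff[THEN iffD1])
        also have "int (k\<^sup>2) - int (r\<^sup>2) = (int k - int r) * (int k + int r)" by (simp add: power2_eq_square algebra_simps)
        finally have "int p dvd int k - int r \<or> int p dvd int k + int r" using p by (simp add: prime_dvd_mult_iff)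
        then show ?thesis
        proof
          assume "int p dvd int k - int r"
          moreover have "\<bar>int k - int r\<bar> < int p" using that(1) r(1) by linarith
          ultimately have "int k - int r = 0" using dvd_imp_le_int[of "int k - int r" "int p"] by fastforce
          then show ?thesis by simp
        next
          assume d: "int p dvd int k + int r"
          then obtain c where c: "int k + int r = int p * c" unfolding dvd_def by blast
          have pp: "int p > 0" using p2 by simp
          have lt: "int k + int r < int p * 2" using that(1) r(1) by linarith
          have gt: "0 < int k + int r" using r0 by linarith
          have "c < 2" using lt[unfolded c] pp by (simp only: mult_less_cancel_left_pos)
          moreover have "0 < c" using gt[unfolded c] pp by (simp only: zero_less_mult_iff) auto
          ultimately have "c = 1" by simp
          then show ?thesis using c by auto
        qed
      qed
      moreover have "int ((p - r)\<^sup>2) mod int p = a"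
      proof -
        have "int ((p - r)\<^sup>2) = int (r\<^sup>2) + int p * (int p - 2 * int r)"
        proof -
          have "int ((p - r)\<^sup>2) = (int p - int r)\<^sup>2" using r(1) by (simp only: of_nat_power of_nat_diff less_imp_le)
          then show ?thesis by (simp add: power2_eq_square algebra_simps)
        qed
        then show ?thesis using r2 by simp
      qed
      ultimately show ?thesis using r(1) r2 r0 by auto
    qed
    moreover have "r \<noteq> p - r"
    proof
      assume "r = p - r"
      then have "p = 2 * r" using r(1) by simp
      then show False using p_odd by simp
    qed
    ultimately show ?thesis using True na by (simp add: Legendre_def cong_0_iff)
  qed
qed

lemma sum_mult_residues:
  assumes f: "\<And>a b. [a = b] (mod int p) \<Longrightarrow> f a = f b" and n: "\<not> int p dvd n"
  shows "(\<Sum>a\<in>{0..<int p}. f (a * n)) = (\<Sum>a\<in>{0..<int p}. f a :: complex)"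
proof -
  have cop: "coprime n (int p)" using n p by (metis coprime_commute prime_imp_coprime prime_int_iff of_nat_0_le_iff prime_nat_int_transfer)
  have inj: "inj_on (\<lambda>a. a * n mod int p) {0..<int p}"
  proof (rule inj_onI)
    fix a b assume ab: "a \<in> {0..<int p}" "b \<in> {0..<int p}" "a * n mod int p = b * n mod int p"
    then have "[a * n = b * n] (mod int p)" by (simp add: cong_def)
    then have "[a = b] (mod int p)" using cong_mult_rcancel[OF cop] by blast
    then show "a = b" using ab by (simp add: cong_def)
  qed
  have "(\<lambda>a. a * n mod int p) ` {0..<int p} \<subseteq> {0..<int p}" using p2 by auto
  then have "bij_betw (\<lambda>a. a * n mod int p) {0..<int p} {0..<int p}"
    using inj endo_inj_surj[of "{0..<int p}"] by (auto simp: bij_betw_def)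
  from sum.reindex_bij_betw[OF this, of f] 
  have "(\<Sum>a\<in>{0..<int p}. f (a * n mod int p)) = (\<Sum>a\<in>{0..<int p}. f a)" .
  moreover have "f (a * n mod int p) = f (a * n)" for a by (rule f) (simp add: cong_def)
  ultimately show ?thesis by simp
qed

lemma cis_cong:
  assumes "[a = b] (mod int p)"
  shows "cis (2 * pi * of_int a / real p) = cis (2 * pi * of_int b / real p)"
proof -
  obtain k where k: "a = b + int p * k" using cong_sym[OF assms] unfolding cong_iff_lin by blast
  have "2 * pi * of_int a / real p = 2 * pi * of_int b / real p + 2 * pi * of_int k"
    using p2 by (simp add: k field_simps)
  then have "cis (2 * pi * of_int a / real p) = cis (2 * pi * of_int b / real p) * cis (2 * pi * of_int k)"
    by (simp only: cis_mult)
  also have "cis (2 * pi * of_int k) = 1" by (rule cis_multiple_2pi) simp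
  finally show ?thesis by simp
qed

lemma csqrt_pstar: "csqrt (of_int pstar) = (if p mod 4 = 1 then 1 else \<i>) * of_real (sqrt (real p))"
proof (cases "p mod 4 = 1")
  case True
  then show ?thesis using of_real_sqrt[of "real p"] by (simp add: pstar_def)
next
  case False
  have "csqrt (of_real (- real p)) = \<i> * of_real (sqrt (real p))" using csqrt_of_real_nonpos[of "- real p"] by simp
  then show ?thesis using False by (simp add: pstar_def)
qed

text \<open>For \<open>n\<close> prime to \<open>p\<close>, permuting the residues by
  \<open>n\<close> pulls out the symbol of \<open>n\<close> and leaves the sum at
  \<open>n = 1\<close>, which is Dirichlet's quadratic Gauss sum.\<close>

lemma Legendre_gauss_sum:
  "(\<Sum>a\<in>{0..<int p}. of_int (Legendre a (int p)) * cis (2 * pi * of_int a * of_int n / of_int (int p))) =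
     of_int (Legendre n (int p)) * csqrt (of_int pstar)"
proof -
  have fib: "(\<Sum>k<p. f (int (k\<^sup>2) mod int p)) = (\<Sum>a\<in>{0..<int p}. (1 + of_int (Legendre a (int p))) * f a)" for f :: "int \<Rightarrow> complex"
  proof -
    have "(\<Sum>k<p. f (int (k\<^sup>2) mod int p)) = (\<Sum>a\<in>{0..<int p}. \<Sum>k\<in>{k \<in> {..<p}. int (k\<^sup>2) mod int p = a}. f (int (k\<^sup>2) mod int p))"
      using p2 by (intro sum.group[symmetric]) auto
    also have "\<dots> = (\<Sum>a\<in>{0..<int p}. (1 + of_int (Legendre a (int p))) * f a)"
    proof (rule sum.cong[OF refl])
      fix a assume a: "a \<in> {0..<int p}"
      have "(\<Sum>k\<in>{k \<in> {..<p}. int (k\<^sup>2) mod int p = a}. f (int (k\<^sup>2) mod int p)) = of_int (int (card {k \<in> {..<p}. int (k\<^sup>2) mod int p = a})) * f a"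
        by simp
      then show "(\<Sum>k\<in>{k \<in> {..<p}. int (k\<^sup>2) mod int p = a}. f (int (k\<^sup>2) mod int p)) = (1 + of_int (Legendre a (int p))) * f a"
        unfolding card_square_roots[OF a] by simp
    qed
    finally show ?thesis .
  qed
  show ?thesis
  proof (cases "int p dvd n")
    case True
    have "cis (2 * pi * of_int a * of_int n / of_int (int p)) = 1" for a :: int
    proof -
      obtain k where "n = int p * k" using True unfolding dvd_def by blast
      then have "2 * pi * of_int a * of_int n / of_int (int p) = 2 * pi * of_int (a * k)" using p2 by simp
      moreover have "cis (2 * pi * of_int (a * k)) = 1" by (rule cis_multiple_2pi) simp
      ultimately show ?thesis by simp
    qed
    \<comment> \<open>The fibre count applied to the constant function 1 compares \<open>p\<close>
      with \<open>p\<close> plus the sum of all symbols.\<close>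
    moreover have "(\<Sum>a\<in>{0..<int p}. complex_of_int (Legendre a (int p))) = 0"
      using fib[of "\<lambda>_. 1"] by (simp add: sum.distrib)
    ultimately show ?thesis using True Legendre_eq_0_iff[of n] by simp
  next
    case False
    define f where "f a = of_int (Legendre a (int p)) * cis (2 * pi * of_int a / real p)" for a
    have L2: "Legendre n (int p) * Legendre n (int p) = 1"
      using False by (auto simp: Legendre_def cong_0_iff)
    have "(\<Sum>a\<in>{0..<int p}. of_int (Legendre a (int p)) * cis (2 * pi * of_int a * of_int n / of_int (int p)))
      = (\<Sum>a\<in>{0..<int p}. of_int (Legendre n (int p)) * f (a * n))"
    proof (rule sum.cong[OF refl])
      fix a
      have "Legendre a (int p) = Legendre n (int p) * Legendre (a * n) (int p)"
      proof -
        have "Legendre n (int p) * Legendre (a * n) (int p) = Legendre a (int p) * (Legendre n (int p) * Legendre n (int p))"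
          by (simp add: Legendre_mult)
        then show ?thesis unfolding L2 by simp
      qed
      then show "of_int (Legendre a (int p)) * cis (2 * pi * of_int a * of_int n / of_int (int p)) = of_int (Legendre n (int p)) * f (a * n)"
        by (simp add: f_def mult_ac)
    qed
    also have "\<dots> = of_int (Legendre n (int p)) * (\<Sum>a\<in>{0..<int p}. f (a * n))" by (rule sum_distrib_left[symmetric])
    also have "(\<Sum>a\<in>{0..<int p}. f (a * n)) = (\<Sum>a\<in>{0..<int p}. f a)"
      by (rule sum_mult_residues[OF _ False]) (simp add: f_def Legendre_cong cis_cong)
    \<comment> \<open>The added sum of all nontrivial \<open>p\<close>-th root powers is 0; with it
      the weights become numbers of square roots.\<close>
    also have "\<dots> = (\<Sum>a\<in>{0..<int p}. (1 + of_int (Legendre a (int p))) * cis (2 * pi * of_int a / real p))"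
    proof -
      have "\<not> int p dvd 1" using p2 by (auto dest: zdvd_imp_le)
      from csum_cis_period[OF this] show ?thesis by (simp add: f_def distrib_right sum.distrib)
    qed
    also have "\<dots> = (\<Sum>k<p. cis (2 * pi * of_int (int (k\<^sup>2) mod int p) / real p))"
      by (rule fib[symmetric])
    also have "\<dots> = (\<Sum>k<p. cis (2 * pi * real (k\<^sup>2) / real p))"
    proof (rule sum.cong[OF refl])
      fix k
      have "cis (2 * pi * of_int (int (k\<^sup>2) mod int p) / real p) = cis (2 * pi * of_int (int (k\<^sup>2)) / real p)"
        by (rule cis_cong) (simp add: cong_def)
      then show "cis (2 * pi * of_int (int (k\<^sup>2) mod int p) / real p) = cis (2 * pi * real (k\<^sup>2) / real p)" by simp
    qed
    also have "\<dots> = csqrt (of_int pstar)"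
      unfolding csqrt_pstar by (rule quadratic_gauss_sum_odd[OF p_odd])
    finally show ?thesis .
  qed
qed

end

section \<open>Products of characters\<close>

lemma cis_int_period:
  assumes "N > 0" "[a = b] (mod N)"
  shows "cis (2 * pi * of_int a / of_int N) = cis (2 * pi * of_int b / of_int N)"
proof -
  obtain k where k: "a = b + N * k" using cong_sym[OF assms(2)] unfolding cong_iff_lin by blast
  have "2 * pi * of_int a / of_int N = 2 * pi * of_int b / of_int N + 2 * pi * of_int k"
    using assms(1) by (simp add: k field_simps)
  then have "cis (2 * pi * of_int a / of_int N) = cis (2 * pi * of_int b / of_int N) * cis (2 * pi * of_int k)"
    by (simp only: cis_mult)
  also have "cis (2 * pi * of_int k) = 1" by (rule cis_multiple_2pi) simp
  finally show ?thesis by simp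
qed

text \<open>The values at primes tie the character to \<open>D\<close>; through them it is compared
  with \<open>jac\<close> and \<open>eps\<close>.\<close>

definition good_character :: "int \<Rightarrow> (int \<Rightarrow> int) \<Rightarrow> bool" where
  "good_character D chi \<longleftrightarrow> quadratic_character D chi \<and> (\<forall>l. prime l \<longrightarrow> chi (int l) = kronecker D l)"

lemma mod_mult_vals:
  fixes a b m :: int
  assumes "a mod m = x" "b mod m = y"
  shows "(a * b) mod m = (x * y) mod m"
  unfolding assms[symmetric] by (rule mod_mult_eq[symmetric])

lemma kronecker_mult:
  assumes l: "prime l" and D: "D1 mod 4 = 1 \<or> D2 mod 4 = 1"
    and e: "even D1 \<or> D1 mod 4 = 1" "even D2 \<or> D2 mod 4 = 1"
  shows "kronecker (D1 * D2) l = kronecker D1 l * kronecker D2 l"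
proof (cases "l = 2")
  case True
  have m: "D mod 8 = 1 \<or> D mod 8 = 5" if "D mod 4 = 1" for D :: int using that by presburger
  show ?thesis
  proof (cases "even D1 \<or> even D2")
    case False
    then have "D1 mod 8 = 1 \<or> D1 mod 8 = 5" "D2 mod 8 = 1 \<or> D2 mod 8 = 5" using m e by auto
    then show ?thesis using False True by (elim disjE) (simp_all add: kronecker_def mod_mult_vals)
  qed (auto simp: kronecker_def True)
next
  case False
  then interpret odd_prime l using l prime_gt_1_nat[OF l] by unfold_locales auto
  show ?thesis using False by (simp add: kronecker_def Legendre_mult)
qed

lemma csqrt_of_int: "D \<noteq> 0 \<Longrightarrow> csqrt (of_int D) = (if D > 0 then 1 else \<i>) * of_real (sqrt \<bar>of_int D\<bar>)"
proof (cases "D > 0")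
  case True
  then show ?thesis using of_real_sqrt[of "of_int D"] by simp
next
  case False
  moreover assume "D \<noteq> 0"
  moreover have "csqrt (of_real (of_int D)) = \<i> * of_real (sqrt \<bar>of_int D\<bar>)" if "D < 0"
    using csqrt_of_real_nonpos[of "of_int D"] that by simp
  ultimately show ?thesis by simp
qed

text \<open>Parametrising residues modulo \<open>\<bar>D1\<bar> p\<close> by \<open>a p + b \<bar>D1\<bar>\<close>, the Gauss sum of the product is \<open>chi p\<close> times the
  Legendre symbol of \<open>\<bar>D1\<bar>\<close> times both Gauss sums; what remains of this sign is the symbol of \<open>sgn D1\<close>,
  which is needed because \<open>csqrt\<close> is not multiplicative on negative numbers.\<close>
lemma (in odd_prime) good_character_mult_Legendre:
  assumes g: "good_character D1 chi" and cop: "coprime D1 (int p)" and e: "even D1 \<or> D1 mod 4 = 1"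
  shows "good_character (D1 * pstar) (\<lambda>n. chi n * Legendre n (int p))"
proof -
  from g have qc: "quadratic_character D1 chi" and kr: "\<And>l. prime l \<Longrightarrow> chi (int l) = kronecker D1 l"
    by (auto simp: good_character_def)
  from qc have D1: "D1 \<noteq> 0" and chi1: "chi 1 = 1" and mult: "\<And>a b. chi (a * b) = chi a * chi b"
    and per: "\<And>a. chi (a + \<bar>D1\<bar>) = chi a" and m1: "chi (-1) = sgn D1" and le: "\<And>a. \<bar>chi a\<bar> \<le> 1"
    and gs: "\<And>n. (\<Sum>a\<in>{0..<\<bar>D1\<bar>}. of_int (chi a) * cis (2 * pi * of_int a * of_int n / of_int \<bar>D1\<bar>)) = of_int (chi n) * csqrt (of_int D1)"
    by (auto simp: quadratic_character_def)
  define N where "N = \<bar>D1\<bar>"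
  have N: "N > 0" using D1 by (simp add: N_def)
  have perm: "chi a = chi b" if ab: "[a = b] (mod N)" for a b
  proof -
    have 1: "chi (a + int k * N) = chi a" for a k
    proof (induction k)
      case (Suc k)
      then show ?case using per[of "a + int k * N"] by (simp add: algebra_simps N_def)
    qed simp
    obtain k where k: "b = a + N * k" using ab unfolding cong_iff_lin by blast
    show ?thesis
    proof (cases "k \<ge> 0")
      case True then show ?thesis using 1[of a "nat k"] k by (simp add: mult.commute)
    next
      case False then show ?thesis using 1[of b "nat (- k)"] k by (simp add: algebra_simps)
    qed
  qed
  have pp: "int p > 0" "prime (int p)" using p p2 by auto
  have copN: "coprime N (int p)" using cop by (simp add: N_def)
  define f where "f n a = of_int (chi a * Legendre a (int p)) * cis (2 * pi * of_int (a * n) / of_int (N * int p))" for n a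
  have fcong: "f n a = f n b" if "[a = b] (mod (N * int p))" for n a b
  proof -
    have "chi a = chi b" using that by (intro perm) (metis cong_modulus_mult)
    moreover have "Legendre a (int p) = Legendre b (int p)" using that by (intro Legendre_cong) (metis cong_modulus_mult mult.commute)
    moreover have "cis (2 * pi * of_int (a * n) / of_int (N * int p)) = cis (2 * pi * of_int (b * n) / of_int (N * int p))"
      using that N pp by (intro cis_int_period cong_scalar_right) auto
    ultimately show ?thesis by (simp add: f_def)
  qed
  \<comment> \<open>The Chinese remainder theorem in additive form: modulo \<open>N\<close> only
    \<open>a * p\<close> remains, modulo \<open>p\<close> only \<open>b * N\<close>.\<close>
  have bij: "bij_betw (\<lambda>(a, b). (a * int p + b * N) mod (N * int p)) ({0..<N} \<times> {0..<int p}) {0..<N * int p}"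
  proof -
    have inj: "inj_on (\<lambda>(a, b). (a * int p + b * N) mod (N * int p)) ({0..<N} \<times> {0..<int p})"
    proof (rule inj_onI, clarify)
      fix a b a' b' assume r: "a \<in> {0..<N}" "b \<in> {0..<int p}" "a' \<in> {0..<N}" "b' \<in> {0..<int p}"
        and eq: "(a * int p + b * N) mod (N * int p) = (a' * int p + b' * N) mod (N * int p)"
      have c: "[a * int p + b * N = a' * int p + b' * N] (mod (N * int p))" using eq by (simp add: cong_def)
      have "[a * int p = a' * int p] (mod N)"
      proof -
        have "[a * int p + b * N = a' * int p + b' * N] (mod N)" using c by (metis cong_modulus_mult)
        then show ?thesis by (simp add: cong_def)
      qed
      then have "[a = a'] (mod N)" using cong_mult_rcancel[of "int p" N] copN by (simp add: coprime_commute)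
      moreover have "[b * N = b' * N] (mod int p)"
      proof -
        have "[a * int p + b * N = a' * int p + b' * N] (mod int p)" using c by (metis cong_modulus_mult mult.commute)
        then show ?thesis by (simp add: cong_def)
      qed
      then have "[b = b'] (mod int p)" using cong_mult_rcancel[of N "int p"] copN by simp
      ultimately show "a = a' \<and> b = b'" using r by (simp add: cong_def)
    qed
    have sub: "(\<lambda>(a, b). (a * int p + b * N) mod (N * int p)) ` ({0..<N} \<times> {0..<int p}) \<subseteq> {0..<N * int p}"
      using N pp by auto
    have "card ((\<lambda>(a, b). (a * int p + b * N) mod (N * int p)) ` ({0..<N} \<times> {0..<int p})) = card {0..<N * int p}"
      unfolding card_image[OF inj] using N pp by (simp add: nat_mult_distrib)
    then have "(\<lambda>(a, b). (a * int p + b * N) mod (N * int p)) ` ({0..<N} \<times> {0..<int p}) = {0..<N * int p}"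
      using sub by (intro card_subset_eq) auto
    then show ?thesis using inj by (simp add: bij_betw_def)
  qed
  have chip: "chi (int p) * Legendre N (int p) = Legendre (sgn D1) (int p)"
  proof -
    have "p \<noteq> 2" using p2 by simp
    then have "chi (int p) = Legendre D1 (int p)" using kr[OF p] by (simp add: kronecker_def)
    also have "D1 = sgn D1 * N" by (simp add: N_def sgn_mult_abs)
    finally have "chi (int p) = Legendre (sgn D1) (int p) * Legendre N (int p)" by (simp only: Legendre_mult)
    moreover have "\<not> int p dvd N"
    proof
      assume "int p dvd N"
      then have "is_unit (int p)" using copN by (metis coprime_common_divisor dvd_refl)
      then show False using p2 by simp
    qed
    then have "Legendre N (int p) * Legendre N (int p) = 1" by (auto simp: Legendre_def cong_0_iff)
    ultimately show ?thesis by (simp add: mult.assoc)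
  qed
  \<comment> \<open>\<open>csqrt\<close> is multiplicative except when both arguments are negative,
    where \<i> * \<i> = -1. Then \<open>p mod 4 = 3\<close> and the symbol of
    \<open>sgn D1 = -1\<close> is -1 as well; in the other cases it is 1.\<close>
  have sq: "csqrt (of_int D1) * csqrt (of_int pstar) * of_int (Legendre (sgn D1) (int p)) = csqrt (of_int (D1 * pstar))"
  proof -
    have ps: "pstar \<noteq> 0" using abs_pstar p2 by auto
    have "sqrt \<bar>real_of_int (D1 * pstar)\<bar> = sqrt \<bar>of_int D1\<bar> * sqrt \<bar>of_int pstar\<bar>" by (simp add: abs_mult real_sqrt_mult)
    moreover have "D1 * pstar > 0 \<longleftrightarrow> (D1 > 0 \<longleftrightarrow> pstar > 0)" using D1 ps by (auto simp: zero_less_mult_iff)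
    moreover have "pstar > 0 \<longleftrightarrow> p mod 4 = 1" using p2 by (simp add: pstar_def)
    moreover have "sgn D1 = (if D1 > 0 then 1 else -1)" using D1 by simp
    ultimately show ?thesis
      using D1 ps csqrt_of_int[of D1] csqrt_of_int[of pstar] csqrt_of_int[of "D1 * pstar"] Legendre_m1 Legendre_1
      by (auto simp: algebra_simps)
  qed
  have gauss: "(\<Sum>a\<in>{0..<N * int p}. of_int (chi a * Legendre a (int p)) * cis (2 * pi * of_int a * of_int n / of_int (N * int p)))
     = of_int (chi n * Legendre n (int p)) * csqrt (of_int (D1 * pstar))" for n
  proof -
    have "(\<Sum>a\<in>{0..<N * int p}. of_int (chi a * Legendre a (int p)) * cis (2 * pi * of_int a * of_int n / of_int (N * int p)))
       = (\<Sum>a\<in>{0..<N * int p}. f n a)" by (simp add: f_def mult_ac)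
    also have "\<dots> = (\<Sum>x\<in>{0..<N} \<times> {0..<int p}. f n (case x of (a, b) \<Rightarrow> (a * int p + b * N) mod (N * int p)))"
      by (rule sum.reindex_bij_betw[OF bij, symmetric])
    also have "\<dots> = (\<Sum>(a, b)\<in>{0..<N} \<times> {0..<int p}.
        of_int (Legendre (sgn D1) (int p)) * ((of_int (chi a) * cis (2 * pi * of_int a * of_int n / of_int N)) * (of_int (Legendre b (int p)) * cis (2 * pi * of_int b * of_int n / of_int (int p)))))"
    proof (rule sum.cong[OF refl], clarify)
      fix a b
      have "f n ((a * int p + b * N) mod (N * int p)) = f n (a * int p + b * N)" by (rule fcong) (simp add: cong_def)
      also have "chi (a * int p + b * N) = chi a * chi (int p)"
        unfolding mult[symmetric] by (rule perm) (simp add: cong_def)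
      then have "f n (a * int p + b * N) = of_int (chi a * chi (int p) * (Legendre b (int p) * Legendre N (int p))) * cis (2 * pi * of_int ((a * int p + b * N) * n) / of_int (N * int p))"
        unfolding f_def by (subst Legendre_cong[of "a * int p + b * N" "b * N"]) (simp_all add: cong_def Legendre_mult)
      also have "2 * pi * of_int ((a * int p + b * N) * n) / of_int (N * int p) = 2 * pi * of_int a * of_int n / of_int N + 2 * pi * of_int b * of_int n / of_int (int p)"
        using N pp by (simp add: field_simps)
      also have "chi a * chi (int p) * (Legendre b (int p) * Legendre N (int p)) = Legendre (sgn D1) (int p) * chi a * Legendre b (int p)"
        unfolding chip[symmetric] by (simp add: mult_ac)
      finally show "f n ((a * int p + b * N) mod (N * int p)) = of_int (Legendre (sgn D1) (int p)) * ((of_int (chi a) * cis (2 * pi * of_int a * of_int n / of_int N)) * (of_int (Legendre b (int p)) * cis (2 * pi * of_int b * of_int n / of_int (int p))))"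
        by (simp add: cis_mult[symmetric] mult_ac)
    qed
    also have "\<dots> = of_int (Legendre (sgn D1) (int p)) * ((\<Sum>a\<in>{0..<N}. of_int (chi a) * cis (2 * pi * of_int a * of_int n / of_int N)) * (\<Sum>b\<in>{0..<int p}. of_int (Legendre b (int p)) * cis (2 * pi * of_int b * of_int n / of_int (int p))))"
      unfolding sum_product sum.cartesian_product unfolding sum_distrib_left case_prod_beta ..
    also have "\<dots> = of_int (chi n * Legendre n (int p)) * (csqrt (of_int D1) * csqrt (of_int pstar) * of_int (Legendre (sgn D1) (int p)))"
      unfolding N_def gs Legendre_gauss_sum by simp
    finally show ?thesis unfolding sq .
  qed
  have aD: "\<bar>D1 * pstar\<bar> = N * int p" by (simp add: abs_mult N_def abs_pstar)
  have "quadratic_character (D1 * pstar) (\<lambda>n. chi n * Legendre n (int p))"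
    unfolding quadratic_character_def aD
  proof (intro conjI allI)
    show "D1 * pstar \<noteq> 0" using D1 abs_pstar p2 by auto
    show "chi 1 * Legendre 1 (int p) = 1" by (simp add: chi1 Legendre_1)
    show "chi (a * b) * Legendre (a * b) (int p) = chi a * Legendre a (int p) * (chi b * Legendre b (int p))" for a b
      by (simp add: mult Legendre_mult)
    show "chi (a + N * int p) * Legendre (a + N * int p) (int p) = chi a * Legendre a (int p)" for a
      using perm[of "a + N * int p" a] Legendre_cong[of "a + N * int p" a] by (simp add: cong_def)
    show "chi (-1) * Legendre (-1) (int p) = sgn (D1 * pstar)"
      using p2 by (simp add: m1 Legendre_m1 sgn_mult pstar_def)
    show "\<bar>chi a * Legendre a (int p)\<bar> \<le> 1" for a
      using le[of a] Legendre_range[of a] by (auto simp: abs_mult)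
  qed (rule gauss)
  moreover have "chi (int l) * Legendre (int l) (int p) = kronecker (D1 * pstar) l" if l: "prime l" for l
    using kronecker_mult[OF l, of D1 pstar] pstar_mod4 e kr[OF l] Legendre_pstar[OF l] by simp
  ultimately show ?thesis by (simp add: good_character_def)
qed

lemma good_character_1: "good_character 1 (\<lambda>_. 1)"
proof -
  have "kronecker 1 l = 1" if "prime l" for l
  proof (cases "l = 2")
    case False
    then interpret odd_prime l using that prime_gt_1_nat[OF that] by unfold_locales auto
    show ?thesis using False Legendre_1 by (simp add: kronecker_def)
  qed (simp add: kronecker_def)
  moreover have "{0..<1::int} = {0}" by auto
  ultimately show ?thesis by (auto simp: good_character_def quadratic_character_def)
qed

section \<open>Characters of 2-power conductor and general fundamental discriminants\<close>

definition chi_m4 :: "int \<Rightarrow> int" where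
  "chi_m4 a = (if even a then 0 else if a mod 4 = 1 then 1 else -1)"

definition chi_8 :: "int \<Rightarrow> int" where
  "chi_8 a = (if even a then 0 else if a mod 8 = 1 \<or> a mod 8 = 7 then 1 else -1)"

lemma chi_m4_mult: "chi_m4 (a * b) = chi_m4 a * chi_m4 b"
proof -
  have m: "x mod 4 = 1 \<or> x mod 4 = 3" if "odd x" for x :: int using that by presburger
  show ?thesis
  proof (cases "even a \<or> even b")
    case False
    then have "a mod 4 = 1 \<or> a mod 4 = 3" "b mod 4 = 1 \<or> b mod 4 = 3" using m by auto
    then show ?thesis using False by (elim disjE) (simp_all add: chi_m4_def mod_mult_vals)
  qed (auto simp: chi_m4_def)
qed

lemma chi_8_mult: "chi_8 (a * b) = chi_8 a * chi_8 b"
proof -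
  have m: "x mod 8 = 1 \<or> x mod 8 = 3 \<or> x mod 8 = 5 \<or> x mod 8 = 7" if "odd x" for x :: int using that by presburger
  show ?thesis
  proof (cases "even a \<or> even b")
    case False
    then have "a mod 8 = 1 \<or> a mod 8 = 3 \<or> a mod 8 = 5 \<or> a mod 8 = 7" "b mod 8 = 1 \<or> b mod 8 = 3 \<or> b mod 8 = 5 \<or> b mod 8 = 7"
      using m by auto
    then show ?thesis using False by (elim disjE) (simp_all add: chi_8_def mod_mult_vals)
  qed (auto simp: chi_8_def)
qed

lemma cis_mod8: "cis (2 * pi * of_int a * of_int n / 8) = cis (pi / 4) ^ nat ((a * n) mod 8)"
proof -
  have "cis (2 * pi * of_int a * of_int n / 8) = cis (2 * pi * of_int (a * n) / of_int 8)" by (simp add: mult_ac)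
  also have "\<dots> = cis (2 * pi * of_int ((a * n) mod 8) / of_int 8)" by (rule cis_int_period) (auto simp: cong_def)
  also have "\<dots> = cis (real (nat ((a * n) mod 8)) * (pi / 4))" by (simp add: mult_ac)
  finally show ?thesis by (simp add: Complex.DeMoivre)
qed

text \<open>Both sides depend on \<open>n\<close> only modulo 8, which leaves eight identities
  between powers of one eighth root of unity.\<close>

lemma gauss_sum_mod8:
  assumes f: "\<And>a. even a \<Longrightarrow> f a = 0" and n: "f n = f (n mod 8)"
    and S: "\<And>r. r \<in> {0,1,2,3,4,5,6,7} \<Longrightarrow> of_int (f 1) * z ^ nat (1 * r mod 8) + of_int (f 3) * z ^ nat (3 * r mod 8) + of_int (f 5) * z ^ nat (5 * r mod 8) + of_int (f 7) * z ^ nat (7 * r mod 8) = of_int (f r) * g"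
    and z: "z = cis (pi / 4)"
  shows "(\<Sum>a\<in>{0..<8}. of_int (f a) * cis (2 * pi * of_int a * of_int n / 8)) = of_int (f n) * (g :: complex)"
proof -
  have set: "{0..<8::int} = {0,1,2,3,4,5,6,7}" by auto
  have r: "n mod 8 \<in> {0,1,2,3,4,5,6,7}" unfolding set[symmetric] by auto
  have "(\<Sum>a\<in>{0..<8}. of_int (f a) * cis (2 * pi * of_int a * of_int n / 8)) = (\<Sum>a\<in>{0,1,2,3,4,5,6,7}. of_int (f a) * z ^ nat (a * (n mod 8) mod 8))"
    unfolding set z by (intro sum.cong refl) (simp only: cis_mod8 mod_mult_right_eq)
  also have "\<dots> = of_int (f (n mod 8)) * g"
    using S[OF r] by (simp add: f add.assoc)
  finally show ?thesis using n by simp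
qed

lemma cis_pi_4: "cis (pi / 4) = (1 + \<i>) / of_real (sqrt 2)"
  by (simp add: complex_eq_iff cos_45 sin_45 Re_divide Im_divide field_simps real_sqrt_mult[symmetric] power2_eq_square)

lemma cis_pi_4_powers:
  defines "z \<equiv> cis (pi / 4)"
  shows "z ^ 2 = \<i>" "z ^ 3 = \<i> * z" "z ^ 4 = -1" "z ^ 5 = - z" "z ^ 6 = - \<i>" "z ^ 7 = - \<i> * z"
proof -
  have 2: "z * z = \<i>" by (simp add: z_def cis_mult)
  show "z ^ 2 = \<i>" "z ^ 3 = \<i> * z" "z ^ 4 = -1" "z ^ 5 = - z" "z ^ 6 = - \<i>" "z ^ 7 = - \<i> * z"
    using 2 by (simp_all add: eval_nat_numeral mult.assoc) (simp_all add: mult.assoc[symmetric] 2)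
qed

lemma sqrt2_times: "z * (1 - \<i>) = of_real (sqrt 2)" "z * (1 + \<i>) = \<i> * of_real (sqrt 2)" if "z = cis (pi / 4)" for z
proof -
  have "complex_of_real (sqrt 2) * of_real (sqrt 2) = 2" by (simp flip: of_real_mult)
  then show "z * (1 - \<i>) = of_real (sqrt 2)" "z * (1 + \<i>) = \<i> * of_real (sqrt 2)"
    unfolding that cis_pi_4 by (simp_all add: divide_eq_eq algebra_simps)
qed

text \<open>The even prime discriminants, settled by finite computation. Their values at odd primes
  reduce to the symbols of -1 and 2, since 4 is a square.\<close>

lemma good_character_prime_disc:
  "good_character (-4) chi_m4" "good_character 8 chi_8" "good_character (-8) (\<lambda>a. chi_m4 a * chi_8 a)"
proof -
  define z where "z = cis (pi / 4)"
  note zp = cis_pi_4_powers[folded z_def]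
  note z2 = sqrt2_times[OF z_def]
  have odd_l: "odd_prime l" if "prime l" "l \<noteq> 2" for l :: nat
    using that prime_gt_1_nat[OF that(1)] by unfold_locales auto
  have km4: "chi_m4 (int l) = kronecker (-4) l" if l: "prime l" for l
  proof (cases "l = 2")
    case False
    then interpret odd_prime l using odd_l l by simp
    have "Legendre (-4) (int l) = Legendre (-1) (int l) * (Legendre 2 (int l) * Legendre 2 (int l))"
      using Legendre_mult[of "-1" 4] Legendre_mult[of 2 2] by simp
    also have "\<dots> = Legendre (-1) (int l)" using Legendre_2 by simp
    finally show ?thesis using False Legendre_m1 p_odd
      by (auto simp: kronecker_def chi_m4_def zmod_int[symmetric, of l 4, simplified])
  qed (simp add: kronecker_def chi_m4_def)
  have k8: "chi_8 (int l) = kronecker 8 l" if l: "prime l" for l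
  proof (cases "l = 2")
    case False
    then interpret odd_prime l using odd_l l by simp
    have "Legendre 8 (int l) = Legendre 2 (int l) * (Legendre 2 (int l) * Legendre 2 (int l))"
      using Legendre_mult[of 2 4] Legendre_mult[of 2 2] by simp
    also have "\<dots> = Legendre 2 (int l)" using Legendre_2 by simp
    finally have "kronecker 8 l = (if l mod 8 \<in> {1, 7} then 1 else -1)" using False Legendre_2 by (simp add: kronecker_def)
    moreover have "int l mod 8 = int (l mod 8)" by (simp add: zmod_int)
    ultimately show ?thesis using p_odd by (auto simp: chi_8_def)
  qed (simp add: kronecker_def chi_8_def)
  have km8: "chi_m4 (int l) * chi_8 (int l) = kronecker (-8) l" if l: "prime l" for l
  proof (cases "l = 2")
    case False
    then interpret odd_prime l using odd_l l by simp
    have "Legendre (-8) (int l) * (Legendre 2 (int l) * Legendre 2 (int l)) = Legendre (-4) (int l) * Legendre 8 (int l)"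
      using Legendre_mult[of "-4" 8] Legendre_mult[of "-8" 4] Legendre_mult[of 2 2] by simp
    then show ?thesis using km4[OF l] k8[OF l] Legendre_2 False by (auto simp: kronecker_def split: if_splits)
  qed (simp add: kronecker_def chi_8_def)
  have q8: "quadratic_character D f" if D: "D = 8 \<or> D = -8" and f1: "f 1 = 1" and m: "\<And>a b. f (a * b) = f a * f b"
    and per: "\<And>a. f (a mod 8) = f a" and fm1: "f 7 = sgn D" and le: "\<And>a. \<bar>f a\<bar> \<le> 1" and ev: "\<And>a. even a \<Longrightarrow> f a = 0"
    and S: "\<And>r. r \<in> {0,1,2,3,4,5,6,7} \<Longrightarrow> of_int (f 1) * z ^ nat (1 * r mod 8) + of_int (f 3) * z ^ nat (3 * r mod 8) + of_int (f 5) * z ^ nat (5 * r mod 8) + of_int (f 7) * z ^ nat (7 * r mod 8) = of_int (f r) * csqrt (of_int D)"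
    for D f
  proof -
    have aD: "\<bar>D\<bar> = 8" using D by auto
    have "f (a + 8) = f a" for a using per[of "a + 8"] per[of a] by simp
    moreover have "f (- 1) = sgn D" using per[of "-1"] fm1 by simp
    moreover have "(\<Sum>a\<in>{0..<8}. of_int (f a) * cis (2 * pi * of_int a * of_int n / of_int 8)) = of_int (f n) * csqrt (of_int D)" for n
      by (simp only: of_int_numeral) (rule gauss_sum_mod8[OF ev per[symmetric] S z_def])
    ultimately show ?thesis unfolding quadratic_character_def aD using D f1 m le by auto
  qed
  have s8: "csqrt (of_int 8) = 2 * of_real (sqrt 2)"
  proof -
    have "sqrt 8 = sqrt (4 * 2)" by simp
    also have "\<dots> = 2 * sqrt 2" unfolding real_sqrt_mult by simp
    finally show ?thesis using csqrt_of_int[of 8] by simp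
  qed
  have sm8: "csqrt (of_int (-8)) = 2 * \<i> * of_real (sqrt 2)"
  proof -
    have "sqrt 8 = sqrt (4 * 2)" by simp
    also have "\<dots> = 2 * sqrt 2" unfolding real_sqrt_mult by simp
    finally show ?thesis using csqrt_of_int[of "-8"] by simp
  qed
  have z2': "z - \<i> * z = of_real (sqrt 2)" "z + \<i> * z = \<i> * of_real (sqrt 2)" using z2 by (simp_all add: algebra_simps)
  \<comment> \<open>With the square root of 2 rewritten in terms of \<open>z\<close>, the powers of
    \<open>z\<close> reduce by \<open>zp\<close> and both sides can be compared as expressions in
    \<open>z\<close> and \<i>.\<close>
  have e1: "of_real (sqrt 2) = z - \<i> * z" using z2' by simp
  have "quadratic_character 8 chi_8"
  proof (rule q8)
    show "chi_8 (a * b) = chi_8 a * chi_8 b" for a b by (rule chi_8_mult)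
    show "chi_8 (a mod 8) = chi_8 a" for a
    proof -
      have "even (a mod 8) = even a" by presburger
      then show ?thesis by (simp add: chi_8_def)
    qed
    fix r :: int assume "r \<in> {0,1,2,3,4,5,6,7}"
    then show "of_int (chi_8 1) * z ^ nat (1 * r mod 8) + of_int (chi_8 3) * z ^ nat (3 * r mod 8) + of_int (chi_8 5) * z ^ nat (5 * r mod 8) + of_int (chi_8 7) * z ^ nat (7 * r mod 8) = of_int (chi_8 r) * csqrt (of_int 8)"
      unfolding s8 e1 insert_iff empty_iff by (elim disjE) (simp_all add: chi_8_def zp algebra_simps)
  qed (auto simp: chi_8_def)
  with k8 show "good_character 8 chi_8" by (simp add: good_character_def)
  have "quadratic_character (-8) (\<lambda>a. chi_m4 a * chi_8 a)"
  proof (rule q8)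
    show "chi_m4 (a mod 8) * chi_8 (a mod 8) = chi_m4 a * chi_8 a" for a
    proof -
      have "a mod 8 mod 4 = a mod 4" by (simp add: mod_mod_cancel)
      moreover have "even (a mod 8) = even a" by presburger
      ultimately show ?thesis by (simp add: chi_8_def chi_m4_def)
    qed
    show "chi_m4 (a * b) * chi_8 (a * b) = chi_m4 a * chi_8 a * (chi_m4 b * chi_8 b)" for a b
      by (simp add: chi_m4_mult chi_8_mult)
    fix r :: int assume "r \<in> {0,1,2,3,4,5,6,7}"
    then show "of_int (chi_m4 1 * chi_8 1) * z ^ nat (1 * r mod 8) + of_int (chi_m4 3 * chi_8 3) * z ^ nat (3 * r mod 8) + of_int (chi_m4 5 * chi_8 5) * z ^ nat (5 * r mod 8) + of_int (chi_m4 7 * chi_8 7) * z ^ nat (7 * r mod 8) = of_int (chi_m4 r * chi_8 r) * csqrt (of_int (-8))"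
      unfolding sm8 e1 insert_iff empty_iff by (elim disjE) (simp_all add: chi_m4_def chi_8_def zp algebra_simps)
  qed (auto simp: chi_8_def chi_m4_def)
  with km8 show "good_character (-8) (\<lambda>a. chi_m4 a * chi_8 a)" by (simp add: good_character_def)
  have "quadratic_character (-4) chi_m4"
    unfolding quadratic_character_def
  proof (intro conjI allI)
    show "chi_m4 (a * b) = chi_m4 a * chi_m4 b" for a b by (rule chi_m4_mult)
    show "chi_m4 (a + \<bar>- 4\<bar>) = chi_m4 a" for a by (simp add: chi_m4_def)
    fix n :: int
    \<comment> \<open>Fourth roots of unity are written as even powers of the eighth root
      \<open>z\<close>, so the same table of powers serves.\<close>
    have c: "cis (2 * pi * of_int a * of_int n / of_int \<bar>- 4\<bar>) = z ^ nat ((2 * a * (n mod 8)) mod 8)" for a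
      using cis_mod8[of "2 * a" n] by (simp add: z_def mod_mult_right_eq)
    have set: "{0..<\<bar>- 4::int\<bar>} = {0,1,2,3}" by auto
    have cs: "csqrt (of_int (-4)) = 2 * \<i>" using csqrt_of_int[of "-4"] real_sqrt_abs[of 2] by simp
    have per: "chi_m4 n = chi_m4 (n mod 8)"
    proof -
      have "even (n mod 8) = even n" by presburger
      then show ?thesis by (simp add: chi_m4_def mod_mod_cancel)
    qed
    have eq: "(\<Sum>a\<in>{0..<\<bar>- 4\<bar>}. of_int (chi_m4 a) * cis (2 * pi * of_int a * of_int n / of_int \<bar>- 4\<bar>)) =
       (\<Sum>a\<in>{0,1,2,3}. of_int (chi_m4 a) * z ^ nat ((2 * a * (n mod 8)) mod 8))"
      unfolding c set ..
    have "{0..<8::int} = {0,1,2,3,4,5,6,7}" by auto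
    then have r: "n mod 8 \<in> {0,1,2,3,4,5,6,7}" by (metis atLeastLessThan_iff pos_mod_bound pos_mod_sign zero_less_numeral)
    show "(\<Sum>a\<in>{0..<\<bar>- 4\<bar>}. of_int (chi_m4 a) * cis (2 * pi * of_int a * of_int n / of_int \<bar>- 4\<bar>)) = of_int (chi_m4 n) * csqrt (of_int (-4))"
      unfolding eq cs per using r unfolding insert_iff empty_iff by (elim disjE) (simp_all add: chi_m4_def zp)
  qed (auto simp: chi_m4_def)
  with km4 show "good_character (-4) chi_m4" by (simp add: good_character_def)
qed

definition disc_of :: "int \<Rightarrow> int" where "disc_of d = (if d mod 4 = 1 then d else 4 * d)"

text \<open>Induction over the odd primes. Splitting off \<open>pstar\<close> instead of
  \<open>p\<close> may change the sign of the remaining factor, so all four values of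
  \<open>d0\<close> have to be carried along at once.\<close>

lemma good_character_exists_aux:
  assumes "finite P" "\<And>p. p \<in> P \<Longrightarrow> prime p \<and> p \<noteq> 2"
  shows "\<forall>d0 \<in> {1, -1, 2, -2}. \<exists>chi. good_character (disc_of (d0 * int (\<Prod>P))) chi"
  using assms
proof (induction P rule: finite_induct)
  case empty
  then show ?case using good_character_1 good_character_prime_disc by (auto simp: disc_of_def)
next
  case (insert p P)
  interpret odd_prime p using insert.prems[of p] prime_gt_1_nat[of p] by unfold_locales auto
  show ?case
  proof
    fix d0 :: int assume d0: "d0 \<in> {1, -1, 2, -2}"
    define s :: int where "s = (if p mod 4 = 1 then 1 else -1)"
    define d where "d = d0 * s * int (\<Prod>P)"
    have "d0 * s \<in> {1, -1, 2, -2}" using d0 by (auto simp: s_def)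
    with insert obtain chi where chi: "good_character (disc_of d) chi" unfolding d_def by blast
    have pr: "d * pstar = d0 * int (\<Prod>(insert p P))"
      using insert.hyps by (simp add: d_def s_def pstar_def)
    have "\<not> p dvd \<Prod>P"
    proof
      assume "p dvd \<Prod>P"
      then obtain x where "x \<in> P" "p dvd x" using p insert.hyps(1) prime_dvd_prod_iff[of P p "\<lambda>x. x"] by auto
      then have "p = x" using primes_dvd_imp_eq[OF p] insert.prems[of x] by auto
      then show False using \<open>x \<in> P\<close> insert.hyps by simp
    qed
    then have "coprime p (\<Prod>P)" by (rule prime_imp_coprime[OF p])
    then have "coprime (\<Prod>P) p" by (simp only: coprime_commute)
    then have c1: "coprime (int (\<Prod>P)) (int p)" unfolding coprime_int_iff .
    have c2: "coprime (2::int) (int p)" using p_odd by simp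
    have "coprime d0 (int p)" using d0 c2 by auto
    moreover have "coprime s (int p)" by (simp add: s_def)
    ultimately have cd: "coprime d (int p)" using c1 by (simp add: d_def)
    have "coprime 4 (int p)" using c2 by (metis coprime_mult_left_iff mult_2 numeral_Bit0 numeral_times_numeral semiring_norm(13) coprime_power_left_iff power2_eq_square)
    then have cop: "coprime (disc_of d) (int p)" using cd by (simp add: disc_of_def)
    have "good_character (disc_of d * pstar) (\<lambda>n. chi n * Legendre n (int p))"
      by (rule good_character_mult_Legendre[OF chi cop]) (auto simp: disc_of_def)
    \<comment> \<open>\<open>pstar\<close> is 1 modulo 4, so multiplying by it preserves the residue
      class modulo 4 that decides about the factor 4.\<close>
    moreover have "disc_of d * pstar = disc_of (d * pstar)"
    proof -
      have "(d * pstar) mod 4 = (d mod 4 * 1) mod 4" by (rule mod_mult_vals[OF refl pstar_mod4])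
      then show ?thesis by (simp add: disc_of_def)
    qed
    ultimately show "\<exists>chi. good_character (disc_of (d0 * int (\<Prod>(insert p P)))) chi" unfolding pr by metis
  qed
qed

text \<open>Being squarefree, \<open>d\<close> is the product of its sign, possibly 2, and distinct
  odd primes.\<close>

lemma good_character_exists:
  assumes sf: "squarefree (d::int)"
  shows "\<exists>chi. good_character (disc_of d) chi"
proof -
  have d: "d \<noteq> 0" using sf by auto
  define m where "m = nat \<bar>d\<bar>"
  have m: "m \<noteq> 0" "int m = \<bar>d\<bar>" using d by (auto simp: m_def)
  have sfm: "squarefree m"
    unfolding squarefree_def
  proof (intro allI impI)
    fix x assume "x\<^sup>2 dvd m"
    then have "int (x\<^sup>2) dvd int m" by (simp only: int_dvd_int_iff)
    then have "(int x)\<^sup>2 dvd d" using m by simp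
    then have "is_unit (int x)" using sf unfolding squarefree_def by blast
    then show "is_unit x" by simp
  qed
  have pm: "\<Prod>(prime_factors m) = m"
  proof -
    have "m = (\<Prod>p\<in>prime_factors m. p ^ multiplicity p m)" using m by (simp add: prime_factorization_nat)
    also have "\<dots> = (\<Prod>p\<in>prime_factors m. p)"
    proof (rule prod.cong[OF refl])
      fix p assume p: "p \<in> prime_factors m"
      then have "multiplicity p m = 1"
        using squarefree_factorial_semiring''[OF m(1)] sfm prime_factors_multiplicity[of m] by (auto simp: le_Suc_eq)
      then show "p ^ multiplicity p m = p" by simp
    qed
    finally show ?thesis by simp
  qed
  define P where "P = prime_factors m - {2}"
  have P: "finite P" "\<And>p. p \<in> P \<Longrightarrow> prime p \<and> p \<noteq> 2" by (auto simp: P_def)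
  define e :: nat where "e = (if 2 \<in> prime_factors m then 2 else 1)"
  have "m = e * \<Prod>P"
  proof (cases "2 \<in> prime_factors m")
    case True
    then show ?thesis using pm prod.remove[of "prime_factors m" 2 "\<lambda>x. x"] by (simp add: e_def P_def)
  next
    case False
    then show ?thesis using pm by (simp add: e_def P_def)
  qed
  then have "d = (sgn d * int e) * int (\<Prod>P)"
    using m by (metis mult.assoc mult_sgn_abs mult.commute of_nat_mult)
  moreover have "sgn d * int e \<in> {1, -1, 2, -2}" using d by (auto simp: e_def sgn_if)
  ultimately show ?thesis using good_character_exists_aux[OF P] by metis
qed

subsection \<open>The approximate functional equation for Dirichlet series\<close>

text \<open>Converts sums over a set of naturals into ordinary series, for which dominated termwise
  integration is available.\<close>

lemma infsum_nat_eq_suminf: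
  fixes f :: "nat \<Rightarrow> 'a::banach"
  assumes "(\<lambda>k. norm (f k)) summable_on K"
  shows "infsum f K = (\<Sum>k. if k \<in> K then f k else 0)"
    and "summable (\<lambda>k. norm (if k \<in> K then f k else 0))"
proof -
  have "(\<lambda>k. norm (if k \<in> K then f k else 0)) summable_on UNIV"
  proof -
    have "((\<lambda>k. norm (if k \<in> K then f k else 0)) summable_on UNIV) = ((\<lambda>k. norm (f k)) summable_on K)"
      by (rule summable_on_cong_neutral) auto
    then show ?thesis using assms by simp
  qed
  then show s: "summable (\<lambda>k. norm (if k \<in> K then f k else 0))" by (rule summable_on_imp_summable)
  have "infsum f K = infsum (\<lambda>k. if k \<in> K then f k else 0) UNIV"
    by (rule infsum_cong_neutral) auto
  also have "((\<lambda>k. if k \<in> K then f k else 0) has_sum (\<Sum>k. if k \<in> K then f k else 0)) UNIV"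
    by (intro norm_summable_imp_has_sum s summable_sums summable_norm_cancel[OF s])
  then have "infsum (\<lambda>k. if k \<in> K then f k else 0) UNIV = (\<Sum>k. if k \<in> K then f k else 0)" by (rule infsumI)
  finally show "infsum f K = (\<Sum>k. if k \<in> K then f k else 0)" .
qed

text \<open>The majorant separates into a summable factor in \<open>k\<close> and an integrable
  factor in \<open>t\<close>, as happens on a vertical line where the modulus of \<open>k\<close> to
  the power \<open>- (w + u)\<close> is independent of \<open>t\<close>.\<close>

lemma integral_infsum_nat:
  fixes h :: "nat \<Rightarrow> real \<Rightarrow> complex" and g :: "real \<Rightarrow> complex"
  assumes hm: "\<And>k. k \<in> K \<Longrightarrow> h k \<in> borel_measurable lborel"
    and hb: "\<And>k t. k \<in> K \<Longrightarrow> norm (h k t) \<le> M k * norm (g t)"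
    and M0: "\<And>k. k \<in> K \<Longrightarrow> M k \<ge> 0" and M: "M summable_on K" and g: "integrable lborel g"
  shows "integrable lborel (\<lambda>t. \<Sum>\<^sub>\<infinity>k\<in>K. h k t)"
    and "(\<integral>t. (\<Sum>\<^sub>\<infinity>k\<in>K. h k t) \<partial>lborel) = (\<Sum>\<^sub>\<infinity>k\<in>K. \<integral>t. h k t \<partial>lborel)"
proof -
  define H where "H k t = (if k \<in> K then h k t else 0)" for k t
  define N where "N k = (if k \<in> K then M k else 0)" for k
  have nM: "(\<lambda>k. norm (M k)) summable_on K"
    using M by (rule summable_on_cong[THEN iffD1, rotated]) (auto simp: M0)
  have Ns: "summable N" using infsum_nat_eq_suminf(2)[OF nM] by (simp add: N_def[abs_def] summable_norm_cancel)
  have N0: "N k \<ge> 0" for k using M0 by (simp add: N_def)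
  have Hb: "norm (H k t) \<le> N k * norm (g t)" for k t using hb by (simp add: H_def N_def)
  have hi: "integrable lborel (h k)" if "k \<in> K" for k
  proof (rule Bochner_Integration.integrable_bound)
    show "integrable lborel (\<lambda>t. M k * norm (g t))" using g by (intro integrable_mult_right integrable_norm)
    show "AE t in lborel. norm (h k t) \<le> norm (M k * norm (g t))"
      using hb[OF that] M0[OF that] by (intro AE_I2) simp
  qed (rule hm[OF that])
  have Hi: "integrable lborel (H k)" for k
    using hi by (cases "k \<in> K") (auto simp: H_def[abs_def])
  have sm: "summable (\<lambda>k. norm (H k t))" for t
    by (rule summable_comparison_test'[where N = 0, OF summable_mult2[OF Ns, of "norm (g t)"]]) (use Hb in simp)
  have si: "summable (\<lambda>k. \<integral>t. norm (H k t) \<partial>lborel)"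
  proof (rule summable_comparison_test'[where N = 0, OF summable_mult2[OF Ns, of "\<integral>t. norm (g t) \<partial>lborel"]])
    fix k
    have "(\<integral>t. norm (H k t) \<partial>lborel) \<le> (\<integral>t. N k * norm (g t) \<partial>lborel)"
      by (intro integral_mono integrable_mult_right integrable_norm Hi g Hb)
    then show "norm (\<integral>t. norm (H k t) \<partial>lborel) \<le> N k * (\<integral>t. norm (g t) \<partial>lborel)"
      by simp
  qed
  have e1: "(\<Sum>\<^sub>\<infinity>k\<in>K. h k t) = (\<Sum>k. H k t)" for t
  proof -
    have "(\<lambda>k. norm (h k t)) summable_on K"
      by (rule summable_on_comparison_test[OF summable_on_cmult_left[OF M, of "norm (g t)"]]) (use hb in auto)
    from infsum_nat_eq_suminf(1)[OF this] show ?thesis by (simp add: H_def)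
  qed
  show "integrable lborel (\<lambda>t. \<Sum>\<^sub>\<infinity>k\<in>K. h k t)"
    unfolding e1 by (rule integrable_suminf) (use Hi sm si in auto)
  have "(\<integral>t. (\<Sum>\<^sub>\<infinity>k\<in>K. h k t) \<partial>lborel) = (\<Sum>k. \<integral>t. H k t \<partial>lborel)"
    unfolding e1 by (rule integral_suminf) (use Hi sm si in auto)
  also have "\<dots> = (\<Sum>\<^sub>\<infinity>k\<in>K. \<integral>t. h k t \<partial>lborel)"
  proof -
    have "(\<lambda>k. norm (\<integral>t. h k t \<partial>lborel)) summable_on K"
    proof (rule summable_on_comparison_test[OF summable_on_cmult_left[OF M, of "\<integral>t. norm (g t) \<partial>lborel"]])
      fix k assume k: "k \<in> K"
      have "norm (\<integral>t. h k t \<partial>lborel) \<le> (\<integral>t. M k * norm (g t) \<partial>lborel)"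
        by (intro Bochner_Integration.integral_norm_bound_integral integrable_mult_right integrable_norm hi[OF k] g hb[OF k])
      then show "norm (\<integral>t. h k t \<partial>lborel) \<le> M k * (\<integral>t. norm (g t) \<partial>lborel)" by simp
    qed auto
    moreover have "(\<integral>t. H k t \<partial>lborel) = (if k \<in> K then \<integral>t. h k t \<partial>lborel else 0)" for k by (simp add: H_def)
    ultimately show ?thesis by (simp add: infsum_nat_eq_suminf(1))
  qed
  finally show "(\<integral>t. (\<Sum>\<^sub>\<infinity>k\<in>K. h k t) \<partial>lborel) = (\<Sum>\<^sub>\<infinity>k\<in>K. \<integral>t. h k t \<partial>lborel)" .
qed

lemma summable_on_powr:
  fixes x :: real
  assumes "x > 1"
  shows "(\<lambda>k::nat. real k powr (- x)) summable_on K"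
proof -
  have "summable (\<lambda>k. norm (real k powr (- x)))" using assms summable_real_powr_iff[of "- x"] by simp
  then have "(\<lambda>k. real k powr (- x)) summable_on UNIV" by (rule norm_summable_imp_summable_on)
  then show ?thesis by (rule summable_on_subset_banach) simp
qed

text \<open>Isolates what the contour argument knows about the Dirichlet series: finitely many
  \<open>f\<close>, coefficients bounded by 1, and its identity with \<open>L\<close> in the
  half-plane of absolute convergence. The arithmetic is supplied by the interpretation for
  \<open>Limp\<close>.\<close>

locale dirichlet_family =
  fixes L :: "complex \<Rightarrow> complex" and I K :: "nat set" and c :: "nat \<Rightarrow> nat \<Rightarrow> complex"
  assumes finI: "finite I" and I0: "0 \<notin> I" and K0: "0 \<notin> K"
    and cb: "norm (c f k) \<le> 1"
    and series: "Re w > 1 \<Longrightarrow> L w = (\<Sum>f\<in>I. of_nat f powr (1 - 2 * w) * (\<Sum>\<^sub>\<infinity>k\<in>K. c f k * of_nat k powr (- w)))"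
begin

text \<open>Termwise integration on a line inside the half-plane of absolute convergence. With
  \<open>X = A\<close> at \<open>s\<close> it produces the first sum, with \<open>X = 1 / A\<close>
  at \<open>1 - s\<close> the second.\<close>

lemma integral_dirichlet_series:
  fixes w :: complex and X \<sigma> :: real and g :: "real \<Rightarrow> complex"
  assumes g: "integrable lborel g" and X: "X > 0" and w: "Re w + \<sigma> > 1"
  shows "(\<integral>t. g t * (L (w + Complex \<sigma> t) * of_real X powr Complex \<sigma> t) \<partial>lborel) =
    (\<Sum>f\<in>I. \<Sum>\<^sub>\<infinity>k\<in>K. 1 / (of_nat k powr w * of_nat f powr (2 * w - 1)) * c f k *
       (\<integral>t. g t * of_real (real k * real f ^ 2 / X) powr (- Complex \<sigma> t) \<partial>lborel))"
proof -
  have gm [measurable]: "g \<in> borel_measurable borel" using g by (auto dest: borel_measurable_integrable)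
  define h where "h f k t = 1 / (of_nat k powr w * of_nat f powr (2 * w - 1)) * c f k *
       (g t * of_real (real k * real f ^ 2 / X) powr (- Complex \<sigma> t))" for f k t
  have pos: "real k > 0" "real f > 0" "real k * real f ^ 2 / X > 0" if "f \<in> I" "k \<in> K" for f k
  proof -
    have "k \<noteq> 0" by (cases "k = 0") (use that K0 in auto)
    moreover have "f \<noteq> 0" by (cases "f = 0") (use that I0 in auto)
    ultimately show "real k > 0" "real f > 0" "real k * real f ^ 2 / X > 0" using X by auto
  qed
  have hm: "h f k \<in> borel_measurable lborel" if fk: "f \<in> I" "k \<in> K" for f k
  proof -
    have "continuous_on UNIV (\<lambda>t. exp (- Complex \<sigma> t * of_real (ln (real k * real f ^ 2 / X))))"
      unfolding Complex_eq by (intro continuous_intros)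
    from borel_measurable_continuous_onI[OF this]
    have [measurable]: "(\<lambda>t. exp (- Complex \<sigma> t * of_real (ln (real k * real f ^ 2 / X)))) \<in> borel_measurable borel" .
    show ?thesis unfolding h_def[abs_def] of_real_powr[OF pos(3)[OF fk]] by measurable
  qed
  \<comment> \<open>The modulus of a term, freed from \<open>t\<close>: its dependence on
    \<open>k\<close> is the power \<open>- (Re w + \<sigma>)\<close>, which is below -1.\<close>
  define M where "M f k = real f powr (1 - 2 * Re w) * (real f ^ 2 / X) powr (- \<sigma>) * real k powr (- (Re w + \<sigma>))" for f k :: nat
  have hb: "norm (h f k t) \<le> M f k * norm (g t)" if fk: "f \<in> I" "k \<in> K" for f k t
  proof -
    note p = pos[OF fk]
    have f2: "real f ^ 2 / X > 0" using p X by simp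
    have "norm (of_nat k powr w :: complex) = real k powr Re w" using norm_of_real_powr[OF p(1), of w] by simp
    moreover have "norm (of_nat f powr (2 * w - 1) :: complex) = real f powr (2 * Re w - 1)" using norm_of_real_powr[OF p(2), of "2 * w - 1"] by simp
    moreover have "norm (of_real (real k * real f ^ 2 / X) powr (- Complex \<sigma> t)) = (real k * (real f ^ 2 / X)) powr (- \<sigma>)"
      using norm_of_real_powr[OF p(3), of "- Complex \<sigma> t"] by simp
    ultimately have "norm (h f k t) = 1 / (real k powr Re w * real f powr (2 * Re w - 1)) * norm (c f k) * (norm (g t) * (real k * (real f ^ 2 / X)) powr (- \<sigma>))"
      by (simp add: h_def norm_mult norm_divide)
    also have "\<dots> \<le> 1 / (real k powr Re w * real f powr (2 * Re w - 1)) * 1 * (norm (g t) * (real k * (real f ^ 2 / X)) powr (- \<sigma>))"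
      using cb by (intro mult_right_mono mult_left_mono) auto
    also have "(real k * (real f ^ 2 / X)) powr (- \<sigma>) = real k powr (- \<sigma>) * (real f ^ 2 / X) powr (- \<sigma>)"
    proof -
      have "(a * b) powr c = a powr c * b powr c" if "a > 0" "b > 0" for a b c :: real
        using that by (simp add: powr_def ln_mult exp_add[symmetric] distrib_left)
      from this[OF p(1) f2] show ?thesis .
    qed
    also have "1 / (real k powr Re w * real f powr (2 * Re w - 1)) = real k powr (- Re w) * real f powr (1 - 2 * Re w)"
    proof -
      have "real f powr (1 - 2 * Re w) = inverse (real f powr (2 * Re w - 1))"
        using powr_minus[of "real f" "2 * Re w - 1"] by simp
      then show ?thesis by (simp add: powr_minus divide_inverse)
    qed
    also have "real k powr (- Re w) * real f powr (1 - 2 * Re w) * 1 * (norm (g t) * (real k powr (- \<sigma>) * (real f ^ 2 / X) powr (- \<sigma>))) =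
       real f powr (1 - 2 * Re w) * (real f ^ 2 / X) powr (- \<sigma>) * (real k powr (- Re w) * real k powr (- \<sigma>)) * norm (g t)" by simp
    also have "real k powr (- Re w) * real k powr (- \<sigma>) = real k powr (- (Re w + \<sigma>))"
      by (simp add: powr_add[symmetric])
    finally show ?thesis by (simp add: M_def)
  qed
  have Ms: "M f summable_on K" for f
    unfolding M_def[abs_def] by (intro summable_on_cmult_right summable_on_powr w)
  have M0: "M f k \<ge> 0" for f k by (simp add: M_def)
  note ex = integral_infsum_nat[of K "h f" "M f" g for f, OF hm hb M0 Ms g]
  have pt: "g t * (L (w + Complex \<sigma> t) * of_real X powr Complex \<sigma> t) = (\<Sum>f\<in>I. \<Sum>\<^sub>\<infinity>k\<in>K. h f k t)" for t
  proof -
    define u where "u = Complex \<sigma> t"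
    have "L (w + u) = (\<Sum>f\<in>I. of_nat f powr (1 - 2 * (w + u)) * (\<Sum>\<^sub>\<infinity>k\<in>K. c f k * of_nat k powr (- (w + u))))"
      by (rule series) (use w in \<open>simp add: u_def\<close>)
    then have "g t * (L (w + u) * of_real X powr u) = (\<Sum>f\<in>I. (g t * of_real X powr u * of_nat f powr (1 - 2 * (w + u))) * (\<Sum>\<^sub>\<infinity>k\<in>K. c f k * of_nat k powr (- (w + u))))"
      by (simp add: sum_distrib_left sum_distrib_right mult_ac)
    also have "\<dots> = (\<Sum>f\<in>I. \<Sum>\<^sub>\<infinity>k\<in>K. h f k t)"
    proof (rule sum.cong[OF refl])
      fix f assume f: "f \<in> I"
      have "h f k t = (g t * of_real X powr u * of_nat f powr (1 - 2 * (w + u))) * (c f k * of_nat k powr (- (w + u)))" if k: "k \<in> K" for k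
      proof -
        note p = pos[OF f k]
        have l: "ln (real k * real f ^ 2 / X) = ln (real k) + 2 * ln (real f) - ln X"
          using p X by (simp add: ln_mult ln_div ln_realpow)
        have 1: "of_nat k powr z = exp (z * of_real (ln (real k)))" for z :: complex using of_real_powr[OF p(1), of z] by simp
        have 2: "of_nat f powr z = exp (z * of_real (ln (real f)))" for z :: complex using of_real_powr[OF p(2), of z] by simp
        have "1 / (of_nat k powr w * of_nat f powr (2 * w - 1)) = exp (- (w * of_real (ln (real k))) - (2 * w - 1) * of_real (ln (real f)))"
          unfolding 1 2 by (simp add: exp_diff exp_minus divide_inverse)
        then have "h f k t = c f k * g t * (exp (- (w * of_real (ln (real k))) - (2 * w - 1) * of_real (ln (real f))) * exp (- u * of_real (ln (real k) + 2 * ln (real f) - ln X)))"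
          unfolding h_def u_def[symmetric] of_real_powr[OF p(3)] l by simp
        also have "exp (- (w * of_real (ln (real k))) - (2 * w - 1) * of_real (ln (real f))) * exp (- u * of_real (ln (real k) + 2 * ln (real f) - ln X)) =
          exp (u * of_real (ln X)) * (exp ((1 - 2 * (w + u)) * of_real (ln (real f))) * exp (- (w + u) * of_real (ln (real k))))"
          unfolding exp_add[symmetric] by (rule arg_cong[of _ _ exp]) (simp add: algebra_simps)
        finally show ?thesis unfolding 1 2 of_real_powr[OF X] by (simp add: mult_ac)
      qed
      then have "(\<Sum>\<^sub>\<infinity>k\<in>K. h f k t) = (\<Sum>\<^sub>\<infinity>k\<in>K. (g t * of_real X powr u * of_nat f powr (1 - 2 * (w + u))) * (c f k * of_nat k powr (- (w + u))))"
        by (rule infsum_cong)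
      then show "(g t * of_real X powr u * of_nat f powr (1 - 2 * (w + u))) * (\<Sum>\<^sub>\<infinity>k\<in>K. c f k * of_nat k powr (- (w + u))) = (\<Sum>\<^sub>\<infinity>k\<in>K. h f k t)"
        by (simp only: infsum_cmult_right')
    qed
    finally show ?thesis unfolding u_def .
  qed
  have "(\<integral>t. g t * (L (w + Complex \<sigma> t) * of_real X powr Complex \<sigma> t) \<partial>lborel) = (\<integral>t. (\<Sum>f\<in>I. \<Sum>\<^sub>\<infinity>k\<in>K. h f k t) \<partial>lborel)"
    unfolding pt ..
  also have "\<dots> = (\<Sum>f\<in>I. \<integral>t. (\<Sum>\<^sub>\<infinity>k\<in>K. h f k t) \<partial>lborel)"
    by (rule Bochner_Integration.integral_sum) (rule ex(1))
  also have "\<dots> = (\<Sum>f\<in>I. \<Sum>\<^sub>\<infinity>k\<in>K. \<integral>t. h f k t \<partial>lborel)"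
    by (rule sum.cong[OF refl]) (rule ex(2))
  finally show ?thesis by (simp only: h_def integral_mult_right_zero)
qed

text \<open>The functional equation is demanded for \<open>Re w < 0\<close> because it is applied at
  \<open>s - u\<close> with \<open>Re u = \<sigma>\<close>, whose real part
  \<open>Re s - \<sigma>\<close> is negative. The two conditions on \<sigma> put
  \<open>s + u\<close> and \<open>1 - s + u\<close> in the half-plane of convergence, and their sum
  gives \<sigma> > 0.\<close>

lemma approximate_functional_equation:
  fixes W :: "complex \<Rightarrow> complex" and s :: complex and A \<sigma> :: real
  assumes hol: "L holomorphic_on UNIV"
    and growth: "\<And>a b. \<exists>C\<ge>0. \<forall>x\<in>{a..b}. \<forall>y. norm (L (Complex x y)) \<le> C * exp (17/20 * \<bar>y\<bar>)"
    and fe: "\<And>w. Re w < 0 \<Longrightarrow> L w = W w * L (1 - w)"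
    and A: "A > 0" and \<sigma>: "\<sigma> + Re s > 1" "\<sigma> + Re (1 - s) > 1"
    and Wc: "continuous_on UNIV (\<lambda>t. W (s - Complex \<sigma> t))"
    and Wb: "\<And>t. norm (W (s - Complex \<sigma> t)) \<le> B * exp (17/20 * \<bar>t\<bar>)"
  shows "L s = (\<Sum>f\<in>I. \<Sum>\<^sub>\<infinity>k\<in>K. 1 / (of_nat k powr s * of_nat f powr (2 * s - 1)) * c f k * of_real (Fcut (real k * real f ^ 2 / A)))
     + (\<Sum>f\<in>I. \<Sum>\<^sub>\<infinity>k\<in>K. 1 / (of_nat k powr (1 - s) * of_nat f powr (1 - 2 * s)) * c f k *
       (1 / (2 * pi) * (\<integral>t. Fmellin (Complex \<sigma> t) * W (s - Complex \<sigma> t) * of_real (real k * real f ^ 2 * A) powr (- Complex \<sigma> t) \<partial>lborel)))"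
proof -
  have s0: "\<sigma> > 0" using \<sigma> by simp
  have k0: "k0 > 0" by (rule bessel2_real(2))
  define R where "R = \<bar>Re s\<bar> + \<sigma>"
  obtain C where C: "C \<ge> 0" "\<And>x y. x \<in> {-R..R} \<Longrightarrow> norm (L (Complex x y)) \<le> C * exp (17/20 * \<bar>y\<bar>)"
    using growth[of "-R" R] by blast
  define E where "E = C * exp (17/20 * \<bar>Im s\<bar>)"
  have E: "E \<ge> 0" using C by (simp add: E_def)
  have Lb: "norm (L (s + Complex x y)) \<le> E * exp (17/20 * \<bar>y\<bar>)" if "\<bar>x\<bar> \<le> \<sigma>" for x y
  proof -
    have "s + Complex x y = Complex (Re s + x) (Im s + y)" by (simp add: complex_eq_iff)
    then have "norm (L (s + Complex x y)) \<le> C * exp (17/20 * \<bar>Im s + y\<bar>)"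
      using that by (simp only:) (intro C(2), auto simp: R_def)
    also have "\<dots> \<le> C * exp (17/20 * \<bar>Im s\<bar> + 17/20 * \<bar>y\<bar>)"
      using C(1) abs_triangle_ineq[of "Im s" y] by (intro mult_left_mono) auto
    finally show ?thesis by (simp add: E_def exp_add mult_ac)
  qed
  define Am where "Am = exp (\<sigma> * \<bar>ln A\<bar>)"
  have Apow: "norm (of_real A powr Complex x y) \<le> Am" if "\<bar>x\<bar> \<le> \<sigma>" for x y
  proof -
    have "x * ln A \<le> \<bar>x\<bar> * \<bar>ln A\<bar>" using abs_ge_self[of "x * ln A"] by (simp add: abs_mult)
    also have "\<dots> \<le> \<sigma> * \<bar>ln A\<bar>" using that by (intro mult_right_mono) auto
    finally show ?thesis unfolding of_real_powr[OF A] norm_exp_eq_Re Am_def by simp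
  qed
  \<comment> \<open>Dividing by \<open>k0\<close>, the value of \<open>bessel2\<close> at 0,
    normalises the residue at 0 to \<open>L s\<close>.\<close>
  define \<phi> where "\<phi> u = L (s + u) * of_real A powr u / of_real k0" for u
  have \<phi>hol: "\<phi> holomorphic_on UNIV"
  proof -
    have "(\<lambda>u. L (s + u)) holomorphic_on UNIV"
      by (rule holomorphic_on_compose_gen[OF _ hol, unfolded o_def]) (auto intro!: holomorphic_intros)
    moreover have "(\<lambda>u. of_real A powr u) holomorphic_on UNIV"
      unfolding of_real_powr[OF A] by (intro holomorphic_intros)
    ultimately show ?thesis unfolding \<phi>_def using k0 by (intro holomorphic_on_divide holomorphic_on_mult holomorphic_on_const) auto
  qed
  define P where "P = E * Am / k0"
  have P: "P \<ge> 0" using E k0 by (simp add: P_def Am_def)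
  have \<phi>b: "norm (\<phi> (Complex x y)) \<le> P * exp (17/20 * \<bar>y\<bar>)" if "\<bar>x\<bar> \<le> \<sigma>" for x y
  proof -
    have "norm (\<phi> (Complex x y)) \<le> (E * exp (17/20 * \<bar>y\<bar>)) * Am / k0"
      unfolding \<phi>_def norm_divide norm_mult using k0 E Lb[OF that] Apow[OF that]
      by (simp add: divide_right_mono mult_mono)
    then show ?thesis by (simp add: P_def mult_ac)
  qed
  have contline: "continuous_on UNIV (\<lambda>t. \<phi> (Complex x t))" for x
    by (rule continuous_on_compose2[OF holomorphic_on_imp_continuous_on[OF \<phi>hol]]) (auto simp: Complex_eq intro!: continuous_intros)
  define h where "h u = bessel2 u * \<phi> u" for u
  have hq: "h (Complex x t) / Complex x t = bessel2 (Complex x t) / Complex x t * \<phi> (Complex x t)" for x t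
    by (simp add: h_def)
  have shift: "(\<integral>t. h (Complex \<sigma> t) / Complex \<sigma> t \<partial>lborel) - (\<integral>t. h (Complex (-\<sigma>) t) / Complex (-\<sigma>) t \<partial>lborel) = 2 * pi * h 0"
  proof (rule vertical_line_shift_pole)
    show "h holomorphic_on UNIV" unfolding h_def by (intro holomorphic_on_mult holomorphic_bessel2 \<phi>hol)
    show "integrable lborel (\<lambda>t. h (Complex (-\<sigma>) t) / Complex (-\<sigma>) t)"
      unfolding hq by (rule integrable_bessel2_line[of "-\<sigma>" "17/20" _ P]) (use s0 contline \<phi>b in auto)
    show "integrable lborel (\<lambda>t. h (Complex \<sigma> t) / Complex \<sigma> t)"
      unfolding hq by (rule integrable_bessel2_line[of \<sigma> "17/20" _ P]) (use s0 contline \<phi>b in auto)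
    obtain Cb where Cb: "Cb \<ge> 0" "\<And>x y. \<bar>x\<bar> \<le> \<sigma> \<Longrightarrow> norm (bessel2 (Complex x y)) \<le> Cb * exp (- \<bar>y\<bar>)"
      using bessel2_decay[of \<sigma>] s0 by auto
    fix e :: real assume e: "e > 0"
    \<comment> \<open>\<open>3/20\<close> is the surplus of the decay rate 1 of the kernel over the
      growth rate \<open>17/20\<close> of \<open>L\<close>.\<close>
    have "((\<lambda>T. Cb * P * exp (- (3/20) * T)) \<longlongrightarrow> Cb * P * 0) at_top"
      by (intro tendsto_mult tendsto_const) real_asymp
    then have "\<forall>\<^sub>F T in at_top. Cb * P * exp (- (3/20) * T) < e" using e by (intro order_tendstoD) auto
    then show "\<forall>\<^sub>F T in at_top. \<forall>x\<in>{-\<sigma>..\<sigma>}. norm (h (Complex x T) / Complex x T) \<le> e \<and> norm (h (Complex x (-T)) / Complex x (-T)) \<le> e"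
      using eventually_ge_at_top[of 1]
    proof eventually_elim
      case (elim T)
      have "norm (h (Complex x y) / Complex x y) \<le> e" if x: "x \<in> {-\<sigma>..\<sigma>}" and y: "\<bar>y\<bar> = T" for x y
      proof -
        have x': "\<bar>x\<bar> \<le> \<sigma>" using x by auto
        have "norm (Complex x y) \<ge> 1" using abs_Im_le_cmod[of "Complex x y"] y elim by simp
        then have "norm (h (Complex x y) / Complex x y) \<le> norm (h (Complex x y)) / 1"
          unfolding norm_divide by (intro divide_left_mono) auto
        also have "\<dots> \<le> (Cb * exp (- \<bar>y\<bar>)) * (P * exp (17/20 * \<bar>y\<bar>))"
          unfolding h_def norm_mult using Cb(2)[OF x', of y] \<phi>b[OF x', of y] Cb(1) by (simp add: mult_mono)
        also have "\<dots> = Cb * P * (exp (- \<bar>y\<bar>) * exp (17/20 * \<bar>y\<bar>))" by simp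
        also have "exp (- \<bar>y\<bar>) * exp (17/20 * \<bar>y\<bar>) = exp (- (3/20) * T)" unfolding y exp_add[symmetric] by simp
        finally show ?thesis using elim by linarith
      qed
      note * = this
      show ?case using elim(2) by (intro ballI conjI *) simp_all
    qed
  qed (use s0 in auto)
  have h0: "h 0 = L s"
    using k0 A by (simp add: h_def \<phi>_def bessel2_real(1))
  define g1 where "g1 t = bessel2 (Complex \<sigma> t) / (Complex \<sigma> t * of_real k0)" for t
  define g2 where "g2 t = Fmellin (Complex \<sigma> t) * W (s - Complex \<sigma> t)" for t
  have Fm: "Fmellin (Complex \<sigma> t) = g1 t" for t
    using Fmellin_eq(2)[of "Complex \<sigma> t"] s0 by (simp add: g1_def)
  have g1i: "integrable lborel g1"
    using integrable_bessel2_line[of \<sigma> 0 "\<lambda>_. 1 / of_real k0" "norm (1 / of_real k0 :: complex)"] s0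
    by (simp add: g1_def[abs_def])
  have g2i: "integrable lborel g2"
  proof -
    have "integrable lborel (\<lambda>t. bessel2 (Complex \<sigma> t) / Complex \<sigma> t * (W (s - Complex \<sigma> t) / of_real k0))"
    proof (rule integrable_bessel2_line[of \<sigma> "17/20" _ "B / k0"])
      show "continuous_on UNIV (\<lambda>t. W (s - Complex \<sigma> t) / of_real k0)"
        using k0 by (intro continuous_on_divide Wc continuous_on_const) auto
      show "norm (W (s - Complex \<sigma> t) / of_real k0) \<le> B / k0 * exp (17/20 * \<bar>t\<bar>)" for t
        using divide_right_mono[OF Wb[of t], of k0] k0 by (simp add: norm_divide)
    qed (use s0 in auto)
    then show ?thesis unfolding g2_def[abs_def] Fm g1_def by simp
  qed
  have first: "(\<integral>t. h (Complex \<sigma> t) / Complex \<sigma> t \<partial>lborel) = (\<Sum>f\<in>I. \<Sum>\<^sub>\<infinity>k\<in>K. 1 / (of_nat k powr s * of_nat f powr (2 * s - 1)) * c f k *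
     (2 * pi * of_real (Fcut (real k * real f ^ 2 / A))))"
  proof -
    have "(\<integral>t. h (Complex \<sigma> t) / Complex \<sigma> t \<partial>lborel) = (\<integral>t. g1 t * (L (s + Complex \<sigma> t) * of_real A powr Complex \<sigma> t) \<partial>lborel)"
      by (simp add: h_def \<phi>_def g1_def mult_ac)
    also have "\<dots> = (\<Sum>f\<in>I. \<Sum>\<^sub>\<infinity>k\<in>K. 1 / (of_nat k powr s * of_nat f powr (2 * s - 1)) * c f k *
       (\<integral>t. g1 t * of_real (real k * real f ^ 2 / A) powr (- Complex \<sigma> t) \<partial>lborel))"
      by (rule integral_dirichlet_series[OF g1i A]) (use \<sigma> in simp)
    also have "\<dots> = (\<Sum>f\<in>I. \<Sum>\<^sub>\<infinity>k\<in>K. 1 / (of_nat k powr s * of_nat f powr (2 * s - 1)) * c f k * (2 * pi * of_real (Fcut (real k * real f ^ 2 / A))))"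
    proof (intro sum.cong infsum_cong refl)
      fix f k assume "f \<in> I" "k \<in> K"
      have "f \<noteq> 0" by (cases "f = 0") (use \<open>f \<in> I\<close> I0 in auto)
      moreover have "k \<noteq> 0" by (cases "k = 0") (use \<open>k \<in> K\<close> K0 in auto)
      ultimately have "real k * real f ^ 2 / A > 0" using A by simp
      from Fcut_mellin_inversion[OF s0 this]
      have "(\<integral>t. g1 t * of_real (real k * real f ^ 2 / A) powr (- Complex \<sigma> t) \<partial>lborel) = 2 * pi * of_real (Fcut (real k * real f ^ 2 / A))"
        unfolding g1_def by simp
      then show "1 / (of_nat k powr s * of_nat f powr (2 * s - 1)) * c f k * (\<integral>t. g1 t * of_real (real k * real f ^ 2 / A) powr (- Complex \<sigma> t) \<partial>lborel) =
        1 / (of_nat k powr s * of_nat f powr (2 * s - 1)) * c f k * (2 * pi * of_real (Fcut (real k * real f ^ 2 / A)))" by simp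
    qed
    finally show ?thesis .
  qed
  have second: "(\<integral>t. h (Complex (-\<sigma>) t) / Complex (-\<sigma>) t \<partial>lborel) = - (\<Sum>f\<in>I. \<Sum>\<^sub>\<infinity>k\<in>K. 1 / (of_nat k powr (1 - s) * of_nat f powr (1 - 2 * s)) * c f k *
       (\<integral>t. g2 t * of_real (real k * real f ^ 2 * A) powr (- Complex \<sigma> t) \<partial>lborel))"
  proof -
    \<comment> \<open>The reflection \<open>t \<mapsto> - t\<close> turns the left line into the
      points \<open>- u\<close> with \<open>u\<close> on the right line. There
      \<open>bessel2\<close> is even and \<open>1 / u\<close> is odd, which produces the minus
      sign.\<close>
    have "(\<integral>t. h (Complex (-\<sigma>) t) / Complex (-\<sigma>) t \<partial>lborel) = (\<integral>t. h (Complex (-\<sigma>) (-t)) / Complex (-\<sigma>) (-t) \<partial>lborel)"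
      using lborel_integral_real_affine[of "-1" "\<lambda>t. h (Complex (-\<sigma>) t) / Complex (-\<sigma>) t" 0] by simp
    also have "\<dots> = (\<integral>t. - (g2 t * (L ((1 - s) + Complex \<sigma> t) * of_real (1 / A) powr Complex \<sigma> t)) \<partial>lborel)"
    proof (intro Bochner_Integration.integral_cong refl)
      fix t
      define u where "u = Complex \<sigma> t"
      have m: "Complex (-\<sigma>) (-t) = - u" by (simp add: u_def complex_eq_iff)
      have "Re (s - u) < 0" using \<sigma> by (simp add: u_def)
      from fe[OF this] have "L (s - u) = W (s - u) * L ((1 - s) + u)" by (simp add: algebra_simps)
      moreover have "of_real A powr (- u) = of_real (1 / A) powr u"
      proof -
        have "1 / A > 0" using A by simp
        then show ?thesis unfolding of_real_powr[OF A] of_real_powr[OF \<open>1 / A > 0\<close>] using A by (simp add: ln_div)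
      qed
      ultimately show "h (Complex (-\<sigma>) (-t)) / Complex (-\<sigma>) (-t) = - (g2 t * (L ((1 - s) + Complex \<sigma> t) * of_real (1 / A) powr Complex \<sigma> t))"
        unfolding m g2_def Fm g1_def unfolding u_def[symmetric] h_def \<phi>_def by (simp add: bessel2_minus mult_ac)
    qed
    also have "\<dots> = - (\<integral>t. g2 t * (L ((1 - s) + Complex \<sigma> t) * of_real (1 / A) powr Complex \<sigma> t) \<partial>lborel)"
      by (rule Bochner_Integration.integral_minus)
    also have "(\<integral>t. g2 t * (L ((1 - s) + Complex \<sigma> t) * of_real (1 / A) powr Complex \<sigma> t) \<partial>lborel) =
       (\<Sum>f\<in>I. \<Sum>\<^sub>\<infinity>k\<in>K. 1 / (of_nat k powr (1 - s) * of_nat f powr (2 * (1 - s) - 1)) * c f k *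
       (\<integral>t. g2 t * of_real (real k * real f ^ 2 / (1 / A)) powr (- Complex \<sigma> t) \<partial>lborel))"
      by (rule integral_dirichlet_series[OF g2i]) (use \<sigma> A in auto)
    finally show ?thesis by (simp add: algebra_simps)
  qed
  have eq: "2 * pi * L s = (\<Sum>f\<in>I. \<Sum>\<^sub>\<infinity>k\<in>K. 1 / (of_nat k powr s * of_nat f powr (2 * s - 1)) * c f k * (2 * pi * of_real (Fcut (real k * real f ^ 2 / A))))
    + (\<Sum>f\<in>I. \<Sum>\<^sub>\<infinity>k\<in>K. 1 / (of_nat k powr (1 - s) * of_nat f powr (1 - 2 * s)) * c f k *
       (\<integral>t. g2 t * of_real (real k * real f ^ 2 * A) powr (- Complex \<sigma> t) \<partial>lborel))"
    using shift unfolding h0 first second by simp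
  then have "L s = 1 / (2 * pi) * ((\<Sum>f\<in>I. \<Sum>\<^sub>\<infinity>k\<in>K. 1 / (of_nat k powr s * of_nat f powr (2 * s - 1)) * c f k * (2 * pi * of_real (Fcut (real k * real f ^ 2 / A))))
    + (\<Sum>f\<in>I. \<Sum>\<^sub>\<infinity>k\<in>K. 1 / (of_nat k powr (1 - s) * of_nat f powr (1 - 2 * s)) * c f k *
       (\<integral>t. g2 t * of_real (real k * real f ^ 2 * A) powr (- Complex \<sigma> t) \<partial>lborel)))"
  proof -
    have "x = complex_of_real (1 / (2 * pi)) * y" if "complex_of_real (2 * pi) * x = y" for x y
      unfolding that[symmetric] by simp
    from this[OF eq] show ?thesis .
  qed
  also have "\<dots> = (\<Sum>f\<in>I. \<Sum>\<^sub>\<infinity>k\<in>K. 1 / (2 * pi) * (1 / (of_nat k powr s * of_nat f powr (2 * s - 1)) * c f k * (2 * pi * of_real (Fcut (real k * real f ^ 2 / A)))))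
    + (\<Sum>f\<in>I. \<Sum>\<^sub>\<infinity>k\<in>K. 1 / (2 * pi) * (1 / (of_nat k powr (1 - s) * of_nat f powr (1 - 2 * s)) * c f k *
       (\<integral>t. g2 t * of_real (real k * real f ^ 2 * A) powr (- Complex \<sigma> t) \<partial>lborel)))"
    unfolding distrib_left sum_distrib_left infsum_cmult_right' ..
  also have "\<dots> = (\<Sum>f\<in>I. \<Sum>\<^sub>\<infinity>k\<in>K. 1 / (of_nat k powr s * of_nat f powr (2 * s - 1)) * c f k * of_real (Fcut (real k * real f ^ 2 / A)))
    + (\<Sum>f\<in>I. \<Sum>\<^sub>\<infinity>k\<in>K. 1 / (of_nat k powr (1 - s) * of_nat f powr (1 - 2 * s)) * c f k *
       (1 / (2 * pi) * (\<integral>t. g2 t * of_real (real k * real f ^ 2 * A) powr (- Complex \<sigma> t) \<partial>lborel)))"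
    by (intro arg_cong2[of _ _ _ _ "(+)"] sum.cong infsum_cong refl) simp_all
  finally show ?thesis by (simp only: g2_def)
qed

end

subsection \<open>Discriminants of S-integers\<close>

lemma multiplicity_int_nat: "multiplicity (int p) (int n) = multiplicity p n"
  by (simp only: multiplicity_def int_dvd_int_iff flip: of_nat_power)

text \<open>\<open>qval\<close> is defined through the reduced fraction; cross multiplication shows
  that any representation gives the same value.\<close>

lemma qval_divide_int:
  fixes a b :: int
  assumes p: "prime (p::nat)" and ab: "a \<noteq> 0" "b \<noteq> 0"
  shows "qval p (of_int a / of_int b) = int (multiplicity (int p) a) - int (multiplicity (int p) b)"
proof -
  obtain a' b' where q: "quotient_of (of_int a / of_int b) = (a', b')" by force
  have b': "b' > 0" using quotient_of_denom_pos[OF q] .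
  have "rat_of_int a / of_int b = of_int a' / of_int b'" by (rule quotient_of_div[OF q])
  then have "rat_of_int (a * b') = of_int (a' * b)" using ab b' by (simp add: field_simps)
  then have e: "a * b' = a' * b" by (simp only: of_int_eq_iff)
  then have a': "a' \<noteq> 0" using ab b' by auto
  have pe: "prime_elem (int p)" using p by simp
  have "multiplicity (int p) a + multiplicity (int p) b' = multiplicity (int p) a' + multiplicity (int p) b"
    using prime_elem_multiplicity_mult_distrib[OF pe, of a b'] prime_elem_multiplicity_mult_distrib[OF pe, of a' b] ab a' b' e by simp
  then show ?thesis by (simp add: qval_def q)
qed

lemma rat_int_quotient: obtains a b :: int where "(x::rat) = of_int a / of_int b" "b > 0" "coprime a b"
proof -
  obtain a b where q: "quotient_of x = (a, b)" by force
  show ?thesis using that[of a b] quotient_of_div[OF q] quotient_of_denom_pos[OF q] quotient_of_coprime[OF q] by simp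
qed

lemma qval_mult:
  assumes p: "prime (p::nat)" and "x \<noteq> 0" "y \<noteq> 0"
  shows "qval p (x * y) = qval p x + qval p y"
proof -
  obtain a b where x: "x = of_int a / of_int b" "b > 0" "coprime a b" by (rule rat_int_quotient[of x])
  obtain c d where y: "y = of_int c / of_int d" "d > 0" "coprime c d" by (rule rat_int_quotient[of y])
  have nz: "a \<noteq> 0" "c \<noteq> 0" "b \<noteq> 0" "d \<noteq> 0" using assms x y by auto
  have pe: "prime_elem (int p)" using p by simp
  have "x * y = of_int (a * c) / of_int (b * d)" using x y by simp
  then have "qval p (x * y) = int (multiplicity (int p) (a * c)) - int (multiplicity (int p) (b * d))"
    using qval_divide_int[OF p, of "a * c" "b * d"] nz by simp
  also have "\<dots> = qval p x + qval p y"
    unfolding x(1) y(1) using nz qval_divide_int[OF p] prime_elem_multiplicity_mult_distrib[OF pe] by simp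
  finally show ?thesis .
qed

lemma qval_of_int: "prime (p::nat) \<Longrightarrow> a \<noteq> 0 \<Longrightarrow> qval p (of_int a) = int (multiplicity (int p) a)"
  using qval_divide_int[of p a 1] by simp

lemma qval_1: "prime (p::nat) \<Longrightarrow> qval p 1 = 0"
  using qval_of_int[of p 1] by simp

lemma qval_inverse: "prime (p::nat) \<Longrightarrow> x \<noteq> 0 \<Longrightarrow> qval p (inverse x) = - qval p x"
  using qval_mult[of p x "inverse x"] qval_1[of p] by simp

lemma qval_divide: "prime (p::nat) \<Longrightarrow> x \<noteq> 0 \<Longrightarrow> y \<noteq> 0 \<Longrightarrow> qval p (x / y) = qval p x - qval p y"
  using qval_mult[of p x "inverse y"] qval_inverse[of p y] by (simp add: divide_inverse)

lemma qval_power: "prime (p::nat) \<Longrightarrow> x \<noteq> 0 \<Longrightarrow> qval p (x ^ n) = int n * qval p x"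
  by (induction n) (auto simp: qval_1 qval_mult algebra_simps)

lemma qval_powi:
  assumes "prime (p::nat)" "x \<noteq> 0"
  shows "qval p (x powi k) = k * qval p x"
  using qval_power[OF assms] qval_power[OF assms(1), of "inverse x"] qval_inverse[OF assms] assms(2)
  by (auto simp: power_int_def)

lemma qval_prod:
  assumes p: "prime (p::nat)" and "finite A" "\<And>a. a \<in> A \<Longrightarrow> f a \<noteq> 0"
  shows "qval p (\<Prod>a\<in>A. f a) = (\<Sum>a\<in>A. qval p (f a))"
  using assms(2,3) by (induction A rule: finite_induct) (auto simp: qval_1[OF p] qval_mult[OF p])

lemma qval_prime: 
  assumes "prime (p::nat)" "prime (l::nat)"
  shows "qval p (of_nat l) = (if p = l then 1 else 0)"
proof -
  have "l \<noteq> 0" using assms(2) by (auto simp: prime_gt_0_nat)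
  then have "qval p (of_nat l) = int (multiplicity (int p) (int l))"
    using qval_of_int[OF assms(1), of "int l"] by simp
  also have "multiplicity (int p) (int l) = (if p = l then 1 else 0)"
  proof (cases "p = l")
    case True
    then show ?thesis using assms by (simp add: multiplicity_self prime_gt_Suc_0_nat)
  next
    case False
    then have "\<not> int p dvd int l" using assms primes_dvd_imp_eq by (auto simp: int_dvd_int_iff)
    then show ?thesis using False by (simp add: not_dvd_imp_multiplicity_0)
  qed
  finally show ?thesis by simp
qed

lemma rat_eq_of_nat_if_qval_nonneg:
  assumes x: "x > 0" and v: "\<And>l. prime (l::nat) \<Longrightarrow> qval l x \<ge> 0"
  obtains n :: nat where "n > 0" "x = of_nat n"
proof -
  obtain a b where ab: "x = of_int a / of_int b" "b > 0" "coprime a b" by (rule rat_int_quotient[of x])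
  have a: "a > 0" using x ab by (simp add: zero_less_divide_iff)
  have "b = 1"
  proof (rule ccontr)
    assume "b \<noteq> 1"
    then have "nat b \<noteq> 1" using ab(2) by auto
    then obtain l where l: "prime l" "l dvd nat b" using prime_factor_nat by blast
    have "int l dvd int (nat b)" using l(2) by (simp only: int_dvd_int_iff)
    moreover have "int (nat b) = b" using ab(2) by simp
    ultimately have lb: "int l dvd b" by (simp only:)
    then have na: "\<not> int l dvd a" using ab(3) l(1) by (metis coprime_common_divisor not_prime_unit prime_nat_int_transfer)
    have "multiplicity (int l) b \<ge> 1"
      using lb l(1) ab(2) by (intro multiplicity_geI) (auto simp: prime_gt_Suc_0_nat)
    moreover have "multiplicity (int l) a = 0" using na by (rule not_dvd_imp_multiplicity_0)
    ultimately have "qval l x < 0" using qval_divide_int[OF l(1), of a b] a ab by simp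
    then show False using v[OF l(1)] by simp
  qed
  then have "x = of_nat (nat a)" "nat a > 0" using ab a by auto
  then show ?thesis using that by blast
qed

lemma multiplicity_squarefree_le:
  assumes "squarefree (d::int)" "prime (p::nat)"
  shows "multiplicity (int p) d \<le> 1"
proof -
  have "d \<noteq> 0" using assms by auto
  then show ?thesis using squarefree_factorial_semiring''[of d] assms by auto
qed

text \<open>At each prime the multiplicities of \<open>d1\<close> and \<open>d2\<close> are at most
  1 and have the same parity, hence agree. The signs agree because squares are positive.\<close>

lemma squarefree_class_unique:
  assumes "squarefree d1" "squarefree d2" and r: "r1 \<noteq> 0" "r2 \<noteq> 0" and eq: "rat_of_int d1 * r1 ^ 2 = of_int d2 * r2 ^ 2"
  shows "d1 = d2"
proof -
  have nz: "d1 \<noteq> 0" "d2 \<noteq> 0" using assms by auto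
  have "multiplicity (int p) d1 = multiplicity (int p) d2" if p: "prime p" for p :: nat
  proof -
    have "qval p (of_int d1 * r1 ^ 2) = qval p (of_int d2 * r2 ^ 2)" using eq by simp
    then have "int (multiplicity (int p) d1) + 2 * qval p r1 = int (multiplicity (int p) d2) + 2 * qval p r2"
      using p nz r by (simp add: qval_mult qval_power qval_of_int)
    then show ?thesis using multiplicity_squarefree_le[OF assms(1) p] multiplicity_squarefree_le[OF assms(2) p] by presburger
  qed
  then have m: "multiplicity P d1 = multiplicity P d2" if "prime P" for P :: int
    using that prime_ge_0_int[OF that] by (metis nonneg_int_cases prime_nat_int_transfer)
  have "normalize d1 = normalize d2" by (rule multiplicity_eq_imp_eq[OF nz m])
  then have "\<bar>d1\<bar> = \<bar>d2\<bar>" by simp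
  moreover have "sgn d1 = sgn d2"
  proof -
    have r2: "r1 ^ 2 > 0" "r2 ^ 2 > 0" using r by auto
    have "sgn (rat_of_int d1 * r1 ^ 2) = sgn (of_int d1)" by (simp only: sgn_mult sgn_pos[OF r2(1)] mult_1_right)
    moreover have "sgn (rat_of_int d2 * r2 ^ 2) = sgn (of_int d2)" by (simp only: sgn_mult sgn_pos[OF r2(2)] mult_1_right)
    ultimately have "sgn (rat_of_int d1) = sgn (rat_of_int d2)" using eq by simp
    then show ?thesis by (simp add: sgn_if split: if_splits)
  qed
  ultimately show ?thesis by (metis mult_sgn_abs)
qed

lemma sqfree_part_spec:
  assumes "\<delta> \<noteq> 0"
  shows "squarefree (sqfree_part \<delta>)" "\<exists>r. r \<noteq> 0 \<and> \<delta> = of_int (sqfree_part \<delta>) * r ^ 2"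
proof -
  obtain a b where ab: "\<delta> = of_int a / of_int b" "b > 0" "coprime a b" by (rule rat_int_quotient[of \<delta>])
  \<comment> \<open>The fraction \<open>a / b\<close> equals \<open>a * b\<close> divided by the
    square of \<open>b\<close>, so the squarefree part of the integer \<open>a * b\<close> is the
    right one.\<close>
  define d where "d = squarefree_part (a * b)"
  define m where "m = square_part (a * b)"
  have a0: "a \<noteq> 0" using assms ab by auto
  have e: "a * b = d * m ^ 2" unfolding d_def m_def by (rule squarefree_decompose)
  have m0: "m \<noteq> 0" using a0 ab by (simp add: m_def)
  have "\<delta> = of_int (a * b) / (of_int b)\<^sup>2" using ab by (simp add: power2_eq_square)
  also have "\<dots> = of_int d * (of_int m / of_int b) ^ 2" unfolding e by (simp add: power_divide)
  finally have ex: "squarefree d \<and> (\<exists>r. r \<noteq> 0 \<and> \<delta> = of_int d * r ^ 2)"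
    using m0 ab by (auto simp: d_def intro!: exI[of _ "of_int m / of_int b"])
  have "squarefree (sqfree_part \<delta>) \<and> (\<exists>r. r \<noteq> 0 \<and> \<delta> = of_int (sqfree_part \<delta>) * r ^ 2)"
    unfolding sqfree_part_def
  proof (rule theI[of _ d])
    show "squarefree d \<and> (\<exists>r. r \<noteq> 0 \<and> \<delta> = of_int d * r ^ 2)" by (rule ex)
    fix d' assume "squarefree d' \<and> (\<exists>r. r \<noteq> 0 \<and> \<delta> = of_int d' * r ^ 2)"
    then show "d' = d" using ex squarefree_class_unique by metis
  qed
  then show "squarefree (sqfree_part \<delta>)" "\<exists>r. r \<noteq> 0 \<and> \<delta> = of_int (sqfree_part \<delta>) * r ^ 2" by auto
qed

lemma fund_disc_eq: "fund_disc \<delta> = disc_of (sqfree_part \<delta>)"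
  by (simp add: fund_disc_def disc_of_def Let_def)

lemma sigma_of_spec:
  assumes "\<delta> \<noteq> 0"
  shows "sigma_of \<delta> > 0" "\<delta> = (sigma_of \<delta>) ^ 2 * of_int (fund_disc \<delta>)"
proof -
  obtain r where r: "r \<noteq> 0" "\<delta> = of_int (sqfree_part \<delta>) * r ^ 2" using sqfree_part_spec[OF assms] by blast
  \<comment> \<open>When the discriminant is four times the squarefree part, the square of the
    halved \<open>r\<close> compensates the 4.\<close>
  define \<sigma> where "\<sigma> = (if sqfree_part \<delta> mod 4 = 1 then \<bar>r\<bar> else \<bar>r\<bar> / 2)"
  have ex: "\<sigma> > 0 \<and> \<delta> = \<sigma> ^ 2 * of_int (fund_disc \<delta>)"
  proof
    show "\<sigma> > 0" using r by (simp add: \<sigma>_def)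
    have "\<sigma> ^ 2 * of_int (fund_disc \<delta>) = of_int (sqfree_part \<delta>) * r ^ 2"
      by (simp add: \<sigma>_def fund_disc_eq disc_of_def power_divide)
    then show "\<delta> = \<sigma> ^ 2 * of_int (fund_disc \<delta>)" using r by simp
  qed
  have D: "fund_disc \<delta> \<noteq> 0" using ex assms by auto
  have "sigma_of \<delta> > 0 \<and> \<delta> = (sigma_of \<delta>) ^ 2 * of_int (fund_disc \<delta>)"
    unfolding sigma_of_def
  proof (rule theI[of _ \<sigma>])
    show "\<sigma> > 0 \<and> \<delta> = \<sigma> ^ 2 * of_int (fund_disc \<delta>)" by (rule ex)
    fix \<sigma>' assume s: "\<sigma>' > 0 \<and> \<delta> = \<sigma>' ^ 2 * of_int (fund_disc \<delta>)"
    then have "\<sigma>' ^ 2 * rat_of_int (fund_disc \<delta>) = \<sigma> ^ 2 * of_int (fund_disc \<delta>)" using ex by metis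
    then have "\<sigma>' ^ 2 = \<sigma> ^ 2" using D by simp
    then show "\<sigma>' = \<sigma>" using s ex by (simp add: power2_eq_iff)
  qed
  then show "sigma_of \<delta> > 0" "\<delta> = (sigma_of \<delta>) ^ 2 * of_int (fund_disc \<delta>)" by auto
qed

section \<open>Divisors and symbols attached to a nonsquare S-integer\<close>

locale nonsquare_S_integer =
  fixes Q :: "nat set" and \<delta> :: rat
  assumes finQ: "finite Q" and Qp: "\<And>q. q \<in> Q \<Longrightarrow> prime q" and Q2: "2 \<in> Q"
    and dZ: "\<delta> \<in> ZS Q" and nsq: "\<not> (\<exists>r::rat. \<delta> = r ^ 2)"
begin

definition D :: int where "D = fund_disc \<delta>"
definition n :: nat where "n = (THE n. of_nat n = sigma_of \<delta> / sigma_q Q \<delta>)"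

lemma delta_nz: "\<delta> \<noteq> 0"
proof
  assume "\<delta> = 0" then have "\<delta> = 0 ^ 2" by simp
  then show False using nsq by blast
qed

lemma squarefree_d: "squarefree (sqfree_part \<delta>)" by (rule sqfree_part_spec[OF delta_nz])

lemma D_nz: "D \<noteq> 0" using sigma_of_spec[OF delta_nz] delta_nz by (auto simp: D_def)

lemma d_not_1: "sqfree_part \<delta> \<noteq> 1"
  using sqfree_part_spec(2)[OF delta_nz] nsq by auto

text \<open>Outside \<open>Q\<close> the prime 2 does not occur, so the possible factor 4 is a unit
  and only the squarefree part contributes.\<close>

lemma qval_D_le:
  assumes l: "prime l" "l \<notin> Q"
  shows "qval l (of_int D) \<le> 1" "qval l (of_int D) \<ge> 0"
proof -
  have l2: "l \<noteq> 2" using l Q2 by auto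
  have d0: "sqfree_part \<delta> \<noteq> 0" using squarefree_d by auto
  have "qval l (of_int 4) = 0"
  proof -
    have "qval l (of_int 4) = qval l (of_nat 2 * of_nat 2)" by simp
    also have "\<dots> = 0" using qval_mult[OF l(1), of "of_nat 2" "of_nat 2"] qval_prime[OF l(1), of 2] l2 by simp
    finally show ?thesis .
  qed
  then have "qval l (of_int D) = qval l (of_int (sqfree_part \<delta>))"
    using qval_mult[OF l(1), of "of_int 4" "of_int (sqfree_part \<delta>)"] d0 by (simp add: D_def fund_disc_eq disc_of_def)
  then have "qval l (of_int D) = int (multiplicity (int l) (sqfree_part \<delta>))" using qval_of_int[OF l(1) d0] by simp
  then show "qval l (of_int D) \<le> 1" "qval l (of_int D) \<ge> 0" using multiplicity_squarefree_le[OF squarefree_d l(1)] by auto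
qed

lemma sigma_q_pos: "sigma_q Q \<delta> > 0"
  unfolding sigma_q_def using Qp by (intro prod_pos) (auto simp: prime_gt_0_nat zero_less_power_int)

lemma qval_sigma_q:
  assumes l: "prime l"
  shows "qval l (sigma_q Q \<delta>) = (if l \<in> Q then qval l (sigma_of \<delta>) else 0)"
proof -
  have nz: "rat_of_nat q \<noteq> 0" if "q \<in> Q" for q using Qp[OF that] by (auto simp: prime_gt_0_nat)
  have "qval l (sigma_q Q \<delta>) = (\<Sum>q\<in>Q. qval l (of_nat q powi qval q (sigma_of \<delta>)))"
    unfolding sigma_q_def using nz by (intro qval_prod l finQ) auto
  also have "\<dots> = (\<Sum>q\<in>Q. if q = l then qval l (sigma_of \<delta>) else 0)"
    by (intro sum.cong refl) (use nz Qp in \<open>auto simp: qval_powi[OF l] qval_prime[OF l]\<close>)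
  finally show ?thesis using finQ by simp
qed

lemma qval_delta:
  assumes l: "prime l"
  shows "qval l \<delta> = 2 * qval l (sigma_of \<delta>) + qval l (of_int D)"
proof -
  have s: "sigma_of \<delta> \<noteq> 0" using sigma_of_spec(1)[OF delta_nz] by simp
  have "qval l \<delta> = qval l ((sigma_of \<delta>) ^ 2 * of_int D)" using sigma_of_spec(2)[OF delta_nz] by (simp add: D_def)
  then show ?thesis using qval_mult[OF l, of "(sigma_of \<delta>) ^ 2" "of_int D"] qval_power[OF l s, of 2] s D_nz by simp
qed

text \<open>At a prime outside \<open>Q\<close> the valuation of \<delta> is twice that of \<sigma>
  plus at most 1. As it is nonnegative, \<sigma> cannot have valuation -1 or less. At primes in
  \<open>Q\<close> the quotient has valuation 0 by construction.\<close>

lemma n_spec: "n > 0" "of_nat n = sigma_of \<delta> / sigma_q Q \<delta>"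
proof -
  have s: "sigma_of \<delta> > 0" by (rule sigma_of_spec[OF delta_nz])
  have "qval l (sigma_of \<delta> / sigma_q Q \<delta>) \<ge> 0" if l: "prime l" for l
  proof (cases "l \<in> Q")
    case True
    then show ?thesis using qval_divide[OF l, of "sigma_of \<delta>" "sigma_q Q \<delta>"] s sigma_q_pos qval_sigma_q[OF l] by simp
  next
    case False
    then have "qval l \<delta> \<ge> 0" using dZ l by (auto simp: ZS_def)
    then have "qval l (sigma_of \<delta>) \<ge> 0" using qval_delta[OF l] qval_D_le[OF l False] by simp
    then show ?thesis using False qval_divide[OF l, of "sigma_of \<delta>" "sigma_q Q \<delta>"] s sigma_q_pos qval_sigma_q[OF l] by simp
  qed
  then obtain m where m: "m > 0" "sigma_of \<delta> / sigma_q Q \<delta> = of_nat m"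
    using rat_eq_of_nat_if_qval_nonneg[of "sigma_of \<delta> / sigma_q Q \<delta>"] s sigma_q_pos by auto
  have "n = m" unfolding n_def m(2) by (rule the_equality) auto
  then show "n > 0" "of_nat n = sigma_of \<delta> / sigma_q Q \<delta>" using m by auto
qed

lemma delta_eq: "\<delta> = (sigma_q Q \<delta>) ^ 2 * (of_nat n) ^ 2 * of_int D"
  using sigma_of_spec(2)[OF delta_nz] sigma_q_pos unfolding n_spec(2) D_def by (simp add: power_divide)

lemma tau_eq: "tau Q \<delta> = of_int ((int n)\<^sup>2 * D)"
proof -
  have "\<delta> / (sigma_q Q \<delta>) ^ 2 = (of_nat n) ^ 2 * of_int D"
    using delta_eq sigma_q_pos by (simp add: field_simps)
  then show ?thesis by (simp add: tau_def)
qed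

lemma sgn_D: "\<delta> > 0 \<longleftrightarrow> D > 0"
proof -
  define c where "c = (sigma_q Q \<delta>) ^ 2 * (rat_of_nat n) ^ 2"
  have "c > 0" unfolding c_def using sigma_q_pos n_spec(1) by simp
  have "\<delta> > 0 \<longleftrightarrow> c * of_int D > 0" by (rule arg_cong[OF delta_eq[folded c_def]])
  then show ?thesis using \<open>c > 0\<close> by (simp add: zero_less_mult_iff)
qed

lemma qval_n: "prime l \<Longrightarrow> qval l (of_nat n) = int (multiplicity l n)"
  using qval_of_int[of l "int n"] n_spec(1) by (simp add: multiplicity_int_nat)

lemma n_coprime: "q \<in> Q \<Longrightarrow> \<not> q dvd n"
proof
  assume q: "q \<in> Q" "q dvd n"
  have "qval q (of_nat n) = 0"
    unfolding n_spec(2) using qval_divide[OF Qp[OF q(1)], of "sigma_of \<delta>" "sigma_q Q \<delta>"] sigma_of_spec(1)[OF delta_nz] sigma_q_pos qval_sigma_q[OF Qp[OF q(1)]] q(1) by simp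
  then have "multiplicity q n = 0" using qval_n[OF Qp[OF q(1)]] by simp
  then show False using multiplicity_eq_zero_iff[of n q] q prime_gt_1_nat[OF Qp[OF q(1)]] n_spec(1) by auto
qed

lemma ZSpos_iff: "k \<in> ZSpos Q \<longleftrightarrow> k > 0 \<and> (\<forall>q\<in>Q. \<not> q dvd k)"
proof -
  have "coprime k q \<longleftrightarrow> \<not> q dvd k" if "q \<in> Q" for q
    using Qp[OF that] by (metis coprime_absorb_right coprime_commute not_prime_unit prime_imp_coprime)
  then show ?thesis by (auto simp: ZSpos_def)
qed

lemma qval_delta_f:
  assumes l: "prime l" "l \<notin> Q" and f: "f > 0"
  shows "qval l (\<delta> / of_nat f ^ 2) = 2 * (int (multiplicity l n) - int (multiplicity l f)) + qval l (of_int D)"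
proof -
  have "qval l (of_nat f) = int (multiplicity l f)"
    using qval_of_int[OF l(1), of "int f"] f by (simp add: multiplicity_int_nat)
  moreover have "qval l (\<delta> / of_nat f ^ 2) = qval l \<delta> - 2 * qval l (of_nat f)"
    using qval_divide[OF l(1) delta_nz, of "of_nat f ^ 2"] qval_power[OF l(1), of "of_nat f" 2] f by simp
  moreover have "qval l (sigma_of \<delta>) = int (multiplicity l n)"
    using qval_n[OF l(1)] qval_divide[OF l(1), of "sigma_of \<delta>" "sigma_q Q \<delta>"] sigma_of_spec(1)[OF delta_nz] sigma_q_pos qval_sigma_q[OF l(1)] l(2)
    unfolding n_spec(2) by simp
  ultimately show ?thesis using qval_delta[OF l(1)] by simp
qed

text \<open>The same parity argument: \<open>2 (v(n) - v(f))\<close> plus 0 or 1 is nonnegative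
  exactly when \<open>v(f) \<le> v(n)\<close>. The primes in \<open>Q\<close> divide neither
  \<open>f\<close> nor \<open>n\<close>.\<close>

lemma fset_eq: "fset Q \<delta> = {f. f dvd n}"
proof (rule equalityI; rule subsetI)
  fix f assume "f \<in> fset Q \<delta>"
  then have f: "f > 0" "\<And>q. q \<in> Q \<Longrightarrow> \<not> q dvd f" and z: "\<delta> / of_nat f ^ 2 \<in> ZS Q"
    by (auto simp: fset_def ZSpos_iff)
  have "f dvd n"
  proof (rule multiplicity_le_imp_dvd)
    fix l :: nat assume l: "prime l"
    show "multiplicity l f \<le> multiplicity l n"
    proof (cases "l \<in> Q")
      case True
      then show ?thesis using f(2) by (simp add: not_dvd_imp_multiplicity_0)
    next
      case False
      then have "qval l (\<delta> / of_nat f ^ 2) \<ge> 0" using z l by (auto simp: ZS_def)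
      then show ?thesis using qval_delta_f[OF l False f(1)] qval_D_le[OF l False] by simp
    qed
  qed (use f in simp)
  then show "f \<in> {f. f dvd n}" by simp
next
  fix f assume "f \<in> {f. f dvd n}"
  then have f: "f dvd n" by simp
  then have f0: "f > 0" using n_spec(1) by (auto intro: dvd_pos_nat)
  have "f \<in> ZSpos Q" using f f0 n_coprime dvd_trans by (auto simp: ZSpos_iff)
  moreover have "\<delta> / of_nat f ^ 2 \<in> ZS Q"
    unfolding ZS_def
  proof (intro CollectI allI impI)
    fix l :: nat assume l: "prime l \<and> l \<notin> Q"
    have "multiplicity l f \<le> multiplicity l n" using f n_spec(1) by (intro dvd_imp_multiplicity_le) auto
    then show "qval l (\<delta> / of_nat f ^ 2) \<ge> 0" using qval_delta_f[of l f] qval_D_le[of l] l f0 by simp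
  qed
  ultimately show "f \<in> fset Q \<delta>" by (simp add: fset_def)
qed

text \<open>With \<open>m = n div f\<close> the rational number is the square of
  \<open>sigma_q\<close> times the square of \<open>m\<close> times \<open>D\<close>. Here
  \<open>sigma_q\<close> is a unit at \<open>p\<close>, so only divisibility of \<open>m\<close> by
  \<open>p\<close> can destroy the symbol of \<open>D\<close>.\<close>

lemma rat_mod_Legendre:
  assumes p: "prime p" "p \<notin> Q" and f: "f dvd n"
  shows "Legendre (rat_mod (\<delta> / of_nat f ^ 2) p) (int p) = (if p dvd n div f then 0 else Legendre D (int p))"
proof -
  have p2: "p > 2" using p Q2 prime_gt_1_nat[OF p(1)] by (cases "p = 2") auto
  interpret P: odd_prime p by unfold_locales (use p p2 in auto)
  have pe: "prime (int p)" using p by simp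
  obtain m where m: "n = f * m" using f by (elim dvdE) auto
  have f0: "f > 0" and m0: "m > 0" using m n_spec(1) by auto
  have nf: "n div f = m" using m f0 by simp
  define x where "x = \<delta> / of_nat f ^ 2"
  have xe: "x = (sigma_q Q \<delta>) ^ 2 * (of_nat m) ^ 2 * of_int D"
    unfolding x_def by (subst delta_eq) (use f0 in \<open>simp add: m power_mult_distrib\<close>)
  obtain a b where q: "quotient_of x = (a, b)" by force
  have ab: "x = of_int a / of_int b" "b > 0" "coprime a b"
    using quotient_of_div[OF q] quotient_of_denom_pos[OF q] quotient_of_coprime[OF q] by auto
  obtain e h where eh: "sigma_q Q \<delta> = of_int e / of_int h" "h > 0" "coprime e h" by (rule rat_int_quotient[of "sigma_q Q \<delta>"])
  have e0: "e \<noteq> 0" using eh sigma_q_pos by auto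
  have peh: "\<not> int p dvd e" "\<not> int p dvd h"
  proof -
    have "int (multiplicity (int p) e) - int (multiplicity (int p) h) = 0"
      using qval_divide_int[OF p(1) e0, of h] qval_sigma_q[OF p(1)] p(2) eh by simp
    then have "multiplicity (int p) e = multiplicity (int p) h" by simp
    then have "int p dvd e \<longleftrightarrow> int p dvd h"
      using e0 eh(2) p(1) by (metis less_irrefl multiplicity_eq_zero_iff not_prime_unit pe)
    moreover have "\<not> (int p dvd e \<and> int p dvd h)" using eh(3) pe by (metis coprime_common_divisor not_prime_unit)
    ultimately show "\<not> int p dvd e" "\<not> int p dvd h" by auto
  qed
  have x0: "x \<noteq> 0" using delta_nz f0 by (simp add: x_def)
  have a0: "a \<noteq> 0" using x0 ab by auto
  have pb: "\<not> int p dvd b"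
  proof
    assume pb: "int p dvd b"
    then have "\<not> int p dvd a" using ab(3) pe by (metis coprime_common_divisor not_prime_unit)
    then have "multiplicity (int p) a = 0" by (rule not_dvd_imp_multiplicity_0)
    moreover have "multiplicity (int p) b \<ge> 1" using pb ab(2) p2 by (intro multiplicity_geI) auto
    ultimately have "qval p x < 0" using qval_divide_int[OF p(1) a0, of b] ab by simp
    moreover have "qval p x \<ge> 0"
    proof -
      have "f \<in> fset Q \<delta>" using f fset_eq by simp
      then show ?thesis using p by (auto simp: fset_def ZS_def x_def)
    qed
    ultimately show False by simp
  qed
  define r where "r = rat_mod x p"
  have r: "[b * r = a] (mod int p)"
  proof -
    have cop: "coprime b (int p)" using pb pe by (metis coprime_commute prime_imp_coprime)
    then obtain y where y: "[b * y = 1] (mod int p)" using cong_solve_coprime_int by blast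
    define r0 where "r0 = (y * a) mod int p"
    have "[b * r0 = b * (y * a)] (mod int p)" unfolding r0_def by (intro cong_scalar_left) (simp add: cong_def)
    also have "[b * (y * a) = 1 * a] (mod int p)" using cong_scalar_right[OF y, of a] by (simp add: mult.assoc)
    finally have r0: "[b * r0 = a] (mod int p)" by simp
    have "0 \<le> r \<and> r < int p \<and> [b * r = a] (mod int p)"
      unfolding r_def rat_mod_def q Let_def prod.case
    proof (rule theI[of _ r0])
      show "0 \<le> r0 \<and> r0 < int p \<and> [b * r0 = a] (mod int p)" using r0 p2 by (simp add: r0_def)
      fix r1 assume r1: "0 \<le> r1 \<and> r1 < int p \<and> [b * r1 = a] (mod int p)"
      then have "[b * r1 = b * r0] (mod int p)" using r0 cong_sym cong_trans by blast
      then have "[r1 = r0] (mod int p)" using cong_mult_lcancel[OF cop] by blast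
      then show "r1 = r0" using r1 p2 by (simp add: cong_def r0_def)
    qed
    then show ?thesis by simp
  qed
  have sq: "Legendre y (int p) * Legendre y (int p) = 1" if "\<not> int p dvd y" for y
    using that by (auto simp: Legendre_def cong_0_iff)
  have L1: "Legendre b (int p) * Legendre r (int p) = Legendre a (int p)"
    using P.Legendre_cong[OF r] by (simp add: P.Legendre_mult)
  then have "Legendre b (int p) * (Legendre b (int p) * Legendre r (int p)) = Legendre b (int p) * Legendre a (int p)" by simp
  then have L2: "Legendre r (int p) = Legendre b (int p) * Legendre a (int p)"
    unfolding mult.assoc[symmetric] sq[OF pb] by simp
  \<comment> \<open>Clearing denominators gives an identity of integers, to which multiplicativity
    of the Legendre symbol applies; the squares of numbers prime to \<open>p\<close> then drop
    out.\<close>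
  have "rat_of_int (a * h\<^sup>2) = of_int (b * e\<^sup>2 * (int m)\<^sup>2 * D)"
  proof -
    have "of_int a / of_int b = (of_int e / of_int h)\<^sup>2 * (of_nat m)\<^sup>2 * rat_of_int D" using xe ab(1) eh(1) by simp
    then show ?thesis using ab(2) eh(2) by (simp add: field_simps power2_eq_square)
  qed
  then have "a * h\<^sup>2 = b * e\<^sup>2 * (int m)\<^sup>2 * D" by (simp only: of_int_eq_iff)
  then have "b * a * (h * h) = (b * b) * (e * e) * (int m * int m) * D" by (simp add: power2_eq_square algebra_simps)
  then have "Legendre (b * a * (h * h)) (int p) = Legendre ((b * b) * (e * e) * (int m * int m) * D) (int p)" by (rule arg_cong)
  then have L3: "Legendre b (int p) * Legendre a (int p) = Legendre (int m) (int p) * Legendre (int m) (int p) * Legendre D (int p)"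
    unfolding P.Legendre_mult sq[OF pb] sq[OF peh(1)] sq[OF peh(2)] by simp
  have "Legendre (int m) (int p) * Legendre (int m) (int p) = (if p dvd m then 0 else 1)"
    using sq[of "int m"] P.Legendre_eq_0_iff[of "int m"] by (simp add: int_dvd_int_iff)
  then show ?thesis using L2 L3 unfolding nf x_def[symmetric] r_def[symmetric] by simp
qed

text \<open>Every prime dividing \<open>k\<close> lies outside \<open>Q\<close>, hence is odd, and
  there \<open>chi\<close> agrees with the Legendre symbol of \<open>D\<close>. Complete
  multiplicativity does the rest.\<close>

lemma jac_eq:
  assumes chi: "good_character D chi" and f: "f dvd n" and k: "k \<in> ZSpos Q"
  shows "jac (\<delta> / of_nat f ^ 2) k = (if \<forall>p\<in>prime_factors (n div f). \<not> p dvd k then chi (int k) else 0)"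
proof -
  have k0: "k > 0" and kq: "\<And>q. q \<in> Q \<Longrightarrow> \<not> q dvd k" using k by (auto simp: ZSpos_iff)
  have qc: "chi 1 = 1" "\<And>a b. chi (a * b) = chi a * chi b" and kr: "\<And>l. prime l \<Longrightarrow> chi (int l) = kronecker D l"
    using chi by (auto simp: good_character_def quadratic_character_def)
  have nf: "n div f \<noteq> 0" using f n_spec(1) by (auto elim!: dvdE)
  have L: "Legendre (rat_mod (\<delta> / of_nat f ^ 2) p) (int p) = (if p dvd n div f then 0 else chi (int p))"
    if p: "p \<in> prime_factors k" for p
  proof -
    have pp: "prime p" "p dvd k" using p by auto
    then have pQ: "p \<notin> Q" using kq by blast
    then have "p \<noteq> 2" using Q2 by auto
    then have "chi (int p) = Legendre D (int p)" using kr[OF pp(1)] by (simp add: kronecker_def)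
    then show ?thesis using rat_mod_Legendre[OF pp(1) pQ f] by simp
  qed
  show ?thesis
  proof (cases "\<forall>p\<in>prime_factors (n div f). \<not> p dvd k")
    case True
    have "jac (\<delta> / of_nat f ^ 2) k = (\<Prod>p\<in>prime_factors k. chi (int p) ^ multiplicity p k)"
      unfolding jac_def
    proof (rule prod.cong[OF refl])
      fix p assume p: "p \<in> prime_factors k"
      have "\<not> p dvd n div f"
      proof
        assume "p dvd n div f"
        then have "p \<in> prime_factors (n div f)" using p nf by (auto simp: in_prime_factors_iff)
        then show False using True p by auto
      qed
      then show "Legendre (rat_mod (\<delta> / of_nat f ^ 2) p) (int p) ^ multiplicity p k = chi (int p) ^ multiplicity p k"
        using L[OF p] by simp
    qed
    also have "\<dots> = chi (int (\<Prod>p\<in>prime_factors k. p ^ multiplicity p k))"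
    proof -
      have pw: "chi (x ^ j) = chi x ^ j" for x j by (induction j) (auto simp: qc)
      have "finite S \<Longrightarrow> (\<Prod>p\<in>S. chi (int p) ^ multiplicity p k) = chi (int (\<Prod>p\<in>S. p ^ multiplicity p k))" for S
        by (induction S rule: finite_induct) (simp_all add: qc pw)
      then show ?thesis by simp
    qed
    also have "(\<Prod>p\<in>prime_factors k. p ^ multiplicity p k) = k" using k0 by (simp add: prime_factorization_nat[symmetric])
    finally show ?thesis using True by simp
  next
    case False
    then obtain p where p: "p \<in> prime_factors (n div f)" "p dvd k" by blast
    then have pk: "p \<in> prime_factors k" using k0 by (auto simp: in_prime_factors_iff)
    have "multiplicity p k > 0" using pk by (simp add: prime_factors_multiplicity)
    then have "Legendre (rat_mod (\<delta> / of_nat f ^ 2) p) (int p) ^ multiplicity p k = 0"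
      using L[OF pk] p by auto
    then have "jac (\<delta> / of_nat f ^ 2) k = 0" unfolding jac_def using pk by (intro prod_zero) auto
    then show ?thesis unfolding if_not_P[OF False] .
  qed
qed

text \<open>\<open>n\<close> is prime to \<open>q\<close>, so its square does not change the symbol;
  for \<open>q = 2\<close> because odd squares are 1 modulo 8.\<close>

lemma eps_eq:
  assumes chi: "good_character D chi" and q: "q \<in> Q"
  shows "eps Q \<delta> q = chi (int q)"
proof -
  have kr: "chi (int q) = kronecker D q" using chi Qp[OF q] by (simp add: good_character_def)
  have e: "eps Q \<delta> q = kronecker ((int n)\<^sup>2 * D) q" by (simp only: eps_def tau_eq quotient_of_rat_of_int fst_conv)
  have nq: "\<not> q dvd n" by (rule n_coprime[OF q])
  show ?thesis
  proof (cases "q = 2")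
    case True
    then have odd: "odd (int n)" using nq by simp
    then have "int n mod 8 = 1 \<or> int n mod 8 = 3 \<or> int n mod 8 = 5 \<or> int n mod 8 = 7" by presburger
    then have n8: "(int n)\<^sup>2 mod 8 = 1" unfolding power2_eq_square by (elim disjE) (simp_all add: mod_mult_vals)
    have "((int n)\<^sup>2 * D) mod 8 = (1 * (D mod 8)) mod 8" by (rule mod_mult_vals[OF n8 refl])
    then have "((int n)\<^sup>2 * D) mod 8 = D mod 8" by simp
    moreover have "even ((int n)\<^sup>2 * D) \<longleftrightarrow> even D" using odd by simp
    ultimately show ?thesis unfolding e kr kronecker_def using True by (simp only: if_True simp_thms)
  next
    case False
    then interpret P: odd_prime q using Qp[OF q] prime_gt_1_nat[of q] by unfold_locales auto
    have "Legendre (int n) (int q) * Legendre (int n) (int q) = 1"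
      using nq by (auto simp: Legendre_def cong_0_iff int_dvd_int_iff)
    then show ?thesis unfolding e kr kronecker_def using False
      by (simp add: P.Legendre_mult power2_eq_square)
  qed
qed

end

subsection \<open>Imprimitive L-functions\<close>

text \<open>Absolute values inside Euler's integral. The numerator of \<open>Wfun\<close> needs no
  more than this boundedness on a vertical line.\<close>

lemma norm_Gamma_le_Gamma_Re:
  assumes "Re z > 0"
  shows "norm (Gamma z) \<le> Gamma (Re z)"
proof -
  have 1: "((\<lambda>t. of_real t powr (z - 1) / of_real (exp t)) has_integral Gamma z) {0..}"
    by (rule Gamma_integral_complex[OF assms])
  have 2: "((\<lambda>t. t powr (Re z - 1) / exp t) has_integral Gamma (Re z)) {0..}"
    by (rule Gamma_integral_real[OF assms])
  have "norm (integral {0..} (\<lambda>t. of_real t powr (z - 1) / of_real (exp t))) \<le> integral {0..} (\<lambda>t. t powr (Re z - 1) / exp t)"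
  proof (rule integral_norm_bound_integral)
    show "(\<lambda>t. complex_of_real t powr (z - 1) / of_real (exp t)) integrable_on {0..}" using 1 by (rule has_integral_integrable)
    show "(\<lambda>t. t powr (Re z - 1) / exp t) integrable_on {0..}" using 2 by (rule has_integral_integrable)
    show "norm (complex_of_real t powr (z - 1) / of_real (exp t)) \<le> t powr (Re z - 1) / exp t" if "t \<in> {0..}" for t
    proof (cases "t = 0")
      case False
      then have "norm (complex_of_real t powr (z - 1)) = t powr (Re z - 1)" using norm_of_real_powr[of t "z - 1"] that by simp
      then show ?thesis unfolding norm_divide norm_of_real by simp
    qed simp
  qed
  then show ?thesis using integral_unique[OF 1] integral_unique[OF 2] by simp
qed

lemma not_nonpos_Int_if_Re_pos: "Re z > 0 \<Longrightarrow> z \<notin> \<int>\<^sub>\<le>\<^sub>0"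
  by (auto elim!: nonpos_Ints_cases)

lemma norm_of_nat_powr:
  assumes "k > 0"
  shows "norm ((of_nat k :: complex) powr w) = real k powr Re w"
  using norm_of_real_powr[of "real k" w] assms by simp

lemma of_nat_mult_powr: "(of_nat (a * b) :: complex) powr z = of_nat a powr z * of_nat b powr z"
  unfolding of_nat_mult by (rule powr_times_real) simp_all

text \<open>The involution \<open>f \<mapsto> m div f\<close> on the divisors of
  \<open>m\<close>.\<close>

lemma sum_divisors_powr_reflect:
  assumes m: "m > 0"
  shows "(\<Sum>f | f dvd m. (of_nat f :: complex) powr z) = of_nat m powr z * (\<Sum>f | f dvd m. of_nat f powr (- z))"
proof -
  have inv: "m div f dvd m" "m div (m div f) = f" if f: "f dvd m" for f
  proof -
    obtain j where j: "m = f * j" using f unfolding dvd_def by blast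
    have nz: "f > 0" "j > 0" using j m by auto
    then have "m div f = j" using j by simp
    then show "m div f dvd m" "m div (m div f) = f" using j nz by simp_all
  qed
  have "(\<Sum>f | f dvd m. (of_nat f :: complex) powr z) = (\<Sum>f | f dvd m. of_nat (m div f) powr z)"
    by (rule sum.reindex_bij_witness[of _ "\<lambda>f. m div f" "\<lambda>f. m div f"]) (use inv in auto)
  also have "\<dots> = (\<Sum>f | f dvd m. of_nat m powr z * of_nat f powr (- z))"
  proof (rule sum.cong[OF refl])
    fix f assume "f \<in> {f. f dvd m}"
    then obtain j where j: "m = f * j" unfolding dvd_def by blast
    have nz: "f > 0" "j > 0" using j m by auto
    have "(of_nat f :: complex) powr z \<noteq> 0" using nz by simp
    moreover have "m div f = j" using j nz by simp
    moreover have "(of_nat m :: complex) powr z = of_nat f powr z * of_nat j powr z" unfolding j by (rule of_nat_mult_powr)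
    ultimately show "of_nat (m div f) powr z = (of_nat m :: complex) powr z * of_nat f powr (- z)"
      by (simp add: powr_minus field_simps)
  qed
  finally show ?thesis by (simp add: sum_distrib_left)
qed

lemma prod_primes_dvd:
  assumes "finite P" "\<And>p. p \<in> P \<Longrightarrow> prime (p::nat)" "\<And>p. p \<in> P \<Longrightarrow> p dvd m"
  shows "\<Prod>P dvd m"
  using assms
proof (induction P rule: finite_induct)
  case (insert p P)
  have "coprime p (\<Prod>P)"
  proof (rule prod_coprime_right)
    fix r assume r: "r \<in> P"
    then have "p \<noteq> r" using insert.hyps by blast
    then show "coprime p r" using primes_coprime[of p r] insert.prems(1)[of p] insert.prems(1)[of r] r by auto
  qed
  then have "p * \<Prod>P dvd m" using insert.IH insert.prems by (intro divides_mult) auto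
  then show ?case using insert.hyps by simp
qed simp

lemma dvd_and_primes_subset_iff:
  fixes n f :: nat
  assumes n: "n > 0" and P: "P \<subseteq> prime_factors n"
  shows "f dvd n \<and> P \<subseteq> prime_factors (n div f) \<longleftrightarrow> f dvd n div \<Prod>P"
proof -
  have fin: "finite P" using P finite_subset by blast
  have pr: "prime p" "p dvd n" if "p \<in> P" for p using that P by auto
  have Pd: "\<Prod>P dvd n" by (rule prod_primes_dvd[OF fin]) (use pr in auto)
  then obtain m where m: "n = \<Prod>P * m" unfolding dvd_def by blast
  have m0: "\<Prod>P > 0" "m > 0" using m n by (auto intro: gr0I)
  have nm: "n div \<Prod>P = m" using m m0 by simp
  show ?thesis unfolding nm
  proof
    assume A: "f dvd n \<and> P \<subseteq> prime_factors (n div f)"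
    then obtain j where j: "n = f * j" unfolding dvd_def by blast
    have "f > 0" using j n by auto
    then have "n div f = j" using j by simp
    then have "\<Prod>P dvd j" using A pr(1) by (intro prod_primes_dvd[OF fin]) auto
    then obtain i where i: "j = \<Prod>P * i" unfolding dvd_def by blast
    have "\<Prod>P * m = f * (\<Prod>P * i)" using m j i by (simp only:)
    then have "\<Prod>P * m = \<Prod>P * (f * i)" by (simp only: mult.left_commute)
    then have "m = f * i" using m0(1) by (metis mult_cancel_left less_irrefl)
    then show "f dvd m" by simp
  next
    assume "f dvd m"
    then obtain i where i: "m = f * i" unfolding dvd_def by blast
    have f0: "f > 0" "i > 0" using i m0 by auto
    have e: "n = f * (\<Prod>P * i)" using m i by simp
    then have nf: "n div f = \<Prod>P * i" using f0 by simp
    have "p \<in> prime_factors (n div f)" if "p \<in> P" for p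
    proof -
      have "p dvd \<Prod>P" using fin that by (rule dvd_prodI)
      then have "p dvd \<Prod>P * i" by (rule dvd_mult2)
      then show ?thesis unfolding nf using pr(1)[OF that] m0 f0 by (auto simp: in_prime_factors_iff)
    qed
    moreover have "f dvd n" unfolding e by (rule dvd_triv_left)
    ultimately show "f dvd n \<and> P \<subseteq> prime_factors (n div f)" by blast
  qed
qed

context quad_char
begin

definition euler :: "nat set \<Rightarrow> complex \<Rightarrow> complex" where
  "euler P w = (\<Prod>p\<in>P. 1 - of_int (chi (int p)) * of_nat p powr (- w))"

text \<open>This is the finite sum \<open>T\<close> of the overview.\<close>

definition divisor_factor :: "nat \<Rightarrow> complex \<Rightarrow> complex" where
  "divisor_factor n w = (\<Sum>f | f dvd n. of_nat f powr (1 - 2 * w) * euler (prime_factors (n div f)) w)"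

lemma norm_euler_term_le:
  assumes "p > 0"
  shows "norm (of_int (chi (int p)) * (of_nat p :: complex) powr (- w)) \<le> real p powr (- Re w)"
  unfolding norm_mult norm_of_nat_powr[OF assms] using mult_right_mono[OF norm_chi_le[of "int p"], of "real p powr (- Re w)"] by simp

lemma chi_series_summable:
  assumes "Re w > 1"
  shows "(\<lambda>k. norm (of_int (chi (int k)) * (of_nat k :: complex) powr (- w))) summable_on K"
proof (rule summable_on_comparison_test[OF summable_on_powr[OF assms]])
  show "norm (of_int (chi (int k)) * (of_nat k :: complex) powr (- w)) \<le> real k powr (- Re w)" for k
    by (cases "k = 0") (simp, simp add: norm_euler_term_le del: norm_of_int)
qed simp

lemma euler_sieve:
  assumes "finite P" "\<And>p. p \<in> P \<Longrightarrow> prime p" and w: "Re w > 1"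
  shows "(\<Sum>\<^sub>\<infinity>k\<in>{k. 0 < k \<and> (\<forall>p\<in>P. \<not> p dvd k)}. of_int (chi (int k)) * of_nat k powr (- w)) = Lfun w * euler P w"
  using assms(1,2)
proof (induction P rule: finite_induct)
  case empty
  have "(\<Sum>\<^sub>\<infinity>k\<in>{k. 0 < k}. of_int (chi (int k)) * of_nat k powr (- w)) = (\<Sum>k. if k \<in> {k. 0 < k} then of_int (chi (int k)) * of_nat k powr (- w) else 0)"
    by (rule infsum_nat_eq_suminf(1)[OF chi_series_summable[OF w]])
  also have "\<dots> = Lfun w"
  proof (rule sums_unique[symmetric])
    let ?f = "\<lambda>k. if k \<in> {k. 0 < k} then of_int (chi (int k)) * (of_nat k :: complex) powr (- w) else 0"
    have "(\<lambda>k. ?f (Suc k)) sums Lfun w" using Lfun_dirichlet_series[OF w] by simp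
    from sums_Suc[OF this] show "?f sums Lfun w" by simp
  qed
  finally show ?case by (simp add: euler_def)
next
  case (insert r P)
  define a where "a k = of_int (chi (int k)) * (of_nat k :: complex) powr (- w)" for k
  define KP where "KP = {k. 0 < k \<and> (\<forall>p\<in>P. \<not> p dvd k)}"
  define KR where "KR = {k. 0 < k \<and> (\<forall>p\<in>insert r P. \<not> p dvd k)}"
  have r: "prime r" using insert.prems by simp
  have r0: "r > 0" using r by (rule prime_gt_0_nat)
  have sm: "a summable_on K" for K
    unfolding a_def by (rule abs_summable_summable[OF chi_series_summable[OF w]])
  have un: "KP = KR \<union> (\<lambda>k. r * k) ` KP"
  proof (intro equalityI subsetI)
    fix k assume k: "k \<in> KP"
    show "k \<in> KR \<union> (\<lambda>k. r * k) ` KP"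
    proof (cases "r dvd k")
      case True
      then obtain j where j: "k = r * j" unfolding dvd_def by blast
      then have "j \<in> KP" using k by (auto simp: KP_def)
      then show ?thesis using j by blast
    next
      case False then show ?thesis using k by (auto simp: KP_def KR_def)
    qed
  next
    fix k assume "k \<in> KR \<union> (\<lambda>k. r * k) ` KP"
    then show "k \<in> KP"
    proof
      assume "k \<in> (\<lambda>k. r * k) ` KP"
      then obtain j where j: "k = r * j" "j \<in> KP" by blast
      have "\<not> p dvd r * j" if p: "p \<in> P" for p
      proof -
        have pp: "prime p" using insert.prems p by simp
        have "p \<noteq> r" using p insert.hyps by blast
        then have "\<not> p dvd r" using primes_dvd_imp_eq[OF pp r] by blast
        then show ?thesis using pp j(2) p by (auto simp: prime_dvd_mult_iff KP_def)
      qed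
      then show ?thesis using j r0 by (auto simp: KP_def)
    qed (auto simp: KP_def KR_def)
  qed
  have dj: "KR \<inter> (\<lambda>k. r * k) ` KP = {}" by (auto simp: KR_def)
  have "infsum a KP = infsum a KR + infsum a ((\<lambda>k. r * k) ` KP)"
    by (subst un) (rule infsum_Un_disjoint[OF sm sm dj])
  also have "infsum a ((\<lambda>k. r * k) ` KP) = infsum (a \<circ> (\<lambda>k. r * k)) KP"
    by (rule infsum_reindex) (use r0 in \<open>auto simp: inj_on_def\<close>)
  also have "a \<circ> (\<lambda>k. r * k) = (\<lambda>k. a r * a k)"
  proof (rule ext)
    fix k
    show "(a \<circ> (\<lambda>k. r * k)) k = a r * a k"
      unfolding a_def o_def of_nat_mult_powr by (simp add: chi_mult)
  qed
  also have "infsum (\<lambda>k. a r * a k) KP = a r * infsum a KP" by (rule infsum_cmult_right')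
  finally have f: "infsum a KP = infsum a KR + a r * infsum a KP" .
  have "infsum a KR = (1 - a r) * infsum a KP"
    unfolding left_diff_distrib mult_1_left eq_diff_eq by (rule f[symmetric])
  moreover have "infsum a KP = Lfun w * euler P w" unfolding a_def KP_def using insert by simp
  moreover have "euler (insert r P) w = (1 - a r) * euler P w"
    unfolding euler_def a_def using insert.hyps by simp
  ultimately have "infsum a KR = Lfun w * euler (insert r P) w" by simp
  then show ?case unfolding a_def KR_def .
qed

lemma holomorphic_euler: "euler P holomorphic_on UNIV"
  unfolding euler_def[abs_def] by (intro holomorphic_intros)

lemma norm_euler_le:
  assumes "\<And>p. p \<in> P \<Longrightarrow> p > 0" and a: "a \<le> Re w"
  shows "norm (euler P w) \<le> (\<Prod>p\<in>P. 1 + real p powr (- a))"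
  unfolding euler_def prod_norm[symmetric]
proof (rule prod_mono)
  fix p assume p: "p \<in> P"
  have p0: "p > 0" by (rule assms(1)[OF p])
  have "norm (1 - of_int (chi (int p)) * (of_nat p :: complex) powr (- w)) \<le> 1 + real p powr (- Re w)"
    using norm_triangle_ineq4[of 1 "of_int (chi (int p)) * (of_nat p :: complex) powr (- w)"] norm_euler_term_le[OF p0, of w] by simp
  also have "real p powr (- Re w) \<le> real p powr (- a)" using a p0 by (intro powr_mono) auto
  finally show "0 \<le> norm (1 - of_int (chi (int p)) * (of_nat p :: complex) powr (- w)) \<and>
      norm (1 - of_int (chi (int p)) * (of_nat p :: complex) powr (- w)) \<le> 1 + real p powr (- a)" by simp
qed

lemma holomorphic_divisor_factor: "divisor_factor n holomorphic_on UNIV"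
  unfolding divisor_factor_def[abs_def] by (intro holomorphic_intros holomorphic_euler)

lemma norm_divisor_factor_le:
  assumes n: "n > 0" and a: "a \<le> Re w"
  shows "norm (divisor_factor n w) \<le> (\<Sum>f | f dvd n. real f powr (1 - 2 * a) * (\<Prod>p\<in>prime_factors (n div f). 1 + real p powr (- a)))"
  unfolding divisor_factor_def
proof (rule sum_norm_le)
  fix f assume "f \<in> {f. f dvd n}"
  then have f: "f > 0" using n by (auto intro: dvd_pos_nat)
  have "norm ((of_nat f :: complex) powr (1 - 2 * w)) = real f powr (1 - 2 * Re w)"
    using norm_of_nat_powr[OF f, of "1 - 2 * w"] by simp
  also have "\<dots> \<le> real f powr (1 - 2 * a)" using a f by (intro powr_mono) auto
  finally show "norm (of_nat f powr (1 - 2 * w) * euler (prime_factors (n div f)) w)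
      \<le> real f powr (1 - 2 * a) * (\<Prod>p\<in>prime_factors (n div f). 1 + real p powr (- a))"
    unfolding norm_mult by (intro mult_mono norm_euler_le a) (auto intro: prime_gt_0_nat in_prime_factors_imp_prime)
qed

lemma euler_expand:
  assumes "finite P"
  shows "euler P w = (\<Sum>X\<in>Pow P. \<Prod>p\<in>X. - (of_int (chi (int p)) * of_nat p powr (- w)))"
  unfolding euler_def using prod_add[OF assms, of "\<lambda>p. - (of_int (chi (int p)) * (of_nat p :: complex) powr (- w))" "\<lambda>_. 1"]
  by simp

text \<open>A set \<open>P\<close> of primes consists of divisors of \<open>n div f\<close> exactly when \<open>f\<close> divides \<open>n div \<Prod>P\<close>.\<close>
lemma divisor_factor_expand:
  assumes n: "n > 0"
  shows "divisor_factor n w = (\<Sum>P\<in>Pow (prime_factors n).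
    (\<Prod>p\<in>P. - (of_int (chi (int p)) * of_nat p powr (- w))) * (\<Sum>f | f dvd n div \<Prod>P. of_nat f powr (1 - 2 * w)))"
proof -
  define c where "c P = (\<Prod>p\<in>P. - (of_int (chi (int p)) * (of_nat p :: complex) powr (- w)))" for P
  have fin: "finite {f. f dvd n}" using n by simp
  have "divisor_factor n w = (\<Sum>f | f dvd n. \<Sum>P\<in>Pow (prime_factors n).
      if P \<subseteq> prime_factors (n div f) then c P * of_nat f powr (1 - 2 * w) else 0)"
    unfolding divisor_factor_def
  proof (rule sum.cong[OF refl])
    fix f assume "f \<in> {f. f dvd n}"
    then have f: "n div f dvd n" by (auto simp: dvd_def)
    have sub: "prime_factors (n div f) \<subseteq> prime_factors n" using dvd_prime_factors[OF _ f] n by simp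
    have "of_nat f powr (1 - 2 * w) * euler (prime_factors (n div f)) w = (\<Sum>P\<in>Pow (prime_factors (n div f)). c P * of_nat f powr (1 - 2 * w))"
      by (subst euler_expand) (simp_all add: c_def sum_distrib_left mult.commute)
    also have "Pow (prime_factors (n div f)) = {P \<in> Pow (prime_factors n). P \<subseteq> prime_factors (n div f)}"
      using sub by auto
    also have "(\<Sum>P\<in>\<dots>. c P * of_nat f powr (1 - 2 * w)) = (\<Sum>P\<in>Pow (prime_factors n).
      if P \<subseteq> prime_factors (n div f) then c P * of_nat f powr (1 - 2 * w) else 0)"
      by (rule sum.inter_filter) simp
    finally show "of_nat f powr (1 - 2 * w) * euler (prime_factors (n div f)) w = (\<Sum>P\<in>Pow (prime_factors n).
      if P \<subseteq> prime_factors (n div f) then c P * of_nat f powr (1 - 2 * w) else 0)" .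
  qed
  also have "\<dots> = (\<Sum>P\<in>Pow (prime_factors n). \<Sum>f | f dvd n.
      if P \<subseteq> prime_factors (n div f) then c P * of_nat f powr (1 - 2 * w) else 0)"
    by (rule sum.swap)
  also have "\<dots> = (\<Sum>P\<in>Pow (prime_factors n). c P * (\<Sum>f | f dvd n div \<Prod>P. of_nat f powr (1 - 2 * w)))"
  proof (rule sum.cong[OF refl])
    fix P assume "P \<in> Pow (prime_factors n)"
    then have P: "P \<subseteq> prime_factors n" by simp
    have "(\<Sum>f | f dvd n. if P \<subseteq> prime_factors (n div f) then c P * of_nat f powr (1 - 2 * w) else 0)
      = (\<Sum>f\<in>{f \<in> {f. f dvd n}. P \<subseteq> prime_factors (n div f)}. c P * of_nat f powr (1 - 2 * w))"
      by (rule sum.inter_filter[OF fin, symmetric])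
    also have "{f \<in> {f. f dvd n}. P \<subseteq> prime_factors (n div f)} = {f. f dvd n div \<Prod>P}"
      using dvd_and_primes_subset_iff[OF n P] by blast
    finally show "(\<Sum>f | f dvd n. if P \<subseteq> prime_factors (n div f) then c P * of_nat f powr (1 - 2 * w) else 0)
      = c P * (\<Sum>f | f dvd n div \<Prod>P. of_nat f powr (1 - 2 * w))" by (simp add: sum_distrib_left)
  qed
  finally show ?thesis by (simp add: c_def)
qed

text \<open>The reflection holds for each set \<open>P\<close> of primes separately. With
  \<open>n = \<Prod>P * m\<close> the product over \<open>P\<close> contributes
  \<open>\<Prod>P\<close> and the divisor sum contributes \<open>m\<close>, each to the power
  \<open>1 - 2 * w\<close>; the values of \<open>chi\<close>, being integers, are the same on both
  sides.\<close>

theorem divisor_factor_reflect: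
  assumes n: "n > 0"
  shows "divisor_factor n w = of_nat n powr (1 - 2 * w) * divisor_factor n (1 - w)"
proof -
  define c where "c P w = (\<Prod>p\<in>P. - (of_int (chi (int p)) * (of_nat p :: complex) powr (- w)))" for P w
  have c: "c P w = of_nat (\<Prod>P) powr (1 - 2 * w) * c P (1 - w)" if "finite P" "\<And>p. p \<in> P \<Longrightarrow> p > 0" for P
    using that
  proof (induction P rule: finite_induct)
    case empty then show ?case by (simp add: c_def)
  next
    case (insert p P)
    have "(of_nat p :: complex) powr (- w) = of_nat p powr ((1 - 2 * w) + (- (1 - w)))" by simp
    also have "\<dots> = of_nat p powr (1 - 2 * w) * of_nat p powr (- (1 - w))" by (rule powr_add)
    finally have 1: "- (of_int (chi (int p)) * (of_nat p :: complex) powr (- w)) =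
      of_nat p powr (1 - 2 * w) * - (of_int (chi (int p)) * of_nat p powr (- (1 - w)))" by simp
    have i: "c (insert p P) w = - (of_int (chi (int p)) * of_nat p powr (- w)) * c P w" for w
      unfolding c_def using insert.hyps by simp
    have "\<Prod>(insert p P) = p * \<Prod>P" using insert.hyps by simp
    then have "(of_nat (\<Prod>(insert p P)) :: complex) powr (1 - 2 * w) = of_nat p powr (1 - 2 * w) * of_nat (\<Prod>P) powr (1 - 2 * w)"
      using of_nat_mult_powr[of p "\<Prod>P" "1 - 2 * w"] by simp
    moreover have "c P w = of_nat (\<Prod>P) powr (1 - 2 * w) * c P (1 - w)" using insert by simp
    ultimately show ?case unfolding i 1 by (simp only: mult_ac)
  qed
  have main: "c P w * (\<Sum>f | f dvd n div \<Prod>P. of_nat f powr (1 - 2 * w)) =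
      of_nat n powr (1 - 2 * w) * (c P (1 - w) * (\<Sum>f | f dvd n div \<Prod>P. of_nat f powr (1 - 2 * (1 - w))))"
    if P: "P \<subseteq> prime_factors n" for P
  proof -
    have fin: "finite P" using P finite_subset by blast
    have pr: "prime p" "p dvd n" if "p \<in> P" for p using that P by auto
    have "\<Prod>P dvd n" by (rule prod_primes_dvd[OF fin]) (use pr in auto)
    then obtain m where m: "n = \<Prod>P * m" unfolding dvd_def by blast
    have m0: "\<Prod>P > 0" "m > 0" using m n by (auto intro: gr0I)
    have nm: "n div \<Prod>P = m" using m m0 by simp
    have "(of_nat n :: complex) powr (1 - 2 * w) = of_nat (\<Prod>P) powr (1 - 2 * w) * of_nat m powr (1 - 2 * w)"
      using of_nat_mult_powr[of "\<Prod>P" m] m by simp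
    moreover have "(\<Sum>f | f dvd m. (of_nat f :: complex) powr (1 - 2 * w)) = of_nat m powr (1 - 2 * w) * (\<Sum>f | f dvd m. of_nat f powr (- (1 - 2 * w)))"
      by (rule sum_divisors_powr_reflect[OF m0(2)])
    moreover have "- (1 - 2 * w) = 1 - 2 * (1 - w)" by simp
    moreover have "c P w = of_nat (\<Prod>P) powr (1 - 2 * w) * c P (1 - w)" using c[OF fin] pr(1) prime_gt_0_nat by blast
    ultimately show ?thesis unfolding nm by (simp only: mult_ac)
  qed
  have e: "divisor_factor n w = (\<Sum>P\<in>Pow (prime_factors n). c P w * (\<Sum>f | f dvd n div \<Prod>P. of_nat f powr (1 - 2 * w)))" for w
    unfolding c_def by (rule divisor_factor_expand[OF n])
  show ?thesis
    unfolding e sum_distrib_left[of "of_nat n powr (1 - 2 * w)"]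
    by (rule sum.cong[OF refl], rule main, simp)
qed

text \<open>\<open>Re w < 0\<close> keeps the gamma factor of \<open>1 - w\<close> away from its
  poles, so that dividing it out of the symmetric \<open>Lam\<close> is legitimate.\<close>

lemma Lfun_functional_equation:
  assumes w: "Re w < 0"
  shows "Lfun w = of_real (pi / q) powr (w - 1/2) * Gamma ((of_nat \<iota> + 1 - w) / 2) * rGamma ((of_nat \<iota> + w) / 2) * Lfun (1 - w)"
proof -
  define z where "z = (of_nat \<iota> + 1 - w) / 2"
  have z: "(1 - w + of_nat \<iota>) / 2 = z" by (simp add: z_def)
  have "Re z > 0" using w by (simp add: z_def)
  then have "z \<notin> \<int>\<^sub>\<le>\<^sub>0" by (rule not_nonpos_Int_if_Re_pos)
  then have G: "Gamma z * rGamma z = 1" by (simp add: rGamma_inverse_Gamma Gamma_eq_zero_iff)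
  have "complex_of_real (pi / q) powr ((w + of_nat \<iota>) / 2) = of_real (pi / q) powr ((w - 1/2) + z)"
    by (rule arg_cong[of _ _ "\<lambda>u. _ powr u"]) (simp add: z_def field_simps)
  also have "\<dots> = of_real (pi / q) powr (w - 1/2) * of_real (pi / q) powr z" by (rule powr_add)
  finally have p: "complex_of_real (pi / q) powr ((w + of_nat \<iota>) / 2) = of_real (pi / q) powr (w - 1/2) * of_real (pi / q) powr z" .
  have "of_real (pi / q) powr (w - 1/2) * Gamma z * rGamma ((of_nat \<iota> + w) / 2) * Lfun (1 - w)
    = Lam w * (of_real (pi / q) powr (w - 1/2) * of_real (pi / q) powr z) * rGamma ((of_nat \<iota> + w) / 2) * (Gamma z * rGamma z)"
    unfolding Lfun_def Lam_reflect z by (simp only: mult_ac)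
  also have "\<dots> = Lfun w" unfolding G p[symmetric] Lfun_def by (simp add: add.commute)
  finally show ?thesis by (simp add: z_def)
qed

end

section \<open>The function \<open>L\<close> of the S-integer and its functional equation\<close>

locale imprimitive_character = quad_char D chi for D :: int and chi :: "int \<Rightarrow> int" +
  fixes Q :: "nat set" and n :: nat
  assumes finQ: "finite Q" and Qp: "\<And>p. p \<in> Q \<Longrightarrow> prime p"
    and n_pos: "n > 0" and n_coprime: "\<And>p. p \<in> Q \<Longrightarrow> \<not> p dvd n"
begin

definition Limp :: "complex \<Rightarrow> complex" where
  "Limp w = Lfun w * euler Q w * divisor_factor n w"

definition euler_ratio :: "complex \<Rightarrow> complex" where
  "euler_ratio w = (\<Prod>p\<in>Q. (1 - of_int (chi (int p)) * of_nat p powr (- w)) / (1 - of_int (chi (int p)) * of_nat p powr (- (1 - w))))"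

text \<open>The factor \<open>W\<close> of the overview; the first base is \<bar>\<tau>\<bar>.
  Writing \<open>rGamma\<close> for the reciprocal of the second gamma factor keeps that factor
  entire.\<close>

definition Wfun :: "complex \<Rightarrow> complex" where
  "Wfun w = of_real ((real n)\<^sup>2 * q) powr (1/2 - w) * of_real pi powr (w - 1/2) * euler_ratio w *
     Gamma ((of_nat \<iota> + 1 - w) / 2) * rGamma ((of_nat \<iota> + w) / 2)"

definition coef :: "nat \<Rightarrow> nat \<Rightarrow> complex" where
  "coef f k = (if \<forall>p\<in>prime_factors (n div f). \<not> p dvd k then of_int (chi (int k)) else 0)"

abbreviation KQ :: "nat set" where "KQ \<equiv> {k. 0 < k \<and> (\<forall>p\<in>Q. \<not> p dvd k)}"

lemma Q_pos: "p \<in> Q \<Longrightarrow> p > 0" using Qp prime_gt_0_nat by blast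

text \<open>For fixed \<open>f\<close> the admissible \<open>k\<close> avoid the primes of
  \<open>Q\<close> and those of \<open>n div f\<close>. These sets are disjoint since no prime of
  \<open>Q\<close> divides \<open>n\<close>, so one sieve over the union yields the product of both
  Euler factors.\<close>

sublocale family: dirichlet_family Limp "{f. f dvd n}" KQ coef
proof
  show "finite {f. f dvd n}" using n_pos by simp
  show "0 \<notin> {f. f dvd n}" using n_pos by simp
  show "0 \<notin> KQ" by simp
  show "norm (coef f k) \<le> 1" for f k unfolding coef_def using norm_chi_le[of "int k"] by (simp del: norm_of_int)
  fix w assume w: "Re w > 1"
  have "(\<Sum>\<^sub>\<infinity>k\<in>KQ. coef f k * of_nat k powr (- w)) = Lfun w * euler Q w * euler (prime_factors (n div f)) w" if f: "f dvd n" for f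
  proof -
    let ?S = "prime_factors (n div f)"
    have dn: "n div f dvd n" using f by (auto simp: dvd_def)
    have "(\<Sum>\<^sub>\<infinity>k\<in>KQ. coef f k * of_nat k powr (- w)) =
        (\<Sum>\<^sub>\<infinity>k\<in>{k. 0 < k \<and> (\<forall>p\<in>Q \<union> ?S. \<not> p dvd k)}. of_int (chi (int k)) * of_nat k powr (- w))"
      by (rule infsum_cong_neutral) (auto simp: coef_def)
    also have "\<dots> = Lfun w * euler (Q \<union> ?S) w"
      by (rule euler_sieve[OF _ _ w]) (use finQ Qp in auto)
    also have "euler (Q \<union> ?S) w = euler Q w * euler ?S w"
    proof -
      have "Q \<inter> ?S = {}" using n_coprime dvd_trans[OF _ dn] by (auto simp: in_prime_factors_iff)
      then show ?thesis unfolding euler_def by (intro prod.union_disjoint finQ) auto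
    qed
    finally show ?thesis by (simp only: mult.assoc)
  qed
  then show "Limp w = (\<Sum>f | f dvd n. of_nat f powr (1 - 2 * w) * (\<Sum>\<^sub>\<infinity>k\<in>KQ. coef f k * of_nat k powr (- w)))"
    unfolding Limp_def divisor_factor_def sum_distrib_left by (intro sum.cong refl) (simp add: mult_ac)
qed

lemma holomorphic_Limp: "Limp holomorphic_on UNIV"
  unfolding Limp_def[abs_def] by (intro holomorphic_on_mult holomorphic_Lfun holomorphic_euler holomorphic_divisor_factor)

lemma Limp_growth: "\<exists>C\<ge>0. \<forall>x\<in>{a..b}. \<forall>y. norm (Limp (Complex x y)) \<le> C * exp (17/20 * \<bar>y\<bar>)"
proof -
  obtain C where C: "C \<ge> 0" "\<And>x y. x \<in> {a..b} \<Longrightarrow> norm (Lfun (Complex x y)) \<le> C * exp (17/20 * \<bar>y\<bar>)"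
    using Lfun_growth[of a b] by blast
  define M1 where "M1 = (\<Prod>p\<in>Q. 1 + real p powr (- a))"
  define M2 where "M2 = (\<Sum>f | f dvd n. real f powr (1 - 2 * a) * (\<Prod>p\<in>prime_factors (n div f). 1 + real p powr (- a)))"
  have M1: "M1 \<ge> 0" unfolding M1_def by (intro prod_nonneg) (auto intro: add_nonneg_nonneg)
  have M2: "M2 \<ge> 0" unfolding M2_def by (intro sum_nonneg mult_nonneg_nonneg prod_nonneg) (auto intro: add_nonneg_nonneg)
  have "norm (Limp (Complex x y)) \<le> C * M1 * M2 * exp (17/20 * \<bar>y\<bar>)" if x: "x \<in> {a..b}" for x y
  proof -
    have e: "norm (euler Q (Complex x y)) \<le> M1" unfolding M1_def using x by (intro norm_euler_le Q_pos) auto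
    have d: "norm (divisor_factor n (Complex x y)) \<le> M2" unfolding M2_def using x by (intro norm_divisor_factor_le n_pos) auto
    have "norm (Limp (Complex x y)) \<le> (C * exp (17/20 * \<bar>y\<bar>)) * M1 * M2"
      unfolding Limp_def norm_mult using C(1) M1 M2 by (intro mult_mono C(2)[OF x] e d mult_nonneg_nonneg) auto
    then show ?thesis by (simp add: mult_ac)
  qed
  moreover have "C * M1 * M2 \<ge> 0" using C M1 M2 by simp
  ultimately show ?thesis by blast
qed

lemma euler_denominator:
  assumes "Re w < 0" "p \<in> Q"
  shows "norm (1 - of_int (chi (int p)) * (of_nat p :: complex) powr (- (1 - w))) \<ge> 1 - real p powr (Re w - 1)"
    and "1 - real p powr (Re w - 1) > 0"
proof -
  have p: "p > 1" using Qp[OF assms(2)] by (rule prime_gt_1_nat)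
  have "norm (of_int (chi (int p)) * (of_nat p :: complex) powr (- (1 - w))) \<le> real p powr (Re w - 1)"
    using norm_euler_term_le[of p "1 - w"] p by simp
  then show "norm (1 - of_int (chi (int p)) * (of_nat p :: complex) powr (- (1 - w))) \<ge> 1 - real p powr (Re w - 1)"
    using norm_triangle_ineq2[of 1 "of_int (chi (int p)) * (of_nat p :: complex) powr (- (1 - w))"] by simp
  show "1 - real p powr (Re w - 1) > 0" using powr_less_mono[of "Re w - 1" 0 "real p"] assms(1) p by simp
qed

text \<open>The Euler factors at \<open>Q\<close> have no reflection of their own; their quotient
  stays in \<open>Wfun\<close>, and for \<open>Re w < 0\<close> the denominators do not vanish. The
  conductor and the reflected divisor sum combine to the power of \<bar>\<tau>\<bar>.\<close>

lemma Limp_functional_equation: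
  assumes w: "Re w < 0"
  shows "Limp w = Wfun w * Limp (1 - w)"
proof -
  have nz: "1 - of_int (chi (int p)) * (of_nat p :: complex) powr (- (1 - w)) \<noteq> 0" if "p \<in> Q" for p
    using euler_denominator[OF w that] by auto
  then have "euler Q (1 - w) \<noteq> 0" unfolding euler_def using finQ by simp
  moreover have "euler_ratio w = euler Q w / euler Q (1 - w)" unfolding euler_ratio_def euler_def by (rule prod_dividef)
  ultimately have e: "euler Q w = euler_ratio w * euler Q (1 - w)" by simp
  have qp: "q > 0" "pi / q > 0" "(real n)\<^sup>2 * q > 0" "real n > 0" using q_pos n_pos by auto
  have "complex_of_real ((real n)\<^sup>2 * q) powr (1/2 - w) * of_real pi powr (w - 1/2) = of_real (real n) powr (1 - 2 * w) * of_real (pi / q) powr (w - 1/2)"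
  proof -
    have l1: "ln ((real n)\<^sup>2 * q) = 2 * ln (real n) + ln q" using qp by (simp add: ln_mult ln_realpow)
    have l2: "ln (pi / q) = ln pi - ln q" using qp by (simp add: ln_div)
    show ?thesis unfolding of_real_powr[OF qp(3)] of_real_powr[OF pi_gt_zero] of_real_powr[OF qp(4)] of_real_powr[OF qp(2)] exp_add[symmetric] l1 l2
      by (rule arg_cong[of _ _ exp]) (simp add: algebra_simps)
  qed
  then have c: "of_real ((real n)\<^sup>2 * q) powr (1/2 - w) * of_real pi powr (w - 1/2) = of_nat n powr (1 - 2 * w) * of_real (pi / q) powr (w - 1/2)" by simp
  have "Limp w = (of_real (pi / q) powr (w - 1/2) * Gamma ((of_nat \<iota> + 1 - w) / 2) * rGamma ((of_nat \<iota> + w) / 2) * Lfun (1 - w)) *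
     (euler_ratio w * euler Q (1 - w)) * (of_nat n powr (1 - 2 * w) * divisor_factor n (1 - w))"
    unfolding Limp_def using Lfun_functional_equation[OF w] e divisor_factor_reflect[OF n_pos, of w] by simp
  also have "\<dots> = (of_nat n powr (1 - 2 * w) * of_real (pi / q) powr (w - 1/2)) * euler_ratio w *
     Gamma ((of_nat \<iota> + 1 - w) / 2) * rGamma ((of_nat \<iota> + w) / 2) * Limp (1 - w)"
    unfolding Limp_def by (simp only: mult_ac)
  finally show ?thesis unfolding Wfun_def c .
qed

text \<open>On a vertical line the powers have constant modulus, the Euler quotient is bounded
  because its denominators stay away from 0, and the numerator gamma factor is bounded by its value
  at the real part. Only \<open>rGamma\<close>, evaluated at half the height, grows.\<close>

lemma
  fixes s :: complex and \<sigma> :: real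
  assumes s: "\<sigma> + Re (1 - s) > 1"
  shows continuous_Wfun_line: "continuous_on UNIV (\<lambda>t. Wfun (s - Complex \<sigma> t))"
    and Wfun_line_bound: "\<exists>B. \<forall>t. norm (Wfun (s - Complex \<sigma> t)) \<le> B * exp (17/20 * \<bar>t\<bar>)"
proof -
  define w where "w t = s - Complex \<sigma> t" for t
  define x where "x = Re s - \<sigma>"
  have x: "x < 0" using s by (simp add: x_def)
  have Re_w: "Re (w t) = x" for t by (simp add: w_def x_def)
  have Im_w: "Im (w t) = Im s - t" for t by (simp add: w_def)
  have wc: "continuous_on UNIV w" unfolding w_def Complex_eq by (intro continuous_intros)
  have Re_w0: "Re (w t) < 0" for t using x Re_w by simp
  have qp: "(real n)\<^sup>2 * q > 0" using q_pos n_pos by simp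
  have nz: "1 - of_int (chi (int p)) * (of_nat p :: complex) powr (- (1 - w t)) \<noteq> 0" if "p \<in> Q" for p t
    using euler_denominator[OF Re_w0 that, of t] by auto
  have G: "(of_nat \<iota> + 1 - w t) / 2 \<notin> \<int>\<^sub>\<le>\<^sub>0" for t
  proof -
    have "Re ((of_nat \<iota> + 1 - w t) / 2) > 0" using Re_w0[of t] by simp
    then show ?thesis by (rule not_nonpos_Int_if_Re_pos)
  qed
  have pw: "continuous_on UNIV (\<lambda>t. (of_nat p :: complex) powr g t)" if "continuous_on UNIV g" "p \<in> Q" for p and g :: "real \<Rightarrow> complex"
    using that Q_pos[OF that(2)] by (simp add: powr_def) (intro continuous_intros, auto)
  have rp: "continuous_on UNIV (\<lambda>t. complex_of_real y powr g t)" if "continuous_on UNIV g" "y > 0" for y and g :: "real \<Rightarrow> complex"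
    unfolding of_real_powr[OF that(2)] using that by (intro continuous_intros)
  have "continuous_on UNIV (\<lambda>t. euler_ratio (w t))"
    unfolding euler_ratio_def by (intro continuous_on_prod continuous_on_divide continuous_intros pw wc) (use nz in auto)
  moreover have "continuous_on UNIV (\<lambda>t. Gamma ((of_nat \<iota> + 1 - w t) / 2))"
    by (rule continuous_on_compose2[of "- \<int>\<^sub>\<le>\<^sub>0" Gamma])
      (use G in \<open>auto intro!: continuous_intros wc holomorphic_on_imp_continuous_on holomorphic_Gamma\<close>)
  moreover have "continuous_on UNIV (\<lambda>t. rGamma ((of_nat \<iota> + w t) / 2))"
    by (rule continuous_on_compose2[of UNIV rGamma]) (auto intro!: continuous_intros wc holomorphic_on_imp_continuous_on holomorphic_rGamma)
  ultimately show "continuous_on UNIV (\<lambda>t. Wfun (s - Complex \<sigma> t))"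
    unfolding Wfun_def w_def[symmetric] by (intro continuous_on_mult rp continuous_intros wc qp pi_gt_zero)
  define y where "y = (real \<iota> + x) / 2"
  obtain C where C: "C \<ge> 0" "\<And>v. norm (rGamma (Complex y v)) \<le> C * exp (17/10 * \<bar>v\<bar>)"
    using norm_rGamma_strip_le[of y y] by auto
  define R where "R = (\<Prod>p\<in>Q. (1 + real p powr (- x)) / (1 - real p powr (x - 1)))"
  define G1 where "G1 = Gamma ((real \<iota> + 1 - x) / 2)"
  define M where "M = ((real n)\<^sup>2 * q) powr (1/2 - x) * pi powr (x - 1/2)"
  have dpos: "1 - real p powr (x - 1) > 0" if "p \<in> Q" for p using euler_denominator(2)[OF Re_w0 that] Re_w by simp
  have R: "R \<ge> 0" unfolding R_def using dpos by (intro prod_nonneg divide_nonneg_pos) (auto intro: add_nonneg_nonneg)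
  have G1: "G1 \<ge> 0" unfolding G1_def using x by (intro Gamma_real_nonneg) auto
  have M: "M \<ge> 0" by (simp add: M_def)
  have "norm (Wfun (w t)) \<le> (M * R * G1 * C * exp (17/20 * \<bar>Im s\<bar>)) * exp (17/20 * \<bar>t\<bar>)" for t
  proof -
    have 1: "norm (of_real ((real n)\<^sup>2 * q) powr (1/2 - w t) * of_real pi powr (w t - 1/2)) \<le> M"
      unfolding norm_mult norm_of_real_powr[OF qp] norm_of_real_powr[OF pi_gt_zero] M_def using Re_w[of t] by simp
    have 2: "norm (euler_ratio (w t)) \<le> R"
      unfolding euler_ratio_def R_def prod_norm[symmetric]
    proof (rule prod_mono)
      fix p assume p: "p \<in> Q"
      have "norm (1 - of_int (chi (int p)) * (of_nat p :: complex) powr (- w t)) \<le> 1 + real p powr (- x)"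
        using norm_triangle_ineq4[of 1 "of_int (chi (int p)) * (of_nat p :: complex) powr (- w t)"] norm_euler_term_le[OF Q_pos[OF p], of "w t"] Re_w[of t] by simp
      then show "0 \<le> norm ((1 - of_int (chi (int p)) * (of_nat p :: complex) powr (- w t)) / (1 - of_int (chi (int p)) * of_nat p powr (- (1 - w t)))) \<and>
        norm ((1 - of_int (chi (int p)) * (of_nat p :: complex) powr (- w t)) / (1 - of_int (chi (int p)) * of_nat p powr (- (1 - w t)))) \<le> (1 + real p powr (- x)) / (1 - real p powr (x - 1))"
        unfolding norm_divide using euler_denominator(1)[OF Re_w0 p, of t] Re_w[of t] dpos[OF p]
        by (intro conjI divide_nonneg_nonneg norm_ge_zero frac_le) (auto intro: add_nonneg_nonneg)
    qed
    have z: "Re ((of_nat \<iota> + 1 - w t) / 2) = (real \<iota> + 1 - x) / 2" using Re_w[of t] by simp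
    have 3: "norm (Gamma ((of_nat \<iota> + 1 - w t) / 2)) \<le> G1"
      using norm_Gamma_le_Gamma_Re[of "(of_nat \<iota> + 1 - w t) / 2"] x unfolding z G1_def by simp
    have "(of_nat \<iota> + w t) / 2 = Complex y ((Im s - t) / 2)" (is "?z = _")
      using Re_w[of t] Im_w[of t] by (simp add: complex_eq_iff y_def)
    then have "norm (rGamma ?z) \<le> C * exp (17/10 * \<bar>(Im s - t) / 2\<bar>)" using C(2) by (simp only:)
    also have "\<dots> \<le> C * exp (17/20 * \<bar>Im s\<bar> + 17/20 * \<bar>t\<bar>)"
      using C(1) abs_triangle_ineq4[of "Im s" t] by (intro mult_left_mono) (simp_all add: field_simps)
    finally have 4: "norm (rGamma ((of_nat \<iota> + w t) / 2)) \<le> C * (exp (17/20 * \<bar>Im s\<bar>) * exp (17/20 * \<bar>t\<bar>))" by (simp add: exp_add)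
    have "norm (Wfun (w t)) \<le> M * R * G1 * (C * (exp (17/20 * \<bar>Im s\<bar>) * exp (17/20 * \<bar>t\<bar>)))"
      unfolding Wfun_def norm_mult[of "_ * _ * _ * _" "rGamma _"] norm_mult[of "_ * _ * _" "Gamma _"] norm_mult[of "_ * _" "euler_ratio _"]
      using M R G1 by (intro mult_mono 1 2 3 4 mult_nonneg_nonneg norm_ge_zero) auto
    then show ?thesis by (simp only: mult_ac)
  qed
  then show "\<exists>B. \<forall>t. norm (Wfun (s - Complex \<sigma> t)) \<le> B * exp (17/20 * \<bar>t\<bar>)" unfolding w_def by blast
qed

theorem Limp_approximate_functional_equation:
  fixes s :: complex and A \<sigma> :: real
  assumes A: "A > 0" and \<sigma>: "\<sigma> + Re s > 1" "\<sigma> + Re (1 - s) > 1"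
  shows "Limp s = (\<Sum>f | f dvd n. \<Sum>\<^sub>\<infinity>k\<in>KQ. 1 / (of_nat k powr s * of_nat f powr (2 * s - 1)) * coef f k * of_real (Fcut (real k * real f ^ 2 / A)))
     + (\<Sum>f | f dvd n. \<Sum>\<^sub>\<infinity>k\<in>KQ. 1 / (of_nat k powr (1 - s) * of_nat f powr (1 - 2 * s)) * coef f k *
       (1 / (2 * pi) * (\<integral>t. Fmellin (Complex \<sigma> t) * Wfun (s - Complex \<sigma> t) * of_real (real k * real f ^ 2 * A) powr (- Complex \<sigma> t) \<partial>lborel)))"
proof -
  obtain B where B: "\<And>t. norm (Wfun (s - Complex \<sigma> t)) \<le> B * exp (17/20 * \<bar>t\<bar>)" using Wfun_line_bound[OF \<sigma>(2)] by blast
  show ?thesis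
    by (rule family.approximate_functional_equation[OF holomorphic_Limp Limp_growth Limp_functional_equation A \<sigma> continuous_Wfun_line[OF \<sigma>(2)] B])
qed

end

context nonsquare_S_integer
begin

text \<open>Since \<delta> is not a square, \<bar>D\<bar> > 1 and some prime divides
  \<open>D\<close>. There the Kronecker symbol vanishes, and multiplying it by 0 gives
  \<open>chi 0 = 0\<close>.\<close>

lemma good_character_zero:
  assumes "good_character D chi"
  shows "chi 0 = 0"
proof -
  have "\<bar>D\<bar> \<noteq> 1"
  proof
    assume "\<bar>D\<bar> = 1"
    then have "D = 1 \<or> D = - 1" by linarith
    then show False using d_not_1 by (auto simp: D_def fund_disc_eq disc_of_def split: if_splits; presburger)
  qed
  then have "nat \<bar>D\<bar> \<noteq> 1" by simp
  then obtain l where l: "prime l" "l dvd nat \<bar>D\<bar>" using prime_factor_nat by blast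
  have "int l dvd int (nat \<bar>D\<bar>)" using l(2) by (simp only: int_dvd_int_iff)
  then have lD: "int l dvd D" by simp
  have "kronecker D l = 0" using lD by (auto simp: kronecker_def Legendre_def cong_0_iff)
  then have "chi (int l) = 0" using assms l(1) by (simp add: good_character_def)
  moreover have "chi (0 * int l) = chi 0 * chi (int l)"
    using assms unfolding good_character_def quadratic_character_def by blast
  ultimately show ?thesis by simp
qed

lemma approximate_functional_equation:
  fixes s :: complex and A \<sigma> :: real
  assumes A: "A > 0" and \<sigma>: "\<sigma> + Re s > 1" "\<sigma> + Re (1 - s) > 1"
  shows "LS Q \<delta> s =
    (\<Sum>\<^sub>\<infinity> f \<in> fset Q \<delta>. \<Sum>\<^sub>\<infinity> k \<in> ZSpos Q.
        1 / (of_nat k powr s * of_nat f powr (2 * s - 1)) *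
        of_int (jac (\<delta> / of_nat f ^ 2) k) *
        complex_of_real (Fcut (real k * real f ^ 2 / A)))
    + complex_of_real \<bar>real_of_rat (tau Q \<delta>)\<bar> powr (1/2 - s) *
    (\<Sum>\<^sub>\<infinity> f \<in> fset Q \<delta>. \<Sum>\<^sub>\<infinity> k \<in> ZSpos Q.
        1 / (of_nat k powr (1 - s) * of_nat f powr (1 - 2 * s)) *
        of_int (jac (\<delta> / of_nat f ^ 2) k) *
        Vfun Q (if \<delta> > 0 then 0 else 1) (eps Q \<delta>) s \<sigma>
          (real k * real f ^ 2 * A / \<bar>real_of_rat (tau Q \<delta>)\<bar>))"
proof -
  obtain chi where chi: "good_character D chi"
    using good_character_exists[OF squarefree_d] unfolding D_def fund_disc_eq by blast
  interpret C: imprimitive_character D chi Q n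
    by unfold_locales (use chi good_character_zero[OF chi] finQ Qp n_spec(1) n_coprime in \<open>auto simp: good_character_def\<close>)
  have K: "ZSpos Q = C.KQ" by (auto simp: ZSpos_iff)
  have fin: "finite {f. f dvd n}" using n_spec(1) by simp
  have coef: "of_int (jac (\<delta> / of_nat f ^ 2) k) = C.coef f k" if "f dvd n" "k \<in> C.KQ" for f k
    using jac_eq[OF chi that(1)] that(2) K by (simp add: C.coef_def)
  define \<tau> where "\<tau> = (real n)\<^sup>2 * C.q"
  have tau: "\<bar>real_of_rat (tau Q \<delta>)\<bar> = \<tau>"
    unfolding tau_eq \<tau>_def C.q_def of_rat_of_int_eq by (simp add: abs_mult)
  have \<tau>: "\<tau> > 0" using C.q_pos n_spec(1) by (simp add: \<tau>_def)
  have iota: "(if \<delta> > 0 then 0 else 1) = C.\<iota>" unfolding C.\<iota>_def sgn_D by simp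
  have LSs: "LSseries Q \<delta> w = C.Limp w" if w: "Re w > 1" for w
  proof -
    have "LSseries Q \<delta> w = (\<Sum>f | f dvd n. of_nat f powr (1 - 2 * w) * (\<Sum>\<^sub>\<infinity>k\<in>C.KQ. of_int (jac (\<delta> / of_nat f ^ 2) k) * of_nat k powr (- w)))"
      unfolding LSseries_def fset_eq K by (rule infsum_finite[OF fin])
    also have "\<dots> = (\<Sum>f | f dvd n. of_nat f powr (1 - 2 * w) * (\<Sum>\<^sub>\<infinity>k\<in>C.KQ. C.coef f k * of_nat k powr (- w)))"
    proof (rule sum.cong[OF refl])
      fix f assume "f \<in> {f. f dvd n}"
      then have "(\<Sum>\<^sub>\<infinity>k\<in>C.KQ. of_int (jac (\<delta> / of_nat f ^ 2) k) * (of_nat k :: complex) powr (- w)) = (\<Sum>\<^sub>\<infinity>k\<in>C.KQ. C.coef f k * of_nat k powr (- w))"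
        by (intro infsum_cong) (simp add: coef)
      then show "of_nat f powr (1 - 2 * w) * (\<Sum>\<^sub>\<infinity>k\<in>C.KQ. of_int (jac (\<delta> / of_nat f ^ 2) k) * of_nat k powr (- w)) =
        of_nat f powr (1 - 2 * w) * (\<Sum>\<^sub>\<infinity>k\<in>C.KQ. C.coef f k * of_nat k powr (- w))" by (simp only:)
    qed
    finally show ?thesis using C.family.series[OF w] by simp
  qed
  \<comment> \<open>The identity theorem on the half-plane \<open>Re s > 1\<close> makes the
    continuation unique, so the description operator in \<open>LS\<close> selects
    \<open>Limp\<close>.\<close>
  have LS: "LS Q \<delta> = C.Limp"
    unfolding LS_def
  proof (rule the_equality)
    show "C.Limp holomorphic_on UNIV \<and> (\<forall>s. Re s > 1 \<longrightarrow> C.Limp s = LSseries Q \<delta> s)"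
      using C.holomorphic_Limp LSs by simp
    fix g assume g: "g holomorphic_on UNIV \<and> (\<forall>s. Re s > 1 \<longrightarrow> g s = LSseries Q \<delta> s)"
    show "g = C.Limp"
    proof (rule ext)
      fix z
      show "g z = C.Limp z"
      proof (rule analytic_continuation_open[of "{s. Re s > 1}" UNIV g C.Limp])
        have "(2 :: complex) \<in> {s. Re s > 1}" by simp
        then show "{s. Re s > 1} \<noteq> {}" by blast
      qed (use g LSs C.holomorphic_Limp in \<open>auto simp: open_halfspace_Re_gt\<close>)
    qed
  qed
  have V: "of_real \<tau> powr (1/2 - s) * Vfun Q C.\<iota> (eps Q \<delta>) s \<sigma> (y / \<tau>) =
      1 / (2 * pi) * (\<integral>t. Fmellin (Complex \<sigma> t) * C.Wfun (s - Complex \<sigma> t) * of_real y powr (- Complex \<sigma> t) \<partial>lborel)"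
    if y: "y > 0" for y
  proof -
    have pt: "of_real \<tau> powr (1/2 - s) * of_real pi powr (s - 1/2) *
        (let u = Complex \<sigma> t in
          Fmellin u *
          (\<Prod>q\<in>Q. (1 - of_int (eps Q \<delta> q) * of_nat q powr (- s + u)) /
                   (1 - of_int (eps Q \<delta> q) * of_nat q powr (s - u - 1))) *
          Gamma ((of_nat C.\<iota> + 1 - s + u) / 2) / Gamma ((of_nat C.\<iota> + s - u) / 2) *
          complex_of_real (pi * (y / \<tau>)) powr (- u)) =
        Fmellin (Complex \<sigma> t) * C.Wfun (s - Complex \<sigma> t) * of_real y powr (- Complex \<sigma> t)" for t
    proof -
      define u where "u = Complex \<sigma> t"
      have e: "(\<Prod>q\<in>Q. (1 - of_int (eps Q \<delta> q) * (of_nat q :: complex) powr (- s + u)) /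
                   (1 - of_int (eps Q \<delta> q) * of_nat q powr (s - u - 1))) = C.euler_ratio (s - u)"
        unfolding C.euler_ratio_def by (intro prod.cong refl) (simp add: eps_eq[OF chi] algebra_simps)
      have py: "pi * (y / \<tau>) > 0" using y \<tau> by simp
      have l: "ln (pi * (y / \<tau>)) = ln pi + ln y - ln \<tau>" using y \<tau> by (simp add: ln_mult ln_div)
      \<comment> \<open>The powers of \<bar>\<tau>\<bar> and \<pi> outside the integral absorb those
        in the argument of \<open>V\<close>, which turns their exponents from \<open>s\<close> into
        \<open>s - u\<close>, as in \<open>Wfun (s - u)\<close>.\<close>
      have p: "of_real \<tau> powr (1/2 - s) * of_real pi powr (s - 1/2) * complex_of_real (pi * (y / \<tau>)) powr (- u) =
          of_real \<tau> powr (1/2 - (s - u)) * of_real pi powr (s - u - 1/2) * of_real y powr (- u)"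
        unfolding of_real_powr[OF \<tau>] of_real_powr[OF pi_gt_zero] of_real_powr[OF py] of_real_powr[OF y] exp_add[symmetric] l
        by (rule arg_cong[of _ _ exp]) (simp add: algebra_simps)
      have alg: "a * b * (F * E * G * H * c) = F * (a' * b' * E * G * H) * d" if "a * b * c = a' * b' * d" for a b c d a' b' E F G H :: complex
      proof -
        have "a * b * (F * E * G * H * c) = (a * b * c) * (F * E * G * H)" by (simp only: mult_ac)
        then show ?thesis unfolding that by (simp only: mult_ac)
      qed
      have g1: "of_nat C.\<iota> + 1 - s + u = of_nat C.\<iota> + 1 - (s - u)" by simp
      have g2: "of_nat C.\<iota> + s - u = of_nat C.\<iota> + (s - u)" by simp
      \<comment> \<open>Dividing by \<open>Gamma\<close> in the definition of \<open>V\<close>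
        agrees with multiplying by \<open>rGamma\<close> everywhere, including at the poles, where
        both give 0.\<close>
      show ?thesis
        unfolding Let_def u_def[symmetric] e C.Wfun_def \<tau>_def[symmetric] g1 g2 rGamma_inverse_Gamma[of "(of_nat C.\<iota> + (s - u)) / 2"] divide_inverse[of _ "Gamma _"]
        by (rule alg[OF p])
    qed
    have "of_real \<tau> powr (1/2 - s) * Vfun Q C.\<iota> (eps Q \<delta>) s \<sigma> (y / \<tau>) = 1 / (2 * pi) *
      (of_real \<tau> powr (1/2 - s) * of_real pi powr (s - 1/2) * (\<integral>t. (let u = Complex \<sigma> t in
          Fmellin u *
          (\<Prod>q\<in>Q. (1 - of_int (eps Q \<delta> q) * of_nat q powr (- s + u)) /
                   (1 - of_int (eps Q \<delta> q) * of_nat q powr (s - u - 1))) *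
          Gamma ((of_nat C.\<iota> + 1 - s + u) / 2) / Gamma ((of_nat C.\<iota> + s - u) / 2) *
          complex_of_real (pi * (y / \<tau>)) powr (- u)) \<partial>lborel))"
      unfolding Vfun_def by simp
    then show ?thesis unfolding integral_mult_right_zero[symmetric] pt .
  qed
  have 1: "(\<Sum>\<^sub>\<infinity> f \<in> fset Q \<delta>. \<Sum>\<^sub>\<infinity> k \<in> ZSpos Q.
        1 / (of_nat k powr s * of_nat f powr (2 * s - 1)) * of_int (jac (\<delta> / of_nat f ^ 2) k) * complex_of_real (Fcut (real k * real f ^ 2 / A)))
      = (\<Sum>f | f dvd n. \<Sum>\<^sub>\<infinity>k\<in>C.KQ. 1 / (of_nat k powr s * of_nat f powr (2 * s - 1)) * C.coef f k * of_real (Fcut (real k * real f ^ 2 / A)))"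
    unfolding fset_eq K infsum_finite[OF fin] by (intro sum.cong infsum_cong refl) (simp add: coef)
  have 2: "complex_of_real \<bar>real_of_rat (tau Q \<delta>)\<bar> powr (1/2 - s) *
    (\<Sum>\<^sub>\<infinity> f \<in> fset Q \<delta>. \<Sum>\<^sub>\<infinity> k \<in> ZSpos Q.
        1 / (of_nat k powr (1 - s) * of_nat f powr (1 - 2 * s)) *
        of_int (jac (\<delta> / of_nat f ^ 2) k) *
        Vfun Q (if \<delta> > 0 then 0 else 1) (eps Q \<delta>) s \<sigma>
          (real k * real f ^ 2 * A / \<bar>real_of_rat (tau Q \<delta>)\<bar>))
    = (\<Sum>f | f dvd n. \<Sum>\<^sub>\<infinity>k\<in>C.KQ. 1 / (of_nat k powr (1 - s) * of_nat f powr (1 - 2 * s)) * C.coef f k *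
       (1 / (2 * pi) * (\<integral>t. Fmellin (Complex \<sigma> t) * C.Wfun (s - Complex \<sigma> t) * of_real (real k * real f ^ 2 * A) powr (- Complex \<sigma> t) \<partial>lborel)))"
    unfolding fset_eq K infsum_finite[OF fin] tau iota sum_distrib_left infsum_cmult_right'[symmetric]
  proof (intro sum.cong infsum_cong refl)
    fix f k assume fk: "f \<in> {f. f dvd n}" "k \<in> C.KQ"
    then have "f > 0" using n_spec(1) by (auto intro: dvd_pos_nat)
    then have y: "real k * real f ^ 2 * A > 0" using fk A by simp
    have co: "of_int (jac (\<delta> / of_nat f ^ 2) k) = C.coef f k" using coef fk by blast
    show "of_real \<tau> powr (1/2 - s) * (1 / (of_nat k powr (1 - s) * of_nat f powr (1 - 2 * s)) * of_int (jac (\<delta> / of_nat f ^ 2) k) *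
        Vfun Q C.\<iota> (eps Q \<delta>) s \<sigma> (real k * real f ^ 2 * A / \<tau>)) =
      1 / (of_nat k powr (1 - s) * of_nat f powr (1 - 2 * s)) * C.coef f k *
       (1 / (2 * pi) * (\<integral>t. Fmellin (Complex \<sigma> t) * C.Wfun (s - Complex \<sigma> t) * of_real (real k * real f ^ 2 * A) powr (- Complex \<sigma> t) \<partial>lborel))"
      unfolding V[OF y, symmetric] co by (simp only: mult_ac)
  qed
  show ?thesis unfolding 1 2 LS by (rule C.Limp_approximate_functional_equation[OF A \<sigma>])
qed

end

theorem mainTheorem13:
  fixes Q :: "nat set" and \<delta> :: rat and s :: complex and A :: real and \<sigma> :: real
  assumes "finite Q" and "\<forall>q\<in>Q. prime q" and "2 \<in> Q"
    and "\<delta> \<in> ZS Q" and "\<not> (\<exists>r::rat. \<delta> = r ^ 2)"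
    and "A > 0"
    and "\<sigma> + Re s > 1" and "\<sigma> + Re (1 - s) > 1"
  shows "LS Q \<delta> s =
    (\<Sum>\<^sub>\<infinity> f \<in> fset Q \<delta>. \<Sum>\<^sub>\<infinity> k \<in> ZSpos Q.
        1 / (of_nat k powr s * of_nat f powr (2 * s - 1)) *
        of_int (jac (\<delta> / of_nat f ^ 2) k) *
        complex_of_real (Fcut (real k * real f ^ 2 / A)))
    + complex_of_real \<bar>real_of_rat (tau Q \<delta>)\<bar> powr (1/2 - s) *
    (\<Sum>\<^sub>\<infinity> f \<in> fset Q \<delta>. \<Sum>\<^sub>\<infinity> k \<in> ZSpos Q.
        1 / (of_nat k powr (1 - s) * of_nat f powr (1 - 2 * s)) *
        of_int (jac (\<delta> / of_nat f ^ 2) k) *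
        Vfun Q (if \<delta> > 0 then 0 else 1) (eps Q \<delta>) s \<sigma>
          (real k * real f ^ 2 * A / \<bar>real_of_rat (tau Q \<delta>)\<bar>))"
  proof -
  interpret nonsquare_S_integer Q \<delta> by unfold_locales (use assms in auto)
  show ?thesis by (rule approximate_functional_equation[OF assms(6-8)])
qed

end
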